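(* Let $U$ and $W$ be connected $L^\infty$-kernels with positive minimum degrees. Then the random rooted trees $\mathfrak{U}_U$ and $\mathfrak{U}_W$ have the same distribution if and only if $U$ and $W$ are projectively fractionally isomorphic.
   Context: **Kernels.** A ground space is a standard Borel space $(X,\mathcal{B})$ with a Borel probability measure $\mu$; each (a)kernel comes with a ground space. An akernel is a measurable function $W:X^2\to[0,\infty)$; a kernel is a symmetric akernel. The degree of $x\in X$ is $\deg_W(x)=\int_X W(x,y)\,d\mu(y)$; $\deg^{\max}(W)$ and $\deg^{\min}(W)$ (maximum and minimum degree) are the essential supremum and essential infimum of $\deg_W$. $W$ is bounded-degree if $\deg^{\max}(W)<\infty$, and is an $L^\infty$-kernel if $\|W\|_\infty<\infty$. A kernel $W$ is connected if $\int_{A\times(X\setminus A)}W>0$ for every $A\in\mathcal{B}$ with $\mu(A)\in(0,1)$. **Random rooted tree $\mathfrak{U}_W$.** For a kernel $W$ with $\|W\|_1<\infty$ and $\deg_W>0$ almost everywhere, $\mathfrak{U}_W$ is the rooted tree of the multitype branching process with type space $\{(\mathsf{anc},x),(\mathsf{oth},x): x\in X\}$ given as follows. (i) The root has type $(\mathsf{anc},x)$ with $x$ distributed according to $\mu$. (ii) A particle of type $(\mathsf{oth},x)$ has children $(\mathsf{oth},x_1),\dots,(\mathsf{oth},x_k)$, where $\{x_1,\dots,x_k\}$ is a Poisson point process on $X$ with intensity $\frac{W(x,y)}{\deg_W(y)}\,d\mu(y)$. (iii) A particle of type $(\mathsf{anc},x)$ has children $(\mathsf{anc},x_0),(\mathsf{oth},x_1),\dots,(\mathsf{oth},x_k)$,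 where $\{x_1,\dots,x_k\}$ is a Poisson point process with the same intensity as in (ii), and $x_0$ is independent with density $\frac{W(x,y)}{\deg_W(x)}$ with respect to $\mu$. Offspring of different particles are generated independently. Afterwards the types are forgotten, so $\mathfrak{U}_W$ is a distribution on isomorphism classes of rooted trees. Two such distributions are the same if for every $k\in\mathbb{N}$ the balls of radius $k$ around the root have the same distribution (as isomorphism classes of rooted trees). **Fractional isomorphism.** Fix $c>0$. For a compact metric space $K$, $\mathcal{M}_{\le c}(K)$ is the set of Borel measures on $K$ of total mass at most $c$, with the topology of weak convergence; $f_*\alpha$ denotes pushforward. Recursively, let $L_0^c=\{\star\}$ and for $k\ge 0$ let $$\mathbb{P}_k^c=\Big\{\alpha\in\prod_{i=0}^k L_i^c : \alpha(\ell)=(p^c_{\ell-1,\ell})_*\alpha(\ell+1)\ \text{for all } 1\le \ell\le k-1\Big\},\qquad L_{k+1}^c=\mathcal{M}_{\le c}(\mathbb{P}_k^c),$$ where $p^c_{h,k}:\mathbb{P}_k^c\to\mathbb{P}_h^c$ ($h\le k$) is the coordinate projection. Let $\mathbb{P}^c=\{\alpha\in\prod_{i=0}^\infty L_i^c : \alpha(k)=(p^c_{k-1,k})_*\alpha(k+1)\ \text{for all } k\ge 1\}$. For an akernel $W$ with $\deg^{\max}(W)\le c$ (modified on a null set so that $\deg_W(x)\le c$ for all $x$), let $i_{W,0}:X\to\mathbb{P}_0^c$ be constant, and recursively $i_{W,k+1}(x)(j)=i_{W,k}(x)(j)$ for $0\le j\le k$ and $i_{W,k+1}(x)(k+1)(A)=\int_{i_{W,k}^{-1}(A)}W(x,y)\,d\mu(y)$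 for Borel $A\subset\mathbb{P}_k^c$. Let $i_W:X\to\mathbb{P}^c$, $i_W(x)(k)=i_{W,k}(x)(k)$, and $\nu_W=(i_W)_*\mu$. Two bounded-degree akernels $U,W$ are fractionally isomorphic if $\nu_U=\nu_W$ (with $c$ any constant bounding both maximum degrees). **Projective fractional isomorphism.** Kernels $U$ and $W$ are projectively fractionally isomorphic if there is a constant $t>0$ such that $U$ and $tW$ are fractionally isomorphic. *)

theory Defs
  imports "HOL-Probability.Probability"
begin

section \<open>Ground spaces and kernels\<close>

definition borel_of :: "'x topology \<Rightarrow> 'x measure" where
  "borel_of T = sigma (topspace T) {A. openin T A}"

definition standard_borel :: "'a measure \<Rightarrow> bool" where
  "standard_borel M \<longleftrightarrow>
     (\<exists>T. topspace T = space M \<and> completely_metrizable_space T \<and> second_countable T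
        \<and> sets M = sets (borel_of T))"

definition ground_space :: "'a measure \<Rightarrow> bool" where
  "ground_space M \<longleftrightarrow> standard_borel M \<and> prob_space M"

definition akernel :: "'a measure \<Rightarrow> ('a \<Rightarrow> 'a \<Rightarrow> real) \<Rightarrow> bool" where
  "akernel M W \<longleftrightarrow> ground_space M
     \<and> (\<lambda>(x, y). W x y) \<in> borel_measurable (M \<Otimes>\<^sub>M M)
     \<and> (\<forall>x\<in>space M. \<forall>y\<in>space M. 0 \<le> W x y)"

definition kernel :: "'a measure \<Rightarrow> ('a \<Rightarrow> 'a \<Rightarrow> real) \<Rightarrow> bool" where
  "kernel M W \<longleftrightarrow> akernel M W \<and> (\<forall>x\<in>space M. \<forall>y\<in>space M. W x y = W y x)"

definition deg :: "'a measure \<Rightarrow> ('a \<Rightarrow> 'a \<Rightarrow> real) \<Rightarrow> 'a \<Rightarrow> ennreal" where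
  "deg M W x = (\<integral>\<^sup>+ y. ennreal (W x y) \<partial>M)"

definition essinf :: "'a measure \<Rightarrow> ('a \<Rightarrow> ennreal) \<Rightarrow> ennreal" where
  "essinf M f = Sup {z. AE x in M. z \<le> f x}"

definition max_deg :: "'a measure \<Rightarrow> ('a \<Rightarrow> 'a \<Rightarrow> real) \<Rightarrow> ennreal" where
  "max_deg M W = esssup M (deg M W)"

definition min_deg :: "'a measure \<Rightarrow> ('a \<Rightarrow> 'a \<Rightarrow> real) \<Rightarrow> ennreal" where
  "min_deg M W = essinf M (deg M W)"

definition bounded_degree :: "'a measure \<Rightarrow> ('a \<Rightarrow> 'a \<Rightarrow> real) \<Rightarrow> bool" where
  "bounded_degree M W \<longleftrightarrow> max_deg M W < \<infinity>"

definition Linf_kernel :: "'a measure \<Rightarrow> ('a \<Rightarrow> 'a \<Rightarrow> real) \<Rightarrow> bool" where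
  "Linf_kernel M W \<longleftrightarrow> kernel M W
     \<and> esssup (M \<Otimes>\<^sub>M M) (\<lambda>(x, y). ennreal (W x y)) < \<infinity>"

definition connected_kernel :: "'a measure \<Rightarrow> ('a \<Rightarrow> 'a \<Rightarrow> real) \<Rightarrow> bool" where
  "connected_kernel M W \<longleftrightarrow>
     (\<forall>A\<in>sets M. 0 < measure M A \<and> measure M A < 1 \<longrightarrow>
        0 < (\<integral>\<^sup>+ p \<in> A \<times> (space M - A). ennreal (W (fst p) (snd p)) \<partial>(M \<Otimes>\<^sub>M M)))"


section \<open>The branching process\<close>

datatype kind = Anc | Oth

definition type_space :: "'a measure \<Rightarrow> (kind \<times> 'a) measure" where
  "type_space M = count_space UNIV \<Otimes>\<^sub>M M"

text \<open>
  The probability measure with density proportional to \<open>f\<close>. When \<open>f\<close> has integral \<open>0\<close> or \<open>\<infinity>\<close> an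
  arbitrary probability measure is returned, so that everything below is a Markov kernel defined for
  every \<open>x\<close>; for an integrable kernel with \<open>deg > 0\<close> a.e. only a null set of points is affected, and a particle
  almost surely never has its point in it.
\<close>
definition normalized_density :: "'a measure \<Rightarrow> ('a \<Rightarrow> ennreal) \<Rightarrow> 'a measure" where
  "normalized_density M f =
     (let m = \<integral>\<^sup>+ y. f y \<partial>M in if 0 < m \<and> m < \<infinity> then density M (\<lambda>y. f y / m) else M)"

text \<open>
  Poisson point process with intensity \<open>f d\<mu>\<close> of finite total mass \<open>m\<close>: a Poisson(\<open>m\<close>) number \<open>n\<close> and,
  independently of \<open>n\<close>, an i.i.d. sequence of points drawn from the normalized intensity. The points of
  the process are the first \<open>n\<close> members of the sequence; the remaining ones are never looked at.
\<close>
definition poisson_process :: "'a measure \<Rightarrow> ('a \<Rightarrow> ennreal) \<Rightarrow> (nat \<times> (nat \<Rightarrow> 'a)) measure" where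
  "poisson_process M f =
     (let m = \<integral>\<^sup>+ y. f y \<partial>M
      in measure_pmf (if 0 < m \<and> m < \<infinity> then poisson_pmf (enn2real m) else return_pmf 0)
         \<Otimes>\<^sub>M (\<Pi>\<^sub>M i\<in>UNIV. normalized_density M f))"

definition oth_points :: "'a measure \<Rightarrow> ('a \<Rightarrow> 'a \<Rightarrow> real) \<Rightarrow> 'a \<Rightarrow> (nat \<times> (nat \<Rightarrow> 'a)) measure" where
  "oth_points M W x = poisson_process M (\<lambda>y. ennreal (W x y) / deg M W y)"

text \<open>
  Number of children of a particle together with the types of its children; again only the first
  \<open>n\<close> entries of the sequence count.
\<close>
definition children_space :: "'a measure \<Rightarrow> (nat \<times> (nat \<Rightarrow> kind \<times> 'a)) measure" where
  "children_space M = count_space UNIV \<Otimes>\<^sub>M (\<Pi>\<^sub>M i\<in>UNIV. type_space M)"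

definition offspring ::
  "'a measure \<Rightarrow> ('a \<Rightarrow> 'a \<Rightarrow> real) \<Rightarrow> kind \<times> 'a \<Rightarrow> (nat \<times> (nat \<Rightarrow> kind \<times> 'a)) measure" where
  "offspring M W t =
     (case t of
        (Oth, x) \<Rightarrow>
          distr (oth_points M W x) (children_space M) (\<lambda>(n, xs). (n, \<lambda>i. (Oth, xs i)))
      | (Anc, x) \<Rightarrow>
          distr (normalized_density M (\<lambda>y. ennreal (W x y)) \<Otimes>\<^sub>M oth_points M W x) (children_space M)
            (\<lambda>(x0, n, xs). (Suc n, case_nat (Anc, x0) (\<lambda>i. (Oth, xs i)))))"

text \<open>
  Particles are addressed as in the Ulam--Harris tree: \<open>[]\<close> is the root and \<open>u @ [i]\<close> is the \<open>i\<close>-th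
  child of \<open>u\<close>. A labelling gives every address a type and a number of children. Addresses that are not
  reached through these numbers carry labels too, but do not belong to the tree.
\<close>
definition labelling_space :: "'a measure \<Rightarrow> (nat list \<Rightarrow> (kind \<times> 'a) \<times> nat) measure" where
  "labelling_space M = (\<Pi>\<^sub>M u\<in>UNIV. type_space M \<Otimes>\<^sub>M count_space UNIV)"

text \<open>
  Law of a particle of type \<open>t\<close> with its first \<open>k\<close> generations of descendants (the particles in
  generation \<open>k\<close> get \<open>0\<close> children).
\<close>
primrec progeny ::
  "'a measure \<Rightarrow> ('a \<Rightarrow> 'a \<Rightarrow> real) \<Rightarrow> nat \<Rightarrow> kind \<times> 'a \<Rightarrow> (nat list \<Rightarrow> (kind \<times> 'a) \<times> nat) measure" where
  "progeny M W 0 t = return (labelling_space M) (\<lambda>u. (t, 0))"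
| "progeny M W (Suc k) t =
     offspring M W t \<bind> (\<lambda>(n, ts).
       distr (\<Pi>\<^sub>M i\<in>UNIV. progeny M W k (ts i)) (labelling_space M)
         (\<lambda>\<omega> u. case u of [] \<Rightarrow> (t, n) | i # v \<Rightarrow> \<omega> i v))"

definition branching_process ::
  "'a measure \<Rightarrow> ('a \<Rightarrow> 'a \<Rightarrow> real) \<Rightarrow> nat \<Rightarrow> (nat list \<Rightarrow> (kind \<times> 'a) \<times> nat) measure" where
  "branching_process M W k = M \<bind> (\<lambda>x. progeny M W k (Anc, x))"

definition untyped_tree :: "(nat list \<Rightarrow> (kind \<times> 'a) \<times> nat) \<Rightarrow> nat list set" where
  "untyped_tree \<omega> = {u. \<forall>v i w. u = v @ i # w \<longrightarrow> i < snd (\<omega> v)}"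

definition is_child :: "nat list \<Rightarrow> nat list \<Rightarrow> bool" where
  "is_child u v \<longleftrightarrow> (\<exists>i. v = u @ [i])"

definition rooted_isomorphic :: "nat list set \<Rightarrow> nat list set \<Rightarrow> bool" where
  "rooted_isomorphic S T \<longleftrightarrow>
     [] \<in> S \<and> (\<exists>f. bij_betw f S T \<and> f [] = []
       \<and> (\<forall>u\<in>S. \<forall>v\<in>S. is_child u v \<longleftrightarrow> is_child (f u) (f v)))"

text \<open>
  The ball of radius \<open>k\<close> around the root consists of the first \<open>k\<close> generations. It is almost surely
  finite and there are only countably many isomorphism classes of finite rooted trees, so its
  distribution is given by the probabilities of the single classes; \<open>F\<close> is a representative.
\<close>
definition ball_prob :: "'a measure \<Rightarrow> ('a \<Rightarrow> 'a \<Rightarrow> real) \<Rightarrow> nat \<Rightarrow> nat list set \<Rightarrow> real" where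
  "ball_prob M W k F = measure (branching_process M W k)
     {\<omega> \<in> space (branching_process M W k). rooted_isomorphic (untyped_tree \<omega>) F}"

definition same_tree_distribution ::
  "'a measure \<Rightarrow> ('a \<Rightarrow> 'a \<Rightarrow> real) \<Rightarrow> 'b measure \<Rightarrow> ('b \<Rightarrow> 'b \<Rightarrow> real) \<Rightarrow> bool" where
  "same_tree_distribution M U N W \<longleftrightarrow>
     (\<forall>k F. finite F \<longrightarrow> ball_prob M U k F = ball_prob N W k F)"


section \<open>Fractional isomorphism\<close>

definition measures_le :: "real \<Rightarrow> 'x topology \<Rightarrow> 'x measure set" where
  "measures_le c T =
     {\<alpha>. sets \<alpha> = sets (borel_of T) \<and> emeasure \<alpha> (space \<alpha>) \<le> ennreal c}"

definition weak_topology :: "real \<Rightarrow> 'x topology \<Rightarrow> 'x measure topology" where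
  "weak_topology c T = topology_generated_by
     {{\<alpha> \<in> measures_le c T. (\<integral>x. f x \<partial>\<alpha>) \<in> V} | f V.
        continuous_map T euclideanreal f \<and> bounded (f ` topspace T) \<and> open V}"

text \<open>
  In the iterated construction \<open>L\<^sub>k\<^sub>+\<^sub>1 = \<M>(\<P>\<^sub>k)\<close> the type of the elements would grow with \<open>k\<close>. To have
  all levels in one type, a measure is represented by a real number through a fixed injection, and the
  topology is transported along it. Such an injection exists: the spaces \<open>\<P>\<^sub>k\<close> are compact
  metrizable, and a finite Borel measure on a second countable space is determined by its values on a
  countable base closed under finite intersections. Which injection is used is immaterial.
\<close>
definition code :: "real \<Rightarrow> 'x topology \<Rightarrow> 'x measure \<Rightarrow> real" where
  "code c T = (SOME e. inj_on e (measures_le c T))"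

definition decode :: "real \<Rightarrow> 'x topology \<Rightarrow> real \<Rightarrow> 'x measure" where
  "decode c T = inv_into (measures_le c T) (code c T)"

definition coded_measures :: "real \<Rightarrow> 'x topology \<Rightarrow> real topology" where
  "coded_measures c T =
     pullback_topology (code c T ` measures_le c T) (decode c T) (weak_topology c T)"

text \<open>
  Points of \<open>\<P>\<^sub>k\<close> are sequences that are \<open>undefined\<close> beyond \<open>k\<close>, so \<open>p\<^sub>h\<^sub>,\<^sub>k\<close> is restriction to \<open>{0..h}\<close>.
  The conditional in \<open>Pspace\<close> only serves termination.
\<close>
function Lspace :: "real \<Rightarrow> nat \<Rightarrow> real topology"
  and Pspace :: "real \<Rightarrow> nat \<Rightarrow> (nat \<Rightarrow> real) topology" where
  "Lspace c 0 = discrete_topology {0}"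
| "Lspace c (Suc k) = coded_measures c (Pspace c k)"
| "Pspace c k = subtopology
     (product_topology (\<lambda>i. if i \<le> k then Lspace c i else discrete_topology {0}) {0..k})
     {\<alpha>. \<forall>l. 1 \<le> l \<and> l < k \<longrightarrow>
        decode c (Pspace c (l - 1)) (\<alpha> l) =
        distr (decode c (Pspace c l) (\<alpha> (Suc l))) (borel_of (Pspace c (l - 1)))
          (\<lambda>\<beta>. restrict \<beta> {0..l - 1})}"
  by pat_completeness auto
termination
  by (relation "Wellfounded.measure (case_sum (\<lambda>(c, k). 2 * k) (\<lambda>(c, k). 2 * k + 1))") auto

declare Pspace.simps [simp del]

definition Pspace_lim :: "real \<Rightarrow> (nat \<Rightarrow> real) topology" where
  "Pspace_lim c = subtopology (product_topology (Lspace c) UNIV)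
     {\<alpha>. \<forall>k\<ge>1. decode c (Pspace c (k - 1)) (\<alpha> k) =
        distr (decode c (Pspace c k) (\<alpha> (Suc k))) (borel_of (Pspace c (k - 1)))
          (\<lambda>\<beta>. restrict \<beta> {0..k - 1})}"

text \<open>
  The modification of \<open>W\<close> that makes all degrees at most \<open>c\<close>; if \<open>deg\<^sup>m\<^sup>a\<^sup>x(W) \<le> c\<close>, it changes \<open>W\<close> only
  on \<open>N \<times> X\<close> for a null set \<open>N\<close>.
\<close>
definition cut_degrees :: "real \<Rightarrow> 'a measure \<Rightarrow> ('a \<Rightarrow> 'a \<Rightarrow> real) \<Rightarrow> 'a \<Rightarrow> 'a \<Rightarrow> real" where
  "cut_degrees c M W x y = (if deg M W x \<le> ennreal c then W x y else 0)"

text \<open>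
  The measure being coded is \<open>A \<mapsto> \<integral> W(x,y) d\<mu>(y)\<close> over the preimage of \<open>A\<close>, i.e. the image of
  \<open>W(x,\<cdot>) d\<mu>\<close>.
\<close>
primrec iterated_degrees ::
  "real \<Rightarrow> 'a measure \<Rightarrow> ('a \<Rightarrow> 'a \<Rightarrow> real) \<Rightarrow> nat \<Rightarrow> 'a \<Rightarrow> nat \<Rightarrow> real" where
  "iterated_degrees c M W 0 x = restrict (\<lambda>_. 0) {0}"
| "iterated_degrees c M W (Suc k) x =
     (iterated_degrees c M W k x)(Suc k := code c (Pspace c k)
        (distr (density M (\<lambda>y. ennreal (W x y))) (borel_of (Pspace c k))
          (iterated_degrees c M W k)))"

definition iterated_degree_measure ::
  "real \<Rightarrow> 'a measure \<Rightarrow> ('a \<Rightarrow> 'a \<Rightarrow> real) \<Rightarrow> (nat \<Rightarrow> real) measure" where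
  "iterated_degree_measure c M W = distr M (borel_of (Pspace_lim c))
     (\<lambda>x k. iterated_degrees c M (cut_degrees c M W) k x k)"

definition fractionally_isomorphic ::
  "'a measure \<Rightarrow> ('a \<Rightarrow> 'a \<Rightarrow> real) \<Rightarrow> 'b measure \<Rightarrow> ('b \<Rightarrow> 'b \<Rightarrow> real) \<Rightarrow> bool" where
  "fractionally_isomorphic M U N W \<longleftrightarrow> bounded_degree M U \<and> bounded_degree N W
     \<and> (\<forall>c>0. max_deg M U \<le> ennreal c \<and> max_deg N W \<le> ennreal c \<longrightarrow>
          iterated_degree_measure c M U = iterated_degree_measure c N W)"

definition projectively_fractionally_isomorphic ::
  "'a measure \<Rightarrow> ('a \<Rightarrow> 'a \<Rightarrow> real) \<Rightarrow> 'b measure \<Rightarrow> ('b \<Rightarrow> 'b \<Rightarrow> real) \<Rightarrow> bool" where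
  "projectively_fractionally_isomorphic M U N W \<longleftrightarrow>
     (\<exists>t>0. fractionally_isomorphic M U N (\<lambda>x y. t * W x y))"

end

theory Submission
  imports Defs
begin

text \<open>
  Write \<open>D\<close> for the degree, \<open>K(x,y) = W(x,y)/D(y)\<close> and \<open>P(x,y) = W(x,y)/D(x)\<close>, and attach to every finite rooted
  tree \<open>F\<close> and every kernel the function of \<open>x\<close> obtained by multiplying, over the subtrees hanging off the root, the
  kernel applied to the functions of these subtrees. The integrals of the tree functions of \<open>W\<close> determine and are
  determined by \<open>\<nu>\<^sub>W\<close>, because continuous test functions on the spaces of iterated degrees can be generated from
  tree functions by integration, lattice operations and limits.

  The probability that the tree of a particle \<open>(oth,x)\<close> is a given plane tree is \<open>exp(- K1(x))/n!\<close> times a product of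
  \<open>K\<close> applied to such probabilities. By extinction these probabilities and the tree functions of \<open>K\<close> generate each
  other through uniform limits. Extinction holds since \<open>K\<close> preserves integrals: the survival probabilities satisfy
  \<open>\<rho>' = 1 - exp(- K\<rho>)\<close>, so their integrals \<open>s\<close> satisfy \<open>s' \<le> s - \<kappa> s\<^sup>2\<close>. In a ball of the tree rooted at the ancestor the
  spine is visible as the only branch reaching the last generation if the rest is small; deleting it leaves the
  tree of an ordinary particle.

  It remains to pass between \<open>K\<close> and \<open>W\<close>. In one direction \<open>D = W1\<close>. In the other, \<open>K\<close> is self-adjoint for the weight
  \<open>1/D\<close>, and connectedness makes the averages of two consecutive powers \<open>K\<^sup>n 1\<close> converge uniformly to \<open>D\<close> divided by
  its integral. So \<open>D\<close> is recovered only up to a constant factor, which is the factor \<open>t\<close> of projective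
  fractional isomorphism.
\<close>

section \<open>Uniform closures of sets of pairs of functions\<close>

text \<open>The two kernels live on unrelated spaces, so all constructions are carried out on pairs
  of functions built by the same recipe on both sides, and only integrals are compared. Three
  obstacles shape the argument. Probabilities of finite trees carry the factor
  \<open>exp (- K1)\<close> exactly once, hence are not closed under products, and the constant 1
  has to be produced from them before tree functions can be reached; extinction supplies it, through
  \<open>exp (- K1) * exp (K (1 - \<rho>)) = 1 - \<rho>'\<close>. Finally, a bipartite kernel can
  make the powers of \<open>K\<close> oscillate between two limits, which is why two parities have
  to be balanced. A constant factor must remain undetermined, since \<open>K\<close> and
  \<open>P\<close>, and with them the law of the tree, do not change when \<open>W\<close> is
  multiplied by a positive constant.\<close>

definition ess_bounded :: "'a measure \<Rightarrow> ('a \<Rightarrow> real) \<Rightarrow> bool" where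
  "ess_bounded M f \<longleftrightarrow> f \<in> borel_measurable M \<and> (\<exists>B. AE x in M. \<bar>f x\<bar> \<le> B)"

lemma ess_boundedI: "f \<in> borel_measurable M \<Longrightarrow> AE x in M. \<bar>f x\<bar> \<le> B \<Longrightarrow> ess_bounded M f"
  by (auto simp: ess_bounded_def)

lemma ess_bounded_measurable [measurable_dest]: "ess_bounded M f \<Longrightarrow> f \<in> borel_measurable M"
  by (simp add: ess_bounded_def)

lemma ess_boundedE:
  assumes "ess_bounded M f" obtains B where "0 \<le> B" "AE x in M. \<bar>f x\<bar> \<le> B"
proof -
  obtain B where "AE x in M. \<bar>f x\<bar> \<le> B" using assms by (auto simp: ess_bounded_def)
  then have "AE x in M. \<bar>f x\<bar> \<le> max 0 B" by eventually_elim auto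
  then show ?thesis using that[of "max 0 B"] by simp
qed

lemma ess_bounded_const [simp]: "ess_bounded M (\<lambda>x. c)"
  by (rule ess_boundedI[of _ _ "\<bar>c\<bar>"]) auto

lemma ess_bounded_add: assumes "ess_bounded M f" "ess_bounded M g" shows "ess_bounded M (\<lambda>x. f x + g x)"
proof -
  obtain B where B: "AE x in M. \<bar>f x\<bar> \<le> B" using assms(1) by (rule ess_boundedE)
  obtain C where C: "AE x in M. \<bar>g x\<bar> \<le> C" using assms(2) by (rule ess_boundedE)
  show ?thesis
    by (rule ess_boundedI[of _ _ "B + C"]) (use assms B C in \<open>auto simp: ess_bounded_def elim!: eventually_elim2\<close>)
qed

lemma ess_bounded_mult: assumes "ess_bounded M f" "ess_bounded M g" shows "ess_bounded M (\<lambda>x. f x * g x)"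
proof -
  obtain B where B: "0 \<le> B" "AE x in M. \<bar>f x\<bar> \<le> B" using assms(1) by (rule ess_boundedE)
  obtain C where C: "0 \<le> C" "AE x in M. \<bar>g x\<bar> \<le> C" using assms(2) by (rule ess_boundedE)
  have "AE x in M. \<bar>f x * g x\<bar> \<le> B * C"
    using B(2) C(2) by eventually_elim (use B(1) C(1) in \<open>auto simp: abs_mult intro!: mult_mono\<close>)
  then show ?thesis by (intro ess_boundedI) (use assms in \<open>auto simp: ess_bounded_def\<close>)
qed

lemma ess_bounded_uminus: "ess_bounded M f \<Longrightarrow> ess_bounded M (\<lambda>x. - f x)"
  using ess_bounded_mult[of M "\<lambda>x. -1" f] by simp

lemma ess_bounded_diff: "ess_bounded M f \<Longrightarrow> ess_bounded M g \<Longrightarrow> ess_bounded M (\<lambda>x. f x - g x)"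
  using ess_bounded_add[of M f "\<lambda>x. - g x"] ess_bounded_uminus[of M g] by simp

lemma ess_bounded_prod_list:
  "(\<And>f. f \<in> set fs \<Longrightarrow> ess_bounded M f) \<Longrightarrow> ess_bounded M (\<lambda>x. \<Prod>f\<leftarrow>fs. f x)"
  by (induction fs) (auto intro: ess_bounded_mult)

lemma ess_bounded_power: "ess_bounded M f \<Longrightarrow> ess_bounded M (\<lambda>x. f x ^ n)"
  by (induction n) (auto intro: ess_bounded_mult)

lemma (in finite_measure) ess_bounded_integrable [intro]: "ess_bounded M f \<Longrightarrow> integrable M f"
  by (auto simp: ess_bounded_def intro!: integrable_const_bound[where f = f])

text \<open>Keeping both components in one object forces the same coefficients and the same
  tolerance on the two sides. Rule \<open>lim\<close> takes measurability as a premise because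
  uniform approximation off a null set does not provide it.\<close>

inductive_set uclosure ::
  "'a measure \<Rightarrow> 'b measure \<Rightarrow> (('a \<Rightarrow> real) \<times> ('b \<Rightarrow> real)) set \<Rightarrow> (('a \<Rightarrow> real) \<times> ('b \<Rightarrow> real)) set"
  for M N B where
  base: "p \<in> B \<Longrightarrow> p \<in> uclosure M N B"
| lin: "(f, g) \<in> uclosure M N B \<Longrightarrow> (f', g') \<in> uclosure M N B \<Longrightarrow>
    (\<lambda>x. a * f x + b * f' x, \<lambda>y. a * g y + b * g' y) \<in> uclosure M N B"
| lim: "f \<in> borel_measurable M \<Longrightarrow> g \<in> borel_measurable N \<Longrightarrow>
    (\<And>e::real. 0 < e \<Longrightarrow> \<exists>f' g'. (f', g') \<in> uclosure M N B \<and>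
       (AE x in M. \<bar>f x - f' x\<bar> \<le> e) \<and> (AE y in N. \<bar>g y - g' y\<bar> \<le> e)) \<Longrightarrow>
    (f, g) \<in> uclosure M N B"

definition ess_bounded_pairs where
  "ess_bounded_pairs M N B \<longleftrightarrow> (\<forall>(f, g)\<in>B. ess_bounded M f \<and> ess_bounded N g)"

text \<open>In the limit case an approximant at distance 1 is bounded, hence so is the
  limit.\<close>

lemma uclosure_ess_bounded:
  assumes "ess_bounded_pairs M N B" "(f, g) \<in> uclosure M N B"
  shows "ess_bounded M f \<and> ess_bounded N g"
  using assms(2)
proof (induction f g rule: uclosure.induct[split_format(complete)])
  case (base f g) then show ?case using assms(1) by (auto simp: ess_bounded_pairs_def)
next
  case (lin f g f' g' a b) then show ?case by (auto intro!: ess_bounded_add ess_bounded_mult)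
next
  case (lim f g)
  obtain f' g' where fg: "ess_bounded M f'" "ess_bounded N g'" "AE x in M. \<bar>f x - f' x\<bar> \<le> 1" "AE y in N. \<bar>g y - g' y\<bar> \<le> 1"
    using lim(3)[of 1] by auto
  obtain B1 where "AE x in M. \<bar>f' x\<bar> \<le> B1" using fg(1) by (rule ess_boundedE)
  with fg(3) have 1: "AE x in M. \<bar>f x\<bar> \<le> B1 + 1" by eventually_elim linarith
  obtain B2 where "AE x in N. \<bar>g' x\<bar> \<le> B2" using fg(2) by (rule ess_boundedE)
  with fg(4) have 2: "AE x in N. \<bar>g x\<bar> \<le> B2 + 1" by eventually_elim linarith
  show ?case using lim 1 2 by (auto simp: ess_bounded_def)
qed

text \<open>The given pair approximates the new one with every tolerance, so this is an instance of
  \<open>lim\<close>.\<close>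

lemma uclosure_cong_AE:
  assumes "(f, g) \<in> uclosure M N B" "f' \<in> borel_measurable M" "g' \<in> borel_measurable N"
    "AE x in M. f' x = f x" "AE y in N. g' y = g y"
  shows "(f', g') \<in> uclosure M N B"
proof (rule uclosure.lim)
  fix e :: real assume "0 < e"
  have "AE x in M. \<bar>f' x - f x\<bar> \<le> e" using assms(4) by eventually_elim (use \<open>0 < e\<close> in auto)
  moreover have "AE x in N. \<bar>g' x - g x\<bar> \<le> e" using assms(5) by eventually_elim (use \<open>0 < e\<close> in auto)
  ultimately show "\<exists>f'' g''. (f'', g'') \<in> uclosure M N B \<and> (AE x in M. \<bar>f' x - f'' x\<bar> \<le> e) \<and> (AE y in N. \<bar>g' y - g'' y\<bar> \<le> e)"
    using assms(1) by blast
qed (use assms in auto)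

lemma uclosure_scale: "(f, g) \<in> uclosure M N B \<Longrightarrow> (\<lambda>x. a * f x, \<lambda>y. a * g y) \<in> uclosure M N B"
  using uclosure.lin[of f g M N B f g a 0] by simp

lemma uclosure_add: "(f, g) \<in> uclosure M N B \<Longrightarrow> (f', g') \<in> uclosure M N B \<Longrightarrow> (\<lambda>x. f x + f' x, \<lambda>y. g y + g' y) \<in> uclosure M N B"
  using uclosure.lin[of f g M N B f' g' 1 1] by simp

lemma uclosure_diff: "(f, g) \<in> uclosure M N B \<Longrightarrow> (f', g') \<in> uclosure M N B \<Longrightarrow> (\<lambda>x. f x - f' x, \<lambda>y. g y - g' y) \<in> uclosure M N B"
  using uclosure.lin[of f g M N B f' g' 1 "-1"] by simp

lemma uclosure_sum:
  assumes "(f0, g0) \<in> uclosure M N B" "\<And>i. i \<in> I \<Longrightarrow> (f i, g i) \<in> uclosure M N B"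
  shows "(\<lambda>x. \<Sum>i\<in>I. f i x, \<lambda>y. \<Sum>i\<in>I. g i y) \<in> uclosure M N B"
proof (cases "finite I")
  case True then show ?thesis using assms(2)
  proof (induction I rule: finite_induct)
    case empty then show ?case using uclosure_scale[OF assms(1), of 0] by simp
  next
    case (insert i I) then show ?case by (auto intro!: uclosure_add)
  qed
next
  case False then show ?thesis using uclosure_scale[OF assms(1), of 0] by simp
qed

text \<open>Integration against a probability measure is linear and continuous for uniform
  convergence, so equality spreads from the generators. This is how equality of integrals passes
  from one family of functions to another: a pair of the second family only has to be found in the
  closure of the first.\<close>

lemma uclosure_integral_eq:
  assumes "prob_space M" "prob_space N" "ess_bounded_pairs M N B"
    "\<And>f g. (f, g) \<in> B \<Longrightarrow> (\<integral>x. f x \<partial>M) = (\<integral>y. g y \<partial>N)" "(f, g) \<in> uclosure M N B"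
  shows "(\<integral>x. f x \<partial>M) = (\<integral>y. g y \<partial>N)"
proof -
  interpret M: prob_space M by fact
  interpret N: prob_space N by fact
  have int: "integrable M f \<and> integrable N g" if "(f, g) \<in> uclosure M N B" for f g
    using uclosure_ess_bounded[OF assms(3) that] by auto
  show ?thesis using assms(5)
  proof (induction f g rule: uclosure.induct[split_format(complete)])
    case (base f g) then show ?case using assms(4) by blast
  next
    case (lin f g f' g' a b)
    then show ?case using int[of f g] int[of f' g'] by simp
  next
    case (lim f g)
    have fg: "(f, g) \<in> uclosure M N B" by (rule uclosure.lim) (use lim in \<open>auto, blast\<close>)
    have "\<bar>(\<integral>x. f x \<partial>M) - (\<integral>y. g y \<partial>N)\<bar> \<le> e" if "0 < e" for e
    proof -
      obtain f' g' where fg': "(f', g') \<in> uclosure M N B" "(\<integral>x. f' x \<partial>M) = (\<integral>y. g' y \<partial>N)"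
        "AE x in M. \<bar>f x - f' x\<bar> \<le> e/2" "AE y in N. \<bar>g y - g' y\<bar> \<le> e/2"
        using lim(3)[of "e/2"] \<open>0 < e\<close> by auto
      have "\<bar>(\<integral>x. f x \<partial>M) - (\<integral>x. f' x \<partial>M)\<bar> = \<bar>\<integral>x. f x - f' x \<partial>M\<bar>"
        using int[OF fg] int[OF fg'(1)] by simp
      also have "\<dots> \<le> (\<integral>x. \<bar>f x - f' x\<bar> \<partial>M)" by (rule integral_abs_bound)
      also have "\<dots> \<le> (\<integral>x. e/2 \<partial>M)"
        by (rule integral_mono_AE) (use fg' int[OF fg] int[OF fg'(1)] in auto)
      finally have 1: "\<bar>(\<integral>x. f x \<partial>M) - (\<integral>x. f' x \<partial>M)\<bar> \<le> e/2" by (simp add: M.prob_space)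
      have "\<bar>(\<integral>x. g x \<partial>N) - (\<integral>x. g' x \<partial>N)\<bar> = \<bar>\<integral>x. g x - g' x \<partial>N\<bar>"
        using int[OF fg] int[OF fg'(1)] by simp
      also have "\<dots> \<le> (\<integral>x. \<bar>g x - g' x\<bar> \<partial>N)" by (rule integral_abs_bound)
      also have "\<dots> \<le> (\<integral>x. e/2 \<partial>N)"
        by (rule integral_mono_AE) (use fg' int[OF fg] int[OF fg'(1)] in auto)
      finally have 2: "\<bar>(\<integral>x. g x \<partial>N) - (\<integral>x. g' x \<partial>N)\<bar> \<le> e/2" by (simp add: N.prob_space)
      show ?thesis using 1 2 fg'(2) by linarith
    qed
    from field_le_epsilon[of "\<bar>(\<integral>x. f x \<partial>M) - (\<integral>y. g y \<partial>N)\<bar>" 0] this show ?case by auto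
  qed
qed

section \<open>Bounded operators and algebra operations on uniform closures\<close>

text \<open>Linearity is required only almost everywhere: the Bochner integral of a nonintegrable
  function is 0, so integral operators need not be linear at exceptional points. With
  \<open>e = 0\<close> the bound says that \<open>T\<close> maps functions vanishing almost
  everywhere to such functions.\<close>

definition bounded_op :: "'a measure \<Rightarrow> (('a \<Rightarrow> real) \<Rightarrow> 'a \<Rightarrow> real) \<Rightarrow> bool" where
  "bounded_op M T \<longleftrightarrow> (\<forall>f. ess_bounded M f \<longrightarrow> T f \<in> borel_measurable M)
     \<and> (\<forall>f g a b. ess_bounded M f \<longrightarrow> ess_bounded M g \<longrightarrow> (AE x in M. T (\<lambda>x. a * f x + b * g x) x = a * T f x + b * T g x))
     \<and> (\<exists>C\<ge>0. \<forall>f e. ess_bounded M f \<longrightarrow> 0 \<le> e \<longrightarrow> (AE x in M. \<bar>f x\<bar> \<le> e) \<longrightarrow> (AE x in M. \<bar>T f x\<bar> \<le> C * e))"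

lemma bounded_opI:
  assumes "\<And>f. ess_bounded M f \<Longrightarrow> T f \<in> borel_measurable M"
    "\<And>f g a b. ess_bounded M f \<Longrightarrow> ess_bounded M g \<Longrightarrow> AE x in M. T (\<lambda>x. a * f x + b * g x) x = a * T f x + b * T g x"
    "0 \<le> C" "\<And>f e. ess_bounded M f \<Longrightarrow> 0 \<le> e \<Longrightarrow> AE x in M. \<bar>f x\<bar> \<le> e \<Longrightarrow> AE x in M. \<bar>T f x\<bar> \<le> C * e"
  shows "bounded_op M T"
  unfolding bounded_op_def using assms by blast

lemma bounded_op_measurable: "bounded_op M T \<Longrightarrow> ess_bounded M f \<Longrightarrow> T f \<in> borel_measurable M"
  by (simp add: bounded_op_def)

lemma bounded_op_lin: "bounded_op M T \<Longrightarrow> ess_bounded M f \<Longrightarrow> ess_bounded M g \<Longrightarrow> AE x in M. T (\<lambda>x. a * f x + b * g x) x = a * T f x + b * T g x"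
  by (simp add: bounded_op_def)

lemma bounded_op_bound:
  assumes "bounded_op M T"
  obtains C where "0 \<le> C" "\<And>f e. ess_bounded M f \<Longrightarrow> 0 \<le> e \<Longrightarrow> AE x in M. \<bar>f x\<bar> \<le> e \<Longrightarrow> AE x in M. \<bar>T f x\<bar> \<le> C * e"
  using assms unfolding bounded_op_def by blast

lemma bounded_op_ess_bounded: assumes "bounded_op M T" "ess_bounded M f" shows "ess_bounded M (T f)"
proof -
  obtain C where C: "0 \<le> C" "\<And>f e. ess_bounded M f \<Longrightarrow> 0 \<le> e \<Longrightarrow> AE x in M. \<bar>f x\<bar> \<le> e \<Longrightarrow> AE x in M. \<bar>T f x\<bar> \<le> C * e"
    using bounded_op_bound[OF assms(1)] by metis
  obtain B where B: "0 \<le> B" "AE x in M. \<bar>f x\<bar> \<le> B" using assms(2) by (rule ess_boundedE)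
  show ?thesis by (rule ess_boundedI[OF bounded_op_measurable[OF assms] C(2)[OF assms(2) B]])
qed

lemma bounded_op_mult: assumes "ess_bounded M A" shows "bounded_op M (\<lambda>f x. A x * f x)"
proof -
  obtain B where B: "0 \<le> B" "AE x in M. \<bar>A x\<bar> \<le> B" using assms by (rule ess_boundedE)
  have [measurable]: "A \<in> borel_measurable M" using assms by (rule ess_bounded_measurable)
  have "AE x in M. \<bar>A x * f x\<bar> \<le> B * e" if "0 \<le> e" "AE x in M. \<bar>f x\<bar> \<le> e" for f e
    using B(2) that(2) by eventually_elim (use B(1) that(1) in \<open>auto simp: abs_mult intro!: mult_mono\<close>)
  then show ?thesis using B(1)
    by (intro bounded_opI[of M _ B]) (auto simp: algebra_simps dest: ess_bounded_measurable)
qed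

text \<open>As \<open>T\<close> is linear only off a null set, \<open>S\<close> has to be
  insensitive to changes on null sets; its bound with \<open>e = 0\<close> gives this.\<close>

lemma bounded_op_comp: assumes S: "bounded_op M S" and T: "bounded_op M T" shows "bounded_op M (\<lambda>f. S (T f))"
proof -
  obtain C where C: "0 \<le> C" "\<And>f e. ess_bounded M f \<Longrightarrow> 0 \<le> e \<Longrightarrow> AE x in M. \<bar>f x\<bar> \<le> e \<Longrightarrow> AE x in M. \<bar>S f x\<bar> \<le> C * e"
    using bounded_op_bound[OF S] by metis
  obtain D where D: "0 \<le> D" "\<And>f e. ess_bounded M f \<Longrightarrow> 0 \<le> e \<Longrightarrow> AE x in M. \<bar>f x\<bar> \<le> e \<Longrightarrow> AE x in M. \<bar>T f x\<bar> \<le> D * e"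
    using bounded_op_bound[OF T] by metis
  have "AE x in M. S (T (\<lambda>x. a * f x + b * g x)) x = a * S (T f) x + b * S (T g) x"
    if f: "ess_bounded M f" and g: "ess_bounded M g" for f g a b
  proof -
    let ?h = "\<lambda>x. a * f x + b * g x" and ?k = "\<lambda>x. a * T f x + b * T g x"
    have e1: "ess_bounded M ?h" "ess_bounded M ?k"
      by (intro ess_bounded_add ess_bounded_mult ess_bounded_const f g bounded_op_ess_bounded[OF T])+
    note e = e1(1) bounded_op_ess_bounded[OF T e1(1)] e1(2)
    have "AE x in M. T ?h x - ?k x = 0" using bounded_op_lin[OF T f g, of a b] by eventually_elim auto
    then have "AE x in M. \<bar>1 * T ?h x + (-1) * ?k x\<bar> \<le> 0" by eventually_elim auto
    from C(2)[OF _ _ this] have "AE x in M. S (\<lambda>x. 1 * T ?h x + (-1) * ?k x) x = 0"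
      using ess_bounded_add[OF ess_bounded_mult[OF ess_bounded_const[of M 1] e(2)] ess_bounded_mult[OF ess_bounded_const[of M "-1"] e(3)]] by simp
    moreover have "AE x in M. S (\<lambda>x. 1 * T ?h x + (-1) * ?k x) x = 1 * S (T ?h) x + (-1) * S ?k x"
      by (rule bounded_op_lin[OF S e(2,3)])
    moreover have "AE x in M. S ?k x = a * S (T f) x + b * S (T g) x"
      by (rule bounded_op_lin[OF S bounded_op_ess_bounded[OF T f] bounded_op_ess_bounded[OF T g]])
    ultimately show ?thesis by eventually_elim auto
  qed
  moreover have "AE x in M. \<bar>S (T f) x\<bar> \<le> (C * D) * e" if "ess_bounded M f" "0 \<le> e" "AE x in M. \<bar>f x\<bar> \<le> e" for f e
    using C(2)[OF bounded_op_ess_bounded[OF T that(1)] _ D(2)[OF that]] D(1) that(2) by (simp add: mult.assoc)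
  moreover have "0 \<le> C * D" using C(1) D(1) by simp
  ultimately show ?thesis using bounded_op_measurable[OF S bounded_op_ess_bounded[OF T]] by (intro bounded_opI[of M _ "C * D"])
qed

text \<open>A bounded operator respects linear combinations and uniform limits, so membership of the
  images need only be checked on the generators.\<close>

lemma uclosure_lift:
  assumes S: "bounded_op M S" and T: "bounded_op N T" and B: "ess_bounded_pairs M N B"
    and base: "\<And>f g. (f, g) \<in> B \<Longrightarrow> (S f, T g) \<in> uclosure M N B'"
    and fg: "(f, g) \<in> uclosure M N B"
  shows "(S f, T g) \<in> uclosure M N B'"
  using fg
proof (induction f g rule: uclosure.induct[split_format(complete)])
  case (base f g) then show ?case using assms(4) by blast
next
  case (lin f g f' g' a b)
  note e = uclosure_ess_bounded[OF B lin(1)] uclosure_ess_bounded[OF B lin(2)]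
  show ?case
    by (rule uclosure_cong_AE[OF uclosure.lin[OF lin(3,4), of a b]])
      (use e in \<open>auto intro!: bounded_op_measurable[OF S] bounded_op_measurable[OF T] bounded_op_lin[OF S] bounded_op_lin[OF T] ess_bounded_add ess_bounded_mult\<close>)
next
  case (lim f g)
  have fg: "(f, g) \<in> uclosure M N B" by (rule uclosure.lim) (use lim in \<open>auto, blast\<close>)
  note e = uclosure_ess_bounded[OF B fg]
  obtain C where C: "0 \<le> C" "\<And>f e. ess_bounded M f \<Longrightarrow> 0 \<le> e \<Longrightarrow> AE x in M. \<bar>f x\<bar> \<le> e \<Longrightarrow> AE x in M. \<bar>S f x\<bar> \<le> C * e"
    using bounded_op_bound[OF S] by metis
  obtain D where D: "0 \<le> D" "\<And>f e. ess_bounded N f \<Longrightarrow> 0 \<le> e \<Longrightarrow> AE x in N. \<bar>f x\<bar> \<le> e \<Longrightarrow> AE x in N. \<bar>T f x\<bar> \<le> D * e"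
    using bounded_op_bound[OF T] by metis
  show ?case
  proof (rule uclosure.lim)
    fix r :: real assume r: "0 < r"
    \<comment> \<open>One tolerance that serves both operators; the summand 1 keeps the denominator
      positive.\<close>
    define d where "d = r / (C + D + 1)"
    have d: "0 < d" "C * d \<le> r" "D * d \<le> r"
    proof -
      show "0 < d" using r C D by (auto simp: d_def)
      then have "C * d \<le> (C + D + 1) * d" "D * d \<le> (C + D + 1) * d" using C(1) D(1) by (auto intro!: mult_right_mono)
      moreover have "(C + D + 1) * d = r" using C(1) D(1) by (simp add: d_def)
      ultimately show "C * d \<le> r" "D * d \<le> r" by simp_all
    qed
    obtain f' g' where fg': "(f', g') \<in> uclosure M N B" "(S f', T g') \<in> uclosure M N B'"
      "AE x in M. \<bar>f x - f' x\<bar> \<le> d" "AE y in N. \<bar>g y - g' y\<bar> \<le> d"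
      using lim(3)[OF d(1)] by auto
    note e' = uclosure_ess_bounded[OF B fg'(1)]
    have "AE x in M. \<bar>S (\<lambda>x. 1 * f x + (-1) * f' x) x\<bar> \<le> C * d"
      using C(2)[OF ess_bounded_diff[of M f f'], of d] e e' fg'(3) d by simp
    moreover have "AE x in M. S (\<lambda>x. 1 * f x + (-1) * f' x) x = 1 * S f x + (-1) * S f' x"
      using bounded_op_lin[OF S] e e' by blast
    ultimately have 1: "AE x in M. \<bar>S f x - S f' x\<bar> \<le> r"
      by eventually_elim (use d in auto)
    have "AE x in N. \<bar>T (\<lambda>x. 1 * g x + (-1) * g' x) x\<bar> \<le> D * d"
      using D(2)[OF ess_bounded_diff[of N g g'], of d] e e' fg'(4) d by simp
    moreover have "AE x in N. T (\<lambda>x. 1 * g x + (-1) * g' x) x = 1 * T g x + (-1) * T g' x"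
      using bounded_op_lin[OF T] e e' by blast
    ultimately have 2: "AE x in N. \<bar>T g x - T g' x\<bar> \<le> r"
      by eventually_elim (use d in auto)
    show "\<exists>f' g'. (f', g') \<in> uclosure M N B' \<and> (AE x in M. \<bar>S f x - f' x\<bar> \<le> r) \<and> (AE y in N. \<bar>T g y - g' y\<bar> \<le> r)"
      using fg'(2) 1 2 by blast
  qed (use e S T in \<open>auto intro: bounded_op_measurable\<close>)
qed

definition mult_closed where
  "mult_closed B \<longleftrightarrow> (\<forall>(f, g)\<in>B. \<forall>(f', g')\<in>B. (\<lambda>x. f x * f' x, \<lambda>y. g y * g' y) \<in> B)"

text \<open>Multiplication by a fixed essentially bounded function is a bounded operator. Lifting it
  twice moves one factor after the other from the generators to the closure.\<close>

lemma uclosure_mult: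
  assumes B: "ess_bounded_pairs M N B" "mult_closed B" and fg: "(f, g) \<in> uclosure M N B" and fg': "(f', g') \<in> uclosure M N B"
  shows "(\<lambda>x. f x * f' x, \<lambda>y. g y * g' y) \<in> uclosure M N B"
proof -
  have 1: "(\<lambda>x. p x * f' x, \<lambda>y. q y * g' y) \<in> uclosure M N B" if pq: "(p, q) \<in> B" for p q
  proof (rule uclosure_lift[OF bounded_op_mult bounded_op_mult B(1) _ fg'])
    show "ess_bounded M p" "ess_bounded N q" using B(1) pq by (auto simp: ess_bounded_pairs_def)
    fix f g assume "(f, g) \<in> B"
    then show "(\<lambda>x. p x * f x, \<lambda>y. q y * g y) \<in> uclosure M N B"
      using B(2) pq by (auto simp: mult_closed_def intro!: uclosure.base)
  qed
  have "(\<lambda>x. f' x * f x, \<lambda>y. g' y * g y) \<in> uclosure M N B"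
    by (rule uclosure_lift[OF bounded_op_mult bounded_op_mult B(1) _ fg])
      (use uclosure_ess_bounded[OF B(1) fg'] 1 in \<open>auto simp: mult.commute\<close>)
  then show ?thesis by (simp add: mult.commute)
qed

text \<open>By Weierstrass, \<open>\<phi>\<close> is a uniform limit of polynomials on
  \<open>{a..b}\<close>, and polynomials in a pair of the closure stay in the closure. An interval
  is specified in order to admit the inverse function, which is continuous only away from 0.\<close>

lemma uclosure_comp:
  assumes B: "ess_bounded_pairs M N B" "mult_closed B" "(\<lambda>x. 1, \<lambda>y. 1) \<in> uclosure M N B" and fg: "(f, g) \<in> uclosure M N B"
    and range: "AE x in M. f x \<in> {a..b}" "AE y in N. g y \<in> {a..b}"
    and phi: "continuous_on {a..b} \<phi>" "(\<lambda>x. \<phi> (f x)) \<in> borel_measurable M" "(\<lambda>y. \<phi> (g y)) \<in> borel_measurable N"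
  shows "(\<lambda>x. \<phi> (f x), \<lambda>y. \<phi> (g y)) \<in> uclosure M N B"
proof (rule uclosure.lim)
  have poly: "(\<lambda>x. p (f x), \<lambda>y. p (g y)) \<in> uclosure M N B" if "real_polynomial_function p" for p :: "real \<Rightarrow> real"
    using that
  proof induction
    case (linear h)
    then obtain c where "h = (\<lambda>x. x * c)" using real_bounded_linear by auto
    then show ?case using uclosure_scale[OF fg, of c] by (simp add: mult.commute)
  next
    case (const c) then show ?case using uclosure_scale[OF B(3), of c] by simp
  next
    case (add p q) then show ?case by (auto intro: uclosure_add)
  next
    case (mult p q) then show ?case by (auto intro: uclosure_mult[OF B(1,2)])
  qed
  fix e :: real assume "0 < e"
  obtain p where p: "real_polynomial_function p" "\<And>x. x \<in> {a..b} \<Longrightarrow> \<bar>\<phi> x - p x\<bar> < e"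
    using Stone_Weierstrass_real_polynomial_function[OF _ phi(1) \<open>0 < e\<close>] by auto
  have "AE x in M. \<bar>\<phi> (f x) - p (f x)\<bar> \<le> e"
    using range(1) by eventually_elim (use p(2) in \<open>auto intro: less_imp_le\<close>)
  moreover have "AE x in N. \<bar>\<phi> (g x) - p (g x)\<bar> \<le> e"
    using range(2) by eventually_elim (use p(2) in \<open>auto intro: less_imp_le\<close>)
  ultimately show "\<exists>f' g'. (f', g') \<in> uclosure M N B \<and> (AE x in M. \<bar>\<phi> (f x) - f' x\<bar> \<le> e) \<and> (AE y in N. \<bar>\<phi> (g y) - g' y\<bar> \<le> e)"
    using poly[OF p(1)] by blast
qed (use phi in auto)

lemma uclosure_comp_continuous:
  assumes B: "ess_bounded_pairs M N B" "mult_closed B" "(\<lambda>x. 1, \<lambda>y. 1) \<in> uclosure M N B" and fg: "(f, g) \<in> uclosure M N B"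
    and phi: "continuous_on UNIV \<phi>"
  shows "(\<lambda>x. \<phi> (f x), \<lambda>y. \<phi> (g y)) \<in> uclosure M N B"
proof -
  obtain C where C: "0 \<le> C" "AE x in M. \<bar>f x\<bar> \<le> C" using uclosure_ess_bounded[OF B(1) fg] ess_boundedE by blast
  obtain D where D: "0 \<le> D" "AE x in N. \<bar>g x\<bar> \<le> D" using uclosure_ess_bounded[OF B(1) fg] ess_boundedE by blast
  have [measurable]: "\<phi> \<in> borel_measurable borel" using phi by (rule borel_measurable_continuous_onI)
  have [measurable]: "f \<in> borel_measurable M" "g \<in> borel_measurable N" using uclosure_ess_bounded[OF B(1) fg] by auto
  show ?thesis
  proof (rule uclosure_comp[OF B fg, of "- (C + D)" "C + D"])
    show "AE x in M. f x \<in> {- (C + D)..C + D}" using C(2) by eventually_elim (use D(1) in auto)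
    show "AE x in N. g x \<in> {- (C + D)..C + D}" using D(2) by eventually_elim (use C(1) in auto)
    show "continuous_on {- (C + D)..C + D} \<phi>" using phi by (rule continuous_on_subset) auto
  qed measurable
qed

section \<open>Integral operators of kernels with essentially bounded degree\<close>

text \<open>The degree is bounded only almost everywhere, as it is before any modification of a
  kernel; \<open>deg_bounded\<close> is the everywhere version used for iterated degrees.\<close>

definition bd_kernel :: "'a measure \<Rightarrow> ('a \<Rightarrow> 'a \<Rightarrow> real) \<Rightarrow> real \<Rightarrow> bool" where
  "bd_kernel M K B \<longleftrightarrow> (\<lambda>(x, y). K x y) \<in> borel_measurable (M \<Otimes>\<^sub>M M)
     \<and> (\<forall>x\<in>space M. \<forall>y\<in>space M. 0 \<le> K x y)
     \<and> 0 \<le> B \<and> (AE x in M. (\<integral>\<^sup>+ y. ennreal (K x y) \<partial>M) \<le> ennreal B)"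

definition kop :: "'a measure \<Rightarrow> ('a \<Rightarrow> 'a \<Rightarrow> real) \<Rightarrow> ('a \<Rightarrow> real) \<Rightarrow> 'a \<Rightarrow> real" where
  "kop M K f x = (\<integral>y. K x y * f y \<partial>M)"

lemma bd_kernel_measurable [measurable_dest]: "bd_kernel M K B \<Longrightarrow> (\<lambda>(x, y). K x y) \<in> borel_measurable (M \<Otimes>\<^sub>M M)"
  by (simp add: bd_kernel_def)

lemma kop_measurable:
  assumes "prob_space M" "bd_kernel M K B" "f \<in> borel_measurable M"
  shows "kop M K f \<in> borel_measurable M"
proof -
  interpret prob_space M by fact
  have [measurable]: "(\<lambda>(x, y). K x y) \<in> borel_measurable (M \<Otimes>\<^sub>M M)" "f \<in> borel_measurable M"
    using assms by (auto simp: bd_kernel_def)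
  show ?thesis unfolding kop_def by measurable
qed

lemma bd_kernel_integrable:
  assumes "prob_space M" "bd_kernel M K B"
  shows "AE x in M. integrable M (K x) \<and> (\<integral>y. K x y \<partial>M) \<le> B"
proof -
  interpret prob_space M by fact
  have [measurable]: "(\<lambda>(x, y). K x y) \<in> borel_measurable (M \<Otimes>\<^sub>M M)"
    using assms by (auto simp: bd_kernel_def)
  have "AE x in M. (\<integral>\<^sup>+ y. ennreal (K x y) \<partial>M) \<le> ennreal B" using assms by (simp add: bd_kernel_def)
  then show ?thesis using AE_space
  proof eventually_elim
    case (elim x)
    have nn: "AE y in M. 0 \<le> K x y" using assms(2) elim(2) by (auto simp: bd_kernel_def)
    have int: "integrable M (K x)"
      using elim nn by (intro integrableI_nonneg) (auto intro: le_less_trans[OF _ ennreal_less_top])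
    have "ennreal (\<integral>y. K x y \<partial>M) \<le> ennreal B"
      using elim(1) nn_integral_eq_integral[OF int nn] by simp
    then show ?case using assms(2) int by (simp add: bd_kernel_def)
  qed
qed

lemma bd_kernel_integrable_mult:
  assumes "prob_space M" "bd_kernel M K B" "ess_bounded M f"
  shows "AE x in M. integrable M (\<lambda>y. K x y * f y)"
proof -
  interpret prob_space M by fact
  have [measurable]: "(\<lambda>(x, y). K x y) \<in> borel_measurable (M \<Otimes>\<^sub>M M)" "f \<in> borel_measurable M"
    using assms by (auto simp: bd_kernel_def)
  obtain C where C: "0 \<le> C" "AE x in M. \<bar>f x\<bar> \<le> C" using assms(3) by (rule ess_boundedE)
  show ?thesis using bd_kernel_integrable[OF assms(1,2)] AE_space
  proof eventually_elim
    case (elim x)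
    show ?case
    proof (rule Bochner_Integration.integrable_bound)
      show "integrable M (\<lambda>y. C * K x y)" using elim by auto
      show "(\<lambda>y. K x y * f y) \<in> borel_measurable M" using elim by measurable
      show "AE y in M. norm (K x y * f y) \<le> norm (C * K x y)"
        using C(2) by eventually_elim (use C(1) in \<open>auto simp: abs_mult mult.commute intro!: mult_mono\<close>)
    qed
  qed
qed

lemma bounded_op_kop:
  assumes "prob_space M" "bd_kernel M K B"
  shows "bounded_op M (kop M K)"
proof -
  interpret prob_space M by fact
  have B: "0 \<le> B" using assms by (simp add: bd_kernel_def)
  have "AE x in M. kop M K (\<lambda>x. a * f x + b * g x) x = a * kop M K f x + b * kop M K g x"
    if "ess_bounded M f" "ess_bounded M g" for f g a b
    using bd_kernel_integrable_mult[OF assms that(1)] bd_kernel_integrable_mult[OF assms that(2)]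
  proof eventually_elim
    case (elim x)
    have "kop M K (\<lambda>x. a * f x + b * g x) x = (\<integral>y. a * (K x y * f y) + b * (K x y * g y) \<partial>M)"
      unfolding kop_def by (simp add: algebra_simps)
    then show ?case unfolding kop_def using elim by simp
  qed
  moreover have "AE x in M. \<bar>kop M K f x\<bar> \<le> B * e" if f: "ess_bounded M f" and e: "0 \<le> e" "AE x in M. \<bar>f x\<bar> \<le> e" for f e
    using bd_kernel_integrable[OF assms] bd_kernel_integrable_mult[OF assms f] AE_space
  proof eventually_elim
    case (elim x)
    have "\<bar>kop M K f x\<bar> \<le> (\<integral>y. \<bar>K x y * f y\<bar> \<partial>M)" unfolding kop_def by (rule integral_abs_bound)
    also have "\<dots> \<le> (\<integral>y. K x y * e \<partial>M)"
    proof (rule integral_mono_AE)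
      show "AE y in M. \<bar>K x y * f y\<bar> \<le> K x y * e"
        using e(2) AE_space
      proof eventually_elim
        case (elim y)
        then show ?case using assms(2) \<open>x \<in> space M\<close> by (auto simp: abs_mult bd_kernel_def intro!: mult_left_mono)
      qed
    qed (use elim in auto)
    also have "\<dots> \<le> B * e" using elim e by (auto intro!: mult_right_mono)
    finally show ?case .
  qed
  ultimately show ?thesis using B kop_measurable[OF assms]
    by (intro bounded_opI[of M _ B]) (auto dest: ess_bounded_measurable)
qed

lemma kop_ess_bounded: "prob_space M \<Longrightarrow> bd_kernel M K B \<Longrightarrow> ess_bounded M f \<Longrightarrow> ess_bounded M (kop M K f)"
  using bounded_op_ess_bounded[OF bounded_op_kop] by blast

text \<open>This holds at every point \<open>x\<close>, not just at almost every one, because the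
  change affects the integrand in \<open>y\<close> only.\<close>

lemma kop_cong_AE:
  assumes "prob_space M" "bd_kernel M K B" "AE y in M. f y = g y" "f \<in> borel_measurable M" "g \<in> borel_measurable M" "x \<in> space M"
  shows "kop M K f x = kop M K g x"
proof -
  have [measurable]: "(\<lambda>(x, y). K x y) \<in> borel_measurable (M \<Otimes>\<^sub>M M)"  "f \<in> borel_measurable M" "g \<in> borel_measurable M"
    using assms by (auto simp: bd_kernel_def)
  show ?thesis unfolding kop_def
    by (rule integral_cong_AE) (use assms in \<open>auto elim: eventually_mono\<close>)
qed

section \<open>Tree functionals\<close>

datatype ptree = PNode "ptree list"

text \<open>Homomorphism density of a rooted tree whose root is mapped to \<open>x\<close>; its
  integral over \<open>x\<close> is the usual tree density. The plane order merely orders the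
  factors.\<close>

primrec tree_fun :: "'a measure \<Rightarrow> ('a \<Rightarrow> 'a \<Rightarrow> real) \<Rightarrow> ptree \<Rightarrow> 'a \<Rightarrow> real" where
  "tree_fun M K (PNode ts) = (\<lambda>x. \<Prod>f\<leftarrow>map (tree_fun M K) ts. kop M K f x)"

lemma tree_fun_ess_bounded: assumes "prob_space M" "bd_kernel M K B" shows "ess_bounded M (tree_fun M K t)"
proof (induction t)
  case (PNode ts)
  have "ess_bounded M (\<lambda>x. \<Prod>h\<leftarrow>map (kop M K) (map (tree_fun M K) ts). h x)"
    by (rule ess_bounded_prod_list) (use PNode kop_ess_bounded[OF assms] in auto)
  then show ?case by (simp add: o_def)
qed

definition tree_funs where
  "tree_funs M U N W = range (\<lambda>t. (tree_fun M U t, tree_fun N W t))"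

lemma tree_funs_ess_bounded_pairs:
  assumes "prob_space M" "bd_kernel M U B" "prob_space N" "bd_kernel N W C"
  shows "ess_bounded_pairs M N (tree_funs M U N W)"
  unfolding ess_bounded_pairs_def tree_funs_def using tree_fun_ess_bounded[OF assms(1,2)] tree_fun_ess_bounded[OF assms(3,4)] by auto

text \<open>Gluing two trees at their roots multiplies their functions.\<close>

lemma tree_funs_mult_closed: "mult_closed (tree_funs M U N W)"
proof -
  have "(\<lambda>x. tree_fun M U s x * tree_fun M U t x, \<lambda>x. tree_fun N W s x * tree_fun N W t x) \<in> tree_funs M U N W" for s t
  proof -
    obtain as bs where "s = PNode as" "t = PNode bs" using ptree.exhaust by metis
    then show ?thesis unfolding tree_funs_def by (intro image_eqI[of _ _ "PNode (as @ bs)"]) auto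
  qed
  then show ?thesis by (auto simp: mult_closed_def tree_funs_def)
qed

lemma tree_funs_one: "(\<lambda>x. 1, \<lambda>y. 1) \<in> uclosure M N (tree_funs M U N W)"
  by (rule uclosure.base) (auto simp: tree_funs_def image_iff intro!: exI[of _ "PNode []"])

text \<open>Planting a tree below a new root applies the operator to its function, so generators go
  to generators.\<close>

lemma tree_funs_kop_closed:
  assumes "prob_space M" "bd_kernel M U B" "prob_space N" "bd_kernel N W C" "(f, g) \<in> uclosure M N (tree_funs M U N W)"
  shows "(kop M U f, kop N W g) \<in> uclosure M N (tree_funs M U N W)"
proof (rule uclosure_lift[OF bounded_op_kop bounded_op_kop tree_funs_ess_bounded_pairs, OF assms(1-4) assms(1-4) _ assms(5)])
  fix f g assume "(f, g) \<in> tree_funs M U N W"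
  then obtain t where t: "f = tree_fun M U t" "g = tree_fun N W t" by (auto simp: tree_funs_def)
  show "(kop M U f, kop N W g) \<in> uclosure M N (tree_funs M U N W)"
    unfolding t by (rule uclosure.base) (auto simp: tree_funs_def fun_eq_iff intro!: image_eqI[of _ _ "PNode [t]"])
qed

text \<open>Minimality of the tree functions among families with these three properties. It is
  applied to the closure generated by the tree functions of \<open>K\<close>, in order to reach
  those of \<open>W\<close>.\<close>

lemma tree_fun_mem_closed:
  assumes "(\<lambda>x. 1, \<lambda>y. 1) \<in> \<C>" 
    "\<And>f g f' g'. (f, g) \<in> \<C> \<Longrightarrow> (f', g') \<in> \<C> \<Longrightarrow> (\<lambda>x. f x * f' x, \<lambda>y. g y * g' y) \<in> \<C>"
    "\<And>f g. (f, g) \<in> \<C> \<Longrightarrow> (kop M U f, kop N W g) \<in> \<C>"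
  shows "(tree_fun M U t, tree_fun N W t) \<in> \<C>"
proof (induction t)
  case (PNode ts)
  then show ?case
  proof (induction ts)
    case Nil then show ?case using assms(1) by simp
  next
    case (Cons t ts)
    have "(kop M U (tree_fun M U t), kop N W (tree_fun N W t)) \<in> \<C>" using Cons.prems assms(3) by auto
    moreover have "(tree_fun M U (PNode ts), tree_fun N W (PNode ts)) \<in> \<C>" using Cons by auto
    ultimately have "(\<lambda>x. kop M U (tree_fun M U t) x * tree_fun M U (PNode ts) x, \<lambda>y. kop N W (tree_fun N W t) y * tree_fun N W (PNode ts) y) \<in> \<C>"
      by (rule assms(2))
    then show ?case by simp
  qed
qed

section \<open>Topologies with a countable lattice of Urysohn functions\<close>

definition clamp01 :: "real \<Rightarrow> real" where "clamp01 t = max 0 (min 1 t)"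

lemma clamp01_range: "clamp01 t \<in> {0..1}" by (auto simp: clamp01_def)

text \<open>Linear combinations are replaced by lattice operations and rational multiples from
  \<open>[0,1]\<close>, which keep a generated family countable and with values in
  \<open>[0,1]\<close>.\<close>

definition lattice_closed :: "(('x \<Rightarrow> real) \<Rightarrow> bool) \<Rightarrow> bool" where
  "lattice_closed R \<longleftrightarrow> R (\<lambda>x. 0) \<and> R (\<lambda>x. 1)
     \<and> (\<forall>f g. R f \<longrightarrow> R g \<longrightarrow> R (\<lambda>x. max (f x) (g x)) \<and> R (\<lambda>x. min (f x) (g x)))
     \<and> (\<forall>f q. R f \<longrightarrow> 0 \<le> q \<longrightarrow> q \<le> 1 \<longrightarrow> R (\<lambda>x. real_of_rat q * f x))"

text \<open>A countable substitute for complete regularity together with a countable base. It passes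
  by explicit formulas through pullbacks, subspaces, countable products and spaces of measures, and
  along the way one can record that every member, composed with two given maps, lies in a
  closure.\<close>

definition urysohn_family :: "'x topology \<Rightarrow> ('x \<Rightarrow> real) set \<Rightarrow> bool" where
  "urysohn_family T F \<longleftrightarrow> countable F \<and> lattice_closed (\<lambda>f. f \<in> F)
     \<and> (\<forall>f\<in>F. continuous_map T euclideanreal f \<and> f ` topspace T \<subseteq> {0..1})
     \<and> (\<forall>G x. openin T G \<and> x \<in> G \<longrightarrow> (\<exists>f\<in>F. f x = 1 \<and> (\<forall>y\<in>topspace T - G. f y = 0)))"

text \<open>Lattice terms over a sequence of generators. There are only countably many, so the
  family of their values is countable; coefficients are clamped on evaluation so that every term is
  admissible.\<close>

datatype lat = At nat | Mx lat lat | Mn lat lat | Sc rat lat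
instance lat :: countable by countable_datatype

primrec eval_lat :: "(nat \<Rightarrow> 'x \<Rightarrow> real) \<Rightarrow> lat \<Rightarrow> 'x \<Rightarrow> real" where
  "eval_lat s (At n) = s n"
| "eval_lat s (Mx a b) = (\<lambda>x. max (eval_lat s a x) (eval_lat s b x))"
| "eval_lat s (Mn a b) = (\<lambda>x. min (eval_lat s a x) (eval_lat s b x))"
| "eval_lat s (Sc q a) = (\<lambda>x. real_of_rat (max 0 (min 1 q)) * eval_lat s a x)"

lemma eval_lat_mem: "lattice_closed R \<Longrightarrow> (\<And>n. R (s n)) \<Longrightarrow> R (eval_lat s t)"
  by (induction t) (simp_all add: lattice_closed_def)

text \<open>The family consists of the values of all lattice terms over \<open>S\<close> and the
  constants 0 and 1. A property \<open>R\<close> preserved by the operations passes from the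
  generators to all members; it will express that compositions with two fixed maps lie in a
  closure.\<close>

lemma urysohn_family_generate:
  fixes S :: "('x \<Rightarrow> real) set" and R :: "('x \<Rightarrow> real) \<Rightarrow> bool"
  assumes "countable S" and R: "lattice_closed R" "\<And>f. f \<in> S \<Longrightarrow> R f"
    and S: "\<And>f. f \<in> S \<Longrightarrow> continuous_map T euclideanreal f \<and> f ` topspace T \<subseteq> {0..1}"
    and sep: "\<And>F G x. lattice_closed (\<lambda>f. f \<in> F) \<Longrightarrow> S \<subseteq> F \<Longrightarrow> (\<And>f y. f \<in> F \<Longrightarrow> y \<in> topspace T \<Longrightarrow> f y \<in> {0..1}) \<Longrightarrow> openin T G \<Longrightarrow> x \<in> G \<Longrightarrow>
      \<exists>f\<in>F. f x = 1 \<and> (\<forall>y\<in>topspace T - G. f y = 0)"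
  shows "\<exists>F. urysohn_family T F \<and> (\<forall>f\<in>F. R f)"
proof -
  let ?S = "S \<union> {\<lambda>x. 0, \<lambda>x. 1}"
  define s where "s = from_nat_into ?S"
  have "countable ?S" using assms(1) by simp
  then have rs: "range s = ?S" unfolding s_def by (intro range_from_nat_into) auto
  let ?F = "range (eval_lat s)"
  have closed: "lattice_closed (\<lambda>f. f \<in> ?F)"
    unfolding lattice_closed_def
  proof (intro conjI allI impI)
    have "(\<lambda>x. 0) \<in> range s" "(\<lambda>x. 1) \<in> range s" unfolding rs by auto
    then show "(\<lambda>x. 0) \<in> ?F" "(\<lambda>x. 1) \<in> ?F" by (metis eval_lat.simps(1) rangeE rangeI)+
  next
    fix f g assume "f \<in> ?F" "g \<in> ?F"
    then obtain a b where "f = eval_lat s a" "g = eval_lat s b" by auto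
    then show "(\<lambda>x. max (f x) (g x)) \<in> ?F" "(\<lambda>x. min (f x) (g x)) \<in> ?F"
      using rangeI[of "eval_lat s" "Mx a b"] rangeI[of "eval_lat s" "Mn a b"] by simp_all
  next
    fix f and q :: rat assume "f \<in> ?F" "0 \<le> q" "q \<le> 1"
    then obtain a where "f = eval_lat s a" by auto
    then show "(\<lambda>x. real_of_rat q * f x) \<in> ?F"
      using rangeI[of "eval_lat s" "Sc q a"] \<open>0 \<le> q\<close> \<open>q \<le> 1\<close> by (simp add: min_def)
  qed
  have mem: "P f" if "f \<in> ?F" "lattice_closed P" "\<And>f. f \<in> S \<Longrightarrow> P f" for f P
  proof -
    have "P (s n)" for n
    proof -
      have "s n \<in> ?S" using rs by auto
      then show ?thesis using that(2,3) by (auto simp: lattice_closed_def)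
    qed
    then show ?thesis using that(1) eval_lat_mem[OF that(2), of s] by auto
  qed
  have Sub: "S \<subseteq> ?F"
  proof
    fix f assume "f \<in> S" then obtain n where "f = s n" using rs by blast
    then show "f \<in> ?F" by (intro image_eqI[of _ _ "At n"]) auto
  qed
  have cont: "continuous_map T euclideanreal f \<and> f ` topspace T \<subseteq> {0..1}" if "f \<in> ?F" for f
  proof (rule mem[OF that])
    show "lattice_closed (\<lambda>f. continuous_map T euclideanreal f \<and> f ` topspace T \<subseteq> {0..1})"
      unfolding lattice_closed_def
      by (auto simp: image_subset_iff max.coboundedI1 min.coboundedI1 mult_le_one intro!: continuous_map_real_max continuous_map_real_min continuous_map_real_mult)
  qed (rule S)
  have "urysohn_family T ?F" unfolding urysohn_family_def
  proof (intro conjI allI ballI impI)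
    show "countable ?F" by simp
    show "lattice_closed (\<lambda>f. f \<in> ?F)" by (rule closed)
    fix f assume "f \<in> ?F"
    then show "continuous_map T euclideanreal f" "f ` topspace T \<subseteq> {0..1}" using cont by auto
  next
    fix G x assume "openin T G \<and> x \<in> G"
    then show "\<exists>f\<in>?F. f x = 1 \<and> (\<forall>y\<in>topspace T - G. f y = 0)"
      by (intro sep[OF closed Sub]) (use cont in \<open>blast+\<close>)
  qed
  moreover have "\<forall>f\<in>?F. R f" using mem[OF _ R] by blast
  ultimately show ?thesis by blast
qed

text \<open>Minimum over a finite index set, described through its values 0 and 1 so that the empty
  index set fits in, with the constant 1.\<close>

lemma lattice_closed_Min:
  assumes "lattice_closed R" "finite J" "\<And>j. j \<in> J \<Longrightarrow> R (f j)"
  shows "\<exists>g. R g \<and> (\<forall>x. (\<forall>j\<in>J. f j x = 1) \<longrightarrow> g x = 1) \<and>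
    (\<forall>y. (\<exists>j\<in>J. f j y = 0) \<and> (\<forall>j\<in>J. 0 \<le> f j y) \<longrightarrow> g y = 0) \<and> (\<forall>y. (\<forall>j\<in>J. 0 \<le> f j y) \<longrightarrow> 0 \<le> g y)"
  using assms(2,3)
proof (induction J rule: finite_induct)
  case empty then show ?case using assms(1) by (intro exI[of _ "\<lambda>x. 1"]) (auto simp: lattice_closed_def)
next
  case (insert j J)
  have "\<exists>g. R g \<and> (\<forall>x. (\<forall>j\<in>J. f j x = 1) \<longrightarrow> g x = 1) \<and>
    (\<forall>y. (\<exists>j\<in>J. f j y = 0) \<and> (\<forall>j\<in>J. 0 \<le> f j y) \<longrightarrow> g y = 0) \<and> (\<forall>y. (\<forall>j\<in>J. 0 \<le> f j y) \<longrightarrow> 0 \<le> g y)"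
    by (rule insert.IH) (use insert.prems in auto)
  then obtain g where g: "R g" "\<And>x. (\<forall>j\<in>J. f j x = 1) \<Longrightarrow> g x = 1"
    "\<And>y. (\<exists>j\<in>J. f j y = 0) \<and> (\<forall>j\<in>J. 0 \<le> f j y) \<Longrightarrow> g y = 0" "\<And>y. (\<forall>j\<in>J. 0 \<le> f j y) \<Longrightarrow> 0 \<le> g y"
    by blast
  show ?case
  proof (intro exI[of _ "\<lambda>x. min (f j x) (g x)"] conjI allI impI)
    show "R (\<lambda>x. min (f j x) (g x))" using assms(1) g(1) insert(4)[of j] by (simp add: lattice_closed_def)
  next
    fix y assume y: "(\<exists>i\<in>insert j J. f i y = 0) \<and> (\<forall>i\<in>insert j J. 0 \<le> f i y)"
    then have "0 \<le> g y" using g(4) by blast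
    moreover have "f j y = 0 \<or> g y = 0" using y g(3)[of y] by blast
    ultimately show "min (f j y) (g y) = 0" using y by (auto simp: min_def)
  qed (use g(2) g(4) in auto)
qed

section \<open>Measurability and equality of measures tested on a Urysohn family\<close>

lemma space_borel_of [simp]: "space (borel_of T) = topspace T"
  unfolding borel_of_def by (rule space_measure_of) (auto dest: openin_subset)

lemma sets_borel_of: "sets (borel_of T) = sigma_sets (topspace T) {A. openin T A}"
  unfolding borel_of_def by (rule sets_measure_of) (auto dest: openin_subset)

lemma borel_of_open: "openin T A \<Longrightarrow> A \<in> sets (borel_of T)"
  by (auto simp: sets_borel_of)

lemma borel_of_continuous:
  assumes "continuous_map T euclideanreal f"
  shows "f \<in> borel_measurable (borel_of T)"
proof (rule borel_measurableI)
  fix S :: "real set" assume "open S"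
  then have "openin T {x \<in> topspace T. f x \<in> S}" using assms by (auto simp: continuous_map_def)
  then have "{x \<in> topspace T. f x \<in> S} \<in> sets (borel_of T)" by (rule borel_of_open)
  also have "{x \<in> topspace T. f x \<in> S} = f -` S \<inter> space (borel_of T)" by auto
  finally show "f -` S \<inter> space (borel_of T) \<in> sets (borel_of T)" .
qed

lemma continuous_map_borel_of:
  assumes "continuous_map T T' f"
  shows "f \<in> measurable (borel_of T) (borel_of T')"
  unfolding borel_of_def[of T']
proof (rule measurable_measure_of)
  fix A assume "A \<in> {A. openin T' A}"
  then have "openin T {x \<in> topspace T. f x \<in> A}" using assms by (auto simp: continuous_map_def)
  moreover have "f -` A \<inter> space (borel_of T) = {x \<in> topspace T. f x \<in> A}" by auto
  ultimately show "f -` A \<inter> space (borel_of T) \<in> sets (borel_of T)" by (simp add: borel_of_open)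
qed (use assms in \<open>auto dest: openin_subset simp: continuous_map_def\<close>)

lemma urysohn_family_lattice: "urysohn_family T F \<Longrightarrow> lattice_closed (\<lambda>f. f \<in> F)" by (simp add: urysohn_family_def)
lemma urysohn_family_cont: "urysohn_family T F \<Longrightarrow> f \<in> F \<Longrightarrow> continuous_map T euclideanreal f" by (simp add: urysohn_family_def)
lemma urysohn_family_range: "urysohn_family T F \<Longrightarrow> f \<in> F \<Longrightarrow> x \<in> topspace T \<Longrightarrow> f x \<in> {0..1}" unfolding urysohn_family_def by blast
lemma urysohn_family_countable: "urysohn_family T F \<Longrightarrow> countable F" by (simp add: urysohn_family_def)
lemma urysohn_family_sep: "urysohn_family T F \<Longrightarrow> openin T G \<Longrightarrow> x \<in> G \<Longrightarrow> \<exists>f\<in>F. f x = 1 \<and> (\<forall>y\<in>topspace T - G. f y = 0)"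
  by (simp add: urysohn_family_def)
lemma urysohn_family_one: "urysohn_family T F \<Longrightarrow> (\<lambda>x. 1) \<in> F" by (simp add: urysohn_family_def lattice_closed_def)

text \<open>The preimage of an open set \<open>G\<close> is the countable union of the sets where
  some member vanishing off \<open>G\<close> is positive.\<close>

lemma urysohn_family_measurable:
  assumes F: "urysohn_family T F" and h: "h \<in> space A \<rightarrow> topspace T"
    and fh: "\<And>f. f \<in> F \<Longrightarrow> (\<lambda>a. f (h a)) \<in> borel_measurable A"
  shows "h \<in> measurable A (borel_of T)"
  unfolding borel_of_def
proof (rule measurable_measure_of)
  fix G assume "G \<in> {A. openin T A}"
  then have G: "openin T G" by simp
  let ?F = "{f \<in> F. \<forall>y\<in>topspace T - G. f y = 0}"
  have "h -` G \<inter> space A = (\<Union>f\<in>?F. {a \<in> space A. 0 < f (h a)})"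
  proof (intro equalityI subsetI)
    fix a assume a: "a \<in> h -` G \<inter> space A"
    then obtain f where "f \<in> F" "f (h a) = 1" "\<forall>y\<in>topspace T - G. f y = 0" using urysohn_family_sep[OF F G, of "h a"] by auto
    then show "a \<in> (\<Union>f\<in>?F. {a \<in> space A. 0 < f (h a)})" using a by (intro UN_I[of f]) auto
  next
    fix a assume "a \<in> (\<Union>f\<in>?F. {a \<in> space A. 0 < f (h a)})"
    then obtain f where f: "f \<in> ?F" "a \<in> space A" "0 < f (h a)" by blast
    then show "a \<in> h -` G \<inter> space A" using h by (cases "h a \<in> G") (auto simp: Pi_iff)
  qed
  also have "\<dots> \<in> sets A"
  proof (rule sets.countable_UN'')
    show "countable ?F" using urysohn_family_countable[OF F] by simp
    fix f assume "f \<in> ?F"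
    then have [measurable]: "(\<lambda>a. f (h a)) \<in> borel_measurable A" using fh by simp
    show "{a \<in> space A. 0 < f (h a)} \<in> sets A" by measurable
  qed
  finally show "h -` G \<inter> space A \<in> sets A" .
qed (use h in \<open>auto dest: openin_subset\<close>)

text \<open>A lower semicontinuous \<open>h\<close> is the supremum of the members below it: if
  \<open>q < h x\<close>, then \<open>q * k\<close> lies below \<open>h\<close> and equals
  \<open>q\<close> at \<open>x\<close>, for a member \<open>k\<close> that is 1 at \<open>x\<close>
  and vanishes outside \<open>{q < h}\<close>. Running maxima of an enumeration turn the supremum
  into an increasing limit.\<close>

lemma urysohn_family_increasing:
  fixes T :: "'x topology" and h :: "'x \<Rightarrow> real"
  assumes F: "urysohn_family T F" and h: "\<And>q. openin T {x \<in> topspace T. q < h x}" "\<And>x. x \<in> topspace T \<Longrightarrow> h x \<in> {0..1}"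
  shows "\<exists>g :: nat \<Rightarrow> 'x \<Rightarrow> real. (\<forall>n. g n \<in> F) \<and> (\<forall>n. \<forall>x\<in>topspace T. g n x \<le> h x)
    \<and> (\<forall>x\<in>topspace T. (\<lambda>n. g n x) \<longlonglongrightarrow> h x)"
proof -
  let ?F = "{f \<in> F. \<forall>y\<in>topspace T. f y \<le> h y}"
  have zero: "(\<lambda>x. 0) \<in> ?F" using F h(2) by (auto simp: urysohn_family_def lattice_closed_def)
  define f where "f = from_nat_into ?F"
  have "countable ?F" using urysohn_family_countable[OF F] by simp
  then have rf: "range f = ?F" unfolding f_def using zero by (intro range_from_nat_into) auto
  define g where "g = rec_nat (f 0) (\<lambda>n g x. max (g x) (f (Suc n) x))"
  have g0: "g 0 = f 0" and gS: "g (Suc n) = (\<lambda>x. max (g n x) (f (Suc n) x))" for n by (auto simp: g_def)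
  have fF: "f n \<in> ?F" for n using rf by auto
  have gF: "g n \<in> ?F" for n
  proof (induction n)
    case 0 then show ?case using fF[of 0] g0 by simp
  next
    case (Suc n) then show ?case using fF[of "Suc n"] gS urysohn_family_lattice[OF F] by (auto simp: lattice_closed_def)
  qed
  have mono: "incseq (\<lambda>n. g n x)" for x by (rule incseq_SucI) (simp add: gS)
  have fg: "f n x \<le> g n x" for n x by (cases n) (auto simp: g0 gS)
  have "(\<lambda>n. g n x) \<longlonglongrightarrow> h x" if x: "x \<in> topspace T" for x
  proof (rule LIMSEQ_I)
    fix r :: real assume "0 < r"
    obtain n where n: "h x - r < g n x"
    proof (cases "h x - r < 0")
      case True
      obtain n where "f n = (\<lambda>x. 0)" using zero rf by (metis (no_types, lifting) rangeE)
      then show ?thesis using that[of n] fg[of n x] True by simp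
    next
      case False
      obtain q where q: "h x - r < of_rat q" "of_rat q < h x" using of_rat_dense[of "h x - r" "h x"] \<open>0 < r\<close> by auto
      have "0 \<le> real_of_rat q" "real_of_rat q \<le> 1" using q False h(2)[OF x] unfolding atLeastAtMost_iff by linarith+
      then have q01: "0 \<le> q" "q \<le> 1" by simp_all
      obtain k where k: "k \<in> F" "k x = 1" "\<forall>y\<in>topspace T - {x \<in> topspace T. of_rat q < h x}. k y = 0"
        using urysohn_family_sep[OF F h(1)[of "of_rat q"], of x] x q by auto
      have "(\<lambda>x. of_rat q * k x) \<in> F" using urysohn_family_lattice[OF F] k q01 by (simp add: lattice_closed_def)
      moreover have "of_rat q * k y \<le> h y" if y: "y \<in> topspace T" for y
      proof (cases "of_rat q < h y")
        case True
        have "of_rat q * k y \<le> of_rat q * 1" using urysohn_family_range[OF F k(1) y] q01 by (intro mult_left_mono) auto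
        then show ?thesis using True by simp
      next
        case False then show ?thesis using k(3) y h(2)[OF y] by auto
      qed
      ultimately have "(\<lambda>x. of_rat q * k x) \<in> range f" unfolding rf by simp
      then obtain n where "f n = (\<lambda>x. of_rat q * k x)" by (metis rangeE)
      then show ?thesis using that[of n] fg[of n x] k(2) q(1) by simp
    qed
    show "\<exists>n0. \<forall>n\<ge>n0. norm (g n x - h x) < r"
    proof (intro exI[of _ n] allI impI)
      fix m assume "n \<le> m"
      then have "g n x \<le> g m x" using mono[of x] by (auto simp: incseq_def)
      moreover have "g m x \<le> h x" using gF x by auto
      ultimately show "norm (g m x - h x) < r" using n by simp
    qed
  qed
  then show ?thesis using gF by (intro exI[of _ g]) auto
qed

text \<open>The sequence is chosen before the measure. For the weak topology one member must control
  all measures at once, and for the uniqueness of measures it must serve two of them.\<close>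

lemma urysohn_family_increasing_integral:
  fixes T :: "'x topology" and h :: "'x \<Rightarrow> real"
  assumes F: "urysohn_family T F" and h: "\<And>q. openin T {x \<in> topspace T. q < h x}" "\<And>x. x \<in> topspace T \<Longrightarrow> h x \<in> {0..1}"
  shows "\<exists>g :: nat \<Rightarrow> 'x \<Rightarrow> real. (\<forall>n. g n \<in> F) \<and>
    (\<forall>\<alpha>. finite_measure \<alpha> \<and> sets \<alpha> = sets (borel_of T) \<longrightarrow>
      (\<forall>n. (\<integral>x. g n x \<partial>\<alpha>) \<le> (\<integral>x. h x \<partial>\<alpha>)) \<and> (\<lambda>n. \<integral>x. g n x \<partial>\<alpha>) \<longlonglongrightarrow> (\<integral>x. h x \<partial>\<alpha>))"
proof -
  obtain g where g: "\<And>n. g n \<in> F" "\<And>n x. x \<in> topspace T \<Longrightarrow> g n x \<le> h x"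
    "\<And>x. x \<in> topspace T \<Longrightarrow> (\<lambda>n. g n x) \<longlonglongrightarrow> h x" using urysohn_family_increasing[OF F h] by metis
  show ?thesis
  proof (intro exI[of _ g] conjI allI impI)
    show "g n \<in> F" for n by (rule g(1))
    fix \<alpha> :: "'x measure" assume "finite_measure \<alpha> \<and> sets \<alpha> = sets (borel_of T)"
    then have fin: "finite_measure \<alpha>" and s: "sets \<alpha> = sets (borel_of T)" by auto
    interpret finite_measure \<alpha> by (rule fin)
    have sp: "space \<alpha> = topspace T" using sets_eq_imp_space_eq[OF s] by simp
    have hm: "h \<in> borel_measurable \<alpha>"
      unfolding borel_measurable_iff_greater using borel_of_open[OF h(1)] by (simp add: sp s)
    have gm: "g n \<in> borel_measurable \<alpha>" for n
      using borel_of_continuous[OF urysohn_family_cont[OF F g(1)[of n]]] measurable_cong_sets[OF s refl] by blast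
    have hi: "integrable \<alpha> h" by (rule integrable_const_bound[of _ 1]) (use h(2) hm in \<open>auto simp: sp\<close>)
    have gi: "integrable \<alpha> (g n)" for n
      by (rule integrable_const_bound[of _ 1]) (use urysohn_family_range[OF F g(1)[of n]] gm in \<open>auto simp: sp\<close>)
    show "(\<integral>x. g n x \<partial>\<alpha>) \<le> (\<integral>x. h x \<partial>\<alpha>)" for n
      by (rule integral_mono[OF gi hi]) (use g(2) in \<open>auto simp: sp\<close>)
    show "(\<lambda>n. \<integral>x. g n x \<partial>\<alpha>) \<longlonglongrightarrow> (\<integral>x. h x \<partial>\<alpha>)"
      by (rule integral_dominated_convergence[where w = "\<lambda>_. 1"])
        (use hm gm g(3) urysohn_family_range[OF F g(1)] in \<open>auto simp: sp\<close>)
  qed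
qed

text \<open>Indicators of open sets are lower semicontinuous, so the integrals determine the
  measures of open sets, which form a generator closed under intersections.\<close>

lemma urysohn_family_measure_eqI:
  assumes F: "urysohn_family T F" and a: "finite_measure \<alpha>" "sets \<alpha> = sets (borel_of T)"
    and b: "finite_measure \<beta>" "sets \<beta> = sets (borel_of T)"
    and eq: "\<And>f. f \<in> F \<Longrightarrow> (\<integral>x. f x \<partial>\<alpha>) = (\<integral>x. f x \<partial>\<beta>)"
  shows "\<alpha> = \<beta>"
proof -
  interpret a: finite_measure \<alpha> by (rule a(1))
  interpret b: finite_measure \<beta> by (rule b(1))
  have sa: "space \<alpha> = topspace T" and sb: "space \<beta> = topspace T"
    using sets_eq_imp_space_eq[OF a(2)] sets_eq_imp_space_eq[OF b(2)] by auto
  have open_eq: "emeasure \<alpha> G = emeasure \<beta> G" if G: "openin T G" for G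
  proof -
    have "openin T {x \<in> topspace T. q < (indicator G x :: real)}" for q
    proof -
      have "{x \<in> topspace T. q < (indicator G x :: real)} = (if q < 0 then topspace T else if q < 1 then G else {})"
        using openin_subset[OF G] by (auto simp: indicator_def)
      then show ?thesis using G by simp
    qed
    note op = this
    have ran: "(indicator G x :: real) \<in> {0..1}" for x by (auto simp: indicator_def)
    obtain g where g: "\<And>n. g n \<in> F" "\<And>\<alpha>. finite_measure \<alpha> \<Longrightarrow> sets \<alpha> = sets (borel_of T) \<Longrightarrow>
      (\<lambda>n. \<integral>x. g n x \<partial>\<alpha>) \<longlonglongrightarrow> (\<integral>x. (indicator G x :: real) \<partial>\<alpha>)"
      using urysohn_family_increasing_integral[OF F op ran] by blast
    have "(\<integral>x. (indicator G x :: real) \<partial>\<alpha>) = (\<integral>x. indicator G x \<partial>\<beta>)"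
      by (rule LIMSEQ_unique[OF g(2)[OF a]]) (use g(2)[OF b] eq[OF g(1)] in simp)
    then show ?thesis using borel_of_open[OF G] a(2) b(2) openin_subset[OF G]
      by (simp add: a.emeasure_eq_measure b.emeasure_eq_measure sa sb Int_absorb2)
  qed
  show ?thesis
  proof (rule measure_eqI_generator_eq[where E = "{A. openin T A}" and \<Omega> = "topspace T" and A = "\<lambda>_. topspace T"])
    show "Int_stable {A. openin T A}" by (auto simp: Int_stable_def)
    show "{A. openin T A} \<subseteq> Pow (topspace T)" by (auto dest: openin_subset)
    show "sets \<alpha> = sigma_sets (topspace T) {A. openin T A}" "sets \<beta> = sigma_sets (topspace T) {A. openin T A}"
      using a(2) b(2) by (simp_all add: sets_borel_of)
  qed (use open_eq a.emeasure_finite in auto)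
qed

lemma measures_leD:
  assumes "\<alpha> \<in> measures_le c T"
  shows "sets \<alpha> = sets (borel_of T)" "finite_measure \<alpha>" "space \<alpha> = topspace T"
proof -
  show s: "sets \<alpha> = sets (borel_of T)" using assms by (simp add: measures_le_def)
  show "finite_measure \<alpha>" using assms by (intro finite_measureI) (auto simp: measures_le_def top_unique)
  show "space \<alpha> = topspace T" using sets_eq_imp_space_eq[OF s] by simp
qed

lemma inj_real_of_countable: "\<exists>e :: ('i :: countable) set \<Rightarrow> real. inj e"
proof -
  have "(UNIV :: nat set set) \<lesssim> (UNIV :: real set)"
    using nat_sets_eqpoll_reals by (simp add: eqpoll_imp_lepoll)
  then obtain e :: "nat set \<Rightarrow> real" where e: "inj e" by (auto simp: lepoll_def)
  have "inj (\<lambda>A :: 'i set. e (to_nat ` A))"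
    using e by (intro injI) (metis inj_eq inj_image_eq_iff inj_to_nat)
  then show ?thesis by blast
qed

text \<open>A measure is determined by the rational cuts of its integrals over the enumerated
  family, that is, by a set of pairs of a natural number and a rational; such sets inject into the
  reals. So an injection exists and the choice made in \<open>code\<close> is one.\<close>

lemma urysohn_family_code_inj:
  assumes F: "urysohn_family T F"
  shows "inj_on (code c T) (measures_le c T)"
proof -
  define f where "f = from_nat_into F"
  have rf: "range f = F" unfolding f_def using urysohn_family_countable[OF F] urysohn_family_one[OF F] by (intro range_from_nat_into) auto
  let ?S = "\<lambda>\<alpha>. {(n, q) | n q. real_of_rat q < (\<integral>x. f n x \<partial>\<alpha>)}"
  have "inj_on ?S (measures_le c T)"
  proof (rule inj_onI)
    fix \<alpha> \<beta> assume \<alpha>: "\<alpha> \<in> measures_le c T" and \<beta>: "\<beta> \<in> measures_le c T" and eq: "?S \<alpha> = ?S \<beta>"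
    show "\<alpha> = \<beta>"
    proof (rule urysohn_family_measure_eqI[OF F])
      fix g assume "g \<in> F"
      then obtain n where n: "g = f n" using rf by auto
      have iff: "real_of_rat q < (\<integral>x. g x \<partial>\<alpha>) \<longleftrightarrow> real_of_rat q < (\<integral>x. g x \<partial>\<beta>)" for q
        using eq n by (auto simp: set_eq_iff)
      show "(\<integral>x. g x \<partial>\<alpha>) = (\<integral>x. g x \<partial>\<beta>)"
      proof (rule ccontr)
        assume "(\<integral>x. g x \<partial>\<alpha>) \<noteq> (\<integral>x. g x \<partial>\<beta>)"
        then consider "(\<integral>x. g x \<partial>\<alpha>) < (\<integral>x. g x \<partial>\<beta>)" | "(\<integral>x. g x \<partial>\<beta>) < (\<integral>x. g x \<partial>\<alpha>)" by linarith
        then show False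
          by cases (use of_rat_dense iff in \<open>meson less_asym not_less_iff_gr_or_eq\<close>)+
      qed
    qed (use measures_leD[OF \<alpha>] measures_leD[OF \<beta>] in auto)
  qed
  moreover obtain e :: "(nat \<times> rat) set \<Rightarrow> real" where "inj e" using inj_real_of_countable by blast
  ultimately have "inj_on (e \<circ> ?S) (measures_le c T)" by (intro comp_inj_on) (auto intro: inj_on_subset)
  then show ?thesis unfolding code_def by (rule someI[of "\<lambda>e. inj_on e (measures_le c T)"])
qed

lemma urysohn_family_subtopology:
  assumes "urysohn_family T F" shows "urysohn_family (subtopology T S) F"
proof -
  have "\<exists>f\<in>F. f x = 1 \<and> (\<forall>y\<in>topspace (subtopology T S) - G. f y = 0)"
    if G: "openin (subtopology T S) G" "x \<in> G" for G x
  proof -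
    obtain V where V: "openin T V" "G = V \<inter> S" using G(1) by (auto simp: openin_subtopology)
    then obtain f where "f \<in> F" "f x = 1" "\<forall>y\<in>topspace T - V. f y = 0" using urysohn_family_sep[OF assms V(1), of x] G(2) by auto
    then show ?thesis using V by (intro bexI[of _ f]) auto
  qed
  then show ?thesis using urysohn_family_lattice[OF assms] urysohn_family_countable[OF assms] urysohn_family_cont[OF assms] urysohn_family_range[OF assms]
    unfolding urysohn_family_def by (auto intro: continuous_map_from_subtopology simp: image_subset_iff)
qed

lemma urysohn_family_pullback:
  assumes F: "urysohn_family T F"
  shows "urysohn_family (pullback_topology A e T) ((\<lambda>f x. f (e x)) ` F)"
  unfolding urysohn_family_def
proof (intro conjI allI ballI impI)
  show "countable ((\<lambda>f x. f (e x)) ` F)" using urysohn_family_countable[OF F] by simp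
  show "lattice_closed (\<lambda>f. f \<in> (\<lambda>f x. f (e x)) ` F)"
    using urysohn_family_lattice[OF F] unfolding lattice_closed_def by (auto simp: image_iff)
  fix f assume "f \<in> (\<lambda>f x. f (e x)) ` F"
  then obtain f' where f': "f' \<in> F" "f = (\<lambda>x. f' (e x))" by auto
  show "continuous_map (pullback_topology A e T) euclideanreal f"
    using continuous_map_pullback[OF urysohn_family_cont[OF F f'(1)], of A e] f'(2) by (simp add: o_def)
  show "f ` topspace (pullback_topology A e T) \<subseteq> {0..1}"
    using urysohn_family_range[OF F f'(1)] f'(2) by (auto simp: topspace_pullback_topology)
next
  fix G x assume "openin (pullback_topology A e T) G \<and> x \<in> G"
  then obtain V where V: "openin T V" "G = e -` V \<inter> A" "x \<in> G" by (auto simp: openin_pullback_topology)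
  then obtain f where f: "f \<in> F" "f (e x) = 1" "\<forall>y\<in>topspace T - V. f y = 0" using urysohn_family_sep[OF F V(1), of "e x"] by auto
  show "\<exists>f\<in>(\<lambda>f x. f (e x)) ` F. f x = 1 \<and> (\<forall>y\<in>topspace (pullback_topology A e T) - G. f y = 0)"
    using f V by (intro bexI[of _ "\<lambda>x. f (e x)"]) (auto simp: topspace_pullback_topology)
qed

text \<open>A basic neighbourhood restricts finitely many coordinates, and the minimum of the
  functions that separate in these coordinates separates in the product.\<close>

lemma urysohn_family_product:
  assumes I: "countable I" and F: "\<And>i. i \<in> I \<Longrightarrow> urysohn_family (X i) (F i)"
    and R: "lattice_closed R" "\<And>i f. i \<in> I \<Longrightarrow> f \<in> F i \<Longrightarrow> R (\<lambda>\<beta>. f (\<beta> i))"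
  shows "\<exists>F. urysohn_family (product_topology X I) F \<and> (\<forall>f\<in>F. R f)"
proof (rule urysohn_family_generate[where S = "\<Union>i\<in>I. (\<lambda>f \<beta>. f (\<beta> i)) ` F i"])
  show "countable (\<Union>i\<in>I. (\<lambda>f \<beta>. f (\<beta> i)) ` F i)" using I urysohn_family_countable[OF F] by auto
  show "lattice_closed R" by fact
  show "R f" if "f \<in> (\<Union>i\<in>I. (\<lambda>f \<beta>. f (\<beta> i)) ` F i)" for f using that R(2) by auto
  show "continuous_map (product_topology X I) euclideanreal f \<and> f ` topspace (product_topology X I) \<subseteq> {0..1}"
    if f: "f \<in> (\<Union>i\<in>I. (\<lambda>f \<beta>. f (\<beta> i)) ` F i)" for f
  proof -
    obtain i f' where i: "i \<in> I" "f' \<in> F i" "f = (\<lambda>\<beta>. f' (\<beta> i))" using f by auto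
    have "continuous_map (product_topology X I) euclideanreal (f' \<circ> (\<lambda>\<beta>. \<beta> i))"
      using continuous_map_product_projection[OF i(1)] urysohn_family_cont[OF F[OF i(1)] i(2)] by (rule continuous_map_compose)
    then show ?thesis using urysohn_family_range[OF F[OF i(1)] i(2)] i by (auto simp: o_def PiE_iff)
  qed
  fix \<F> G x
  assume \<F>: "lattice_closed (\<lambda>f. f \<in> \<F>)" "(\<Union>i\<in>I. (\<lambda>f \<beta>. f (\<beta> i)) ` F i) \<subseteq> \<F>"
    and G: "openin (product_topology X I) G" "x \<in> G"
  obtain U where U: "finite {i \<in> I. U i \<noteq> topspace (X i)}" "\<forall>i\<in>I. openin (X i) (U i)" "x \<in> Pi\<^sub>E I U" "Pi\<^sub>E I U \<subseteq> G"
    using G unfolding openin_product_topology_alt by blast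
  let ?J = "{i \<in> I. U i \<noteq> topspace (X i)}"
  have "\<exists>f\<in>F i. f (x i) = 1 \<and> (\<forall>y\<in>topspace (X i) - U i. f y = 0)" if "i \<in> I" for i
    using urysohn_family_sep[OF F[OF that], of "U i" "x i"] U that by auto
  then obtain f where f: "\<And>i. i \<in> I \<Longrightarrow> f i \<in> F i \<and> f i (x i) = 1 \<and> (\<forall>y\<in>topspace (X i) - U i. f i y = 0)" by metis
  obtain g where g: "g \<in> \<F>" "\<And>x. (\<forall>j\<in>?J. f j (x j) = 1) \<Longrightarrow> g x = 1"
    "\<And>y. (\<exists>j\<in>?J. f j (y j) = 0) \<and> (\<forall>j\<in>?J. 0 \<le> f j (y j)) \<Longrightarrow> g y = 0"
    using lattice_closed_Min[OF \<F>(1) U(1), of "\<lambda>j \<beta>. f j (\<beta> j)"] \<F>(2) f by blast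
  have "g y = 0" if "y \<in> topspace (product_topology X I) - G" for y
  proof -
    have y: "y \<in> Pi\<^sub>E I (\<lambda>i. topspace (X i))" "y \<notin> Pi\<^sub>E I U" using that U(4) by auto
    then obtain i where "i \<in> I" "y i \<notin> U i" by (auto simp: PiE_iff)
    then have "i \<in> ?J" "f i (y i) = 0" using y f by (auto simp: PiE_iff)
    moreover have "0 \<le> f j (y j)" if "j \<in> I" for j
      using urysohn_family_range[OF F[OF that], of "f j" "y j"] f[OF that] y(1) that by (auto simp: PiE_iff)
    ultimately show ?thesis by (intro g(3)) auto
  qed
  then show "\<exists>f\<in>\<F>. f x = 1 \<and> (\<forall>y\<in>topspace (product_topology X I) - G. f y = 0)"
    using g(1) g(2)[of x] f by (intro bexI[of _ g]) auto
qed

lemma topspace_weak_topology [simp]: "topspace (weak_topology c T) = measures_le c T"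
  unfolding weak_topology_def topology_generated_by_topspace
proof (intro equalityI subsetI UnionI)
  fix \<alpha> assume "\<alpha> \<in> measures_le c T"
  show "measures_le c T \<in> {{\<alpha> \<in> measures_le c T. (\<integral>x. f x \<partial>\<alpha>) \<in> V} | f V.
        continuous_map T euclideanreal f \<and> bounded (f ` topspace T) \<and> open V}"
    by (intro CollectI exI[of _ "\<lambda>x. 0"] exI[of _ UNIV]) (auto intro: bounded_subset[of "{0}"])
qed auto

lemma continuous_weak_topology:
  assumes "continuous_map T euclideanreal f" "bounded (f ` topspace T)"
  shows "continuous_map (weak_topology c T) euclideanreal (\<lambda>\<alpha>. \<integral>x. f x \<partial>\<alpha>)"
  unfolding continuous_map_def
proof (intro conjI allI impI)
  fix V :: "real set" assume "openin euclideanreal V"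
  then show "openin (weak_topology c T) {\<alpha> \<in> topspace (weak_topology c T). (\<integral>x. f x \<partial>\<alpha>) \<in> V}"
    using assms by (subst weak_topology_def, intro topology_generated_by_Basis) auto
qed auto

text \<open>The generators are clamped affine functions of the integrals of members of
  \<open>F\<close>. Lower bounds on the integral of a continuous \<open>h\<close> come from monotone
  approximation by members of \<open>F\<close>; an upper bound, with negative slope, is used for the
  total mass. Lower bounds for a rescaled \<open>h\<close> and for its complement to 1, together
  with the upper bound on the mass, enclose the integral of \<open>h\<close> from both
  sides.\<close>

lemma urysohn_family_weak:
  fixes T :: "'x topology"
  assumes F: "urysohn_family T F" and R: "lattice_closed R"
    "\<And>f a m. f \<in> F \<Longrightarrow> R (\<lambda>\<alpha>. clamp01 (m * ((\<integral>x. f x \<partial>\<alpha>) - a)))"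
  shows "\<exists>F'. urysohn_family (weak_topology c T) F' \<and> (\<forall>f\<in>F'. R f)"
proof -
  define \<Phi> :: "('x \<Rightarrow> real) \<times> int \<times> rat \<Rightarrow> 'x measure \<Rightarrow> real" where "\<Phi> = (\<lambda>(f, m :: int, a :: rat) (\<alpha> :: 'x measure). clamp01 (of_int m * ((\<integral>x. f x \<partial>\<alpha>) - of_rat a)))"
  let ?S = "\<Phi> ` (F \<times> UNIV)"
  have bdF: "bounded (f ` topspace T)" if "f \<in> F" for f
    using urysohn_family_range[OF F that] bounded_subset[OF bounded_closed_interval, of "f ` topspace T" 0 1] by blast
  show ?thesis
  proof (rule urysohn_family_generate[where S = ?S])
    show "countable ?S" using urysohn_family_countable[OF F] by auto
    show "lattice_closed R" by fact
    show "R f" if "f \<in> ?S" for f using that R(2) by (auto simp: \<Phi>_def)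
    show "continuous_map (weak_topology c T) euclideanreal f \<and> f ` topspace (weak_topology c T) \<subseteq> {0..1}"
      if "f \<in> ?S" for f
    proof -
      obtain k m a where f: "k \<in> F" "f = (\<lambda>\<alpha>. clamp01 (of_int m * ((\<integral>x. k x \<partial>\<alpha>) - of_rat a)))"
        using \<open>f \<in> ?S\<close> by (auto simp: \<Phi>_def)
      have "continuous_map (weak_topology c T) euclideanreal f"
        unfolding f(2) clamp01_def
        by (intro continuous_map_real_max continuous_map_real_min continuous_map_real_mult continuous_map_diff
            continuous_weak_topology urysohn_family_cont[OF F f(1)] bdF[OF f(1)]) auto
      then show ?thesis using clamp01_range unfolding f(2) by auto
    qed
    fix \<F> G \<alpha>
    assume \<F>: "lattice_closed (\<lambda>f. f \<in> \<F>)" "?S \<subseteq> \<F>"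
      and nn: "\<And>f y. f \<in> \<F> \<Longrightarrow> y \<in> topspace (weak_topology c T) \<Longrightarrow> f y \<in> {0..1}"
      and G: "openin (weak_topology c T) G" "\<alpha> \<in> G"
    have lsc: "\<exists>\<phi>\<in>\<F>. \<phi> \<alpha> = 1 \<and> (\<forall>\<beta>\<in>measures_le c T. (\<integral>x. h x \<partial>\<beta>) \<le> t \<longrightarrow> \<phi> \<beta> = 0)"
      if h: "continuous_map T euclideanreal h" "\<And>x. x \<in> topspace T \<Longrightarrow> h x \<in> {0..1}"
        and \<alpha>: "\<alpha> \<in> measures_le c T" and t: "t < (\<integral>x. h x \<partial>\<alpha>)" for h t and \<alpha> :: "'x measure"
    proof -
      have "openin T {x \<in> topspace T. q < h x}" for q
        using openin_continuous_map_preimage[OF h(1), of "{q<..}"] by auto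
      note op = this
      obtain g where g0: "\<And>n. g n \<in> F" "\<And>\<alpha>. finite_measure \<alpha> \<and> sets \<alpha> = sets (borel_of T) \<Longrightarrow>
          (\<forall>n. (\<integral>x. g n x \<partial>\<alpha>) \<le> (\<integral>x. h x \<partial>\<alpha>)) \<and> (\<lambda>n. \<integral>x. g n x \<partial>\<alpha>) \<longlonglongrightarrow> (\<integral>x. h x \<partial>\<alpha>)"
        using urysohn_family_increasing_integral[OF F op h(2)] by blast
      have g: "\<And>n. g n \<in> F" "\<And>\<alpha>. \<alpha> \<in> measures_le c T \<Longrightarrow>
          (\<forall>n. (\<integral>x. g n x \<partial>\<alpha>) \<le> (\<integral>x. h x \<partial>\<alpha>)) \<and> (\<lambda>n. \<integral>x. g n x \<partial>\<alpha>) \<longlonglongrightarrow> (\<integral>x. h x \<partial>\<alpha>)" for \<alpha> :: "'x measure"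
        using g0(1) g0(2)[OF conjI[OF measures_leD(2,1)]] by blast+
      have "eventually (\<lambda>n. t < (\<integral>x. g n x \<partial>\<alpha>)) sequentially"
        using g(2)[OF \<alpha>] t by (auto dest: order_tendstoD)
      then obtain n where n: "t < (\<integral>x. g n x \<partial>\<alpha>)" by (auto simp: eventually_sequentially)
      then obtain a where a: "t < real_of_rat a" "real_of_rat a < (\<integral>x. g n x \<partial>\<alpha>)" using of_rat_dense by blast
      \<comment> \<open>With this slope the unclamped function exceeds 1 at \<open>\<alpha>\<close>;
        it is at most 0 wherever the integral of \<open>h\<close> is at most
        \<open>t\<close>.\<close>
      obtain m :: nat where m: "1 < of_nat m * ((\<integral>x. g n x \<partial>\<alpha>) - of_rat a)"
        using reals_Archimedean3[of "(\<integral>x. g n x \<partial>\<alpha>) - of_rat a"] a by auto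
      show ?thesis
      proof (intro bexI[of _ "\<Phi> (g n, int m, a)"] conjI ballI impI)
        show "\<Phi> (g n, int m, a) \<in> \<F>" using g(1) \<F>(2) by auto
        show "\<Phi> (g n, int m, a) \<alpha> = 1" using m by (simp add: \<Phi>_def clamp01_def)
        fix \<beta> assume "\<beta> \<in> measures_le c T" "(\<integral>x. h x \<partial>\<beta>) \<le> t"
        then have "(\<integral>x. g n x \<partial>\<beta>) - of_rat a \<le> 0" using g(2)[of \<beta>] a(1) by (meson diff_le_0_iff_le less_imp_le order_trans)
        then have "real m * ((\<integral>x. g n x \<partial>\<beta>) - of_rat a) \<le> 0" by (simp add: mult_nonneg_nonpos)
        then show "\<Phi> (g n, int m, a) \<beta> = 0" by (simp add: \<Phi>_def clamp01_def)
      qed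
    qed
    have usc1: "\<exists>\<phi>\<in>\<F>. \<phi> \<alpha> = 1 \<and> (\<forall>\<beta>\<in>measures_le c T. t \<le> (\<integral>x. 1 \<partial>\<beta>) \<longrightarrow> \<phi> \<beta> = 0)"
      if t: "(\<integral>x. 1 \<partial>\<alpha>) < t" for t :: real and \<alpha> :: "'x measure"
    proof -
      obtain a where a: "(\<integral>x. 1 \<partial>\<alpha>) < real_of_rat a" "real_of_rat a < t" using of_rat_dense t by blast
      obtain m :: nat where m: "1 < real m * (real_of_rat a - (\<integral>x. 1 \<partial>\<alpha>))"
        using reals_Archimedean3[of "real_of_rat a - (\<integral>x. 1 \<partial>\<alpha>)"] a by auto
      show ?thesis
      proof (intro bexI[of _ "\<Phi> (\<lambda>x. 1, - int m, a)"] conjI ballI impI)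
        show "\<Phi> (\<lambda>x. 1, - int m, a) \<in> \<F>" using urysohn_family_one[OF F] \<F>(2) by auto
        show "\<Phi> (\<lambda>x. 1, - int m, a) \<alpha> = 1" using m by (simp add: \<Phi>_def clamp01_def algebra_simps)
        fix \<beta> :: "'x measure" assume "t \<le> (\<integral>x. 1 \<partial>\<beta>)"
        then have "0 \<le> (\<integral>x. 1 \<partial>\<beta>) - real_of_rat a" using a by simp
        then have "0 \<le> real m * ((\<integral>x. 1 \<partial>\<beta>) - real_of_rat a)" by (rule mult_nonneg_nonneg[rotated]) simp
        then show "\<Phi> (\<lambda>x. 1, - int m, a) \<beta> = 0" by (simp add: \<Phi>_def clamp01_def)
      qed
    qed
    have "generate_topology_on {{\<alpha> \<in> measures_le c T. (\<integral>x. f x \<partial>\<alpha>) \<in> V} | f V.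
        continuous_map T euclideanreal f \<and> bounded (f ` topspace T) \<and> open V} G"
      using G(1) unfolding weak_topology_def openin_topology_generated_by_iff .
    then have "\<forall>\<alpha>\<in>G. \<exists>f\<in>\<F>. f \<alpha> = 1 \<and> (\<forall>y\<in>measures_le c T - G. f y = 0)"
    proof induction
      case Empty then show ?case by simp
    next
      case (Int a b)
      show ?case
      proof
        fix \<alpha> assume "\<alpha> \<in> a \<inter> b"
        then obtain f g where f: "f \<in> \<F>" "f \<alpha> = 1" "\<forall>y\<in>measures_le c T - a. f y = 0"
          and g: "g \<in> \<F>" "g \<alpha> = 1" "\<forall>y\<in>measures_le c T - b. g y = 0" using Int.IH by blast
        show "\<exists>f\<in>\<F>. f \<alpha> = 1 \<and> (\<forall>y\<in>measures_le c T - a \<inter> b. f y = 0)"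
        proof (intro bexI[of _ "\<lambda>x. min (f x) (g x)"] conjI ballI)
          show "(\<lambda>x. min (f x) (g x)) \<in> \<F>" using \<F>(1) f(1) g(1) by (simp add: lattice_closed_def)
          fix y assume y: "y \<in> measures_le c T - a \<inter> b"
          then have "f y \<in> {0..1}" "g y \<in> {0..1}" using nn f(1) g(1) by auto
          then show "min (f y) (g y) = 0" using y f(3) g(3) by (auto simp: min_def)
        qed (use f g in auto)
      qed
    next
      case (UN K)
      show ?case
      proof
        fix \<alpha> assume "\<alpha> \<in> \<Union>K"
        then obtain k where k: "k \<in> K" "\<alpha> \<in> k" by blast
        then obtain f where "f \<in> \<F>" "f \<alpha> = 1" "\<forall>y\<in>measures_le c T - k. f y = 0" using UN.IH by blast
        then show "\<exists>f\<in>\<F>. f \<alpha> = 1 \<and> (\<forall>y\<in>measures_le c T - \<Union>K. f y = 0)" using k(1) by (intro bexI[of _ f]) auto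
      qed
    next
      case (Basis s)
      then obtain h V where h: "continuous_map T euclideanreal h" "bounded (h ` topspace T)" "open V"
        and s: "s = {\<alpha> \<in> measures_le c T. (\<integral>x. h x \<partial>\<alpha>) \<in> V}" by auto
      obtain B where B: "0 < B" "\<And>x. x \<in> topspace T \<Longrightarrow> \<bar>h x\<bar> \<le> B"
        using h(2) by (auto simp: bounded_pos)
      \<comment> \<open>Affine image of \<open>h\<close> with values in \<open>[0,1]\<close>, as the
        approximation by members of \<open>F\<close> requires.\<close>
      define h1 where "h1 = (\<lambda>x. 1 / 2 + 1 / (2 * B) * h x)"
      define h2 where "h2 = (\<lambda>x. 1 - h1 x)"
      have h1: "continuous_map T euclideanreal h1" unfolding h1_def
        by (intro continuous_map_add continuous_map_real_mult h(1)) auto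
      have h2: "continuous_map T euclideanreal h2" unfolding h2_def
        by (intro continuous_map_diff h1) auto
      have r1: "h1 x \<in> {0..1}" if "x \<in> topspace T" for x
        using B(2)[OF that] B(1) by (auto simp: h1_def field_simps)
      then have r2: "h2 x \<in> {0..1}" if "x \<in> topspace T" for x using that by (auto simp: h2_def)
      show ?case
      proof
        fix \<alpha> assume "\<alpha> \<in> s"
        then have \<alpha>: "\<alpha> \<in> measures_le c T" and V: "(\<integral>x. h x \<partial>\<alpha>) \<in> V" using s by auto
        obtain e where e: "0 < e" "\<And>y. \<bar>y - (\<integral>x. h x \<partial>\<alpha>)\<bar> < e \<Longrightarrow> y \<in> V"
          using h(3) V by (auto simp: open_dist dist_real_def)
        \<comment> \<open>The three bounds below let the integral of \<open>h / (2 * B)\<close>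
          deviate by less than \<open>3 * d\<close>: \<open>2 * d\<close> from \<open>h1\<close> and
          \<open>d\<close> from half of the total mass. Multiplying by \<open>2 * B\<close> gives
          the factor 6.\<close>
        define d where "d = e / (6 * B)"
        have d: "0 < d" "6 * B * d = e" using e B by (auto simp: d_def)
        obtain f1 where f1: "f1 \<in> \<F>" "f1 \<alpha> = 1" "\<And>\<beta>. \<beta> \<in> measures_le c T \<Longrightarrow> (\<integral>x. h1 x \<partial>\<beta>) \<le> (\<integral>x. h1 x \<partial>\<alpha>) - d \<Longrightarrow> f1 \<beta> = 0"
          using lsc[OF h1 r1 \<alpha>, of "(\<integral>x. h1 x \<partial>\<alpha>) - d"] d by auto
        obtain f2 where f2: "f2 \<in> \<F>" "f2 \<alpha> = 1" "\<And>\<beta>. \<beta> \<in> measures_le c T \<Longrightarrow> (\<integral>x. h2 x \<partial>\<beta>) \<le> (\<integral>x. h2 x \<partial>\<alpha>) - d \<Longrightarrow> f2 \<beta> = 0"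
          using lsc[OF h2 r2 \<alpha>, of "(\<integral>x. h2 x \<partial>\<alpha>) - d"] d by auto
        obtain f3 where f3: "f3 \<in> \<F>" "f3 \<alpha> = 1" "\<And>\<beta>. \<beta> \<in> measures_le c T \<Longrightarrow> (\<integral>x. 1 \<partial>\<alpha>) + d \<le> (\<integral>x. 1 \<partial>\<beta>) \<Longrightarrow> f3 \<beta> = 0"
          using usc1[of \<alpha> "(\<integral>x. 1 \<partial>\<alpha>) + d"] d by auto
        let ?f = "\<lambda>\<beta>. min (f1 \<beta>) (min (f2 \<beta>) (f3 \<beta>))"
        show "\<exists>f\<in>\<F>. f \<alpha> = 1 \<and> (\<forall>y\<in>measures_le c T - s. f y = 0)"
        proof (intro bexI[of _ ?f] conjI ballI)
          show "?f \<in> \<F>" using \<F>(1) f1(1) f2(1) f3(1) by (simp add: lattice_closed_def)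
          show "?f \<alpha> = 1" using f1 f2 f3 by simp
          fix \<beta> assume "\<beta> \<in> measures_le c T - s"
          then have \<beta>: "\<beta> \<in> measures_le c T" "(\<integral>x. h x \<partial>\<beta>) \<notin> V" using s by auto
          have nn': "0 \<le> f1 \<beta>" "0 \<le> f2 \<beta>" "0 \<le> f3 \<beta>" using nn f1(1) f2(1) f3(1) \<beta>(1) by auto
          have id: "(\<integral>x. h1 x \<partial>\<gamma>) = 1 / 2 * (\<integral>x. 1 \<partial>\<gamma>) + 1 / (2 * B) * (\<integral>x. h x \<partial>\<gamma>) \<and> (\<integral>x. h2 x \<partial>\<gamma>) = (\<integral>x. 1 \<partial>\<gamma>) - (\<integral>x. h1 x \<partial>\<gamma>)"
            if "\<gamma> \<in> measures_le c T" for \<gamma>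
          proof -
            interpret finite_measure \<gamma> using measures_leD[OF that] by simp
            have hm: "h \<in> borel_measurable \<gamma>"
              using borel_of_continuous[OF h(1)] measurable_cong_sets[OF measures_leD(1)[OF that] refl] by blast
            have hi: "integrable \<gamma> h" by (rule integrable_const_bound[of _ B]) (use B(2) hm measures_leD(3)[OF that] in auto)
            have c: "integrable \<gamma> (\<lambda>x. k :: real)" for k by simp
            have 1: "(\<integral>x. h1 x \<partial>\<gamma>) = (\<integral>x. 1 / 2 * 1 \<partial>\<gamma>) + (\<integral>x. 1 / (2 * B) * h x \<partial>\<gamma>)"
              unfolding h1_def by (subst Bochner_Integration.integral_add) (use hi c in auto)
            have i1: "integrable \<gamma> h1" unfolding h1_def using hi c by auto
            have 2: "(\<integral>x. h2 x \<partial>\<gamma>) = (\<integral>x. 1 \<partial>\<gamma>) - (\<integral>x. h1 x \<partial>\<gamma>)"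
              unfolding h2_def by (subst Bochner_Integration.integral_diff) (use i1 c in auto)
            show ?thesis using 1 2 by (simp only: integral_mult_right_zero)
          qed
          show "?f \<beta> = 0"
          proof (rule ccontr)
            assume "?f \<beta> \<noteq> 0"
            then have "0 < ?f \<beta>" using nn' by linarith
            then have "f1 \<beta> \<noteq> 0" "f2 \<beta> \<noteq> 0" "f3 \<beta> \<noteq> 0" by auto
            then have ge: "(\<integral>x. h1 x \<partial>\<beta>) > (\<integral>x. h1 x \<partial>\<alpha>) - d" "(\<integral>x. h2 x \<partial>\<beta>) > (\<integral>x. h2 x \<partial>\<alpha>) - d" "(\<integral>x. 1 \<partial>\<alpha>) + d > (\<integral>x. 1 \<partial>\<beta>)"
              using f1(3) f2(3) f3(3) \<beta>(1) by (meson not_le)+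
            let ?D = "(\<integral>x. h x \<partial>\<beta>) - (\<integral>x. h x \<partial>\<alpha>)"
            have "\<bar>1 / (2 * B) * ?D\<bar> < 3 * d"
              using id[OF \<alpha>] id[OF \<beta>(1)] ge d unfolding right_diff_distrib by linarith
            then have "\<bar>?D\<bar> < 6 * B * d" using B(1) by (simp add: abs_mult field_simps)
            then show False using e(2)[of "\<integral>x. h x \<partial>\<beta>"] \<beta>(2) d by simp
          qed
        qed
      qed
    qed
    then show "\<exists>f\<in>\<F>. f \<alpha> = 1 \<and> (\<forall>y\<in>topspace (weak_topology c T) - G. f y = 0)" using G(2) by simp
  qed
qed

section \<open>Iterated degrees and tree functionals\<close>

text \<open>The bound holds at every point, so that the measures of all points lie in
  \<open>measures_le\<close>.\<close>

definition deg_bounded :: "'a measure \<Rightarrow> ('a \<Rightarrow> 'a \<Rightarrow> real) \<Rightarrow> real \<Rightarrow> bool" where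
  "deg_bounded M V c \<longleftrightarrow> prob_space M \<and> (\<lambda>(x, y). V x y) \<in> borel_measurable (M \<Otimes>\<^sub>M M)
     \<and> (\<forall>x\<in>space M. \<forall>y\<in>space M. 0 \<le> V x y)
     \<and> 0 \<le> c \<and> (\<forall>x\<in>space M. (\<integral>\<^sup>+ y. ennreal (V x y) \<partial>M) \<le> ennreal c)"

lemma deg_bounded_bd_kernel: "deg_bounded M V c \<Longrightarrow> bd_kernel M V c"
  by (auto simp: deg_bounded_def bd_kernel_def)

lemma deg_bounded_prob: "deg_bounded M V c \<Longrightarrow> prob_space M" by (simp add: deg_bounded_def)

definition level_measure :: "real \<Rightarrow> 'a measure \<Rightarrow> ('a \<Rightarrow> 'a \<Rightarrow> real) \<Rightarrow> nat \<Rightarrow> 'a \<Rightarrow> (nat \<Rightarrow> real) measure" where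
  "level_measure c M V k x = distr (density M (\<lambda>y. ennreal (V x y))) (borel_of (Pspace c k)) (iterated_degrees c M V k)"

text \<open>All levels of a point in one sequence. The maps \<open>iterated_degrees\<close> are its
  restrictions, which makes their compatibility with the projections visible.\<close>

definition profile :: "real \<Rightarrow> 'a measure \<Rightarrow> ('a \<Rightarrow> 'a \<Rightarrow> real) \<Rightarrow> 'a \<Rightarrow> nat \<Rightarrow> real" where
  "profile c M V x i = (case i of 0 \<Rightarrow> 0 | Suc j \<Rightarrow> code c (Pspace c j) (level_measure c M V j x))"

lemma iterated_degrees_eq:
  "iterated_degrees c M V k x = restrict (profile c M V x) {0..k}"
proof (induction k)
  case 0 then show ?case by (auto simp: profile_def restrict_def)
next
  case (Suc k)
  show ?case
    unfolding iterated_degrees.simps(2) level_measure_def[symmetric]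
    by (auto simp: Suc fun_eq_iff profile_def restrict_def le_Suc_eq)
qed

lemma profile_eq: "(\<lambda>x k. iterated_degrees c M V k x k) = profile c M V"
  by (simp add: iterated_degrees_eq fun_eq_iff)

lemma level_measure_measures_le:
  assumes V: "deg_bounded M V c" and m: "iterated_degrees c M V k \<in> M \<rightarrow>\<^sub>M borel_of (Pspace c k)" and x: "x \<in> space M"
  shows "level_measure c M V k x \<in> measures_le c (Pspace c k)"
proof -
  have [measurable]: "(\<lambda>(x, y). V x y) \<in> borel_measurable (M \<Otimes>\<^sub>M M)" using V by (simp add: deg_bounded_def)
  have [measurable]: "V x \<in> borel_measurable M" using x by measurable
  have "emeasure (level_measure c M V k x) (space (level_measure c M V k x)) = emeasure (density M (\<lambda>y. ennreal (V x y))) (space M)"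
    unfolding level_measure_def using m measurable_space[OF m] by (subst emeasure_distr) (auto intro!: arg_cong2[where f = emeasure] simp: borel_of_open simp del: iterated_degrees.simps)
  also have "\<dots> = (\<integral>\<^sup>+ y. ennreal (V x y) \<partial>M)" by (subst emeasure_density) (auto intro!: nn_integral_cong)
  also have "\<dots> \<le> ennreal c" using V x by (simp add: deg_bounded_def)
  finally show ?thesis by (simp add: measures_le_def level_measure_def)
qed

lemma level_measure_integral:
  assumes V: "deg_bounded M V c" and m: "iterated_degrees c M V k \<in> M \<rightarrow>\<^sub>M borel_of (Pspace c k)" and x: "x \<in> space M"
    and f: "f \<in> borel_measurable (borel_of (Pspace c k))"
  shows "(\<integral>\<beta>. f \<beta> \<partial>level_measure c M V k x) = kop M V (\<lambda>y. f (iterated_degrees c M V k y)) x"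
proof -
  have [measurable]: "(\<lambda>(x, y). V x y) \<in> borel_measurable (M \<Otimes>\<^sub>M M)" using V by (simp add: deg_bounded_def)
  have [measurable]: "V x \<in> borel_measurable M" using x by measurable
  have [measurable]: "(\<lambda>y. f (iterated_degrees c M V k y)) \<in> borel_measurable M" using measurable_compose[OF m f] .
  have "(\<integral>\<beta>. f \<beta> \<partial>level_measure c M V k x) = (\<integral>y. f (iterated_degrees c M V k y) \<partial>density M (\<lambda>y. ennreal (V x y)))"
    unfolding level_measure_def by (rule integral_distr) (use m f in simp_all)
  also have "\<dots> = (\<integral>y. V x y *\<^sub>R f (iterated_degrees c M V k y) \<partial>M)"
    by (rule integral_density) (use V x in \<open>auto simp: deg_bounded_def\<close>)
  finally show ?thesis by (simp add: kop_def)
qed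

lemma urysohn_family_Pspace_code:
  assumes "urysohn_family (Pspace c k) F" "\<alpha> \<in> measures_le c (Pspace c k)"
  shows "decode c (Pspace c k) (code c (Pspace c k) \<alpha>) = \<alpha>"
    "code c (Pspace c k) \<alpha> \<in> topspace (Lspace c (Suc k))"
proof -
  show *: "decode c (Pspace c k) (code c (Pspace c k) \<alpha>) = \<alpha>"
    unfolding decode_def by (rule inv_into_f_f[OF urysohn_family_code_inj[OF assms(1)] assms(2)])
  show "code c (Pspace c k) \<alpha> \<in> topspace (Lspace c (Suc k))"
    using * assms(2) by (simp add: coded_measures_def topspace_pullback_topology)
qed

abbreviation compat where
  "compat c l \<alpha> \<equiv> decode c (Pspace c (l - 1)) (\<alpha> l) =
        distr (decode c (Pspace c l) (\<alpha> (Suc l))) (borel_of (Pspace c (l - 1)))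
          (\<lambda>\<beta>. restrict \<beta> {0..l - 1})"

lemma topspace_Pspace:
  "\<alpha> \<in> topspace (Pspace c k) \<longleftrightarrow> \<alpha> \<in> Pi\<^sub>E {0..k} (\<lambda>i. topspace (Lspace c i)) \<and> (\<forall>l. 1 \<le> l \<and> l < k \<longrightarrow> compat c l \<alpha>)"
proof -
  have "(\<Pi>\<^sub>E i\<in>{0..k}. topspace (if i \<le> k then Lspace c i else discrete_topology {0})) = Pi\<^sub>E {0..k} (\<lambda>i. topspace (Lspace c i))"
    by (rule PiE_cong) auto
  then show ?thesis by (subst Pspace.simps) (auto simp del: Lspace.simps)
qed

lemma continuous_Pspace_restrict:
  "continuous_map (Pspace c (Suc k)) (Pspace c k) (\<lambda>\<beta>. restrict \<beta> {0..k})"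
proof -
  let ?X = "\<lambda>k i. if i \<le> k then Lspace c i else discrete_topology {0}"
  have "continuous_map (product_topology (?X (Suc k)) {0..Suc k}) (product_topology (?X k) {0..k}) (\<lambda>\<beta>. restrict \<beta> {0..k})"
    unfolding continuous_map_componentwise
  proof (intro conjI ballI)
    fix i assume i: "i \<in> {0..k}"
    then have "continuous_map (product_topology (?X (Suc k)) {0..Suc k}) (?X (Suc k) i) (\<lambda>\<beta>. \<beta> i)"
      by (intro continuous_map_product_projection) auto
    then show "continuous_map (product_topology (?X (Suc k)) {0..Suc k}) (?X k i) (\<lambda>\<beta>. restrict \<beta> {0..k} i)"
      using i by (simp del: Lspace.simps)
  qed auto
  then have c: "continuous_map (Pspace c (Suc k)) (product_topology (?X k) {0..k}) (\<lambda>\<beta>. restrict \<beta> {0..k})"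
    by (subst Pspace.simps) (rule continuous_map_from_subtopology)
  have "restrict \<beta> {0..k} \<in> topspace (Pspace c k)" if "\<beta> \<in> topspace (Pspace c (Suc k))" for \<beta>
    using that unfolding topspace_Pspace by (auto simp: PiE_iff simp del: Lspace.simps)
  then show ?thesis
    using c by (subst (2) Pspace.simps, subst continuous_map_in_subtopology)
      (auto simp del: Lspace.simps simp: topspace_Pspace)
qed

text \<open>Restricting the map of level \<open>Suc j\<close> gives the map of level
  \<open>j\<close>, and images of measures respect composition. The families enter because decoding
  inverts the code only once the code is known to be injective.\<close>

lemma compat_profile_aux:
  assumes V: "deg_bounded M V c" and x: "x \<in> space M"
    and m: "iterated_degrees c M V (Suc j) \<in> M \<rightarrow>\<^sub>M borel_of (Pspace c (Suc j))" "iterated_degrees c M V j \<in> M \<rightarrow>\<^sub>M borel_of (Pspace c j)"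
    and F: "urysohn_family (Pspace c (Suc j)) F" and F': "urysohn_family (Pspace c j) F'"
  shows "compat c (Suc j) (profile c M V x)"
proof -
  have "distr (level_measure c M V (Suc j) x) (borel_of (Pspace c j)) (\<lambda>\<beta>. restrict \<beta> {0..j})
    = distr (density M (\<lambda>y. ennreal (V x y))) (borel_of (Pspace c j)) ((\<lambda>\<beta>. restrict \<beta> {0..j}) \<circ> iterated_degrees c M V (Suc j))"
    unfolding level_measure_def
    by (rule distr_distr) (use m continuous_map_borel_of[OF continuous_Pspace_restrict] in \<open>simp_all del: iterated_degrees.simps\<close>)
  also have "(\<lambda>\<beta>. restrict \<beta> {0..j}) \<circ> iterated_degrees c M V (Suc j) = iterated_degrees c M V j"
    by (auto simp: fun_eq_iff iterated_degrees_eq restrict_def simp del: iterated_degrees.simps)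
  finally have "distr (level_measure c M V (Suc j) x) (borel_of (Pspace c j)) (\<lambda>\<beta>. restrict \<beta> {0..j}) = level_measure c M V j x"
    unfolding level_measure_def .
  then show ?thesis
    using urysohn_family_Pspace_code(1)[OF F level_measure_measures_le[OF V m(1) x]] urysohn_family_Pspace_code(1)[OF F' level_measure_measures_le[OF V m(2) x]]
    unfolding profile_def by (simp del: iterated_degrees.simps)
qed

locale deg_bounded_pair =
  fixes M :: "'a measure" and U :: "'a \<Rightarrow> 'a \<Rightarrow> real" and N :: "'b measure" and W :: "'b \<Rightarrow> 'b \<Rightarrow> real" and c :: real
  assumes M: "deg_bounded M U c" and N: "deg_bounded N W c"
begin

abbreviation "\<C> \<equiv> uclosure M N (tree_funs M U N W)"

lemma ess_bounded_pairs: "ess_bounded_pairs M N (tree_funs M U N W)"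
  by (rule tree_funs_ess_bounded_pairs[OF deg_bounded_prob[OF M] deg_bounded_bd_kernel[OF M] deg_bounded_prob[OF N] deg_bounded_bd_kernel[OF N]])

lemma comp_cont: "(f, g) \<in> \<C> \<Longrightarrow> continuous_on UNIV \<phi> \<Longrightarrow> (\<lambda>x. \<phi> (f x), \<lambda>y. \<phi> (g y)) \<in> \<C>"
  by (rule uclosure_comp_continuous[OF ess_bounded_pairs tree_funs_mult_closed tree_funs_one])

text \<open>Maximum and minimum are linear combinations of the sum and the absolute difference, and
  the absolute value is continuous. Stated for \<open>f\<close> along two fixed maps, this is the
  property \<open>R\<close> that is carried through the Urysohn families.\<close>

lemma lattice: "lattice_closed (\<lambda>f. (\<lambda>x. f (h x), \<lambda>y. f (h' y)) \<in> \<C>)"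
  unfolding lattice_closed_def
proof (intro conjI allI impI)
  show "(\<lambda>x. 0, \<lambda>y. 0) \<in> \<C>" using uclosure_scale[OF tree_funs_one, of 0 M N U W] by simp
  show "(\<lambda>x. 1, \<lambda>y. 1) \<in> \<C>" by (rule tree_funs_one)
  show "(\<lambda>x. real_of_rat q * f (h x), \<lambda>y. real_of_rat q * f (h' y)) \<in> \<C>"
    if "(\<lambda>x. f (h x), \<lambda>y. f (h' y)) \<in> \<C>" for f q using uclosure_scale[OF that] .
  fix f g assume fg: "(\<lambda>x. f (h x), \<lambda>y. f (h' y)) \<in> \<C>" "(\<lambda>x. g (h x), \<lambda>y. g (h' y)) \<in> \<C>"
  have d: "(\<lambda>x. \<bar>f (h x) - g (h x)\<bar>, \<lambda>y. \<bar>f (h' y) - g (h' y)\<bar>) \<in> \<C>"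
    by (rule comp_cont[OF uclosure_diff[OF fg]]) (intro continuous_intros)
  have mx: "max a b = 1 / 2 * (a + b) + 1 / 2 * \<bar>a - b\<bar>" and mn: "min a b = 1 / 2 * (a + b) + (- 1 / 2) * \<bar>a - b\<bar>" for a b :: real
    by (auto simp: max_def min_def field_simps abs_if)
  show "(\<lambda>x. max (f (h x)) (g (h x)), \<lambda>y. max (f (h' y)) (g (h' y))) \<in> \<C>"
    unfolding mx by (rule uclosure.lin[OF uclosure_add[OF fg] d])
  show "(\<lambda>x. min (f (h x)) (g (h x)), \<lambda>y. min (f (h' y)) (g (h' y))) \<in> \<C>"
    unfolding mn by (rule uclosure.lin[OF uclosure_add[OF fg] d])
qed

text \<open>The parts depend on each other: a family on a level makes the maps of this level
  measurable, and measurable maps are needed to form the level measures, on whose space the next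
  family is built. Hence they are proved together.\<close>

definition level_ok where
  "level_ok k \<longleftrightarrow> iterated_degrees c M U k \<in> M \<rightarrow>\<^sub>M borel_of (Pspace c k) \<and> iterated_degrees c N W k \<in> N \<rightarrow>\<^sub>M borel_of (Pspace c k) \<and>
    (\<exists>F. urysohn_family (Pspace c k) F \<and> (\<forall>f\<in>F. (\<lambda>x. f (iterated_degrees c M U k x), \<lambda>y. f (iterated_degrees c N W k y)) \<in> \<C>))"

text \<open>Integrating \<open>f\<close> against a level measure is the same as applying the kernel
  operator to \<open>f\<close> composed with the map of the previous level, and the closure is
  stable under the operator and under clamping. So the generators on the space of measures compose
  into the closure, and decoding transports the family to the coded space.\<close>

lemma coordinate:
  assumes "\<And>j. j < i \<Longrightarrow> level_ok j"
  shows "(\<exists>F. urysohn_family (Lspace c i) F \<and> (\<forall>f\<in>F. (\<lambda>x. f (profile c M U x i), \<lambda>y. f (profile c N W y i)) \<in> \<C>))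
    \<and> (\<forall>x\<in>space M. profile c M U x i \<in> topspace (Lspace c i)) \<and> (\<forall>x\<in>space N. profile c N W x i \<in> topspace (Lspace c i))"
proof (cases i)
  case 0
  have "\<exists>F. urysohn_family (discrete_topology {0}) F \<and> (\<forall>f\<in>F. (\<lambda>x. f (profile c M U x i), \<lambda>y. f (profile c N W y i)) \<in> \<C>)"
  proof (rule urysohn_family_generate[where S = "{}"])
    fix F :: "(real \<Rightarrow> real) set" and G :: "real set" and x
    assume "lattice_closed (\<lambda>f. f \<in> F)" "openin (discrete_topology {0}) G" "x \<in> G"
    then show "\<exists>f\<in>F. f x = 1 \<and> (\<forall>y\<in>topspace (discrete_topology {0}) - G. f y = 0)"
      by (intro bexI[of _ "\<lambda>x. 1"]) (auto simp: lattice_closed_def)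
  qed (auto intro: lattice)
  then show ?thesis using 0 by (simp add: profile_def)
next
  case (Suc j)
  obtain F where F: "urysohn_family (Pspace c j) F" "\<And>f. f \<in> F \<Longrightarrow> (\<lambda>x. f (iterated_degrees c M U j x), \<lambda>y. f (iterated_degrees c N W j y)) \<in> \<C>"
    and mU: "iterated_degrees c M U j \<in> M \<rightarrow>\<^sub>M borel_of (Pspace c j)" and mW: "iterated_degrees c N W j \<in> N \<rightarrow>\<^sub>M borel_of (Pspace c j)"
    using assms[of j] Suc by (auto simp: level_ok_def)
  have "\<exists>F'. urysohn_family (weak_topology c (Pspace c j)) F' \<and> (\<forall>f\<in>F'. (\<lambda>x. f (level_measure c M U j x), \<lambda>y. f (level_measure c N W j y)) \<in> \<C>)"
  proof (rule urysohn_family_weak[OF F(1) lattice])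
    fix f a m assume f: "f \<in> F"
    note fb = borel_of_continuous[OF urysohn_family_cont[OF F(1) f]]
    have C: "(kop M U (\<lambda>x. f (iterated_degrees c M U j x)), kop N W (\<lambda>x. f (iterated_degrees c N W j x))) \<in> \<C>"
      by (rule tree_funs_kop_closed[OF deg_bounded_prob[OF M] deg_bounded_bd_kernel[OF M] deg_bounded_prob[OF N] deg_bounded_bd_kernel[OF N] F(2)[OF f]])
    have "(\<lambda>x. \<integral>\<beta>. f \<beta> \<partial>level_measure c M U j x, \<lambda>x. \<integral>\<beta>. f \<beta> \<partial>level_measure c N W j x) \<in> \<C>"
    proof (rule uclosure_cong_AE[OF C])
      show "(\<lambda>x. \<integral>\<beta>. f \<beta> \<partial>level_measure c M U j x) \<in> borel_measurable M"
        using uclosure_ess_bounded[OF ess_bounded_pairs C] level_measure_integral[OF M mU _ fb] by (simp cong: measurable_cong add: ess_bounded_def)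
      show "(\<lambda>x. \<integral>\<beta>. f \<beta> \<partial>level_measure c N W j x) \<in> borel_measurable N"
        using uclosure_ess_bounded[OF ess_bounded_pairs C] level_measure_integral[OF N mW _ fb] by (simp cong: measurable_cong add: ess_bounded_def)
    qed (use level_measure_integral[OF M mU _ fb] level_measure_integral[OF N mW _ fb] in auto)
    then show "(\<lambda>x. clamp01 (m * ((\<integral>\<beta>. f \<beta> \<partial>level_measure c M U j x) - a)), \<lambda>y. clamp01 (m * ((\<integral>\<beta>. f \<beta> \<partial>level_measure c N W j y) - a))) \<in> \<C>"
      by (rule comp_cont[where \<phi> = "\<lambda>t. clamp01 (m * (t - a))"])
        (auto simp: clamp01_def intro!: continuous_intros)
  qed
  then obtain F' where F': "urysohn_family (weak_topology c (Pspace c j)) F'" "\<And>f. f \<in> F' \<Longrightarrow> (\<lambda>x. f (level_measure c M U j x), \<lambda>y. f (level_measure c N W j y)) \<in> \<C>"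
    by blast
  let ?D = "decode c (Pspace c j)"
  note cM = urysohn_family_Pspace_code[OF F(1) level_measure_measures_le[OF M mU]]
  note cN = urysohn_family_Pspace_code[OF F(1) level_measure_measures_le[OF N mW]]
  have "urysohn_family (Lspace c i) ((\<lambda>f x. f (?D x)) ` F')"
    unfolding Suc Lspace.simps coded_measures_def by (rule urysohn_family_pullback[OF F'(1)])
  moreover have "(\<lambda>x. f (?D (profile c M U x i)), \<lambda>y. f (?D (profile c N W y i))) \<in> \<C>" if f: "f \<in> F'" for f
  proof (rule uclosure_cong_AE[OF F'(2)[OF f]])
    show "(\<lambda>x. f (?D (profile c M U x i))) \<in> borel_measurable M"
      using uclosure_ess_bounded[OF ess_bounded_pairs F'(2)[OF f]] cM(1) by (simp cong: measurable_cong add: ess_bounded_def profile_def Suc)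
    show "(\<lambda>x. f (?D (profile c N W x i))) \<in> borel_measurable N"
      using uclosure_ess_bounded[OF ess_bounded_pairs F'(2)[OF f]] cN(1) by (simp cong: measurable_cong add: ess_bounded_def profile_def Suc)
  qed (use cM cN in \<open>auto simp: profile_def Suc\<close>)
  ultimately show ?thesis using cM cN by (auto simp: profile_def Suc simp del: Lspace.simps)
qed

lemma compat_profile:
  assumes "level_ok l" "level_ok (l - 1)" "1 \<le> l"
  shows "x \<in> space M \<Longrightarrow> compat c l (profile c M U x)" "y \<in> space N \<Longrightarrow> compat c l (profile c N W y)"
proof -
  obtain j where l: "l = Suc j" using assms(3) by (cases l) auto
  obtain F where F: "urysohn_family (Pspace c l) F" using assms by (auto simp: level_ok_def)
  obtain F' where F': "urysohn_family (Pspace c j) F'" using assms l by (auto simp: level_ok_def)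
  show "x \<in> space M \<Longrightarrow> compat c l (profile c M U x)"
    using compat_profile_aux[OF M _ _ _ F[unfolded l] F'] assms(1,2) by (simp add: level_ok_def l del: iterated_degrees.simps)
  show "y \<in> space N \<Longrightarrow> compat c l (profile c N W y)"
    using compat_profile_aux[OF N _ _ _ F[unfolded l] F'] assms(1,2) by (simp add: level_ok_def l del: iterated_degrees.simps)
qed

lemma level_ok_all: "level_ok k"
proof (induction k rule: less_induct)
  case (less k)
  let ?X = "\<lambda>i. if i \<le> k then Lspace c i else discrete_topology {0}"
  have "\<exists>F. urysohn_family (?X i) F \<and> (\<forall>f\<in>F. (\<lambda>x. f (profile c M U x i), \<lambda>y. f (profile c N W y i)) \<in> \<C>)" if "i \<in> {0..k}" for i
    using coordinate[of i] less that by auto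
  then obtain F where F: "\<And>i. i \<in> {0..k} \<Longrightarrow> urysohn_family (?X i) (F i)"
    "\<And>i f. i \<in> {0..k} \<Longrightarrow> f \<in> F i \<Longrightarrow> (\<lambda>x. f (profile c M U x i), \<lambda>y. f (profile c N W y i)) \<in> \<C>" by metis
  have "\<exists>F. urysohn_family (product_topology ?X {0..k}) F \<and> (\<forall>f\<in>F. (\<lambda>x. f (iterated_degrees c M U k x), \<lambda>y. f (iterated_degrees c N W k y)) \<in> \<C>)"
    by (rule urysohn_family_product[OF _ F(1) lattice]) (use F(2) in \<open>auto simp: iterated_degrees_eq simp del: iterated_degrees.simps\<close>)
  then obtain F' where F': "urysohn_family (Pspace c k) F'"
    "\<And>f. f \<in> F' \<Longrightarrow> (\<lambda>x. f (iterated_degrees c M U k x), \<lambda>y. f (iterated_degrees c N W k y)) \<in> \<C>"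
    unfolding Pspace.simps[of c k] using urysohn_family_subtopology by blast
  have "iterated_degrees c M U k \<in> space M \<rightarrow> topspace (Pspace c k)" "iterated_degrees c N W k \<in> space N \<rightarrow> topspace (Pspace c k)"
    unfolding Pi_iff topspace_Pspace iterated_degrees_eq
    using coordinate less compat_profile by (auto simp del: Lspace.simps)
  note t = this
  have "iterated_degrees c M U k \<in> M \<rightarrow>\<^sub>M borel_of (Pspace c k)"
    by (rule urysohn_family_measurable[OF F'(1) t(1)]) (use uclosure_ess_bounded[OF ess_bounded_pairs F'(2)] in \<open>auto simp: ess_bounded_def\<close>)
  moreover have "iterated_degrees c N W k \<in> N \<rightarrow>\<^sub>M borel_of (Pspace c k)"
    by (rule urysohn_family_measurable[OF F'(1) t(2)]) (use uclosure_ess_bounded[OF ess_bounded_pairs F'(2)] in \<open>auto simp: ess_bounded_def\<close>)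
  ultimately show ?case using F' unfolding level_ok_def by blast
qed

lemma profile_limit:
  shows "profile c M U \<in> M \<rightarrow>\<^sub>M borel_of (Pspace_lim c)" "profile c N W \<in> N \<rightarrow>\<^sub>M borel_of (Pspace_lim c)"
    "\<exists>F. urysohn_family (Pspace_lim c) F \<and> (\<forall>f\<in>F. (\<lambda>x. f (profile c M U x), \<lambda>y. f (profile c N W y)) \<in> \<C>)"
proof -
  have "\<exists>F. urysohn_family (Lspace c i) F \<and> (\<forall>f\<in>F. (\<lambda>x. f (profile c M U x i), \<lambda>y. f (profile c N W y i)) \<in> \<C>)" for i
    using coordinate[of i] level_ok_all by auto
  then obtain F where F: "\<And>i. urysohn_family (Lspace c i) (F i)"
    "\<And>i f. f \<in> F i \<Longrightarrow> (\<lambda>x. f (profile c M U x i), \<lambda>y. f (profile c N W y i)) \<in> \<C>" by metis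
  have "\<exists>F. urysohn_family (product_topology (Lspace c) UNIV) F \<and> (\<forall>f\<in>F. (\<lambda>x. f (profile c M U x), \<lambda>y. f (profile c N W y)) \<in> \<C>)"
    by (rule urysohn_family_product[OF _ F(1) lattice]) (use F(2) in auto)
  then obtain F' where F': "urysohn_family (Pspace_lim c) F'"
    "\<And>f. f \<in> F' \<Longrightarrow> (\<lambda>x. f (profile c M U x), \<lambda>y. f (profile c N W y)) \<in> \<C>"
    unfolding Pspace_lim_def using urysohn_family_subtopology by blast
  have "profile c M U \<in> space M \<rightarrow> topspace (Pspace_lim c)" "profile c N W \<in> space N \<rightarrow> topspace (Pspace_lim c)"
    unfolding Pi_iff Pspace_lim_def
    using coordinate level_ok_all compat_profile by (auto simp del: Lspace.simps)
  note t = this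
  show "profile c M U \<in> M \<rightarrow>\<^sub>M borel_of (Pspace_lim c)"
    by (rule urysohn_family_measurable[OF F'(1) t(1)]) (use uclosure_ess_bounded[OF ess_bounded_pairs F'(2)] in \<open>auto simp: ess_bounded_def\<close>)
  show "profile c N W \<in> N \<rightarrow>\<^sub>M borel_of (Pspace_lim c)"
    by (rule urysohn_family_measurable[OF F'(1) t(2)]) (use uclosure_ess_bounded[OF ess_bounded_pairs F'(2)] in \<open>auto simp: ess_bounded_def\<close>)
  show "\<exists>F. urysohn_family (Pspace_lim c) F \<and> (\<forall>f\<in>F. (\<lambda>x. f (profile c M U x), \<lambda>y. f (profile c N W y)) \<in> \<C>)" using F' by blast
qed

text \<open>The members of the limit family compose into the closure of the tree functions, so their
  integrals agree, and these integrals determine the law.\<close>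

lemma profile_law_eq:
  assumes "\<And>t. (\<integral>x. tree_fun M U t x \<partial>M) = (\<integral>y. tree_fun N W t y \<partial>N)"
  shows "distr M (borel_of (Pspace_lim c)) (profile c M U) = distr N (borel_of (Pspace_lim c)) (profile c N W)"
proof -
  interpret M: prob_space M by (rule deg_bounded_prob[OF M])
  interpret N: prob_space N by (rule deg_bounded_prob[OF N])
  obtain F where F: "urysohn_family (Pspace_lim c) F" "\<And>f. f \<in> F \<Longrightarrow> (\<lambda>x. f (profile c M U x), \<lambda>y. f (profile c N W y)) \<in> \<C>"
    using profile_limit(3) by blast
  show ?thesis
  proof (rule urysohn_family_measure_eqI[OF F(1)])
    show "finite_measure (distr M (borel_of (Pspace_lim c)) (profile c M U))"
      using prob_space.prob_space_distr[OF M.prob_space_axioms profile_limit(1)] by (simp add: prob_space_def)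
    show "finite_measure (distr N (borel_of (Pspace_lim c)) (profile c N W))"
      using prob_space.prob_space_distr[OF N.prob_space_axioms profile_limit(2)] by (simp add: prob_space_def)
    fix f assume f: "f \<in> F"
    note fb = borel_of_continuous[OF urysohn_family_cont[OF F(1) f]]
    show "(\<integral>x. f x \<partial>distr M (borel_of (Pspace_lim c)) (profile c M U)) = (\<integral>x. f x \<partial>distr N (borel_of (Pspace_lim c)) (profile c N W))"
      unfolding integral_distr[OF profile_limit(1) fb] integral_distr[OF profile_limit(2) fb]
      by (rule uclosure_integral_eq[OF deg_bounded_prob[OF M] deg_bounded_prob[OF N] ess_bounded_pairs _ F(2)[OF f]]) (use assms in \<open>auto simp: tree_funs_def\<close>)
  qed auto
qed

end

section \<open>Tree functions read off from iterated degrees\<close>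

primrec height :: "ptree \<Rightarrow> nat" where
  "height (PNode ts) = foldr max (map Suc (map height ts)) 0"

lemma foldr_max_Suc_le: "foldr max (map Suc hs) 0 \<le> k \<longleftrightarrow> (\<forall>h\<in>set hs. h < k)"
  for k :: nat by (induction hs) auto

lemma height_le: "height (PNode ts) \<le> k \<longleftrightarrow> (\<forall>t\<in>set ts. height t < k)"
  unfolding height.simps foldr_max_Suc_le by auto

text \<open>Recovers a tree function from coordinate \<open>k\<close> of a profile: the coordinate
  is decoded to a measure and the subtrees are evaluated at one coordinate lower under the integral.
  The value 1 at \<open>k = 0\<close> is right for a single vertex; for other trees \<open>k\<close>
  has to be at least the height.\<close>

primrec level_tree_fun :: "real \<Rightarrow> ptree \<Rightarrow> nat \<Rightarrow> real \<Rightarrow> real" where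
  "level_tree_fun c (PNode ts) = (\<lambda>k r. case k of 0 \<Rightarrow> 1 | Suc k \<Rightarrow>
     (\<Prod>s\<leftarrow>map (level_tree_fun c) ts. \<integral>\<beta>. s k (\<beta> k) \<partial>decode c (Pspace c k) r))"

lemma continuous_map_prod_list:
  "(\<And>f. f \<in> set fs \<Longrightarrow> continuous_map T euclideanreal f) \<Longrightarrow> continuous_map T euclideanreal (\<lambda>x. \<Prod>f\<leftarrow>fs. f x)"
  by (induction fs) (auto intro!: continuous_map_real_mult)

lemma bounded_prod_list:
  "(\<And>f. f \<in> set fs \<Longrightarrow> bounded (f ` S)) \<Longrightarrow> bounded ((\<lambda>x. \<Prod>f\<leftarrow>fs. f x :: real) ` S)"
proof (induction fs)
  case (Cons f fs)
  obtain A where A: "\<And>x. x \<in> S \<Longrightarrow> \<bar>f x\<bar> \<le> A" using Cons(2)[of f] by (auto simp: bounded_iff)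
  obtain B where B: "\<And>x. x \<in> S \<Longrightarrow> \<bar>\<Prod>f\<leftarrow>fs. f x\<bar> \<le> B" using Cons by (auto simp: bounded_iff)
  show ?case unfolding bounded_iff
  proof (intro exI[of _ "A * B"] ballI)
    fix z assume "z \<in> (\<lambda>x. \<Prod>f\<leftarrow>f # fs. f x) ` S"
    then obtain x where x: "x \<in> S" "z = f x * (\<Prod>f\<leftarrow>fs. f x)" by auto
    then show "norm z \<le> A * B" using A[OF x(1)] B[OF x(1)] by (auto simp: abs_mult intro!: mult_mono)
  qed
qed (auto intro: bounded_subset[of "{1}"])

lemma Pspace_projection:
  assumes "k \<le> n" shows "continuous_map (Pspace c n) (Lspace c k) (\<lambda>\<beta>. \<beta> k)"
proof -
  let ?X = "\<lambda>i. if i \<le> n then Lspace c i else discrete_topology {0}"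
  have "continuous_map (product_topology ?X {0..n}) (?X k) (\<lambda>\<beta>. \<beta> k)"
    using assms by (intro continuous_map_product_projection) auto
  then have "continuous_map (product_topology ?X {0..n}) (Lspace c k) (\<lambda>\<beta>. \<beta> k)" using assms by (simp del: Lspace.simps)
  then show ?thesis by (subst Pspace.simps) (rule continuous_map_from_subtopology)
qed

text \<open>Continuity and boundedness need each other: the weak topology is tested on functions
  that are both, and the bound on the total mass passes boundedness on to the next level.\<close>

lemma level_tree_fun_continuous:
  "continuous_map (Lspace c k) euclideanreal (level_tree_fun c t k) \<and> bounded (level_tree_fun c t k ` topspace (Lspace c k))"
proof (induction t arbitrary: k)
  case (PNode ts)
  show ?case
  proof (cases k)
    case 0 then show ?thesis by (auto intro: bounded_subset[of "{1}"])
  next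
    case (Suc j)
    let ?f = "\<lambda>t r. \<integral>\<beta>. level_tree_fun c t j (\<beta> j) \<partial>decode c (Pspace c j) r"
    have cb: "continuous_map (Lspace c k) euclideanreal (?f t) \<and> bounded (?f t ` topspace (Lspace c k))" if t: "t \<in> set ts" for t
    proof
      note IH = PNode[OF t, of j]
      have c: "continuous_map (Pspace c j) euclideanreal (\<lambda>\<beta>. level_tree_fun c t j (\<beta> j))"
        using continuous_map_compose[OF Pspace_projection[OF order_refl] conjunct1[OF IH]] by (simp add: o_def)
      have sub: "(\<lambda>\<beta>. level_tree_fun c t j (\<beta> j)) ` topspace (Pspace c j) \<subseteq> level_tree_fun c t j ` topspace (Lspace c j)"
        by (auto simp: topspace_Pspace PiE_iff simp del: Lspace.simps)
      have b: "bounded ((\<lambda>\<beta>. level_tree_fun c t j (\<beta> j)) ` topspace (Pspace c j))"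
        by (rule bounded_subset[OF conjunct2[OF IH] sub])
      show "continuous_map (Lspace c k) euclideanreal (?f t)"
        unfolding Suc Lspace.simps coded_measures_def
        using continuous_map_pullback[OF continuous_weak_topology[OF c b]] by (simp add: o_def)
      obtain B where B: "\<And>x. x \<in> topspace (Pspace c j) \<Longrightarrow> \<bar>level_tree_fun c t j (x j)\<bar> \<le> B" using b by (auto simp: bounded_iff)
      show "bounded (?f t ` topspace (Lspace c k))"
        unfolding bounded_iff
      \<comment> \<open>Neither \<open>c\<close> nor \<open>B\<close> is known to be nonnegative
        here.\<close>
      proof (intro exI[of _ "max 0 c * max 0 B"] ballI)
        fix z assume "z \<in> ?f t ` topspace (Lspace c k)"
        then obtain r where r: "decode c (Pspace c j) r \<in> measures_le c (Pspace c j)" "z = ?f t r"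
          by (auto simp: Suc coded_measures_def topspace_pullback_topology)
        let ?\<alpha> = "decode c (Pspace c j) r"
        interpret finite_measure ?\<alpha> using measures_leD(2)[OF r(1)] .
        have "ennreal (measure ?\<alpha> (space ?\<alpha>)) \<le> ennreal (max 0 c)"
          using r(1) emeasure_eq_measure[of "space ?\<alpha>"] by (auto simp: measures_le_def max_def ennreal_neg)
        then have m: "measure ?\<alpha> (space ?\<alpha>) \<le> max 0 c" by (subst (asm) ennreal_le_iff) auto
        have meas: "(\<lambda>\<beta>. level_tree_fun c t j (\<beta> j)) \<in> borel_measurable ?\<alpha>"
          using borel_of_continuous[OF c] measurable_cong_sets[OF measures_leD(1)[OF r(1)] refl] by blast
        have int: "integrable ?\<alpha> (\<lambda>\<beta>. level_tree_fun c t j (\<beta> j))"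
          by (rule integrable_const_bound[of _ B]) (use B meas measures_leD(3)[OF r(1)] in auto)
        have "norm z \<le> (\<integral>x. norm (level_tree_fun c t j (x j)) \<partial>?\<alpha>)"
          unfolding r(2) by (rule integral_norm_bound)
        also have "\<dots> \<le> (\<integral>x. max 0 B \<partial>?\<alpha>)"
        proof (rule integral_mono[OF integrable_norm[OF int]])
          fix x assume "x \<in> space ?\<alpha>"
          then show "norm (level_tree_fun c t j (x j)) \<le> max 0 B" using B[of x] measures_leD(3)[OF r(1)] by auto
        qed simp
        also have "\<dots> \<le> max 0 c * max 0 B" using m by (auto intro!: mult_right_mono)
        finally show "norm z \<le> max 0 c * max 0 B" .
      qed
    qed
    have e: "level_tree_fun c (PNode ts) k = (\<lambda>r. \<Prod>f\<leftarrow>map ?f ts. f r)" by (simp add: Suc o_def)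
    show ?thesis unfolding e
      by (intro conjI continuous_map_prod_list bounded_prod_list) (use cb in auto)
  qed
qed

lemma (in deg_bounded_pair) level_tree_fun_profile:
  shows "height t \<le> k \<Longrightarrow> x \<in> space M \<Longrightarrow> level_tree_fun c t k (profile c M U x k) = tree_fun M U t x"
proof (induction t arbitrary: k x)
  case (PNode ts)
  show ?case
  proof (cases k)
    case 0
    then have "ts = []" using PNode.prems(1) height_le[of ts 0] by (cases ts) auto
    then show ?thesis using 0 by simp
  next
    case (Suc j)
    obtain F where F: "urysohn_family (Pspace c j) F" and mU: "iterated_degrees c M U j \<in> M \<rightarrow>\<^sub>M borel_of (Pspace c j)"
      using level_ok_all[of j] by (auto simp: level_ok_def)
    have "(\<integral>\<beta>. level_tree_fun c t j (\<beta> j) \<partial>level_measure c M U j x) = kop M U (tree_fun M U t) x" if t: "t \<in> set ts" for t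
    proof -
      have "(\<lambda>\<beta>. level_tree_fun c t j (\<beta> j)) \<in> borel_measurable (borel_of (Pspace c j))"
        using continuous_map_compose[OF Pspace_projection[OF order_refl] conjunct1[OF level_tree_fun_continuous]]
        by (intro borel_of_continuous) (simp add: o_def)
      from level_measure_integral[OF M mU PNode.prems(2) this]
      have "(\<integral>\<beta>. level_tree_fun c t j (\<beta> j) \<partial>level_measure c M U j x) = kop M U (\<lambda>y. level_tree_fun c t j (profile c M U y j)) x"
        by (simp add: iterated_degrees_eq del: iterated_degrees.simps)
      also have "\<dots> = kop M U (tree_fun M U t) x"
        unfolding kop_def using PNode.IH[OF t, of j] PNode.prems(1) t height_le[of ts k] Suc
        by (intro Bochner_Integration.integral_cong) auto
      finally show ?thesis .
    qed
    then show ?thesis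
      using urysohn_family_Pspace_code(1)[OF F level_measure_measures_le[OF M mU PNode.prems(2)]]
      by (simp add: Suc profile_def o_def cong: map_cong)
  qed
qed

text \<open>Both integrals are integrals of one measurable function on the limit space against the
  common law. The interpretation \<open>sw\<close> exchanges the two kernels, so that the evaluation
  of tree functions applies to the second one too.\<close>

lemma (in deg_bounded_pair) tree_fun_eq_of_profile_law:
  assumes "distr M (borel_of (Pspace_lim c)) (profile c M U) = distr N (borel_of (Pspace_lim c)) (profile c N W)"
  shows "(\<integral>x. tree_fun M U t x \<partial>M) = (\<integral>y. tree_fun N W t y \<partial>N)"
proof -
  interpret sw: deg_bounded_pair N W M U c by unfold_locales (rule N, rule M)
  have "continuous_map (Pspace_lim c) (Lspace c (height t)) (\<lambda>\<beta>. \<beta> (height t))"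
    unfolding Pspace_lim_def by (intro continuous_map_from_subtopology continuous_map_product_projection) auto
  from continuous_map_compose[OF this conjunct1[OF level_tree_fun_continuous]]
  have m: "(\<lambda>\<beta>. level_tree_fun c t (height t) (\<beta> (height t))) \<in> borel_measurable (borel_of (Pspace_lim c))"
    by (intro borel_of_continuous) (simp add: o_def)
  have "(\<integral>x. tree_fun M U t x \<partial>M) = (\<integral>x. level_tree_fun c t (height t) (profile c M U x (height t)) \<partial>M)"
    by (rule Bochner_Integration.integral_cong) (simp_all add: level_tree_fun_profile)
  also have "\<dots> = (\<integral>\<beta>. level_tree_fun c t (height t) (\<beta> (height t)) \<partial>distr M (borel_of (Pspace_lim c)) (profile c M U))"
    by (rule integral_distr[symmetric, OF profile_limit(1) m])
  also have "\<dots> = (\<integral>x. level_tree_fun c t (height t) (profile c N W x (height t)) \<partial>N)"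
    unfolding assms by (rule integral_distr[OF profile_limit(2) m])
  also have "\<dots> = (\<integral>x. tree_fun N W t x \<partial>N)"
    by (rule Bochner_Integration.integral_cong) (simp_all add: sw.level_tree_fun_profile)
  finally show ?thesis .
qed

section \<open>Plane trees and rooted isomorphism\<close>

instance ptree :: countable by countable_datatype

text \<open>Nested multisets serve as canonical forms of finite rooted trees up to
  isomorphism.\<close>

datatype shape = Sh "shape multiset"

primrec canon :: "ptree \<Rightarrow> shape" where
  "canon (PNode ts) = Sh (mset (map canon ts))"

primrec tree :: "ptree \<Rightarrow> nat list set" where
  "tree (PNode ts) = insert [] (\<Union>i<length ts. (#) i ` (map tree ts ! i))"

lemma Nil_tree [simp]: "[] \<in> tree t" by (cases t) simp

lemma Cons_tree [simp]: "i # u \<in> tree (PNode ts) \<longleftrightarrow> i < length ts \<and> u \<in> tree (ts ! i)"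
  by auto

declare tree.simps [simp del]

lemma tree_prefix: "u @ v \<in> tree s \<Longrightarrow> u \<in> tree s"
proof (induction u arbitrary: s)
  case (Cons a u) then show ?case by (cases s) auto
qed simp

lemma finite_tree: "finite (tree t)"
  by (induction t) (auto simp: tree.simps)

lemma Nil_untyped [simp]: "[] \<in> untyped_tree \<omega>" by (simp add: untyped_tree_def)

lemma Cons_untyped [simp]: "i # u \<in> untyped_tree \<omega> \<longleftrightarrow> i < snd (\<omega> []) \<and> u \<in> untyped_tree (\<lambda>v. \<omega> (i # v))"
  unfolding untyped_tree_def
proof (intro iffI conjI CollectI allI impI)
  assume *: "i # u \<in> {u. \<forall>v i w. u = v @ i # w \<longrightarrow> i < snd (\<omega> v)}"
  then show "i < snd (\<omega> [])" by blast
  fix v j w assume "u = v @ j # w"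
  then have "i # u = (i # v) @ j # w" by simp
  then show "j < snd (\<omega> (i # v))" using * by blast
next
  fix v j w assume *: "i < snd (\<omega> []) \<and> u \<in> {u. \<forall>v j w. u = v @ j # w \<longrightarrow> j < snd (\<omega> (i # v))}" and e: "i # u = v @ j # w"
  then show "j < snd (\<omega> v)" by (cases v) auto
qed

lemma untyped_eq_tree:
  "untyped_tree \<omega> = tree (PNode ts) \<longleftrightarrow>
    snd (\<omega> []) = length ts \<and> (\<forall>i<length ts. untyped_tree (\<lambda>v. \<omega> (i # v)) = tree (ts ! i))"
proof
  assume eq: "untyped_tree \<omega> = tree (PNode ts)"
  have "i < snd (\<omega> []) \<longleftrightarrow> i < length ts" for i
    using Cons_untyped[of i "[]" \<omega>] Cons_tree[of i "[]" ts] eq by simp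
  then have l: "snd (\<omega> []) = length ts" by (metis linorder_neqE_nat less_irrefl)
  moreover have "untyped_tree (\<lambda>v. \<omega> (i # v)) = tree (ts ! i)" if "i < length ts" for i
    using that l Cons_untyped[of i _ \<omega>] Cons_tree[of i _ ts] eq by auto
  ultimately show "snd (\<omega> []) = length ts \<and> (\<forall>i<length ts. untyped_tree (\<lambda>v. \<omega> (i # v)) = tree (ts ! i))" by blast
next
  assume *: "snd (\<omega> []) = length ts \<and> (\<forall>i<length ts. untyped_tree (\<lambda>v. \<omega> (i # v)) = tree (ts ! i))"
  show "untyped_tree \<omega> = tree (PNode ts)"
  proof (rule set_eqI)
    fix u show "u \<in> untyped_tree \<omega> \<longleftrightarrow> u \<in> tree (PNode ts)" using * by (cases u) auto
  qed
qed

lemma tree_inj: "tree s = tree t \<Longrightarrow> s = t"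
proof (induction s arbitrary: t)
  case (PNode ss)
  obtain ts where t: "t = PNode ts" by (cases t)
  note eq = PNode.prems[unfolded t]
  have "i < length ss \<longleftrightarrow> i < length ts" for i
    using Cons_tree[of i "[]" ss] Cons_tree[of i "[]" ts] eq by simp
  then have l: "length ss = length ts" by (metis linorder_neqE_nat less_irrefl)
  have "ss = ts"
  proof (rule nth_equalityI[OF l])
    fix i assume i: "i < length ss"
    have "tree (ss ! i) = tree (ts ! i)" using i l Cons_tree[of i _ ss] Cons_tree[of i _ ts] eq by auto
    then show "ss ! i = ts ! i" using PNode.IH[of "ss ! i"] i by simp
  qed
  then show ?case using t by simp
qed

lemma finite_untyped: "finite (untyped_tree \<omega>) \<longleftrightarrow> (\<forall>i<snd (\<omega> []). finite (untyped_tree (\<lambda>v. \<omega> (i # v))))"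
proof -
  have "untyped_tree \<omega> = insert [] (\<Union>i<snd (\<omega> []). (#) i ` untyped_tree (\<lambda>v. \<omega> (i # v)))"
  proof (rule set_eqI)
    fix u show "u \<in> untyped_tree \<omega> \<longleftrightarrow> u \<in> insert [] (\<Union>i<snd (\<omega> []). (#) i ` untyped_tree (\<lambda>v. \<omega> (i # v)))"
      by (cases u) auto
  qed
  then have "finite (untyped_tree \<omega>) \<longleftrightarrow> (\<forall>i\<in>{..<snd (\<omega> [])}. finite (untyped_tree (\<lambda>v. \<omega> (i # v))))"
    by (simp add: finite_image_iff)
  then show ?thesis by (simp only: Ball_def lessThan_iff)
qed

lemma finite_untyped_tree:
  "finite (untyped_tree \<omega>) \<Longrightarrow> \<exists>t. untyped_tree \<omega> = tree t"
proof (induction "card (untyped_tree \<omega>)" arbitrary: \<omega> rule: less_induct)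
  case less
  have "\<exists>t. untyped_tree (\<lambda>v. \<omega> (i # v)) = tree t" if i: "i < snd (\<omega> [])" for i
  proof (rule less(1))
    have "(#) i ` untyped_tree (\<lambda>v. \<omega> (i # v)) \<subset> untyped_tree \<omega>" using i by (auto intro!: psubsetI)
    then have "card ((#) i ` untyped_tree (\<lambda>v. \<omega> (i # v))) < card (untyped_tree \<omega>)" by (rule psubset_card_mono[OF less(2)])
    then show "card (untyped_tree (\<lambda>v. \<omega> (i # v))) < card (untyped_tree \<omega>)" by (simp add: card_image)
    show "finite (untyped_tree (\<lambda>v. \<omega> (i # v)))" using less(2) finite_untyped i by blast
  qed
  then obtain f where f: "\<And>i. i < snd (\<omega> []) \<Longrightarrow> untyped_tree (\<lambda>v. \<omega> (i # v)) = tree (f i)" by metis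
  have "untyped_tree \<omega> = tree (PNode (map f [0..<snd (\<omega> [])]))"
    unfolding untyped_eq_tree using f by simp
  then show ?case by blast
qed

lemma rooted_isomorphic_refl: "[] \<in> S \<Longrightarrow> rooted_isomorphic S S"
  unfolding rooted_isomorphic_def by (auto intro!: exI[of _ id])

lemma rooted_isomorphic_trans:
  assumes "rooted_isomorphic S T" "rooted_isomorphic T V" shows "rooted_isomorphic S V"
proof -
  obtain f where f: "bij_betw f S T" "f [] = []" "\<forall>u\<in>S. \<forall>v\<in>S. is_child u v \<longleftrightarrow> is_child (f u) (f v)" and S: "[] \<in> S"
    using assms(1) by (auto simp: rooted_isomorphic_def)
  obtain g where g: "bij_betw g T V" "g [] = []" "\<forall>u\<in>T. \<forall>v\<in>T. is_child u v \<longleftrightarrow> is_child (g u) (g v)"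
    using assms(2) by (auto simp: rooted_isomorphic_def)
  show ?thesis unfolding rooted_isomorphic_def
    using S bij_betw_trans[OF f(1) g(1)] f g bij_betwE[OF f(1)] by (auto intro!: exI[of _ "g \<circ> f"])
qed

lemma rooted_isomorphic_sym:
  assumes "rooted_isomorphic S T" shows "rooted_isomorphic T S"
proof -
  obtain f where f: "bij_betw f S T" "f [] = []" "\<forall>u\<in>S. \<forall>v\<in>S. is_child u v \<longleftrightarrow> is_child (f u) (f v)" and S: "[] \<in> S"
    using assms(1) by (auto simp: rooted_isomorphic_def)
  let ?g = "inv_into S f"
  have g: "bij_betw ?g T S" using f(1) by (rule bij_betw_inv_into)
  have gf: "?g u \<in> S" "f (?g u) = u" if "u \<in> T" for u
    using that bij_betwE[OF g] bij_betw_inv_into_right[OF f(1)] by auto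
  have "[] \<in> T" using S f bij_betwE[OF f(1)] by metis
  moreover have "?g [] = []" using bij_betw_inv_into_left[OF f(1) S] f(2) by simp
  ultimately show ?thesis unfolding rooted_isomorphic_def using g f(3) gf by (intro conjI exI[of _ ?g]) auto
qed

text \<open>An isomorphism permutes the children of the root by some \<open>\<sigma>\<close> and
  maps the subtree at child \<open>i\<close> onto the subtree at \<open>\<sigma> i\<close>. Its
  restrictions are isomorphisms of these subtrees, so the multisets of canonical forms agree by
  induction.\<close>

lemma rooted_isomorphic_canon:
  "rooted_isomorphic (tree s) (tree t) \<Longrightarrow> canon s = canon t"
proof (induction s arbitrary: t)
  case (PNode ss)
  obtain ts where t: "t = PNode ts" by (cases t)
  obtain f where f: "bij_betw f (tree (PNode ss)) (tree (PNode ts))" "f [] = []"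
    and child: "\<And>u v. u \<in> tree (PNode ss) \<Longrightarrow> v \<in> tree (PNode ss) \<Longrightarrow> is_child u v \<longleftrightarrow> is_child (f u) (f v)"
    using PNode.prems unfolding t rooted_isomorphic_def by blast
  have fin: "f u \<in> tree (PNode ts)" if "u \<in> tree (PNode ss)" for u using bij_betwE[OF f(1)] that by blast
  have inj: "u = v" if "f u = f v" "u \<in> tree (PNode ss)" "v \<in> tree (PNode ss)" for u v
    using f(1) that by (auto simp: bij_betw_def inj_on_def)
  have surj: "\<exists>u\<in>tree (PNode ss). f u = w" if "w \<in> tree (PNode ts)" for w
    using f(1) that by (metis bij_betw_imp_surj_on imageE)
  have "\<exists>j. f [i] = [j]" if "i < length ss" for i
    using child[of "[]" "[i]"] f(2) that by (auto simp: is_child_def)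
  then obtain \<sigma> where \<sigma>: "\<And>i. i < length ss \<Longrightarrow> f [i] = [\<sigma> i]" by metis
  have \<sigma>_less: "\<sigma> i < length ts" if "i < length ss" for i
    using fin[of "[i]"] \<sigma>[OF that] that by simp
  have \<sigma>_bij: "bij_betw \<sigma> {..<length ss} {..<length ts}"
    unfolding bij_betw_def
  proof (intro conjI equalityI subsetI)
    show "inj_on \<sigma> {..<length ss}"
    proof (rule inj_onI)
      fix i j assume "i \<in> {..<length ss}" "j \<in> {..<length ss}" "\<sigma> i = \<sigma> j"
      then show "i = j" using \<sigma>[of i] \<sigma>[of j] inj[of "[i]" "[j]"] by simp
    qed
    fix j assume "j \<in> {..<length ts}"
    then obtain u where u: "u \<in> tree (PNode ss)" "f u = [j]" using surj[of "[j]"] by auto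
    then have "is_child [] u" using child[of "[]" u] f(2) by (auto simp: is_child_def)
    then obtain i where i: "u = [i]" by (auto simp: is_child_def)
    then show "j \<in> \<sigma> ` {..<length ss}" using u \<sigma>[of i] by auto
  qed (use \<sigma>_less in auto)
  \<comment> \<open>Going down one generation extends the image address at its end, so the first
    letter never changes.\<close>
  have hd: "f (i # u) = \<sigma> i # tl (f (i # u))" if i: "i < length ss" and u: "u \<in> tree (ss ! i)" for i u
    using u
  proof (induction u rule: rev_induct)
    case Nil then show ?case using \<sigma>[OF i] by simp
  next
    case (snoc j u)
    have u: "u \<in> tree (ss ! i)" by (rule tree_prefix[OF snoc.prems])
    have "is_child (i # u) (i # u @ [j])" by (auto simp: is_child_def)
    then have "is_child (f (i # u)) (f (i # u @ [j]))"
      using child[of "i # u" "i # u @ [j]"] snoc.prems u i by simp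
    then obtain k where "f (i # u @ [j]) = f (i # u) @ [k]" by (auto simp: is_child_def)
    then show ?case using snoc.IH[OF u] by (metis append_Cons list.sel(3))
  qed
  have sub: "canon (ss ! i) = canon (ts ! \<sigma> i)" if i: "i < length ss" for i
  proof (rule PNode.IH)
    show "ss ! i \<in> set ss" using i by simp
    define g where "g u = tl (f (i # u))" for u
    have hd': "f (i # u) = \<sigma> i # g u" if "u \<in> tree (ss ! i)" for u
      using hd[OF i that] by (simp add: g_def)
    have gT: "g u \<in> tree (ts ! \<sigma> i)" if "u \<in> tree (ss ! i)" for u
      using fin[of "i # u"] hd'[OF that] that i by simp
    have "bij_betw g (tree (ss ! i)) (tree (ts ! \<sigma> i))"
      unfolding bij_betw_def
    proof (intro conjI equalityI subsetI)
      show "inj_on g (tree (ss ! i))"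
      proof (rule inj_onI)
        fix u v assume "u \<in> tree (ss ! i)" "v \<in> tree (ss ! i)" "g u = g v"
        then show "u = v" using hd'[of u] hd'[of v] inj[of "i # u" "i # v"] i by simp
      qed
      fix w assume w: "w \<in> tree (ts ! \<sigma> i)"
      then obtain u where u: "u \<in> tree (PNode ss)" "f u = \<sigma> i # w" using surj[of "\<sigma> i # w"] \<sigma>_less[OF i] by auto
      then obtain j v where jv: "u = j # v" using f(2) by (cases u) auto
      then have jv': "j < length ss" "v \<in> tree (ss ! j)" using u by auto
      have "\<sigma> j = \<sigma> i" using hd[OF jv'] u(2) jv by auto
      then have "j = i" using \<sigma>_bij jv'(1) i by (auto simp: bij_betw_def inj_on_def)
      then show "w \<in> g ` tree (ss ! i)" using jv jv' u(2) by (auto simp: g_def intro!: image_eqI[of _ _ v])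
    qed (use gT in auto)
    moreover have "g [] = []" using \<sigma>[OF i] by (simp add: g_def)
    moreover have "is_child u v \<longleftrightarrow> is_child (g u) (g v)" if "u \<in> tree (ss ! i)" "v \<in> tree (ss ! i)" for u v
      using child[of "i # u" "i # v"] hd' that i by (simp add: is_child_def)
    ultimately show "rooted_isomorphic (tree (ss ! i)) (tree (ts ! \<sigma> i))"
      unfolding rooted_isomorphic_def by auto
  qed
  have "mset (map canon ss) = image_mset (\<lambda>i. canon (ss ! i)) (mset_set {..<length ss})"
    by (metis (no_types, lifting) atLeast_upt image_mset_cong map_nth mset_map mset_upt multiset.map_comp comp_apply atLeast0LessThan)
  also have "\<dots> = image_mset (\<lambda>i. canon (ts ! \<sigma> i)) (mset_set {..<length ss})"
    using sub by (intro image_mset_cong) auto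
  also have "\<dots> = image_mset (\<lambda>j. canon (ts ! j)) (image_mset \<sigma> (mset_set {..<length ss}))"
    by (simp add: multiset.map_comp o_def)
  also have "image_mset \<sigma> (mset_set {..<length ss}) = mset_set {..<length ts}"
    using \<sigma>_bij by (simp add: image_mset_mset_set bij_betw_def)
  also have "image_mset (\<lambda>j. canon (ts ! j)) (mset_set {..<length ts}) = mset (map canon ts)"
    by (metis (no_types, lifting) atLeast_upt image_mset_cong map_nth mset_map mset_upt multiset.map_comp comp_apply atLeast0LessThan)
  finally show ?case using t by simp
qed

text \<open>The values of \<open>g\<close> are compared only across the two lists, which is what an
  induction hypothesis about the trees in \<open>ss\<close> provides. It follows that
  \<open>g\<close> factors through \<open>canon\<close> on both lists, by one and the same
  function.\<close>

lemma canon_children: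
  assumes "canon (PNode ss) = canon (PNode ts)"
    and "\<And>s t. s \<in> set ss \<Longrightarrow> t \<in> set ts \<Longrightarrow> canon s = canon t \<Longrightarrow> g s = g t"
  shows "mset (map g ss) = mset (map g ts)"
proof -
  have m: "mset (map canon ss) = mset (map canon ts)" using assms(1) by simp
  then have sets: "canon ` set ss = canon ` set ts" by (metis mset_eq_setD set_map)
  define h where "h c = g (SOME s. s \<in> set ss \<and> canon s = c)" for c
  have height: "g t = h (canon t)" if t: "t \<in> set ts" for t
  proof -
    have "\<exists>s. s \<in> set ss \<and> canon s = canon t" using sets t by (metis imageE imageI)
    from someI_ex[OF this] show ?thesis using assms(2)[OF _ t] by (simp add: h_def)
  qed
  have hs: "g s = h (canon s)" if s: "s \<in> set ss" for s
  proof -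
    obtain t where t: "t \<in> set ts" "canon s = canon t" using sets s by (metis imageE imageI)
    then show ?thesis using assms(2)[OF s t] height by simp
  qed
  have "map g ss = map h (map canon ss)" using hs by simp
  then have "mset (map g ss) = image_mset h (mset (map canon ss))" by (simp only: mset_map)
  also have "\<dots> = mset (map h (map canon ts))" unfolding m by (simp only: mset_map)
  also have "map h (map canon ts) = map g ts" using height by simp
  finally show ?thesis .
qed

lemma foldr_max_eq_Max: "foldr max (map Suc hs) 0 = Max (insert 0 (Suc ` set hs))"
proof (induction hs)
  case (Cons h hs)
  have "Max (insert 0 (Suc ` set (h # hs))) = Max (insert (Suc h) (insert 0 (Suc ` set hs)))"
    by (simp add: insert_commute)
  also have "\<dots> = max (Suc h) (Max (insert 0 (Suc ` set hs)))" by (rule Max_insert) auto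
  finally show ?case using Cons by simp
qed simp

lemma canon_height: "canon s = canon t \<Longrightarrow> height s = height t"
proof (induction s arbitrary: t)
  case (PNode ss)
  obtain ts where t: "t = PNode ts" by (cases t)
  have "mset (map height ss) = mset (map height ts)"
    by (rule canon_children[OF PNode.prems[unfolded t] PNode.IH])
  then have "set (map height ss) = set (map height ts)" by (rule mset_eq_setD)
  then show ?case unfolding t height.simps foldr_max_eq_Max by simp
qed

text \<open>The number of children is fixed, and by induction they come from a finite set.\<close>

lemma finite_canon: "finite {s. canon s = canon t}"
proof (induction t)
  case (PNode ts)
  let ?A = "\<Union>t\<in>set ts. {s. canon s = canon t}"
  have fin: "finite ?A" using PNode by auto
  have "{s. canon s = canon (PNode ts)} \<subseteq> PNode ` {l. set l \<subseteq> ?A \<and> length l = length ts}"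
  proof
    fix s assume "s \<in> {s. canon s = canon (PNode ts)}"
    moreover obtain ss where s: "s = PNode ss" by (cases s)
    ultimately have m: "mset (map canon ss) = mset (map canon ts)" by simp
    have "canon ` set ss = canon ` set ts" using m by (metis mset_eq_setD set_map)
    have "set ss \<subseteq> ?A"
    proof
      fix x assume "x \<in> set ss"
      then have "canon x \<in> canon ` set ts" using \<open>canon ` set ss = canon ` set ts\<close> by blast
      then show "x \<in> ?A" by auto
    qed
    moreover have "length ss = length ts" using m by (metis length_map mset_eq_length)
    ultimately show "s \<in> PNode ` {l. set l \<subseteq> ?A \<and> length l = length ts}" using s by simp
  qed
  then show ?case by (rule finite_subset) (use finite_lists_length_eq[OF fin] in simp)
qed

section \<open>The degree as a limit of tree functionals, and extinction\<close>

text \<open>The hypotheses of the theorem with explicit constants: \<open>C\<close> bounds the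
  kernel and \<open>d\<close> bounds the degree from below. The bound on the kernel is an iterated
  almost-everywhere statement, ready for use at a fixed \<open>x\<close>.\<close>

locale nice_kernel = prob_space M for M :: "'a measure" +
  fixes W :: "'a \<Rightarrow> 'a \<Rightarrow> real" and C d :: real
  assumes W_meas [measurable]: "(\<lambda>(x, y). W x y) \<in> borel_measurable (M \<Otimes>\<^sub>M M)"
    and W_nonneg: "\<And>x y. x \<in> space M \<Longrightarrow> y \<in> space M \<Longrightarrow> 0 \<le> W x y"
    and W_sym: "\<And>x y. x \<in> space M \<Longrightarrow> y \<in> space M \<Longrightarrow> W x y = W y x"
    and W_le: "AE x in M. AE y in M. W x y \<le> C" and C_nonneg: "0 \<le> C"
    and d_pos: "0 < d" and deg_ge: "AE x in M. ennreal d \<le> deg M W x"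
    and conn: "connected_kernel M W"
begin

text \<open>\<open>K\<close> is the density of the mean number of ordinary children,
  \<open>P\<close> the transition density along the line of ancestors.\<close>

definition D :: "'a \<Rightarrow> real" where "D x = enn2real (deg M W x)"
definition K :: "'a \<Rightarrow> 'a \<Rightarrow> real" where "K x y = W x y / D y"
definition P :: "'a \<Rightarrow> 'a \<Rightarrow> real" where "P x y = W x y / D x"

lemma deg_meas [measurable]: "deg M W \<in> borel_measurable M"
proof -
  have "(\<lambda>x. \<integral>\<^sup>+ y. ennreal (W x y) \<partial>M) \<in> borel_measurable M" by measurable
  then show ?thesis by (simp add: deg_def[abs_def])
qed

lemma D_meas [measurable]: "D \<in> borel_measurable M" unfolding D_def[abs_def] by measurable

lemma deg_le: "AE x in M. deg M W x \<le> ennreal C"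
  using W_le AE_space
proof eventually_elim
  case (elim x)
  have "deg M W x \<le> (\<integral>\<^sup>+ y. ennreal C \<partial>M)" unfolding deg_def
    by (rule nn_integral_mono_AE) (use elim in \<open>auto elim!: eventually_mono intro: ennreal_leI\<close>)
  then show ?case by (simp add: emeasure_space_1)
qed

lemma D_bounds: "AE x in M. d \<le> D x \<and> D x \<le> C \<and> deg M W x = ennreal (D x)"
  using deg_le deg_ge
proof eventually_elim
  case (elim x)
  have fin: "deg M W x < \<top>" using elim(1) by (auto intro: le_less_trans)
  then have e: "deg M W x = ennreal (D x)" by (simp add: D_def)
  have nn: "0 \<le> D x" by (simp add: D_def)
  show ?case using elim e C_nonneg d_pos nn unfolding e
    by (simp add: ennreal_le_iff)
qed

lemma C_pos: "0 < C"
proof -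
  obtain x where "d \<le> D x \<and> D x \<le> C"
    using D_bounds AE_False eventually_mono[OF D_bounds, of "\<lambda>_. False"] prob_space_axioms by (metis (mono_tags, lifting))
  then show ?thesis using d_pos by linarith
qed

lemma bd_kernel_W: "bd_kernel M W C"
  unfolding bd_kernel_def using W_nonneg C_nonneg deg_le by (auto simp: deg_def)

lemma W_one: "AE x in M. kop M W (\<lambda>_. 1) x = D x"
  using D_bounds bd_kernel_integrable[OF prob_space_axioms bd_kernel_W] AE_space
proof eventually_elim
  case (elim x)
  have nn: "AE y in M. 0 \<le> W x y" using W_nonneg elim by auto
  have "ennreal (\<integral>y. W x y \<partial>M) = ennreal (D x)"
    using elim nn_integral_eq_integral[OF _ nn] by (simp add: deg_def)
  moreover have "0 \<le> (\<integral>y. W x y \<partial>M)" "0 \<le> D x" using nn integral_nonneg_AE elim d_pos by auto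
  ultimately show ?case by (simp add: kop_def)
qed

lemma D_nonneg: "0 \<le> D x" by (simp add: D_def)

lemma bd_kernel_K: "bd_kernel M K (C / d)"
proof -
  have "AE x in M. (\<integral>\<^sup>+ y. ennreal (K x y) \<partial>M) \<le> ennreal (C / d)"
    using W_le AE_space
  proof eventually_elim
    case (elim x)
    have "(\<integral>\<^sup>+ y. ennreal (K x y) \<partial>M) \<le> (\<integral>\<^sup>+ y. ennreal (C / d) \<partial>M)"
    proof (rule nn_integral_mono_AE)
      show "AE y in M. ennreal (K x y) \<le> ennreal (C / d)"
        using elim(1) D_bounds AE_space
        by eventually_elim (use d_pos C_nonneg elim(2) W_nonneg in \<open>auto simp: K_def intro!: ennreal_leI frac_le\<close>)
    qed
    then show ?case by (simp add: emeasure_space_1)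
  qed
  moreover have "(\<lambda>(x, y). K x y) \<in> borel_measurable (M \<Otimes>\<^sub>M M)"
    unfolding K_def by measurable
  moreover have "\<forall>x\<in>space M. \<forall>y\<in>space M. 0 \<le> K x y" using W_nonneg D_nonneg by (auto simp: K_def)
  ultimately show ?thesis unfolding bd_kernel_def using C_nonneg d_pos by simp
qed

lemma bd_kernel_P: "bd_kernel M P 1"
proof -
  have "AE x in M. (\<integral>\<^sup>+ y. ennreal (P x y) \<partial>M) \<le> ennreal 1"
    using D_bounds AE_space
  proof eventually_elim
    case (elim x)
    have [measurable]: "W x \<in> borel_measurable M" using elim by measurable
    have "(\<integral>\<^sup>+ y. ennreal (P x y) \<partial>M) = (\<integral>\<^sup>+ y. ennreal (W x y) * ennreal (1 / D x) \<partial>M)"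
      unfolding P_def using elim d_pos W_nonneg
      by (intro nn_integral_cong) (simp flip: ennreal_mult')
    also have "\<dots> = deg M W x * ennreal (1 / D x)"
      by (subst nn_integral_multc) (auto simp: deg_def)
    also have "\<dots> = ennreal 1" using elim d_pos by (simp flip: ennreal_mult'')
    finally show ?case by simp
  qed
  moreover have "(\<lambda>(x, y). P x y) \<in> borel_measurable (M \<Otimes>\<^sub>M M)"
    unfolding P_def by measurable
  moreover have "\<forall>x\<in>space M. \<forall>y\<in>space M. 0 \<le> P x y" using W_nonneg D_nonneg by (auto simp: P_def)
  ultimately show ?thesis unfolding bd_kernel_def by simp
qed

lemma ess_bounded_D: "ess_bounded M D"
proof (rule ess_boundedI)
  show "AE x in M. \<bar>D x\<bar> \<le> C" using D_bounds by eventually_elim (use d_pos in auto)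
qed measurable

lemma ess_bounded_divide_D: assumes "ess_bounded M f" shows "ess_bounded M (\<lambda>x. f x / D x)"
proof -
  have "ess_bounded M (\<lambda>x. 1 / D x)"
  proof (rule ess_boundedI)
    show "AE x in M. \<bar>1 / D x\<bar> \<le> 1 / d" using D_bounds by eventually_elim (use d_pos in \<open>auto intro!: frac_le\<close>)
  qed measurable
  from ess_bounded_mult[OF assms this] show ?thesis by simp
qed

lemma kop_K: "kop M K f x = kop M W (\<lambda>y. f y / D y) x"
  by (simp add: kop_def K_def)

lemma kop_P: "kop M P f x = kop M W f x / D x"
proof -
  have "kop M P f x = (\<integral>y. (W x y * f y) * (1 / D x) \<partial>M)" by (simp add: kop_def P_def)
  also have "\<dots> = kop M W f x / D x" unfolding integral_mult_left_zero by (simp add: kop_def)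
  finally show ?thesis .
qed

lemma AE_pair: 
  assumes "AE x in M. AE y in M. Q x y" "{p \<in> space (M \<Otimes>\<^sub>M M). Q (fst p) (snd p)} \<in> sets (M \<Otimes>\<^sub>M M)"
  shows "AE p in M \<Otimes>\<^sub>M M. Q (fst p) (snd p)"
proof -
  interpret pp: pair_prob_space M M by unfold_locales
  show ?thesis using assms by (intro pp.AE_pair_measure) auto
qed

lemma pair_integrable:
  assumes "ess_bounded M f" "ess_bounded M g"
  shows "integrable (M \<Otimes>\<^sub>M M) (\<lambda>(x, y). g x * (W x y * f y))"
proof -
  interpret pp: pair_prob_space M M by unfold_locales
  obtain A where A: "0 \<le> A" "AE x in M. \<bar>f x\<bar> \<le> A" using assms(1) by (rule ess_boundedE)
  obtain B where B: "0 \<le> B" "AE x in M. \<bar>g x\<bar> \<le> B" using assms(2) by (rule ess_boundedE)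
  have [measurable]: "f \<in> borel_measurable M" "g \<in> borel_measurable M" using assms by (auto simp: ess_bounded_def)
  have "AE x in M. AE y in M. norm (g x * (W x y * f y)) \<le> B * (C * A)"
    using B(2) W_le AE_space
  proof eventually_elim
    case (elim x)
    show ?case using elim(2) A(2) AE_space
      by eventually_elim (use elim A B C_nonneg W_nonneg in \<open>auto simp: abs_mult intro!: mult_mono\<close>)
  qed
  then have "AE p in M \<Otimes>\<^sub>M M. norm (g (fst p) * (W (fst p) (snd p) * f (snd p))) \<le> B * (C * A)"
    by (rule AE_pair) measurable
  then show ?thesis
    by (intro pp.P.integrable_const_bound[where B = "B * (C * A)"]) (auto simp: split_beta)
qed

lemma W_dual:
  assumes "ess_bounded M f" "ess_bounded M g"
  shows "(\<integral>x. g x * kop M W f x \<partial>M) = (\<integral>x. kop M W g x * f x \<partial>M)"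
proof -
  interpret pp: pair_prob_space M M by unfold_locales
  have i: "integrable (M \<Otimes>\<^sub>M M) (\<lambda>(x, y). g x * (W x y * f y))"
    by (rule pair_integrable[OF assms])
  have "(\<integral>x. g x * kop M W f x \<partial>M) = (\<integral>x. (\<integral>y. g x * (W x y * f y) \<partial>M) \<partial>M)"
    by (simp add: kop_def)
  also have "\<dots> = (\<integral>y. (\<integral>x. g x * (W x y * f y) \<partial>M) \<partial>M)"
    using pp.Fubini_integral[OF i] by simp
  also have "\<dots> = (\<integral>y. kop M W g y * f y \<partial>M)"
  proof (rule Bochner_Integration.integral_cong)
    fix y assume y: "y \<in> space M"
    have "(\<integral>x. g x * (W x y * f y) \<partial>M) = (\<integral>x. (W y x * g x) * f y \<partial>M)"
      using W_sym y by (intro Bochner_Integration.integral_cong) auto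
    then show "(\<integral>x. g x * (W x y * f y) \<partial>M) = kop M W g y * f y" by (simp add: kop_def)
  qed simp
  finally show ?thesis .
qed

lemma ess_bounded_W: "ess_bounded M f \<Longrightarrow> ess_bounded M (kop M W f)" by (rule kop_ess_bounded[OF prob_space_axioms bd_kernel_W])
lemma ess_bounded_K: "ess_bounded M f \<Longrightarrow> ess_bounded M (kop M K f)" by (rule kop_ess_bounded[OF prob_space_axioms bd_kernel_K])

lemma W_dual_one:
  assumes "ess_bounded M f" shows "(\<integral>x. kop M W f x \<partial>M) = (\<integral>x. D x * f x \<partial>M)"
proof -
  have "(\<integral>x. kop M W f x \<partial>M) = (\<integral>x. kop M W (\<lambda>_. 1) x * f x \<partial>M)"
    using W_dual[OF assms ess_bounded_const, of 1] by simp
  also have "\<dots> = (\<integral>x. D x * f x \<partial>M)"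
    using assms ess_bounded_W[OF ess_bounded_const, of 1] W_one by (intro integral_cong_AE) (auto simp: ess_bounded_def)
  finally show ?thesis .
qed

lemma K_integral: 
  assumes "ess_bounded M f" shows "(\<integral>x. kop M K f x \<partial>M) = (\<integral>x. f x \<partial>M)"
proof -
  have "(\<integral>x. kop M K f x \<partial>M) = (\<integral>x. D x * (f x / D x) \<partial>M)"
    unfolding kop_K by (rule W_dual_one[OF ess_bounded_divide_D[OF assms]])
  also have "\<dots> = (\<integral>x. f x \<partial>M)"
  proof (rule integral_cong_AE)
    show "AE x in M. D x * (f x / D x) = f x" using D_bounds by eventually_elim (use d_pos in auto)
  qed (use assms in \<open>auto simp: ess_bounded_def\<close>)
  finally show ?thesis .
qed

text \<open>\<open>K\<close> is bounded by \<open>C / d\<close> almost everywhere, so it turns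
  smallness in the mean into uniform smallness. Convergence of integrals is upgraded in this way to
  the uniform convergence that the closures need.\<close>

lemma K_smoothing:
  assumes "ess_bounded M f" shows "AE x in M. \<bar>kop M K f x\<bar> \<le> C / d * (\<integral>y. \<bar>f y\<bar> \<partial>M)"
  using W_le AE_space bd_kernel_integrable_mult[OF prob_space_axioms bd_kernel_K assms]
proof eventually_elim
  case (elim x)
  have "\<bar>kop M K f x\<bar> \<le> (\<integral>y. \<bar>K x y * f y\<bar> \<partial>M)" unfolding kop_def by (rule integral_abs_bound)
  also have "\<dots> \<le> (\<integral>y. C / d * \<bar>f y\<bar> \<partial>M)"
  proof (rule integral_mono_AE)
    show "AE y in M. \<bar>K x y * f y\<bar> \<le> C / d * \<bar>f y\<bar>"
      using elim(1) D_bounds AE_space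
      by eventually_elim (use d_pos C_nonneg W_nonneg elim(2) in \<open>auto simp: K_def abs_mult intro!: mult_right_mono frac_le\<close>)
  qed (use elim ess_bounded_integrable[OF assms] in auto)
  finally show ?case by simp
qed

subsection \<open>Extinction\<close>

text \<open>Probability that a particle of kind \<open>Oth\<close> at \<open>x\<close> has
  descendants in generation \<open>n\<close>. The children that survive for \<open>n\<close>
  generations form a thinned Poisson process of mean \<open>K (survival n)\<close>, which is empty
  with probability \<open>exp (- K (survival n))\<close>.\<close>

primrec survival :: "nat \<Rightarrow> 'a \<Rightarrow> real" where
  "survival 0 = (\<lambda>x. 1)"
| "survival (Suc n) = (\<lambda>x. 1 - exp (- kop M K (survival n) x))"

lemma K_nonneg: assumes "ess_bounded M f" "AE x in M. 0 \<le> f x" shows "AE x in M. 0 \<le> kop M K f x"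
  using AE_space
proof eventually_elim
  case (elim x)
  show ?case unfolding kop_def
  proof (rule integral_nonneg_AE)
    show "AE y in M. 0 \<le> K x y * f y" using assms(2) AE_space
      by eventually_elim (use elim W_nonneg D_nonneg in \<open>auto simp: K_def\<close>)
  qed
qed

lemma survival_bounds: "ess_bounded M (survival n) \<and> (AE x in M. 0 \<le> survival n x)"
proof (induction n)
  case (Suc n)
  have k: "ess_bounded M (kop M K (survival n))" "AE x in M. 0 \<le> kop M K (survival n) x" using Suc ess_bounded_K K_nonneg by auto
  have [measurable]: "kop M K (survival n) \<in> borel_measurable M" using k(1) by (simp add: ess_bounded_def)
  have "AE x in M. 0 \<le> survival (Suc n) x \<and> survival (Suc n) x \<le> 1" using k(2) by eventually_elim auto
  moreover have "survival (Suc n) \<in> borel_measurable M" by simp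
  ultimately show ?case by (auto intro!: ess_boundedI[of _ _ 1] elim: eventually_mono)
qed simp

text \<open>Taylor expansion to second order; for \<open>z\<close> in the given range the
  exponential in the remainder is at least \<open>exp (- B)\<close>.\<close>

lemma exp_bound:
  fixes z :: real assumes "0 \<le> z" "z \<le> B"
  shows "1 - exp (- z) \<le> z - exp (- B) / 2 * z\<^sup>2"
proof -
  obtain t where t: "\<bar>t\<bar> \<le> \<bar>- z\<bar>" "exp (- z) = (\<Sum>m<2. (- z) ^ m / fact m) + exp t / fact 2 * (- z) ^ 2"
    using Maclaurin_exp_le[of "- z" 2] by auto
  have "exp (- B) \<le> exp t" using t(1) assms by auto
  then have "exp (- B) / 2 * z\<^sup>2 \<le> exp t / 2 * z\<^sup>2" by (intro mult_right_mono) auto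
  then show ?thesis using t(2) by (simp add: numeral_2_eq_2)
qed

text \<open>The variance of \<open>f\<close> is nonnegative.\<close>

lemma square_integral: 
  assumes "ess_bounded M f" shows "(\<integral>x. f x \<partial>M)\<^sup>2 \<le> (\<integral>x. (f x)\<^sup>2 \<partial>M)"
proof -
  let ?m = "\<integral>x. f x \<partial>M"
  have i: "integrable M f" "integrable M (\<lambda>x. (f x)\<^sup>2)" using assms ess_bounded_power[OF assms, of 2] by auto
  have "0 \<le> (\<integral>x. (f x - ?m)\<^sup>2 \<partial>M)" by (rule integral_nonneg_AE) simp
  also have "\<dots> = (\<integral>x. (f x)\<^sup>2 - 2 * ?m * f x + ?m\<^sup>2 \<partial>M)" by (simp add: power2_diff algebra_simps)
  also have "\<dots> = (\<integral>x. (f x)\<^sup>2 \<partial>M) - 2 * ?m * ?m + ?m\<^sup>2" using i by (simp add: prob_space)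
  finally show ?thesis by (simp add: power2_eq_square)
qed

text \<open>As \<open>survival n\<close> is at most 1, its image under \<open>K\<close> is at most
  \<open>C / d\<close>, which is the \<open>B\<close> of \<open>exp_bound\<close>. The square is
  then taken out of the integral, and \<open>K\<close> preserves integrals.\<close>

lemma survival_integral_step:
  "(\<integral>x. survival (Suc n) x \<partial>M) \<le> (\<integral>x. survival n x \<partial>M) - exp (- (C / d)) / 2 * (\<integral>x. survival n x \<partial>M)\<^sup>2"
proof -
  let ?z = "kop M K (survival n)" and ?k = "exp (- (C / d)) / 2"
  have r: "ess_bounded M (survival n)" "AE x in M. 0 \<le> survival n x" and z: "ess_bounded M ?z" "AE x in M. 0 \<le> ?z x"
    using survival_bounds[of n] ess_bounded_K K_nonneg by auto
  have le1: "AE x in M. survival n x \<le> 1"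
  proof (cases n)
    case (Suc m) then show ?thesis by simp
  qed simp
  have "(\<integral>y. \<bar>survival n y\<bar> \<partial>M) \<le> (\<integral>y. 1 \<partial>M)"
    by (rule integral_mono_AE) (use r le1 in \<open>auto elim!: eventually_elim2\<close>)
  then have i1: "C / d * (\<integral>y. \<bar>survival n y\<bar> \<partial>M) \<le> C / d" using C_nonneg d_pos by (intro mult_left_le) (simp_all add: prob_space)
  have zB: "AE x in M. ?z x \<le> C / d"
    using K_smoothing[OF r(1)] by eventually_elim (use i1 in auto)
  have "(\<integral>x. survival (Suc n) x \<partial>M) \<le> (\<integral>x. ?z x - ?k * (?z x)\<^sup>2 \<partial>M)"
  proof (rule integral_mono_AE)
    show "integrable M (survival (Suc n))" using survival_bounds[of "Suc n"] by blast
    show "integrable M (\<lambda>x. ?z x - ?k * (?z x)\<^sup>2)"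
      using z(1) by (intro ess_bounded_integrable ess_bounded_diff ess_bounded_mult ess_bounded_power) auto
    show "AE x in M. survival (Suc n) x \<le> ?z x - ?k * (?z x)\<^sup>2"
      using zB z(2) by eventually_elim (use exp_bound in auto)
  qed
  also have "\<dots> = (\<integral>x. ?z x \<partial>M) - ?k * (\<integral>x. (?z x)\<^sup>2 \<partial>M)"
    using ess_bounded_integrable[OF z(1)] ess_bounded_integrable[OF ess_bounded_power[OF z(1), of 2]] by (simp del: times_divide_eq_left)
  also have "\<dots> \<le> (\<integral>x. ?z x \<partial>M) - ?k * (\<integral>x. ?z x \<partial>M)\<^sup>2"
    using square_integral[OF z(1)] by (intro diff_left_mono mult_left_mono) auto
  finally show ?thesis using K_integral[OF r(1)] by simp
qed

lemma survival_integral_tendsto: "(\<lambda>n. \<integral>x. survival n x \<partial>M) \<longlonglongrightarrow> 0"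
proof -
  let ?s = "\<lambda>n. \<integral>x. survival n x \<partial>M" and ?k = "exp (- (C / d)) / 2"
  have nn: "0 \<le> ?s n" for n using survival_bounds[of n] by (intro integral_nonneg_AE) auto
  have "decseq ?s"
  proof (rule decseq_SucI)
    fix n have "0 \<le> ?k * (?s n)\<^sup>2" by simp
    then show "?s (Suc n) \<le> ?s n" using survival_integral_step[of n] by linarith
  qed
  then obtain L where L: "?s \<longlonglongrightarrow> L" using decseq_convergent[of ?s 0] nn by blast
  have "(\<lambda>n. ?s n - ?k * (?s n)\<^sup>2) \<longlonglongrightarrow> L - ?k * L\<^sup>2" by (intro tendsto_intros L)
  moreover have "(\<lambda>n. ?s (Suc n)) \<longlonglongrightarrow> L" using L by (rule LIMSEQ_Suc)
  \<comment> \<open>The limit inherits the inequality of a single step, which leaves only the value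
    0.\<close>
  ultimately have "L \<le> L - ?k * L\<^sup>2" using survival_integral_step by (intro LIMSEQ_le) auto
  then have "?k * L\<^sup>2 \<le> 0" by simp
  then have "L = 0" by (simp add: mult_le_0_iff)
  then show ?thesis using L by simp
qed

text \<open>The integrals tend to 0, and the application of \<open>K\<close> in the next generation
  makes the convergence uniform; hence the shift of the index by one.\<close>

lemma extinction:
  assumes "0 < e" shows "\<exists>n0. \<forall>n\<ge>n0. AE x in M. \<bar>survival n x\<bar> \<le> e"
proof -
  have "(\<lambda>n. C / d * (\<integral>x. survival n x \<partial>M)) \<longlonglongrightarrow> C / d * 0" by (intro tendsto_intros survival_integral_tendsto)
  then have "eventually (\<lambda>n. C / d * (\<integral>x. survival n x \<partial>M) < e) sequentially"
    using assms by (auto dest!: order_tendstoD(2))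
  then obtain n0 where n0: "\<And>n. n \<ge> n0 \<Longrightarrow> C / d * (\<integral>x. survival n x \<partial>M) < e" by (auto simp: eventually_sequentially)
  have "AE x in M. \<bar>survival (Suc n) x\<bar> \<le> e" if "n \<ge> n0" for n
  proof -
    have r: "ess_bounded M (survival n)" "AE x in M. 0 \<le> survival n x" using survival_bounds[of n] by auto
    have "(\<integral>y. \<bar>survival n y\<bar> \<partial>M) = (\<integral>y. survival n y \<partial>M)"
      by (rule integral_cong_AE) (use r in \<open>auto simp: ess_bounded_def\<close>)
    then have i: "C / d * (\<integral>y. \<bar>survival n y\<bar> \<partial>M) < e" using n0[OF that] by simp
    show ?thesis using K_smoothing[OF r(1)] K_nonneg[OF r]
    proof eventually_elim
      case (elim x)
      have "1 - exp (- kop M K (survival n) x) \<le> kop M K (survival n) x" using exp_ge_add_one_self[of "- kop M K (survival n) x"] by simp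
      then show ?case using elim i by (simp del: times_divide_eq_left)
    qed
  qed
  then have "AE x in M. \<bar>survival n x\<bar> \<le> e" if "n \<ge> Suc n0" for n
  proof -
    obtain m where "n = Suc m" "n0 \<le> m" using Suc_le_D[OF \<open>Suc n0 \<le> n\<close>] \<open>Suc n0 \<le> n\<close> by auto
    then show ?thesis using \<open>\<And>n. n0 \<le> n \<Longrightarrow> AE x in M. \<bar>survival (Suc n) x\<bar> \<le> e\<close> by blast
  qed
  then show ?thesis by blast
qed

subsection \<open>Convergence of path densities to the normalised degree\<close>

definition wip :: "('a \<Rightarrow> real) \<Rightarrow> ('a \<Rightarrow> real) \<Rightarrow> real" where
  "wip f g = (\<integral>x. f x * g x / D x \<partial>M)"

lemma wip_ess_bounded: "ess_bounded M f \<Longrightarrow> ess_bounded M g \<Longrightarrow> ess_bounded M (\<lambda>x. f x * g x / D x)"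
  by (intro ess_bounded_divide_D ess_bounded_mult)

lemma wip_K: assumes "ess_bounded M f" "ess_bounded M g" shows "wip (kop M K f) g = wip f (kop M K g)"
proof -
  have "wip (kop M K f) g = (\<integral>x. g x / D x * kop M W (\<lambda>y. f y / D y) x \<partial>M)"
    by (simp add: wip_def kop_K mult.commute)
  also have "\<dots> = (\<integral>x. kop M W (\<lambda>y. g y / D y) x * (f x / D x) \<partial>M)"
    by (rule W_dual) (intro ess_bounded_divide_D assms)+
  also have "\<dots> = wip f (kop M K g)" by (simp add: wip_def kop_K mult.commute)
  finally show ?thesis .
qed

lemma energy_inner:
  assumes "ess_bounded M u" "ess_bounded M v"
  shows "AE x in M. (\<integral>y. W x y * (u x - v y)\<^sup>2 \<partial>M) = D x * (u x)\<^sup>2 - 2 * (u x * kop M W v x) + kop M W (\<lambda>y. (v y)\<^sup>2) x"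
  using bd_kernel_integrable[OF prob_space_axioms bd_kernel_W] bd_kernel_integrable_mult[OF prob_space_axioms bd_kernel_W assms(2)]
    bd_kernel_integrable_mult[OF prob_space_axioms bd_kernel_W ess_bounded_power[OF assms(2), of 2]] W_one
proof eventually_elim
  case (elim x)
  have "(\<integral>y. W x y * (u x - v y)\<^sup>2 \<partial>M) = (\<integral>y. (u x)\<^sup>2 * W x y - (2 * u x) * (W x y * v y) + W x y * (v y)\<^sup>2 \<partial>M)"
    by (intro Bochner_Integration.integral_cong) (simp_all add: power2_diff algebra_simps)
  also have "\<dots> = (u x)\<^sup>2 * (\<integral>y. W x y \<partial>M) - (2 * u x) * (\<integral>y. W x y * v y \<partial>M) + (\<integral>y. W x y * (v y)\<^sup>2 \<partial>M)"
    using elim by (simp del: mult.assoc)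
  finally show ?case using elim by (simp add: kop_def mult.commute mult.left_commute)
qed

text \<open>The Dirichlet form of \<open>W\<close> with two functions, expanded. For
  \<open>u = K f / D\<close> and \<open>v = f / D\<close> its nonnegativity makes \<open>K\<close> a
  contraction for the weighted norm; for \<open>u = v = h / D\<close> it vanishes when
  \<open>h\<close> is a fixed point of \<open>K\<close>.\<close>

lemma energy:
  assumes "ess_bounded M u" "ess_bounded M v"
  shows "(\<integral>x. (\<integral>y. W x y * (u x - v y)\<^sup>2 \<partial>M) \<partial>M) = (\<integral>x. D x * (u x)\<^sup>2 \<partial>M) - 2 * (\<integral>x. u x * kop M W v x \<partial>M) + (\<integral>x. D x * (v x)\<^sup>2 \<partial>M)"
proof -
  have [measurable]: "u \<in> borel_measurable M" "v \<in> borel_measurable M" using assms by (auto simp: ess_bounded_def)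
  have i: "ess_bounded M (\<lambda>x. D x * (u x)\<^sup>2)" "ess_bounded M (\<lambda>x. u x * kop M W v x)" "ess_bounded M (kop M W (\<lambda>y. (v y)\<^sup>2))"
    by (intro ess_bounded_mult ess_bounded_power ess_bounded_D ess_bounded_W assms)+
  have "(\<integral>x. (\<integral>y. W x y * (u x - v y)\<^sup>2 \<partial>M) \<partial>M) = (\<integral>x. D x * (u x)\<^sup>2 - 2 * (u x * kop M W v x) + kop M W (\<lambda>y. (v y)\<^sup>2) x \<partial>M)"
  proof (rule integral_cong_AE[OF _ _ energy_inner[OF assms]])
    show "(\<lambda>x. \<integral>y. W x y * (u x - v y)\<^sup>2 \<partial>M) \<in> borel_measurable M" by measurable
    show "(\<lambda>x. D x * (u x)\<^sup>2 - 2 * (u x * kop M W v x) + kop M W (\<lambda>y. (v y)\<^sup>2) x) \<in> borel_measurable M"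
      using i by (auto simp: ess_bounded_def)
  qed
  also have "\<dots> = (\<integral>x. D x * (u x)\<^sup>2 \<partial>M) - 2 * (\<integral>x. u x * kop M W v x \<partial>M) + (\<integral>x. kop M W (\<lambda>y. (v y)\<^sup>2) x \<partial>M)"
    using i[THEN ess_bounded_integrable] by simp
  also have "(\<integral>x. kop M W (\<lambda>y. (v y)\<^sup>2) x \<partial>M) = (\<integral>x. D x * (v x)\<^sup>2 \<partial>M)"
    by (rule W_dual_one[OF ess_bounded_power[OF assms(2)]])
  finally show ?thesis .
qed

lemma energy_nonneg: "0 \<le> (\<integral>x. (\<integral>y. W x y * (u x - v y)\<^sup>2 \<partial>M) \<partial>M)"
  by (intro integral_nonneg_AE AE_I2) (use W_nonneg in auto)

lemma D_square: assumes "ess_bounded M f" shows "(\<integral>x. D x * (f x / D x)\<^sup>2 \<partial>M) = wip f f"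
  unfolding wip_def
proof (rule integral_cong_AE)
  show "AE x in M. D x * (f x / D x)\<^sup>2 = f x * f x / D x" using D_bounds
    by eventually_elim (use d_pos in \<open>auto simp: power2_eq_square\<close>)
qed (use assms in \<open>auto simp: ess_bounded_def\<close>)

lemma wip_contraction: assumes "ess_bounded M f" shows "wip (kop M K f) (kop M K f) \<le> wip f f"
proof -
  let ?u = "\<lambda>x. kop M K f x / D x" and ?v = "\<lambda>x. f x / D x"
  have e: "ess_bounded M ?u" "ess_bounded M ?v" by (intro ess_bounded_divide_D ess_bounded_K assms)+
  have "(\<integral>x. ?u x * kop M W ?v x \<partial>M) = wip (kop M K f) (kop M K f)"
    by (simp add: wip_def kop_K mult.commute)
  then show ?thesis
    using energy[OF e] energy_nonneg[of ?u ?v] D_square[OF ess_bounded_K[OF assms]] D_square[OF assms] by simp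
qed

text \<open>Mean size of generation \<open>n\<close> among the descendants of an ordinary
  particle.\<close>

definition mean_pop :: "nat \<Rightarrow> 'a \<Rightarrow> real" where "mean_pop n = (kop M K ^^ n) (\<lambda>x. 1)"

lemma mean_pop_Suc: "mean_pop (Suc n) = kop M K (mean_pop n)" by (simp add: mean_pop_def)
lemma mean_pop_ess_bounded: "ess_bounded M (mean_pop n)" by (induction n) (auto simp: mean_pop_Suc ess_bounded_K, simp add: mean_pop_def)

lemma mean_pop_integral: "(\<integral>x. mean_pop n x \<partial>M) = 1"
  by (induction n) (auto simp: mean_pop_Suc K_integral mean_pop_ess_bounded, simp add: mean_pop_def prob_space)

text \<open>By self-adjointness all applications of \<open>K\<close> can be moved to one side, so
  only their total number matters.\<close>

lemma wip_mean_pop: "wip (mean_pop n) (mean_pop m) = wip (mean_pop (n + m)) (mean_pop 0)"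
proof (induction m arbitrary: n)
  case (Suc m)
  have "wip (mean_pop n) (mean_pop (Suc m)) = wip (mean_pop (Suc n)) (mean_pop m)" using wip_K[OF mean_pop_ess_bounded mean_pop_ess_bounded] by (simp add: mean_pop_Suc)
  then show ?case using Suc[of "Suc n"] by simp
qed simp

lemma wip_diff:
  assumes "ess_bounded M f" "ess_bounded M g" shows "wip (\<lambda>x. f x - g x) (\<lambda>x. f x - g x) = wip f f + wip g g - 2 * wip f g"
proof -
  note i = wip_ess_bounded[OF assms(1) assms(1), THEN ess_bounded_integrable] wip_ess_bounded[OF assms(2) assms(2), THEN ess_bounded_integrable] wip_ess_bounded[OF assms, THEN ess_bounded_integrable]
  have "wip (\<lambda>x. f x - g x) (\<lambda>x. f x - g x) = (\<integral>x. f x * f x / D x + g x * g x / D x - 2 * (f x * g x / D x) \<partial>M)"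
    unfolding wip_def by (intro Bochner_Integration.integral_cong) (simp_all add: algebra_simps diff_divide_distrib add_divide_distrib)
  also have "\<dots> = wip f f + wip g g - 2 * wip f g" unfolding wip_def using i by (simp del: times_divide_eq_right)
  finally show ?thesis .
qed

text \<open>Moments of even order are squared norms, which decrease because \<open>K\<close> is a
  contraction.\<close>

lemma wip_mean_pop_convergent: "\<exists>L. (\<lambda>n. wip (mean_pop (2 * n)) (mean_pop 0)) \<longlonglongrightarrow> L"
proof -
  have eq: "wip (mean_pop (2 * n)) (mean_pop 0) = wip (mean_pop n) (mean_pop n)" for n using wip_mean_pop[of n n] by (simp add: mult_2)
  have "0 \<le> wip (mean_pop n) (mean_pop n)" for n unfolding wip_def using D_nonneg by (intro integral_nonneg_AE) auto
  moreover have "decseq (\<lambda>n. wip (mean_pop n) (mean_pop n))"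
    by (rule decseq_SucI) (use wip_contraction[OF mean_pop_ess_bounded] in \<open>simp add: mean_pop_Suc\<close>)
  ultimately show ?thesis unfolding eq using decseq_convergent[of "\<lambda>n. wip (mean_pop n) (mean_pop n)" 0] by blast
qed

text \<open>Smoothing bounds \<open>K f\<close> by the mean of the modulus of \<open>f\<close>,
  which is at most its quadratic mean; \<open>D \<le> C\<close> inserts the weight.\<close>

lemma K_bound_wip:
  assumes f: "ess_bounded M f" shows "AE x in M. \<bar>kop M K f x\<bar> \<le> C / d * sqrt (C * wip f f)"
proof -
  have "(\<integral>x. \<bar>f x\<bar> \<partial>M)\<^sup>2 \<le> (\<integral>x. \<bar>f x\<bar>\<^sup>2 \<partial>M)"
    by (rule square_integral) (use f in \<open>auto simp: ess_bounded_def\<close>)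
  also have "\<dots> \<le> (\<integral>x. C * (f x * f x / D x) \<partial>M)"
  proof (rule integral_mono_AE)
    show "integrable M (\<lambda>x. \<bar>f x\<bar>\<^sup>2)" using ess_bounded_power[OF f, of 2] by auto
    show "integrable M (\<lambda>x. C * (f x * f x / D x))" by (intro integrable_mult_right ess_bounded_integrable wip_ess_bounded f)
    show "AE x in M. \<bar>f x\<bar>\<^sup>2 \<le> C * (f x * f x / D x)"
      using D_bounds
    proof eventually_elim
      case (elim x)
      have "\<bar>f x\<bar>\<^sup>2 * D x \<le> (f x * f x) * C" using elim by (auto simp: power2_eq_square intro!: mult_left_mono)
      then show ?case using elim d_pos by (simp add: field_simps)
    qed
  qed
  also have "\<dots> = C * wip f f" unfolding wip_def by (rule integral_mult_right_zero)
  finally have "\<bar>\<integral>x. \<bar>f x\<bar> \<partial>M\<bar> \<le> sqrt (C * wip f f)" by (rule real_le_rsqrt[OF order_trans[OF eq_refl[OF power2_abs]]])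
  then have "C / d * (\<integral>x. \<bar>f x\<bar> \<partial>M) \<le> C / d * sqrt (C * wip f f)"
    using C_nonneg d_pos by (intro mult_left_mono) auto
  then show ?thesis using K_smoothing[OF f] by (auto elim!: eventually_mono)
qed

text \<open>The squared distance of two powers of equal parity combines three moments of even order,
  all close to the common limit. Here \<open>i\<close> selects the parity, and the additional
  \<open>Suc\<close> is the application of \<open>K\<close> that makes the estimate uniform.\<close>

lemma mean_pop_uniform_Cauchy:
  assumes "0 < e" shows "\<exists>n0. \<forall>n\<ge>n0. \<forall>m\<ge>n0. AE x in M. \<bar>mean_pop (Suc (i + 2 * n)) x - mean_pop (Suc (i + 2 * m)) x\<bar> \<le> e"
proof -
  obtain L where L: "(\<lambda>n. wip (mean_pop (2 * n)) (mean_pop 0)) \<longlonglongrightarrow> L" using wip_mean_pop_convergent by blast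
  \<comment> \<open>The moments enter with coefficients 1, 1 and -2 and each lies within
    \<open>r\<close> of the limit, so the squared distance is at most \<open>4 * r\<close>; this
    \<open>r\<close> makes \<open>C / d * sqrt (C * (4 * r))\<close> equal to
    \<open>e\<close>.\<close>
  define r where "r = (e * d / C)\<^sup>2 / (4 * C)"
  have r: "0 < r" using assms d_pos C_pos by (simp add: r_def)
  have "eventually (\<lambda>n. \<bar>wip (mean_pop (2 * n)) (mean_pop 0) - L\<bar> < r) sequentially"
    using tendstoD[OF L r] by (simp add: dist_real_def)
  then obtain n0 where n0: "\<And>n. n \<ge> n0 \<Longrightarrow> \<bar>wip (mean_pop (2 * n)) (mean_pop 0) - L\<bar> < r" by (auto simp: eventually_sequentially)
  have "AE x in M. \<bar>mean_pop (Suc (i + 2 * n)) x - mean_pop (Suc (i + 2 * m)) x\<bar> \<le> e" if nm: "n \<ge> n0" "m \<ge> n0" for n m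
  proof -
    let ?f = "mean_pop (i + 2 * n)" and ?g = "mean_pop (i + 2 * m)"
    let ?h = "\<lambda>x. ?f x - ?g x"
    have "wip ?h ?h = wip ?f ?f + wip ?g ?g - 2 * wip ?f ?g" by (rule wip_diff[OF mean_pop_ess_bounded mean_pop_ess_bounded])
    also have "\<dots> = wip (mean_pop (2 * (i + 2 * n))) (mean_pop 0) + wip (mean_pop (2 * (i + 2 * m))) (mean_pop 0) - 2 * wip (mean_pop (2 * (i + n + m))) (mean_pop 0)"
      unfolding wip_mean_pop[of "i + 2 * n" "i + 2 * n"] wip_mean_pop[of "i + 2 * m" "i + 2 * m"] wip_mean_pop[of "i + 2 * n" "i + 2 * m"]
      by (simp add: algebra_simps)
    also have "\<dots> \<le> 4 * r" using n0[of "i + 2 * n"] n0[of "i + 2 * m"] n0[of "i + n + m"] nm by linarith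
    finally have "C * wip ?h ?h \<le> C * (4 * r)" using C_nonneg by (intro mult_left_mono)
    also have "\<dots> = (e * d / C)\<^sup>2" using C_pos by (simp add: r_def)
    finally have "sqrt (C * wip ?h ?h) \<le> e * d / C" using assms d_pos C_pos by (intro real_le_lsqrt) auto
    then have "C / d * sqrt (C * wip ?h ?h) \<le> C / d * (e * d / C)" using C_pos d_pos by (intro mult_left_mono) auto
    also have "\<dots> = e" using C_pos d_pos by simp
    finally have le: "C / d * sqrt (C * wip ?h ?h) \<le> e" .
    have h: "ess_bounded M ?h" by (intro ess_bounded_diff mean_pop_ess_bounded)
    have "AE x in M. kop M K (\<lambda>x. 1 * ?f x + (-1) * ?g x) x = 1 * kop M K ?f x + (-1) * kop M K ?g x"
      by (rule bounded_op_lin[OF bounded_op_kop[OF prob_space_axioms bd_kernel_K] mean_pop_ess_bounded mean_pop_ess_bounded])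
    then show ?thesis using K_bound_wip[OF h]
      by eventually_elim (use le in \<open>auto simp: mean_pop_Suc\<close>)
  qed
  then show ?thesis by blast
qed

text \<open>Countably many tolerances suffice, so that outside a single null set all the sequences
  are Cauchy; the pointwise limit is then also a uniform one.\<close>

lemma uniform_limit_exists:
  fixes F :: "nat \<Rightarrow> 'a \<Rightarrow> real"
  assumes "\<And>n. ess_bounded M (F n)" "\<And>e. 0 < e \<Longrightarrow> \<exists>n0. \<forall>n\<ge>n0. \<forall>m\<ge>n0. AE x in M. \<bar>F n x - F m x\<bar> \<le> e"
  shows "\<exists>h. ess_bounded M h \<and> (\<forall>e>0. \<exists>n0. \<forall>n\<ge>n0. AE x in M. \<bar>F n x - h x\<bar> \<le> e)"
proof -
  have [measurable]: "F n \<in> borel_measurable M" for n using assms(1) by (simp add: ess_bounded_def)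
  have "\<forall>k. \<exists>n0. \<forall>n\<ge>n0. \<forall>m\<ge>n0. AE x in M. \<bar>F n x - F m x\<bar> \<le> inverse (Suc k)"
    using assms(2) by simp
  then obtain n0 where n0: "\<And>k n m. n \<ge> n0 k \<Longrightarrow> m \<ge> n0 k \<Longrightarrow> AE x in M. \<bar>F n x - F m x\<bar> \<le> inverse (Suc k)" by metis
  have "AE x in M. \<forall>k n m. n \<ge> n0 k \<longrightarrow> m \<ge> n0 k \<longrightarrow> \<bar>F n x - F m x\<bar> \<le> inverse (Suc k)"
    using n0 by (simp add: AE_all_countable)
  then have lim: "AE x in M. (\<lambda>n. F n x) \<longlonglongrightarrow> lim (\<lambda>n. F n x)"
  proof eventually_elim
    case (elim x)
    have "Cauchy (\<lambda>n. F n x)"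
    proof (rule CauchyI)
      fix e :: real assume "0 < e"
      then obtain k where k: "inverse (Suc k) < e" using reals_Archimedean by blast
      show "\<exists>M. \<forall>m\<ge>M. \<forall>n\<ge>M. norm (F m x - F n x) < e"
        using elim k by (intro exI[of _ "n0 k"]) (auto intro: le_less_trans)
    qed
    then show ?case by (simp add: Cauchy_convergent_iff convergent_LIMSEQ_iff)
  qed
  let ?h = "\<lambda>x. lim (\<lambda>n. F n x)"
  have conv: "\<exists>n0. \<forall>n\<ge>n0. AE x in M. \<bar>F n x - ?h x\<bar> \<le> e" if e0: "0 < e" for e
  proof -
    obtain n0 where n0: "\<And>n m. n \<ge> n0 \<Longrightarrow> m \<ge> n0 \<Longrightarrow> AE x in M. \<bar>F n x - F m x\<bar> \<le> e" using assms(2)[OF e0] by blast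
    have "AE x in M. \<bar>F n x - ?h x\<bar> \<le> e" if n: "n \<ge> n0" for n
    proof -
      have "AE x in M. \<forall>m. m \<ge> n0 \<longrightarrow> \<bar>F n x - F m x\<bar> \<le> e" using n0[OF n] by (simp add: AE_all_countable)
      then show ?thesis using lim
      proof eventually_elim
        case (elim x)
        have "(\<lambda>m. \<bar>F n x - F m x\<bar>) \<longlonglongrightarrow> \<bar>F n x - ?h x\<bar>" by (intro tendsto_intros elim)
        then show ?case by (rule LIMSEQ_le_const2) (use elim(1) in blast)
      qed
    qed
    then show ?thesis by blast
  qed
  obtain n where n: "AE x in M. \<bar>F n x - ?h x\<bar> \<le> 1" using conv[of 1] by auto
  obtain B where B: "AE x in M. \<bar>F n x\<bar> \<le> B" using assms(1)[of n] by (rule ess_boundedE)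
  have "ess_bounded M ?h"
  proof (rule ess_boundedI)
    show "AE x in M. \<bar>?h x\<bar> \<le> B + 1" using n B by eventually_elim linarith
  qed measurable
  then show ?thesis using conv by blast
qed

text \<open>The constant is the supremum of the levels that \<open>v\<close> exceeds almost
  surely.\<close>

lemma AE_const:
  assumes v: "ess_bounded M v" and 01: "\<And>q. prob {x \<in> space M. q < v x} \<in> {0, 1}"
  shows "\<exists>c. AE x in M. v x = c"
proof -
  have [measurable]: "v \<in> borel_measurable M" using v by (simp add: ess_bounded_def)
  obtain B where B: "0 \<le> B" "AE x in M. \<bar>v x\<bar> \<le> B" using v by (rule ess_boundedE)
  define S where "S = {q. prob {x \<in> space M. q < v x} = 1}"
  have S1: "q \<in> S \<longleftrightarrow> (AE x in M. q < v x)" for q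
    unfolding S_def using prob_Collect_eq_1[of "\<lambda>x. q < v x"] by simp
  have S0: "q \<notin> S \<Longrightarrow> AE x in M. v x \<le> q" for q
    using 01[of q] prob_Collect_eq_0[of "\<lambda>x. q < v x"] by (auto simp: S_def not_less)
  have ne: "- B - 1 \<in> S" unfolding S1 using B(2) by eventually_elim auto
  have bdd: "q \<le> B" if "q \<in> S" for q
  proof -
    have "AE x in M. q \<le> B" using B(2) that[unfolded S1] by eventually_elim auto
    then show ?thesis by simp
  qed
  then have bdd': "bdd_above S" by (auto simp: bdd_above_def)
  define c where "c = Sup S"
  have "AE x in M. \<bar>v x - c\<bar> \<le> inverse (Suc n)" for n
  proof -
    obtain q where q: "q \<in> S" "c - inverse (Suc n) < q"
      using less_cSup_iff[of S "c - inverse (Suc n)"] ne bdd' by (auto simp: c_def)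
    have "c + inverse (Suc n) \<notin> S" using cSup_upper[OF _ bdd', of "c + inverse (Suc n)"] by (auto simp: c_def)
    from S0[OF this] q(1)[unfolded S1] show ?thesis by eventually_elim (use q(2) in auto)
  qed
  then have "AE x in M. \<forall>n. \<bar>v x - c\<bar> \<le> inverse (Suc n)" by (simp add: AE_all_countable)
  then have "AE x in M. v x = c"
  proof eventually_elim
    case (elim x)
    show ?case
    proof (rule ccontr)
      assume "v x \<noteq> c" then obtain n where "inverse (Suc n) < \<bar>v x - c\<bar>" using reals_Archimedean[of "\<bar>v x - c\<bar>"] by auto
      then show False using elim[rule_format, of n] by simp
    qed
  qed
  then show ?thesis by blast
qed

text \<open>The energy of \<open>v = h / D\<close> vanishes, so \<open>W x y = 0\<close> for almost
  all pairs with \<open>v x \<noteq> v y\<close>. Hence \<open>W\<close> puts no mass between a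
  superlevel set of \<open>v\<close> and its complement, and by connectedness these sets have
  measure 0 or 1.\<close>

lemma K_fixed:
  assumes h: "ess_bounded M h" and fx: "AE x in M. kop M K h x = h x"
  shows "\<exists>c. AE x in M. h x = c * D x"
proof -
  let ?v = "\<lambda>x. h x / D x"
  have v: "ess_bounded M ?v" by (rule ess_bounded_divide_D[OF h])
  have [measurable]: "h \<in> borel_measurable M" using h by (simp add: ess_bounded_def)
  have "(\<integral>x. ?v x * kop M W ?v x \<partial>M) = (\<integral>x. h x * h x / D x \<partial>M)"
  proof (rule integral_cong_AE)
    show "AE x in M. ?v x * kop M W ?v x = h x * h x / D x" using fx unfolding kop_K by eventually_elim simp
  qed (use h ess_bounded_W[OF v] in \<open>auto simp: ess_bounded_def\<close>)
  then have E0: "(\<integral>x. (\<integral>y. W x y * (?v x - ?v y)\<^sup>2 \<partial>M) \<partial>M) = 0"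
    using energy[OF v v] D_square[OF h] by (simp add: wip_def)
  have pm: "(\<lambda>(x, y). W x y * (?v x - ?v y)\<^sup>2) \<in> borel_measurable (M \<Otimes>\<^sub>M M)" by measurable
  have inn: "0 \<le> (\<integral>y. W x y * (?v x - ?v y)\<^sup>2 \<partial>M)" if "x \<in> space M" for x
    using W_nonneg that by (intro integral_nonneg_AE) auto
  have i1: "integrable M (\<lambda>x. \<integral>y. W x y * (?v x - ?v y)\<^sup>2 \<partial>M)"
  proof (rule Bochner_Integration.integrable_cong_AE[THEN iffD2, OF _ _ energy_inner[OF v v]])
    show "integrable M (\<lambda>x. D x * (?v x)\<^sup>2 - 2 * (?v x * kop M W ?v x) + kop M W (\<lambda>y. (?v y)\<^sup>2) x)"
      by (intro ess_bounded_integrable ess_bounded_add ess_bounded_diff ess_bounded_mult ess_bounded_D ess_bounded_W ess_bounded_power v ess_bounded_const)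
    show "(\<lambda>x. D x * (?v x)\<^sup>2 - 2 * (?v x * kop M W ?v x) + kop M W (\<lambda>y. (?v y)\<^sup>2) x) \<in> borel_measurable M"
      using v by (intro ess_bounded_measurable ess_bounded_add ess_bounded_diff ess_bounded_mult ess_bounded_D ess_bounded_W ess_bounded_power v ess_bounded_const)
  qed measurable
  have "AE x in M. (\<integral>y. W x y * (?v x - ?v y)\<^sup>2 \<partial>M) = 0"
    using integral_nonneg_eq_0_iff_AE[OF i1] inn E0 by auto
  then have "AE x in M. AE y in M. W x y * (?v x - ?v y)\<^sup>2 = 0"
    using AE_space bd_kernel_integrable[OF prob_space_axioms bd_kernel_W] bd_kernel_integrable_mult[OF prob_space_axioms bd_kernel_W v]
      bd_kernel_integrable_mult[OF prob_space_axioms bd_kernel_W ess_bounded_power[OF v, of 2]]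
  proof eventually_elim
    case (elim x)
    have "integrable M (\<lambda>y. (?v x)\<^sup>2 * W x y - (2 * ?v x) * (W x y * ?v y) + W x y * (?v y)\<^sup>2)"
      using elim by (intro Bochner_Integration.integrable_add Bochner_Integration.integrable_diff integrable_mult_right) auto
    then have "integrable M (\<lambda>y. W x y * (?v x - ?v y)\<^sup>2)"
      by (rule Bochner_Integration.integrable_cong[THEN iffD1, OF refl, rotated]) (simp add: power2_diff algebra_simps)
    then show ?case using integral_nonneg_eq_0_iff_AE[of M "\<lambda>y. W x y * (?v x - ?v y)\<^sup>2"] elim W_nonneg by auto
  qed
  then have ae: "AE p in M \<Otimes>\<^sub>M M. W (fst p) (snd p) * (?v (fst p) - ?v (snd p))\<^sup>2 = 0"
    by (rule AE_pair) measurable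
  have "prob {x \<in> space M. q < ?v x} \<in> {0, 1}" for q
  proof -
    let ?A = "{x \<in> space M. q < ?v x}"
    have A: "?A \<in> sets M" by measurable
    have "(\<integral>\<^sup>+ p \<in> ?A \<times> (space M - ?A). ennreal (W (fst p) (snd p)) \<partial>(M \<Otimes>\<^sub>M M)) = (\<integral>\<^sup>+ p. 0 \<partial>(M \<Otimes>\<^sub>M M))"
    proof (rule nn_integral_cong_AE)
      show "AE p in M \<Otimes>\<^sub>M M. ennreal (W (fst p) (snd p)) * indicator (?A \<times> (space M - ?A)) p = 0"
        using ae by eventually_elim (auto simp: indicator_def)
    qed
    then have "\<not> (0 < prob ?A \<and> prob ?A < 1)" using conn A by (auto simp: connected_kernel_def)
    then show ?thesis using measure_nonneg[of M ?A] prob_le_1[of ?A] by force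
  qed
  then obtain c where "AE x in M. ?v x = c" using AE_const[OF v] by blast
  then have "AE x in M. h x = c * D x" using D_bounds by eventually_elim (use d_pos in auto)
  then show ?thesis by blast
qed

lemma D_integral_pos: "0 < (\<integral>x. D x \<partial>M)"
proof -
  have "(\<integral>x. d \<partial>M) \<le> (\<integral>x. D x \<partial>M)"
    by (rule integral_mono_AE) (use D_bounds ess_bounded_D in auto)
  then show ?thesis using d_pos by (simp add: prob_space)
qed

lemma kop_K_close:
  assumes f: "ess_bounded M f" "ess_bounded M g" and e: "AE x in M. \<bar>f x - g x\<bar> \<le> e" "0 \<le> e"
  shows "AE x in M. \<bar>kop M K f x - kop M K g x\<bar> \<le> C / d * e"
proof -
  have h: "ess_bounded M (\<lambda>x. f x - g x)" by (intro ess_bounded_diff f)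
  have "(\<integral>y. \<bar>f y - g y\<bar> \<partial>M) \<le> (\<integral>y. e \<partial>M)" by (rule integral_mono_AE) (use e h in auto)
  then have le: "C / d * (\<integral>y. \<bar>f y - g y\<bar> \<partial>M) \<le> C / d * e" using C_nonneg d_pos by (intro mult_left_mono) (auto simp: prob_space)
  have "AE x in M. kop M K (\<lambda>x. 1 * f x + (-1) * g x) x = 1 * kop M K f x + (-1) * kop M K g x"
    by (rule bounded_op_lin[OF bounded_op_kop[OF prob_space_axioms bd_kernel_K] f])
  then show ?thesis using K_smoothing[OF h] by eventually_elim (use le in auto)
qed

text \<open>\<open>K\<close> exchanges the limits of the odd and of the even powers, so their mean
  is a fixed point and thus a multiple of \<open>D\<close>. All powers have integral 1, which
  determines the multiple.\<close>

lemma degree_limit: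
  assumes "0 < e"
  shows "\<exists>n0. \<forall>n\<ge>n0. AE x in M. \<bar>(mean_pop (Suc (2 * n)) x + mean_pop (Suc (Suc (2 * n))) x) / 2 - D x / (\<integral>x. D x \<partial>M)\<bar> \<le> e"
proof -
  obtain h0 where h0: "ess_bounded M h0" "\<And>e. 0 < e \<Longrightarrow> \<exists>n0. \<forall>n\<ge>n0. AE x in M. \<bar>mean_pop (Suc (2 * n)) x - h0 x\<bar> \<le> e"
    using uniform_limit_exists[of "\<lambda>n. mean_pop (Suc (2 * n))"] mean_pop_ess_bounded mean_pop_uniform_Cauchy[of _ 0] by auto
  obtain h1 where h1: "ess_bounded M h1" "\<And>e. 0 < e \<Longrightarrow> \<exists>n0. \<forall>n\<ge>n0. AE x in M. \<bar>mean_pop (Suc (Suc (2 * n))) x - h1 x\<bar> \<le> e"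
    using uniform_limit_exists[of "\<lambda>n. mean_pop (Suc (Suc (2 * n)))"] mean_pop_ess_bounded mean_pop_uniform_Cauchy[of _ 1] by auto
  have small: "AE x in M. f x = g x" if "\<And>e::real. 0 < e \<Longrightarrow> AE x in M. \<bar>f x - g x\<bar> \<le> e" for f g :: "'a \<Rightarrow> real"
  proof -
    have "AE x in M. \<forall>n. \<bar>f x - g x\<bar> \<le> inverse (Suc n)" using that by (simp add: AE_all_countable)
    then show ?thesis
    proof eventually_elim
      case (elim x)
      show ?case
      proof (rule ccontr)
        assume "f x \<noteq> g x" then obtain n where "inverse (Suc n) < \<bar>f x - g x\<bar>" using reals_Archimedean[of "\<bar>f x - g x\<bar>"] by auto
        then show False using elim[rule_format, of n] by simp
      qed
    qed
  qed
  have K0: "AE x in M. kop M K h0 x = h1 x"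
  proof (rule small)
    fix e :: real assume e: "0 < e"
    \<comment> \<open>Replacing \<open>h0\<close> by a power under \<open>K\<close> costs
      \<open>C / d * r\<close>, replacing the next power by \<open>h1\<close> costs another
      \<open>r\<close>.\<close>
    define r where "r = e / (C / d + 1)"
    have cd: "0 < C / d + 1" using C_nonneg d_pos by (intro add_nonneg_pos) auto
    have "C / d * r + r = (C / d + 1) * r" by (simp only: distrib_right mult_1)
    then have r: "0 < r" "C / d * r + r = e" using e cd by (simp_all add: r_def)
    obtain n1 n2 where "\<forall>n\<ge>n1. AE x in M. \<bar>mean_pop (Suc (2 * n)) x - h0 x\<bar> \<le> r" "\<forall>n\<ge>n2. AE x in M. \<bar>mean_pop (Suc (Suc (2 * n))) x - h1 x\<bar> \<le> r"
      using h0(2)[OF r(1)] h1(2)[OF r(1)] by blast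
    then have n: "AE x in M. \<bar>mean_pop (Suc (2 * max n1 n2)) x - h0 x\<bar> \<le> r" "AE x in M. \<bar>mean_pop (Suc (Suc (2 * max n1 n2))) x - h1 x\<bar> \<le> r" by auto
    show "AE x in M. \<bar>kop M K h0 x - h1 x\<bar> \<le> e"
      using kop_K_close[OF mean_pop_ess_bounded h0(1) n(1) less_imp_le[OF r(1)]] n(2)
      by eventually_elim (use r(2) in \<open>simp flip: mean_pop_Suc del: times_divide_eq_left\<close>)
  qed
  have K1: "AE x in M. kop M K h1 x = h0 x"
  proof (rule small)
    fix e :: real assume e: "0 < e"
    define r where "r = e / (C / d + 1)"
    have cd: "0 < C / d + 1" using C_nonneg d_pos by (intro add_nonneg_pos) auto
    have "C / d * r + r = (C / d + 1) * r" by (simp only: distrib_right mult_1)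
    then have r: "0 < r" "C / d * r + r = e" using e cd by (simp_all add: r_def)
    obtain n1 n2 where "\<forall>n\<ge>n1. AE x in M. \<bar>mean_pop (Suc (2 * n)) x - h0 x\<bar> \<le> r" "\<forall>n\<ge>n2. AE x in M. \<bar>mean_pop (Suc (Suc (2 * n))) x - h1 x\<bar> \<le> r"
      using h0(2)[OF r(1)] h1(2)[OF r(1)] by blast
    \<comment> \<open>The extra \<open>Suc\<close> is needed because \<open>K\<close> maps the power
      with index \<open>2 * n + 2\<close> to the one with index \<open>2 * n + 3\<close>.\<close>
    then have n: "AE x in M. \<bar>mean_pop (Suc (2 * Suc (max n1 n2))) x - h0 x\<bar> \<le> r" "AE x in M. \<bar>mean_pop (Suc (Suc (2 * max n1 n2))) x - h1 x\<bar> \<le> r"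
      by (auto simp del: mult_Suc_right)
    show "AE x in M. \<bar>kop M K h1 x - h0 x\<bar> \<le> e"
      using kop_K_close[OF mean_pop_ess_bounded h1(1) n(2) less_imp_le[OF r(1)]] n(1)
      by eventually_elim (use r(2) in \<open>simp flip: mean_pop_Suc del: times_divide_eq_left\<close>)
  qed
  let ?h = "\<lambda>x. 1 / 2 * h0 x + 1 / 2 * h1 x"
  have h: "ess_bounded M ?h" by (intro ess_bounded_add ess_bounded_mult ess_bounded_const h0 h1)
  have "AE x in M. kop M K ?h x = 1 / 2 * kop M K h0 x + 1 / 2 * kop M K h1 x"
    by (rule bounded_op_lin[OF bounded_op_kop[OF prob_space_axioms bd_kernel_K] h0(1) h1(1)])
  then have "AE x in M. kop M K ?h x = ?h x" using K0 K1 by eventually_elim auto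
  then obtain c where c: "AE x in M. ?h x = c * D x" using K_fixed[OF h] by blast
  let ?g = "\<lambda>n x. (mean_pop (Suc (2 * n)) x + mean_pop (Suc (Suc (2 * n))) x) / 2"
  have conv: "\<exists>n0. \<forall>n\<ge>n0. AE x in M. \<bar>?g n x - c * D x\<bar> \<le> e" if e: "0 < e" for e
  proof -
    obtain n1 n2 where n: "\<And>n. n\<ge>n1 \<Longrightarrow> AE x in M. \<bar>mean_pop (Suc (2 * n)) x - h0 x\<bar> \<le> e" "\<And>n. n\<ge>n2 \<Longrightarrow> AE x in M. \<bar>mean_pop (Suc (Suc (2 * n))) x - h1 x\<bar> \<le> e"
      using h0(2)[OF e] h1(2)[OF e] by blast
    have "AE x in M. \<bar>?g n x - c * D x\<bar> \<le> e" if "n \<ge> max n1 n2" for n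
    proof -
      have n': "AE x in M. \<bar>mean_pop (Suc (2 * n)) x - h0 x\<bar> \<le> e" "AE x in M. \<bar>mean_pop (Suc (Suc (2 * n))) x - h1 x\<bar> \<le> e"
        using n that by auto
      show ?thesis using n' c by eventually_elim argo
    qed
    then show ?thesis by blast
  qed
  have g: "ess_bounded M (?g n)" "(\<integral>x. ?g n x \<partial>M) = 1" for n
    using ess_bounded_mult[OF ess_bounded_const[of M "1/2"] ess_bounded_add[OF mean_pop_ess_bounded mean_pop_ess_bounded]] mean_pop_ess_bounded[THEN ess_bounded_integrable] by (auto simp: mean_pop_integral)
  have "\<bar>1 - c * (\<integral>x. D x \<partial>M)\<bar> \<le> e" if e: "0 < e" for e
  proof -
    obtain n where n: "AE x in M. \<bar>?g n x - c * D x\<bar> \<le> e" using conv[OF e] by blast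
    have i: "integrable M (\<lambda>x. c * D x)" "integrable M (?g n)" using ess_bounded_D g(1) by auto
    have "\<bar>1 - c * (\<integral>x. D x \<partial>M)\<bar> = \<bar>\<integral>x. ?g n x - c * D x \<partial>M\<bar>"
      using i g(2)[of n] by (subst Bochner_Integration.integral_diff) auto
    also have "\<dots> \<le> (\<integral>x. \<bar>?g n x - c * D x\<bar> \<partial>M)" by (rule integral_abs_bound)
    also have "\<dots> \<le> (\<integral>x. e \<partial>M)" by (rule integral_mono_AE) (use i n in auto)
    finally show ?thesis by (simp add: prob_space)
  qed
  then have "\<bar>1 - c * (\<integral>x. D x \<partial>M)\<bar> \<le> 0" using field_le_epsilon[of "\<bar>1 - c * (\<integral>x. D x \<partial>M)\<bar>" 0] by auto
  then have "c = 1 / (\<integral>x. D x \<partial>M)" using D_integral_pos by (simp add: field_simps)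
  then show ?thesis using conv[OF assms] by simp
qed

end

section \<open>The law of the branching process\<close>

lemma measurable_PiM_UNIV:
  assumes "\<And>i. (\<lambda>x. f x i) \<in> A \<rightarrow>\<^sub>M B i" shows "f \<in> A \<rightarrow>\<^sub>M Pi\<^sub>M UNIV B"
  using measurable_space[OF assms] by (intro measurable_PiM_single' assms) (auto simp: PiE_UNIV_domain)

lemma measurable_PiM_UNIV_component:
  assumes "g \<in> A \<rightarrow>\<^sub>M Pi\<^sub>M UNIV B" shows "(\<lambda>x. g x i) \<in> A \<rightarrow>\<^sub>M B i"
  using measurable_compose[OF assms measurable_component_singleton[of i UNIV B]] by simp

text \<open>Measurability is tested on cylinders, which form a generator closed under intersections
  and on which the product is a finite product of kernels.\<close>

lemma kernel_PiM_measurable: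
  fixes \<kappa> :: "nat \<Rightarrow> 'x \<Rightarrow> 'y measure"
  assumes \<kappa>: "\<And>i. \<kappa> i \<in> A \<rightarrow>\<^sub>M prob_algebra B"
  shows "(\<lambda>x. \<Pi>\<^sub>M i\<in>UNIV. \<kappa> i x) \<in> A \<rightarrow>\<^sub>M prob_algebra (\<Pi>\<^sub>M i\<in>UNIV. B)"
proof (rule measurable_prob_algebra_generated[OF sets_PiM Int_stable_prod_algebra prod_algebra_sets_into_space])
  have ps: "prob_space (\<kappa> i x)" "sets (\<kappa> i x) = sets B" if "x \<in> space A" for i x
    using measurable_space[OF \<kappa> that] by (auto simp: space_prob_algebra)
  fix x assume x: "x \<in> space A"
  show "prob_space (\<Pi>\<^sub>M i\<in>UNIV. \<kappa> i x)" by (rule prob_space_PiM) (rule ps[OF x])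
  show "sets (\<Pi>\<^sub>M i\<in>UNIV. \<kappa> i x) = sets (\<Pi>\<^sub>M i\<in>UNIV. B)" by (rule sets_PiM_cong) (use ps[OF x] in auto)
next
  have ps: "prob_space (\<kappa> i x)" "sets (\<kappa> i x) = sets B" if "x \<in> space A" for i x
    using measurable_space[OF \<kappa> that] by (auto simp: space_prob_algebra)
  fix X assume "X \<in> prod_algebra UNIV (\<lambda>i::nat. B)"
  then obtain J E where J: "finite J" "X = prod_emb UNIV (\<lambda>i. B) J (Pi\<^sub>E J E)" "\<And>i. i \<in> J \<Longrightarrow> E i \<in> sets B"
    by (elim prod_algebraE) auto
  have "emeasure (\<Pi>\<^sub>M i\<in>UNIV. \<kappa> i x) X = (\<Prod>i\<in>J. emeasure (\<kappa> i x) (E i))" if x: "x \<in> space A" for x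
  proof -
    have "X = prod_emb UNIV (\<lambda>i. \<kappa> i x) J (Pi\<^sub>E J E)"
      using sets_eq_imp_space_eq[OF ps(2)[OF x]] by (auto simp: J prod_emb_def)
    then show ?thesis using J ps[OF x] by (simp add: emeasure_PiM_emb)
  qed
  moreover have "(\<lambda>x. \<Prod>i\<in>J. emeasure (\<kappa> i x) (E i)) \<in> borel_measurable A"
  proof (rule borel_measurable_prod_ennreal)
    fix i assume "i \<in> J"
    show "(\<lambda>x. emeasure (\<kappa> i x) (E i)) \<in> borel_measurable A"
      by (rule measurable_compose[OF measurable_prob_algebraD[OF \<kappa>] measurable_emeasure_subprob_algebra[OF J(3)[OF \<open>i \<in> J\<close>]]])
  qed
  ultimately show "(\<lambda>x. emeasure (\<Pi>\<^sub>M i\<in>UNIV. \<kappa> i x) X) \<in> borel_measurable A"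
    by (simp cong: measurable_cong)
qed

text \<open>The integrand depends on the first \<open>n\<close> coordinates, so the infinite product
  may be replaced by its finite marginal.\<close>

lemma nn_integral_PiM_prod:
  fixes Q :: "'y measure"
  assumes Q: "prob_space Q" and f: "\<And>i. i < n \<Longrightarrow> f i \<in> borel_measurable Q"
  shows "(\<integral>\<^sup>+ \<omega>. (\<Prod>i<n. f i (\<omega> i)) \<partial>(\<Pi>\<^sub>M i\<in>(UNIV :: nat set). Q)) = (\<Prod>i<n. \<integral>\<^sup>+ y. f i y \<partial>Q)"
proof -
  interpret Q: prob_space Q by fact
  interpret PS: product_prob_space "\<lambda>_ :: nat. Q" UNIV by unfold_locales
  have [measurable]: "(\<lambda>\<omega>. \<Prod>i<n. f i (\<omega> i)) \<in> borel_measurable (\<Pi>\<^sub>M i\<in>{..<n}. Q)"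
  proof (rule borel_measurable_prod_ennreal)
    fix i assume i: "i \<in> {..<n}"
    have "(\<lambda>\<omega>. \<omega> i) \<in> (\<Pi>\<^sub>M i\<in>{..<n}. Q) \<rightarrow>\<^sub>M Q" by (rule measurable_component_singleton[OF i])
    from measurable_compose[OF this f] i show "(\<lambda>\<omega>. f i (\<omega> i)) \<in> borel_measurable (\<Pi>\<^sub>M i\<in>{..<n}. Q)" by simp
  qed
  have "(\<integral>\<^sup>+ \<omega>. (\<Prod>i<n. f i (\<omega> i)) \<partial>(\<Pi>\<^sub>M i\<in>(UNIV :: nat set). Q))
    = (\<integral>\<^sup>+ \<omega>. (\<Prod>i<n. f i (restrict \<omega> {..<n} i)) \<partial>(\<Pi>\<^sub>M i\<in>(UNIV :: nat set). Q))"
    by (intro nn_integral_cong prod.cong) auto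
  also have "\<dots> = (\<integral>\<^sup>+ \<omega>. (\<Prod>i<n. f i (\<omega> i)) \<partial>distr (\<Pi>\<^sub>M i\<in>(UNIV :: nat set). Q) (\<Pi>\<^sub>M i\<in>{..<n}. Q) (\<lambda>x. restrict x {..<n}))"
    by (subst nn_integral_distr) (auto intro: measurable_restrict_subset)
  also have "\<dots> = (\<integral>\<^sup>+ \<omega>. (\<Prod>i<n. f i (\<omega> i)) \<partial>(\<Pi>\<^sub>M i\<in>{..<n}. Q))"
    by (subst PS.distr_PiM_restrict_finite) auto
  also have "\<dots> = (\<Prod>i<n. \<integral>\<^sup>+ y. f i y \<partial>Q)"
    using f by (subst PS.product_nn_integral_prod) auto
  finally show ?thesis .
qed

lemma count_indicator_measurable:
  "(\<lambda>c. indicator {n :: nat} (fst c) :: ennreal) \<in> borel_measurable (count_space UNIV \<Otimes>\<^sub>M B)"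
  by (rule measurable_compose[OF measurable_fst]) simp

lemma count_indicator_children:
  "(\<lambda>c. indicator {n :: nat} (fst c) :: ennreal) \<in> borel_measurable (children_space M)"
  unfolding children_space_def by (rule count_indicator_measurable)

lemma measurable_kernel_cong_kind:
  assumes "\<And>k. (\<lambda>y. f (k, y)) \<in> M \<rightarrow>\<^sub>M K" shows "f \<in> type_space M \<rightarrow>\<^sub>M K"
  unfolding type_space_def
proof (rule measurable_pair_measure_countable1)
  have "(UNIV :: kind set) = {Anc, Oth}" using kind.exhaust by auto
  then show "countable (UNIV :: kind set)" by (metis countable_finite finite.emptyI finite_insert)
qed (rule assms)

section \<open>Events of labelled trees and their decomposition at the root\<close>

definition tree_event :: "'a measure \<Rightarrow> ptree \<Rightarrow> (nat list \<Rightarrow> (kind \<times> 'a) \<times> nat) set" where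
  "tree_event M q = {\<omega> \<in> space (labelling_space M). untyped_tree \<omega> = tree q}"

definition finite_event :: "'a measure \<Rightarrow> (nat list \<Rightarrow> (kind \<times> 'a) \<times> nat) set" where
  "finite_event M = {\<omega> \<in> space (labelling_space M). finite (untyped_tree \<omega>)}"

text \<open>Being a given plane tree and being finite both decompose at the root into events of this
  form, so one formula for their probability covers both.\<close>

definition graft_event :: "'a measure \<Rightarrow> nat \<Rightarrow> (nat \<Rightarrow> (nat list \<Rightarrow> (kind \<times> 'a) \<times> nat) set) \<Rightarrow> (nat list \<Rightarrow> (kind \<times> 'a) \<times> nat) set" where
  "graft_event M n E = {\<omega> \<in> space (labelling_space M). snd (\<omega> []) = n \<and> (\<forall>i<n. (\<lambda>v. \<omega> (i # v)) \<in> E i)}"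

lemma space_labelling: "\<omega> \<in> space (labelling_space M) \<longleftrightarrow> (\<forall>u. snd (fst (\<omega> u)) \<in> space M)"
  by (simp add: labelling_space_def space_PiM space_pair_measure type_space_def mem_Times_iff PiE_UNIV_domain Pi_iff)

lemma tree_event_graft: "tree_event M (PNode ts) = graft_event M (length ts) (\<lambda>i. tree_event M (ts ! i))"
  unfolding tree_event_def graft_event_def untyped_eq_tree by (auto simp: space_labelling)

lemma sub_measurable [measurable]: "(\<lambda>\<omega> v. \<omega> (i # v)) \<in> labelling_space M \<rightarrow>\<^sub>M labelling_space M"
  unfolding labelling_space_def
proof (rule measurable_PiM_UNIV)
  fix u
  show "(\<lambda>\<omega>. \<omega> (i # u)) \<in> (\<Pi>\<^sub>M u\<in>UNIV. type_space M \<Otimes>\<^sub>M count_space UNIV) \<rightarrow>\<^sub>M type_space M \<Otimes>\<^sub>M count_space UNIV"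
    by (rule measurable_component_singleton) simp
qed

lemma root_measurable [measurable]: "(\<lambda>\<omega>. snd (\<omega> [])) \<in> labelling_space M \<rightarrow>\<^sub>M count_space UNIV"
proof -
  have "(\<lambda>\<omega>. \<omega> []) \<in> labelling_space M \<rightarrow>\<^sub>M type_space M \<Otimes>\<^sub>M count_space UNIV"
    unfolding labelling_space_def by (rule measurable_component_singleton) simp
  from measurable_compose[OF this measurable_snd] show ?thesis .
qed

lemma graft_event_sets:
  assumes "\<And>i. i < n \<Longrightarrow> E i \<in> sets (labelling_space M)"
  shows "graft_event M n E \<in> sets (labelling_space M)"
proof -
  have "{\<omega> \<in> space (labelling_space M). (\<lambda>v. \<omega> (i # v)) \<in> E i} \<in> sets (labelling_space M)" if "i \<in> {..<n}" for i
    using measurable_sets[OF sub_measurable assms[of i]] that by (simp add: vimage_def Int_def conj_commute)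
  then have 1: "{\<omega> \<in> space (labelling_space M). \<forall>i\<in>{..<n}. (\<lambda>v. \<omega> (i # v)) \<in> E i} \<in> sets (labelling_space M)"
    by (rule sets.sets_Collect_finite_All) auto
  have 2: "{\<omega> \<in> space (labelling_space M). snd (\<omega> []) = n} \<in> sets (labelling_space M)" by measurable
  have "graft_event M n E = {\<omega> \<in> space (labelling_space M). snd (\<omega> []) = n \<and> (\<forall>i\<in>{..<n}. (\<lambda>v. \<omega> (i # v)) \<in> E i)}"
    unfolding graft_event_def Ball_def lessThan_iff ..
  then show ?thesis using sets.sets_Collect_conj[OF 1 2] by (simp only:)
qed

lemma tree_event_sets: "tree_event M q \<in> sets (labelling_space M)"
proof (induction q)
  case (PNode ts)
  show ?case unfolding tree_event_graft by (rule graft_event_sets) (use PNode in simp)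
qed

lemma finite_event_eq: "finite_event (M :: 'a measure) = (\<Union>q. tree_event M q)"
proof (rule set_eqI)
  fix \<omega> :: "nat list \<Rightarrow> (kind \<times> 'a) \<times> nat"
  have "finite (untyped_tree \<omega>) \<longleftrightarrow> (\<exists>q. untyped_tree \<omega> = tree q)"
    using finite_untyped_tree[of \<omega>] finite_tree by auto
  then show "\<omega> \<in> finite_event M \<longleftrightarrow> \<omega> \<in> (\<Union>q. tree_event M q)" by (auto simp: finite_event_def tree_event_def)
qed

lemma finite_event_sets: "finite_event M \<in> sets (labelling_space M)"
  unfolding finite_event_eq by (intro sets.countable_UN'') (auto simp: tree_event_sets)

lemma finite_event_graft: "finite_event M = (\<Union>n. graft_event M n (\<lambda>_. finite_event M))"
proof (rule set_eqI)
  fix \<omega> show "\<omega> \<in> finite_event M \<longleftrightarrow> \<omega> \<in> (\<Union>n. graft_event M n (\<lambda>_. finite_event M))"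
    using finite_untyped[of \<omega>] by (auto simp: graft_event_def finite_event_def space_labelling)
qed

lemma disjoint_tree_event: "disjoint_family (tree_event M)"
  unfolding disjoint_family_on_def tree_event_def using tree_inj by auto

section \<open>The branching process as a composition of Markov kernels\<close>

locale meas_kernel = prob_space M for M :: "'a measure" +
  fixes W :: "'a \<Rightarrow> 'a \<Rightarrow> real"
  assumes meas [measurable]: "(\<lambda>(x, y). W x y) \<in> borel_measurable (M \<Otimes>\<^sub>M M)"
begin

lemma deg_measurable [measurable]: "deg M W \<in> borel_measurable M"
proof -
  have "(\<lambda>x. \<integral>\<^sup>+ y. ennreal (W x y) \<partial>M) \<in> borel_measurable M" by measurable
  then show ?thesis by (simp add: deg_def[abs_def])
qed

lemma normalized_density_measurable:
  assumes [measurable]: "(\<lambda>(x, y). f x y) \<in> borel_measurable (M \<Otimes>\<^sub>M M)"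
  shows "(\<lambda>x. normalized_density M (f x)) \<in> M \<rightarrow>\<^sub>M prob_algebra M"
proof (rule measurable_prob_algebraI)
  let ?m = "\<lambda>x. \<integral>\<^sup>+ y. f x y \<partial>M"
  show ps: "prob_space (normalized_density M (f x))" if [measurable]: "x \<in> space M" for x
  proof (cases "0 < ?m x \<and> ?m x < \<infinity>")
    case True
    have [measurable]: "f x \<in> borel_measurable M" by measurable
    have "(\<integral>\<^sup>+ y. f x y / ?m x \<partial>M) = ?m x / ?m x" by (rule nn_integral_divide) measurable
    also have "\<dots> = 1" using True by (intro ennreal_divide_self) auto
    finally have 1: "(\<integral>\<^sup>+ y. f x y / ?m x \<partial>M) = 1" .
    have "prob_space (density M (\<lambda>y. f x y / ?m x))"
    proof
      have "emeasure (density M (\<lambda>y. f x y / ?m x)) (space M) = (\<integral>\<^sup>+ y. f x y / ?m x * indicator (space M) y \<partial>M)"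
        by (subst emeasure_density) auto
      also have "\<dots> = 1" unfolding 1[symmetric] by (intro nn_integral_cong) auto
      finally show "emeasure (density M (\<lambda>y. f x y / ?m x)) (space (density M (\<lambda>y. f x y / ?m x))) = 1" by simp
    qed
    then show ?thesis using True by (simp add: normalized_density_def Let_def)
  next
    case False then show ?thesis using prob_space_axioms by (auto simp: normalized_density_def Let_def)
  qed
  show "(\<lambda>x. normalized_density M (f x)) \<in> M \<rightarrow>\<^sub>M subprob_algebra M"
  proof (rule measurable_subprob_algebra)
    fix x assume "x \<in> space M" then show "subprob_space (normalized_density M (f x))"
      using ps prob_space_imp_subprob_space by blast
    show "sets (normalized_density M (f x)) = sets M" by (simp add: normalized_density_def Let_def)
  next
    fix A assume [measurable]: "A \<in> sets M"
    have "emeasure (normalized_density M (f x)) A =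
      (if 0 < ?m x \<and> ?m x < \<infinity> then \<integral>\<^sup>+ y. f x y / ?m x * indicator A y \<partial>M else emeasure M A)" if [measurable]: "x \<in> space M" for x
    proof -
      have [measurable]: "f x \<in> borel_measurable M" by measurable
      show ?thesis by (simp add: normalized_density_def Let_def emeasure_density)
    qed
    moreover have "(\<lambda>x. if 0 < ?m x \<and> ?m x < \<infinity> then \<integral>\<^sup>+ y. f x y / ?m x * indicator A y \<partial>M else emeasure M A) \<in> borel_measurable M"
      by measurable
    ultimately show "(\<lambda>x. emeasure (normalized_density M (f x)) A) \<in> borel_measurable M"
      by (simp cong: measurable_cong)
  qed
qed

abbreviation "f0 x y \<equiv> ennreal (W x y) / deg M W y"

text \<open>The law of the number of points in \<open>poisson_process\<close>, split off so that
  \<open>oth_points\<close> becomes visibly a product measure.\<close>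

definition pois :: "'a \<Rightarrow> nat pmf" where
  "pois x = (let m = \<integral>\<^sup>+ y. f0 x y \<partial>M in if 0 < m \<and> m < \<infinity> then poisson_pmf (enn2real m) else return_pmf 0)"

lemma f0_measurable [measurable]: "(\<lambda>(x, y). f0 x y) \<in> borel_measurable (M \<Otimes>\<^sub>M M)"
  by measurable

lemma pois_measurable: "(\<lambda>x. measure_pmf (pois x)) \<in> M \<rightarrow>\<^sub>M prob_algebra (count_space UNIV)"
proof (rule measurable_prob_algebraI)
  show "prob_space (measure_pmf (pois x))" for x by (rule prob_space_measure_pmf)
  show "(\<lambda>x. measure_pmf (pois x)) \<in> M \<rightarrow>\<^sub>M subprob_algebra (count_space UNIV)"
  proof (rule measurable_subprob_algebra)
    fix A :: "nat set"
    let ?m = "\<lambda>x. \<integral>\<^sup>+ y. f0 x y \<partial>M"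
    have pm: "(\<lambda>x. ennreal (pmf (pois x) n)) \<in> borel_measurable M" for n
    proof -
      have "ennreal (pmf (pois x) n) = (if 0 < ?m x \<and> ?m x < \<infinity> then ennreal (enn2real (?m x) ^ n / fact n * exp (- enn2real (?m x))) else indicator {0} n)" for x
        using enn2real_positive_iff[of "?m x"] by (auto simp: pois_def Let_def pmf_return indicator_def)
      then show ?thesis by simp
    qed
    have "emeasure (measure_pmf (pois x)) A = (\<Sum>n. ennreal (pmf (pois x) n) * indicator A n)" for x
    proof -
      have "emeasure (measure_pmf (pois x)) A = (\<integral>\<^sup>+ n. ennreal (pmf (pois x) n) \<partial>count_space A)"
        by (rule nn_integral_pmf[symmetric])
      also have "\<dots> = (\<integral>\<^sup>+ n. ennreal (pmf (pois x) n) * indicator A n \<partial>count_space UNIV)"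
        by (simp add: nn_integral_count_space_indicator)
      finally show ?thesis by (simp add: nn_integral_count_space_nat)
    qed
    then show "(\<lambda>x. emeasure (measure_pmf (pois x)) A) \<in> borel_measurable M" using pm by simp
  qed (auto intro: prob_space_imp_subprob_space prob_space_measure_pmf)
qed

abbreviation "nd x \<equiv> normalized_density M (f0 x)"
abbreviation "na x \<equiv> normalized_density M (\<lambda>y. ennreal (W x y))"

lemma nd_measurable [measurable]: "nd \<in> M \<rightarrow>\<^sub>M prob_algebra M"
  by (rule normalized_density_measurable[OF f0_measurable])

lemma na_measurable [measurable]: "na \<in> M \<rightarrow>\<^sub>M prob_algebra M"
  by (rule normalized_density_measurable) measurable

lemma oth_points_eq: "oth_points M W x = measure_pmf (pois x) \<Otimes>\<^sub>M (\<Pi>\<^sub>M i\<in>UNIV. nd x)"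
  by (simp add: oth_points_def poisson_process_def pois_def Let_def)

lemma oth_points_measurable [measurable]: 
  "oth_points M W \<in> M \<rightarrow>\<^sub>M prob_algebra (count_space UNIV \<Otimes>\<^sub>M (\<Pi>\<^sub>M i\<in>UNIV. M))"
proof -
  have 1: "(\<lambda>x. \<Pi>\<^sub>M i\<in>(UNIV :: nat set). nd x) \<in> M \<rightarrow>\<^sub>M prob_algebra (\<Pi>\<^sub>M i\<in>UNIV. M)"
    by (rule kernel_PiM_measurable[OF nd_measurable])
  show ?thesis unfolding oth_points_eq[abs_def]
    by (rule measurable_pair_prob[OF pois_measurable 1])
qed

lemma oth_map_measurable:
  "(\<lambda>(n, xs). (n, \<lambda>i. (Oth, xs i))) \<in> count_space UNIV \<Otimes>\<^sub>M (\<Pi>\<^sub>M i\<in>(UNIV :: nat set). M) \<rightarrow>\<^sub>M children_space M"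
proof -
  have "(\<lambda>p i. (Oth, snd p i)) \<in> count_space (UNIV :: nat set) \<Otimes>\<^sub>M (\<Pi>\<^sub>M i\<in>(UNIV :: nat set). M) \<rightarrow>\<^sub>M (\<Pi>\<^sub>M i\<in>(UNIV :: nat set). type_space M)"
    by (rule measurable_PiM_UNIV) (unfold type_space_def, measurable)
  then show ?thesis unfolding children_space_def by (simp add: split_beta)
qed

lemma anc_map_measurable:
  "(\<lambda>(x0, n, xs). (Suc n, case_nat (Anc, x0) (\<lambda>i. (Oth, xs i)))) \<in> M \<Otimes>\<^sub>M (count_space UNIV \<Otimes>\<^sub>M (\<Pi>\<^sub>M i\<in>(UNIV :: nat set). M)) \<rightarrow>\<^sub>M children_space M"
proof -
  let ?A = "M \<Otimes>\<^sub>M (count_space UNIV \<Otimes>\<^sub>M (\<Pi>\<^sub>M i\<in>(UNIV :: nat set). M)) :: ('a \<times> nat \<times> (nat \<Rightarrow> 'a)) measure"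
  have "(\<lambda>p. case_nat (Anc, fst p) (\<lambda>i. (Oth, snd (snd p) i))) \<in> ?A \<rightarrow>\<^sub>M (\<Pi>\<^sub>M i\<in>(UNIV :: nat set). type_space M)"
  proof (rule measurable_PiM_UNIV)
    fix i :: nat
    show "(\<lambda>p. case_nat (Anc, fst p) (\<lambda>i. (Oth, snd (snd p) i)) i) \<in> ?A \<rightarrow>\<^sub>M type_space M"
      by (cases i; simp; unfold type_space_def, measurable)
  qed
  moreover have "(\<lambda>p. Suc (fst (snd p))) \<in> ?A \<rightarrow>\<^sub>M count_space UNIV" by measurable
  ultimately show ?thesis unfolding children_space_def by (simp add: split_beta)
qed

lemma offspring_measurable [measurable]: "offspring M W \<in> type_space M \<rightarrow>\<^sub>M prob_algebra (children_space M)"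
proof (rule measurable_kernel_cong_kind)
  fix k :: kind
  show "(\<lambda>y. offspring M W (k, y)) \<in> M \<rightarrow>\<^sub>M prob_algebra (children_space M)"
  proof (cases k)
    case Anc
    have "(\<lambda>x. distr (na x \<Otimes>\<^sub>M oth_points M W x) (children_space M) (\<lambda>(x0, n, xs). (Suc n, case_nat (Anc, x0) (\<lambda>i. (Oth, xs i))))) \<in> M \<rightarrow>\<^sub>M prob_algebra (children_space M)"
      by (rule measurable_compose[OF measurable_pair_prob[OF na_measurable oth_points_measurable] measurable_distr_prob_space[OF anc_map_measurable]])
    then show ?thesis using Anc by (simp add: offspring_def)
  next
    case Oth
    have "(\<lambda>x. distr (oth_points M W x) (children_space M) (\<lambda>(n, xs). (n, \<lambda>i. (Oth, xs i)))) \<in> M \<rightarrow>\<^sub>M prob_algebra (children_space M)"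
      by (rule measurable_compose[OF oth_points_measurable measurable_distr_prob_space[OF oth_map_measurable]])
    then show ?thesis using Oth by (simp add: offspring_def)
  qed
qed

definition graft :: "kind \<times> 'a \<Rightarrow> nat \<Rightarrow> (nat \<Rightarrow> nat list \<Rightarrow> (kind \<times> 'a) \<times> nat) \<Rightarrow> nat list \<Rightarrow> (kind \<times> 'a) \<times> nat" where
  "graft t n \<omega> u = (case u of [] \<Rightarrow> (t, n) | i # v \<Rightarrow> \<omega> i v)"

lemma graft_measurable:
  "(\<lambda>((t, n, ts), \<omega>). graft t n \<omega>) \<in> (type_space M \<Otimes>\<^sub>M children_space M) \<Otimes>\<^sub>M (\<Pi>\<^sub>M i\<in>UNIV. labelling_space M) \<rightarrow>\<^sub>M labelling_space M"
proof -
  let ?A = "(type_space M \<Otimes>\<^sub>M children_space M) \<Otimes>\<^sub>M (\<Pi>\<^sub>M i\<in>(UNIV :: nat set). labelling_space M)"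
  have "(\<lambda>p. graft (fst (fst p)) (fst (snd (fst p))) (snd p)) \<in> ?A \<rightarrow>\<^sub>M (\<Pi>\<^sub>M u\<in>UNIV. type_space M \<Otimes>\<^sub>M count_space UNIV)"
  proof (rule measurable_PiM_UNIV)
    fix u :: "nat list"
    show "(\<lambda>p. graft (fst (fst p)) (fst (snd (fst p))) (snd p) u) \<in> ?A \<rightarrow>\<^sub>M type_space M \<Otimes>\<^sub>M count_space UNIV"
    proof (cases u)
      case Nil
      have "(\<lambda>p. (fst (fst p), fst (snd (fst p)))) \<in> ?A \<rightarrow>\<^sub>M type_space M \<Otimes>\<^sub>M count_space UNIV"
        unfolding children_space_def by measurable
      then show ?thesis using Nil by (simp add: graft_def)
    next
      case (Cons i v)
      have "(\<lambda>p. snd p i) \<in> ?A \<rightarrow>\<^sub>M labelling_space M" by measurable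
      then have "(\<lambda>p. snd p i v) \<in> ?A \<rightarrow>\<^sub>M type_space M \<Otimes>\<^sub>M count_space UNIV"
        unfolding labelling_space_def by (rule measurable_PiM_UNIV_component)
      then show ?thesis using Cons by (simp add: graft_def)
    qed
  qed
  then show ?thesis unfolding labelling_space_def by (simp add: split_beta')
qed

lemma progeny_Suc: "progeny M W (Suc k) t = offspring M W t \<bind> (\<lambda>(n, ts). distr (\<Pi>\<^sub>M i\<in>UNIV. progeny M W k (ts i)) (labelling_space M) (graft t n))"
  by (simp add: graft_def[abs_def])

lemma progeny_step_measurable:
  assumes "progeny M W k \<in> type_space M \<rightarrow>\<^sub>M prob_algebra (labelling_space M)"
  shows "(\<lambda>(t, n, ts). distr (\<Pi>\<^sub>M i\<in>UNIV. progeny M W k (ts i)) (labelling_space M) (graft t n))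
    \<in> type_space M \<Otimes>\<^sub>M children_space M \<rightarrow>\<^sub>M prob_algebra (labelling_space M)"
proof -
  have 1: "(\<lambda>x. \<Pi>\<^sub>M i\<in>UNIV. progeny M W k (snd (snd x) i)) \<in> type_space M \<Otimes>\<^sub>M children_space M \<rightarrow>\<^sub>M prob_algebra (\<Pi>\<^sub>M i\<in>(UNIV :: nat set). labelling_space M)"
    by (rule kernel_PiM_measurable, rule measurable_compose[OF _ assms]) (unfold children_space_def, measurable)
  have "(\<lambda>x. distr (\<Pi>\<^sub>M i\<in>UNIV. progeny M W k (snd (snd x) i)) (labelling_space M) (graft (fst x) (fst (snd x))))
    \<in> type_space M \<Otimes>\<^sub>M children_space M \<rightarrow>\<^sub>M prob_algebra (labelling_space M)"
    by (rule measurable_distr_prob_space2[OF 1]) (use graft_measurable in \<open>simp add: split_beta'\<close>)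
  then show ?thesis by (simp add: split_beta)
qed

lemma progeny_measurable [measurable]: "progeny M W k \<in> type_space M \<rightarrow>\<^sub>M prob_algebra (labelling_space M)"
proof (induction k)
  case 0
  have "(\<lambda>t u. (t, 0)) \<in> type_space M \<rightarrow>\<^sub>M labelling_space M"
    unfolding labelling_space_def by (intro measurable_PiM_UNIV measurable_Pair measurable_ident_sets measurable_const) auto
  then have "(\<lambda>t. return (labelling_space M) (\<lambda>u. (t, 0))) \<in> type_space M \<rightarrow>\<^sub>M prob_algebra (labelling_space M)"
    by (rule measurable_compose[OF _ measurable_return_prob_space])
  then show ?case unfolding progeny.simps(1)[abs_def] .
next
  case (Suc k)
  show ?case unfolding progeny_Suc[abs_def]
    by (rule measurable_bind_prob_space2[OF offspring_measurable]) (use progeny_step_measurable[OF Suc] in \<open>simp add: split_beta'\<close>)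
qed

lemma progeny_prob: "t \<in> space (type_space M) \<Longrightarrow> prob_space (progeny M W k t) \<and> sets (progeny M W k t) = sets (labelling_space M)"
  using measurable_space[OF progeny_measurable] by (auto simp: space_prob_algebra)

lemma progeny_emeasure_measurable [measurable]:
  "E \<in> sets (labelling_space M) \<Longrightarrow> (\<lambda>t. emeasure (progeny M W k t) E) \<in> borel_measurable (type_space M)"
  by (rule measurable_compose[OF measurable_prob_algebraD[OF progeny_measurable] measurable_emeasure_subprob_algebra])

text \<open>Given the types of the children their progenies are independent, and the event fixes the
  number of children and restricts the first \<open>n\<close> subtrees: under the gluing map its
  preimage is a cylinder or empty.\<close>

lemma graft_Suc:
  assumes E: "\<And>i. i < n \<Longrightarrow> E i \<in> sets (labelling_space M)" and t: "t \<in> space (type_space M)"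
  shows "emeasure (progeny M W (Suc k) t) (graft_event M n E)
    = (\<integral>\<^sup>+ c. indicator {n} (fst c) * (\<Prod>i<n. emeasure (progeny M W k (snd c i)) (E i)) \<partial>offspring M W t)"
proof -
  let ?g = "\<lambda>c. distr (\<Pi>\<^sub>M i\<in>UNIV. progeny M W k (snd c i)) (labelling_space M) (graft t (fst c))"
  have "(\<lambda>c. (t, c)) \<in> children_space M \<rightarrow>\<^sub>M type_space M \<Otimes>\<^sub>M children_space M" using t by measurable
  from measurable_compose[OF this progeny_step_measurable[OF progeny_measurable, of k]]
  have gm: "?g \<in> children_space M \<rightarrow>\<^sub>M prob_algebra (labelling_space M)" by (simp add: split_beta)
  have om: "offspring M W t \<in> space (prob_algebra (children_space M))" by (rule measurable_space[OF offspring_measurable t])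
  have so: "space (offspring M W t) = space (children_space M)"
    using om by (intro sets_eq_imp_space_eq) (simp add: space_prob_algebra)
  have "emeasure (progeny M W (Suc k) t) (graft_event M n E) = (\<integral>\<^sup>+ c. emeasure (?g c) (graft_event M n E) \<partial>offspring M W t)"
    unfolding progeny_Suc using emeasure_bind_prob_algebra[OF om gm graft_event_sets[of n E M, OF E]] by (simp add: split_beta')
  also have "\<dots> = (\<integral>\<^sup>+ c. indicator {n} (fst c) * (\<Prod>i<n. emeasure (progeny M W k (snd c i)) (E i)) \<partial>offspring M W t)"
  proof (rule nn_integral_cong)
    fix c assume c: "c \<in> space (offspring M W t)"
    obtain m ts where mts: "c = (m, ts)" by (cases c)
    have ts: "ts i \<in> space (type_space M)" for i using c by (auto simp: so mts children_space_def space_pair_measure space_PiM)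
    have ps: "prob_space (progeny M W k (ts i))" "sets (progeny M W k (ts i)) = sets (labelling_space M)" for i
      using progeny_prob[OF ts] by auto
    have sp: "space (progeny M W k (ts i)) = space (labelling_space M)" for i by (rule sets_eq_imp_space_eq[OF ps(2)])
    let ?P = "\<Pi>\<^sub>M i\<in>(UNIV :: nat set). progeny M W k (ts i)"
    interpret PP: prob_space ?P by (rule prob_space_PiM) (rule ps)
    have sP: "sets ?P = sets (\<Pi>\<^sub>M i\<in>(UNIV :: nat set). labelling_space M)" by (rule sets_PiM_cong) (use ps in auto)
    have tc: "(t, m, ts) \<in> space (type_space M \<Otimes>\<^sub>M children_space M)"
      using c t by (simp add: so mts space_pair_measure)
    have "(\<lambda>\<omega>. ((t, m, ts), \<omega>)) \<in> ?P \<rightarrow>\<^sub>M (type_space M \<Otimes>\<^sub>M children_space M) \<Otimes>\<^sub>M (\<Pi>\<^sub>M i\<in>(UNIV :: nat set). labelling_space M)"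
      by (rule measurable_Pair1'[OF tc, THEN measurable_cong_sets[OF sP refl, THEN equalityD2, THEN subsetD]])
    from measurable_compose[OF this graft_measurable] have jm: "graft t m \<in> ?P \<rightarrow>\<^sub>M labelling_space M" by simp
    have "emeasure (?g c) (graft_event M n E) = emeasure ?P (graft t m -` graft_event M n E \<inter> space ?P)"
      using emeasure_distr[OF jm graft_event_sets[OF E]] by (simp add: mts)
    also have "graft t m -` graft_event M n E \<inter> space ?P = (if m = n then prod_emb UNIV (\<lambda>i. progeny M W k (ts i)) {..<n} (Pi\<^sub>E {..<n} E) else {})"
      using t ts by (auto simp: graft_event_def graft_def prod_emb_def space_PiM sp space_labelling PiE_iff type_space_def space_pair_measure split: list.split)
    also have "emeasure ?P \<dots> = indicator {n} m * (\<Prod>i<n. emeasure (progeny M W k (ts i)) (E i))"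
    proof (cases "m = n")
      case True
      have "emeasure ?P (prod_emb UNIV (\<lambda>i. progeny M W k (ts i)) {..<n} (Pi\<^sub>E {..<n} E)) = (\<Prod>i<n. emeasure (progeny M W k (ts i)) (E i))"
        by (rule emeasure_PiM_emb) (use ps E in auto)
      then show ?thesis using True by simp
    qed simp
    finally show "emeasure (?g c) (graft_event M n E) = indicator {n} (fst c) * (\<Prod>i<n. emeasure (progeny M W k (snd c i)) (E i))"
      by (simp add: mts)
  qed
  finally show ?thesis .
qed

text \<open>The number of points is independent of the sequence of positions, the positions are
  independent draws, and only the first \<open>n\<close> of them occur in the integrand.\<close>

lemma oth_points_integral:
  assumes x: "x \<in> space M" and f: "\<And>i. i < n \<Longrightarrow> f i \<in> borel_measurable M"
  shows "(\<integral>\<^sup>+ (m, xs). indicator {n} m * (\<Prod>i<n. f i (xs i)) \<partial>oth_points M W x) = ennreal (pmf (pois x) n) * (\<Prod>i<n. \<integral>\<^sup>+ y. f i y \<partial>nd x)"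
proof -
  have nd: "prob_space (nd x)" "sets (nd x) = sets M" using measurable_space[OF nd_measurable x] by (auto simp: space_prob_algebra)
  interpret nd: prob_space "nd x" by (rule nd)
  interpret Q: prob_space "\<Pi>\<^sub>M i\<in>(UNIV :: nat set). nd x" by (rule prob_space_PiM) (rule nd)
  have f': "f i \<in> borel_measurable (nd x)" if "i < n" for i using f[OF that] measurable_cong_sets[OF nd(2) refl] by blast
  have m1: "(\<lambda>xs. \<Prod>i<n. f i (xs i)) \<in> borel_measurable (\<Pi>\<^sub>M i\<in>(UNIV :: nat set). nd x)"
  proof (rule borel_measurable_prod_ennreal)
    fix i assume i: "i \<in> {..<n}"
    have "(\<lambda>\<omega>. \<omega> i) \<in> (\<Pi>\<^sub>M i\<in>(UNIV :: nat set). nd x) \<rightarrow>\<^sub>M nd x" by (rule measurable_component_singleton) simp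
    from measurable_compose[OF this f'] i show "(\<lambda>\<omega>. f i (\<omega> i)) \<in> borel_measurable (\<Pi>\<^sub>M i\<in>(UNIV :: nat set). nd x)" by simp
  qed
  have m2: "(\<lambda>c. \<Prod>i<n. f i (snd c i)) \<in> borel_measurable (measure_pmf (pois x) \<Otimes>\<^sub>M (\<Pi>\<^sub>M i\<in>(UNIV :: nat set). nd x))"
    by (rule measurable_compose[OF measurable_snd m1])
  have m3: "(\<lambda>c. indicator {n} (fst c) :: ennreal) \<in> borel_measurable (measure_pmf (pois x) \<Otimes>\<^sub>M (\<Pi>\<^sub>M i\<in>(UNIV :: nat set). nd x))"
    by (rule measurable_compose[OF measurable_fst]) simp
  have [measurable]: "(\<lambda>(m, xs). indicator {n} m * (\<Prod>i<n. f i (xs i)) :: ennreal) \<in> borel_measurable (measure_pmf (pois x) \<Otimes>\<^sub>M (\<Pi>\<^sub>M i\<in>(UNIV :: nat set). nd x))"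
    using borel_measurable_times_ennreal[OF m3 m2] by (simp add: split_beta')
  have "(\<integral>\<^sup>+ (m, xs). indicator {n} m * (\<Prod>i<n. f i (xs i)) \<partial>oth_points M W x)
    = (\<integral>\<^sup>+ m. (\<integral>\<^sup>+ xs. indicator {n} m * (\<Prod>i<n. f i (xs i)) \<partial>(\<Pi>\<^sub>M i\<in>(UNIV :: nat set). nd x)) \<partial>measure_pmf (pois x))"
    unfolding oth_points_eq by (subst Q.nn_integral_fst[symmetric]) auto
  also have "\<dots> = (\<integral>\<^sup>+ m. indicator {n} m * (\<Prod>i<n. \<integral>\<^sup>+ y. f i y \<partial>nd x) \<partial>measure_pmf (pois x))"
    using m1 by (simp add: nn_integral_cmult nn_integral_PiM_prod[OF nd(1) f'])
  also have "\<dots> = emeasure (measure_pmf (pois x)) {n} * (\<Prod>i<n. \<integral>\<^sup>+ y. f i y \<partial>nd x)"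
    by (subst nn_integral_multc) auto
  finally show ?thesis by (simp add: emeasure_pmf_single)
qed

lemma type_in [simp]: "(k, x) \<in> space (type_space M) \<longleftrightarrow> x \<in> space M"
  by (simp add: type_space_def space_pair_measure)

lemma type_measurable [measurable]: "(\<lambda>x. (k, x)) \<in> M \<rightarrow>\<^sub>M type_space M"
  unfolding type_space_def by measurable

lemma progeny_Oth:
  assumes E: "\<And>i. i < n \<Longrightarrow> E i \<in> sets (labelling_space M)" and x: "x \<in> space M"
  shows "emeasure (progeny M W (Suc k) (Oth, x)) (graft_event M n E)
    = ennreal (pmf (pois x) n) * (\<Prod>i<n. \<integral>\<^sup>+ y. emeasure (progeny M W k (Oth, y)) (E i) \<partial>nd x)"
proof -
  have pm: "(\<lambda>c. \<Prod>i<n. emeasure (progeny M W k (snd c i)) (E i)) \<in> borel_measurable (children_space M)"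
  proof (rule borel_measurable_prod_ennreal)
    fix i assume "i \<in> {..<n}"
    then have [measurable]: "(\<lambda>t. emeasure (progeny M W k t) (E i)) \<in> borel_measurable (type_space M)" using E by simp
    show "(\<lambda>c. emeasure (progeny M W k (snd c i)) (E i)) \<in> borel_measurable (children_space M)"
      unfolding children_space_def by measurable
  qed
  have cm: "(\<lambda>c. indicator {n} (fst c) * (\<Prod>i<n. emeasure (progeny M W k (snd c i)) (E i))) \<in> borel_measurable (children_space M)"
    by (rule borel_measurable_times_ennreal[OF count_indicator_children pm])
  have so: "sets (oth_points M W x) = sets (count_space UNIV \<Otimes>\<^sub>M (\<Pi>\<^sub>M i\<in>UNIV. M))"
    using measurable_space[OF oth_points_measurable x] by (simp add: space_prob_algebra)
  have mm: "(\<lambda>(n, xs). (n, \<lambda>i. (Oth, xs i))) \<in> oth_points M W x \<rightarrow>\<^sub>M children_space M"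
    using oth_map_measurable measurable_cong_sets[OF so refl] by blast
  have "emeasure (progeny M W (Suc k) (Oth, x)) (graft_event M n E)
    = (\<integral>\<^sup>+ c. indicator {n} (fst c) * (\<Prod>i<n. emeasure (progeny M W k (snd c i)) (E i)) \<partial>offspring M W (Oth, x))"
    by (rule graft_Suc[OF E]) (use x in auto)
  also have "\<dots> = (\<integral>\<^sup>+ (m, xs). indicator {n} m * (\<Prod>i<n. emeasure (progeny M W k (Oth, xs i)) (E i)) \<partial>oth_points M W x)"
    unfolding offspring_def prod.case kind.case
    by (subst nn_integral_distr[OF mm]) (use cm in \<open>simp_all add: split_beta'\<close>)
  also have "\<dots> = ennreal (pmf (pois x) n) * (\<Prod>i<n. \<integral>\<^sup>+ y. emeasure (progeny M W k (Oth, y)) (E i) \<partial>nd x)"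
    by (rule oth_points_integral[OF x]) (use E in measurable)
  finally show ?thesis .
qed

text \<open>Child 0 is the next ancestor; the other children are generated independently of it,
  exactly like those of an ordinary particle at the same point. This factorisation is what allows
  the spine to be cut off.\<close>

lemma progeny_Anc:
  assumes E: "\<And>i. i < Suc n \<Longrightarrow> E i \<in> sets (labelling_space M)" and x: "x \<in> space M"
  shows "emeasure (progeny M W (Suc k) (Anc, x)) (graft_event M (Suc n) E)
    = (\<integral>\<^sup>+ y. emeasure (progeny M W k (Anc, y)) (E 0) \<partial>na x) * emeasure (progeny M W (Suc k) (Oth, x)) (graft_event M n (\<lambda>i. E (Suc i)))"
proof -
  have pm: "(\<lambda>c. \<Prod>i<Suc n. emeasure (progeny M W k (snd c i)) (E i)) \<in> borel_measurable (children_space M)"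
  proof (rule borel_measurable_prod_ennreal)
    fix i assume "i \<in> {..<Suc n}"
    then have [measurable]: "(\<lambda>t. emeasure (progeny M W k t) (E i)) \<in> borel_measurable (type_space M)" using E by simp
    show "(\<lambda>c. emeasure (progeny M W k (snd c i)) (E i)) \<in> borel_measurable (children_space M)"
      unfolding children_space_def by measurable
  qed
  have cm: "(\<lambda>c. indicator {Suc n} (fst c) * (\<Prod>i<Suc n. emeasure (progeny M W k (snd c i)) (E i))) \<in> borel_measurable (children_space M)"
    by (rule borel_measurable_times_ennreal[OF count_indicator_children pm])
  have so: "sets (oth_points M W x) = sets (count_space UNIV \<Otimes>\<^sub>M (\<Pi>\<^sub>M i\<in>UNIV. M))" and po: "prob_space (oth_points M W x)"
    using measurable_space[OF oth_points_measurable x] by (simp_all add: space_prob_algebra)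
  have sn: "sets (na x) = sets M" and pn: "prob_space (na x)"
    using measurable_space[OF na_measurable x] by (simp_all add: space_prob_algebra)
  interpret O: prob_space "oth_points M W x" by (rule po)
  have mm: "(\<lambda>(x0, n, xs). (Suc n, case_nat (Anc, x0) (\<lambda>i. (Oth, xs i)))) \<in> na x \<Otimes>\<^sub>M oth_points M W x \<rightarrow>\<^sub>M children_space M"
    using anc_map_measurable measurable_cong_sets[OF sets_pair_measure_cong[OF sn so] refl] by blast
  let ?A = "\<lambda>y. emeasure (progeny M W k (Anc, y)) (E 0)"
  let ?R = "\<lambda>c. indicator {n} (fst c) * (\<Prod>i<n. emeasure (progeny M W k (Oth, snd c i)) (E (Suc i)))"
  have [measurable]: "(\<lambda>t. emeasure (progeny M W k t) (E 0)) \<in> borel_measurable (type_space M)" using E by simp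
  have A: "?A \<in> borel_measurable (na x)"
    by (subst measurable_cong_sets[OF sn refl]) measurable
  have R: "?R \<in> borel_measurable (oth_points M W x)"
  proof -
    have "(\<lambda>c. \<Prod>i<n. emeasure (progeny M W k (Oth, snd c i)) (E (Suc i))) \<in> borel_measurable (count_space UNIV \<Otimes>\<^sub>M (\<Pi>\<^sub>M i\<in>(UNIV :: nat set). M))"
    proof (rule borel_measurable_prod_ennreal)
      fix i assume "i \<in> {..<n}"
      then have [measurable]: "(\<lambda>t. emeasure (progeny M W k t) (E (Suc i))) \<in> borel_measurable (type_space M)" using E by simp
      show "(\<lambda>c. emeasure (progeny M W k (Oth, snd c i)) (E (Suc i))) \<in> borel_measurable (count_space UNIV \<Otimes>\<^sub>M (\<Pi>\<^sub>M i\<in>(UNIV :: nat set). M))"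
        by measurable
    qed
    then have "?R \<in> borel_measurable (count_space UNIV \<Otimes>\<^sub>M (\<Pi>\<^sub>M i\<in>(UNIV :: nat set). M))"
      by (rule borel_measurable_times_ennreal[OF count_indicator_measurable])
    then show ?thesis using measurable_cong_sets[OF so refl] by blast
  qed
  have "emeasure (progeny M W (Suc k) (Anc, x)) (graft_event M (Suc n) E)
    = (\<integral>\<^sup>+ c. indicator {Suc n} (fst c) * (\<Prod>i<Suc n. emeasure (progeny M W k (snd c i)) (E i)) \<partial>offspring M W (Anc, x))"
    by (rule graft_Suc[OF E]) (use x in auto)
  also have "\<dots> = (\<integral>\<^sup>+ p. ?A (fst p) * ?R (snd p) \<partial>(na x \<Otimes>\<^sub>M oth_points M W x))"
    unfolding offspring_def prod.case kind.case
  proof (subst nn_integral_distr[OF mm])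
    show "(\<lambda>c. indicator {Suc n} (fst c) * (\<Prod>i<Suc n. emeasure (progeny M W k (snd c i)) (E i)))
      \<in> borel_measurable (distr (na x \<Otimes>\<^sub>M oth_points M W x) (children_space M) (\<lambda>(x0, n, xs). (Suc n, case_nat (Anc, x0) (\<lambda>i. (Oth, xs i)))))"
      using cm by (simp del: prod.lessThan_Suc)
  qed (auto simp: split_beta' prod.lessThan_Suc_shift indicator_def intro!: nn_integral_cong simp del: prod.lessThan_Suc)
  also have "\<dots> = (\<integral>\<^sup>+ y. (\<integral>\<^sup>+ c. ?A y * ?R c \<partial>oth_points M W x) \<partial>na x)"
    using A R by (subst O.nn_integral_fst[symmetric]) (auto simp: split_beta)
  also have "\<dots> = (\<integral>\<^sup>+ y. ?A y \<partial>na x) * (\<integral>\<^sup>+ c. ?R c \<partial>oth_points M W x)"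
    using A R by (simp add: nn_integral_cmult nn_integral_multc)
  also have "(\<integral>\<^sup>+ c. ?R c \<partial>oth_points M W x) = ennreal (pmf (pois x) n) * (\<Prod>i<n. \<integral>\<^sup>+ y. emeasure (progeny M W k (Oth, y)) (E (Suc i)) \<partial>nd x)"
    using oth_points_integral[OF x, of n "\<lambda>i y. emeasure (progeny M W k (Oth, y)) (E (Suc i))"] E by (simp add: split_beta')
  also have "\<dots> = emeasure (progeny M W (Suc k) (Oth, x)) (graft_event M n (\<lambda>i. E (Suc i)))"
    using progeny_Oth[of n "\<lambda>i. E (Suc i)" x k] E x by simp
  finally show ?thesis .
qed

end

section \<open>Recognising and removing the spine\<close>

text \<open>Plane trees with exactly one subtree of height at least \<open>j\<close> at the root,
  such that the remaining ones form \<open>q\<close> up to isomorphism. The position of the tall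
  subtree is left open so that membership depends on the isomorphism class only; in the branching
  process with \<open>Suc j\<close> generations it is child 0 almost surely.\<close>

definition spine_set :: "nat \<Rightarrow> ptree \<Rightarrow> ptree set" where
  "spine_set j q = {PNode l | l. length (filter (\<lambda>t. j \<le> height t) l) = 1 \<and> canon (PNode (filter (\<lambda>t. height t < j) l)) = canon q}"

context meas_kernel begin

lemma progeny_Anc_leaf:
  assumes x: "x \<in> space M" shows "emeasure (progeny M W (Suc k) (Anc, x)) (graft_event M 0 E) = 0"
proof -
  have so: "sets (oth_points M W x) = sets (count_space UNIV \<Otimes>\<^sub>M (\<Pi>\<^sub>M i\<in>UNIV. M))"
    using measurable_space[OF oth_points_measurable x] by (simp_all add: space_prob_algebra)
  have sn: "sets (na x) = sets M" using measurable_space[OF na_measurable x] by (simp_all add: space_prob_algebra)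
  have mm: "(\<lambda>(x0, n, xs). (Suc n, case_nat (Anc, x0) (\<lambda>i. (Oth, xs i)))) \<in> na x \<Otimes>\<^sub>M oth_points M W x \<rightarrow>\<^sub>M children_space M"
    using anc_map_measurable measurable_cong_sets[OF sets_pair_measure_cong[OF sn so] refl] by blast
  have cm: "(\<lambda>c. indicator {0} (fst c) * (\<Prod>i<0. emeasure (progeny M W k (snd c i)) (E i))) \<in> borel_measurable (children_space M)"
    using count_indicator_children[of 0 M] by simp
  have "emeasure (progeny M W (Suc k) (Anc, x)) (graft_event M 0 E)
    = (\<integral>\<^sup>+ c. indicator {0} (fst c) * (\<Prod>i<0. emeasure (progeny M W k (snd c i)) (E i)) \<partial>offspring M W (Anc, x))"
    by (rule graft_Suc) (use x in auto)
  also have "\<dots> = 0"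
    unfolding offspring_def prod.case kind.case
    by (subst nn_integral_distr[OF mm]) (use cm in \<open>simp_all add: split_beta'\<close>)
  finally show ?thesis .
qed

lemma progeny_0: 
  assumes "t \<in> space (type_space M)" shows "emeasure (progeny M W 0 t) (tree_event M q) = (if q = PNode [] then 1 else 0)"
proof -
  have "(\<lambda>u. (t, 0)) \<in> space (labelling_space M)" using assms by (simp add: space_labelling type_space_def space_pair_measure mem_Times_iff)
  moreover have "untyped_tree (\<lambda>u. (t, 0)) = tree (PNode [])" by (simp add: untyped_eq_tree)
  ultimately have "(\<lambda>u. (t, 0)) \<in> tree_event M q \<longleftrightarrow> q = PNode []" using tree_inj by (auto simp: tree_event_def)
  then show ?thesis by (auto simp: tree_event_sets)
qed

text \<open>The particles of generation \<open>k\<close> are given no children, so the height is at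
  most \<open>k\<close>.\<close>

lemma progeny_Oth_height: "height q > k \<Longrightarrow> x \<in> space M \<Longrightarrow> emeasure (progeny M W k (Oth, x)) (tree_event M q) = 0"
proof (induction k arbitrary: q x)
  case 0 
  then have "q \<noteq> PNode []" by auto
  then show ?case using progeny_0[of "(Oth, x)" q] 0 by (simp del: progeny.simps)
next
  case (Suc k)
  obtain ts where q: "q = PNode ts" by (cases q)
  obtain t where t: "t \<in> set ts" "k < height t" using Suc.prems(1) height_le[of ts "Suc k"] unfolding q by (meson linorder_not_less not_less_eq)
  then obtain i where i: "i < length ts" "t = ts ! i" by (metis in_set_conv_nth)
  have sn: "space (nd x) = space M" using measurable_space[OF nd_measurable Suc.prems(2)] by (intro sets_eq_imp_space_eq) (simp add: space_prob_algebra)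
  have "(\<integral>\<^sup>+ y. emeasure (progeny M W k (Oth, y)) (tree_event M (ts ! i)) \<partial>nd x) = (\<integral>\<^sup>+ y. 0 \<partial>nd x)"
    by (rule nn_integral_cong) (use Suc.IH t i sn in auto)
  then have "(\<Prod>i<length ts. \<integral>\<^sup>+ y. emeasure (progeny M W k (Oth, y)) (tree_event M (ts ! i)) \<partial>nd x) = 0"
    by (intro prod_zero) (use i in auto)
  then show ?case unfolding q tree_event_graft by (subst progeny_Oth) (use Suc.prems tree_event_sets in \<open>auto simp del: progeny.simps\<close>)
qed

lemma graft_event_Suc: "\<omega> \<in> graft_event M (Suc n) (case_nat A B) \<longleftrightarrow> \<omega> \<in> space (labelling_space M) \<and> snd (\<omega> []) = Suc n
    \<and> (\<lambda>v. \<omega> (0 # v)) \<in> A \<and> (\<forall>i<n. (\<lambda>v. \<omega> (Suc i # v)) \<in> B i)"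
  by (simp add: graft_event_def All_less_Suc2)

lemma tree_event_Cons: "tree_event M (PNode (r # l)) = graft_event M (Suc (length l)) (case_nat (tree_event M r) (\<lambda>i. tree_event M (l ! i)))"
proof -
  have "(\<lambda>i. tree_event M ((r # l) ! i)) = case_nat (tree_event M r) (\<lambda>i. tree_event M (l ! i))"
    by (rule ext) (auto split: nat.split)
  then show ?thesis unfolding tree_event_graft by simp
qed

lemma progeny_Anc_graft:
  assumes "E \<in> sets (labelling_space M)" "x \<in> space M"
  shows "emeasure (progeny M W (Suc k) (Anc, x)) (graft_event M (Suc (length l)) (case_nat E (\<lambda>i. tree_event M (l ! i))))
    = (\<integral>\<^sup>+ y. emeasure (progeny M W k (Anc, y)) E \<partial>na x) * emeasure (progeny M W (Suc k) (Oth, x)) (tree_event M (PNode l))"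
  unfolding tree_event_graft by (subst progeny_Anc) (use assms tree_event_sets in \<open>auto simp del: progeny.simps split: nat.split\<close>)

text \<open>Every ancestor before the last generation has the next ancestor among its children, so
  generation \<open>k\<close> is always reached. This is what makes the spine visible in the untyped
  tree.\<close>

lemma progeny_Anc_height: "height q \<noteq> k \<Longrightarrow> x \<in> space M \<Longrightarrow> emeasure (progeny M W k (Anc, x)) (tree_event M q) = 0"
proof (induction k arbitrary: q x)
  case 0 
  then have "q \<noteq> PNode []" by auto
  then show ?case using progeny_0[of "(Anc, x)" q] 0 by (simp del: progeny.simps)
next
  case (Suc k)
  obtain ts where q: "q = PNode ts" by (cases q)
  show ?case
  proof (cases ts)
    case Nil then show ?thesis unfolding q tree_event_graft using progeny_Anc_leaf[OF Suc.prems(2)] by (simp del: progeny.simps)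
  next
    case (Cons r l)
    have sn: "space (na x) = space M" using measurable_space[OF na_measurable Suc.prems(2)] by (intro sets_eq_imp_space_eq) (simp add: space_prob_algebra)
    have "height q = max (Suc (height r)) (height (PNode l))" unfolding q Cons by simp
    then have "height r \<noteq> k \<or> height (PNode l) > Suc k" using Suc.prems(1) by (metis not_le max_absorb1)
    then consider "height r \<noteq> k" | "height (PNode l) > Suc k" by blast
    then show ?thesis
    proof cases
      case 1
      have "(\<integral>\<^sup>+ y. emeasure (progeny M W k (Anc, y)) (tree_event M r) \<partial>na x) = (\<integral>\<^sup>+ y. 0 \<partial>na x)"
        by (rule nn_integral_cong) (use Suc.IH[OF 1] sn in auto)
      then show ?thesis unfolding q Cons tree_event_Cons using progeny_Anc_graft[OF tree_event_sets Suc.prems(2)] by (simp del: progeny.simps)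
    next
      case 2
      then show ?thesis unfolding q Cons tree_event_Cons using progeny_Anc_graft[OF tree_event_sets Suc.prems(2)] progeny_Oth_height[OF 2 Suc.prems(2)] by (simp del: progeny.simps)
    qed
  qed
qed

lemma disjoint_graft: "disjoint_family (\<lambda>n. graft_event M n (E n))"
  unfolding disjoint_family_on_def graft_event_def by auto

lemma Fin_UN_Suc:
  "(\<Union>n. graft_event M (Suc n) (\<lambda>_. finite_event M)) \<subseteq> finite_event M"
  using finite_event_graft[of M] by blast

text \<open>The Poisson weights add up to 1 and each child has a finite progeny almost surely by
  induction. For an ancestor the number of children is shifted by one, and the event without
  children has no mass.\<close>

lemma progeny_Fin: "x \<in> space M \<Longrightarrow> emeasure (progeny M W k (kd, x)) (finite_event M) = 1"
proof (induction k arbitrary: kd x)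
  case 0
  have "(1 :: ennreal) = emeasure (progeny M W 0 (kd, x)) (tree_event M (PNode []))" using progeny_0[of "(kd, x)" "PNode []"] 0 by simp
  also have "\<dots> \<le> emeasure (progeny M W 0 (kd, x)) (finite_event M)"
  proof (rule emeasure_mono)
    show "tree_event M (PNode []) \<subseteq> finite_event M" unfolding finite_event_eq by blast
    show "finite_event M \<in> sets (progeny M W 0 (kd, x))" using finite_event_sets progeny_prob[of "(kd, x)" 0] 0 by (simp del: progeny.simps)
  qed
  finally show ?case using progeny_prob[of "(kd, x)" 0] 0 prob_space.emeasure_le_1[of "progeny M W 0 (kd, x)" "finite_event M"] by (auto simp del: progeny.simps)
next
  case (Suc k)
  note x = Suc.prems
  have pp: "prob_space (progeny M W (Suc k) (kd, x))" "sets (progeny M W (Suc k) (kd, x)) = sets (labelling_space M)" for kd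
    using progeny_prob[of "(kd, x)" "Suc k"] x by (auto simp del: progeny.simps)
  have int1: "(\<integral>\<^sup>+ y. emeasure (progeny M W k (kd, y)) (finite_event M) \<partial>Q) = 1" if "prob_space Q" "sets Q = sets M" for kd and Q :: "'a measure"
  proof -
    have "(\<integral>\<^sup>+ y. emeasure (progeny M W k (kd, y)) (finite_event M) \<partial>Q) = (\<integral>\<^sup>+ y. 1 \<partial>Q)"
      by (rule nn_integral_cong) (use Suc.IH sets_eq_imp_space_eq[OF that(2)] in auto)
    then show ?thesis using prob_space.emeasure_space_1[OF that(1)] by simp
  qed
  have nd: "prob_space (nd x)" "sets (nd x) = sets M" and na: "prob_space (na x)" "sets (na x) = sets M"
    using measurable_space[OF nd_measurable x] measurable_space[OF na_measurable x] by (auto simp: space_prob_algebra)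
  have O: "emeasure (progeny M W (Suc k) (Oth, x)) (graft_event M n (\<lambda>_. finite_event M)) = ennreal (pmf (pois x) n)" for n
    using progeny_Oth[of n "\<lambda>_. finite_event M", OF finite_event_sets x, of k] int1[OF nd] by (simp del: progeny.simps)
  have S: "(\<Sum>n. ennreal (pmf (pois x) n)) = 1"
  proof -
    have "(\<Sum>n. ennreal (pmf (pois x) n)) = (\<integral>\<^sup>+ n. ennreal (pmf (pois x) n) \<partial>count_space UNIV)"
      by (rule nn_integral_count_space_nat[symmetric])
    also have "\<dots> = emeasure (measure_pmf (pois x)) UNIV" by (rule nn_integral_pmf)
    also have "\<dots> = 1" using measure_pmf.emeasure_space_1[of "pois x"] by (simp only: space_measure_pmf)
    finally show ?thesis .
  qed
  have gs: "range (\<lambda>n. graft_event M n (\<lambda>_. finite_event M)) \<subseteq> sets (progeny M W (Suc k) (kd, x))" for kd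
    unfolding pp by (auto intro: graft_event_sets finite_event_sets)
  have gs': "range (\<lambda>n. graft_event M (Suc n) (\<lambda>_. finite_event M)) \<subseteq> sets (progeny M W (Suc k) (kd, x))" for kd
    unfolding pp by (auto intro: graft_event_sets finite_event_sets)
  show ?case
  proof (cases kd)
    case Oth
    have "emeasure (progeny M W (Suc k) (Oth, x)) (\<Union>n. graft_event M n (\<lambda>_. finite_event M)) = (\<Sum>n. emeasure (progeny M W (Suc k) (Oth, x)) (graft_event M n (\<lambda>_. finite_event M)))"
      by (rule suminf_emeasure[symmetric, OF gs disjoint_graft])
    then have "emeasure (progeny M W (Suc k) (Oth, x)) (finite_event M) = (\<Sum>n. emeasure (progeny M W (Suc k) (Oth, x)) (graft_event M n (\<lambda>_. finite_event M)))"
      by (simp only: finite_event_graft[symmetric])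
    then show ?thesis using Oth O S by (simp del: progeny.simps)
  next
    case Anc
    have A: "emeasure (progeny M W (Suc k) (Anc, x)) (graft_event M (Suc n) (\<lambda>_. finite_event M)) = ennreal (pmf (pois x) n)" for n
      using progeny_Anc[of n "\<lambda>_. finite_event M", OF finite_event_sets x, of k] int1[OF na] O by (simp del: progeny.simps)
    have dj: "disjoint_family (\<lambda>n. graft_event M (Suc n) (\<lambda>_. finite_event M))"
      unfolding disjoint_family_on_def graft_event_def by auto
    have "1 = (\<Sum>n. emeasure (progeny M W (Suc k) (Anc, x)) (graft_event M (Suc n) (\<lambda>_. finite_event M)))" using A S by (simp del: progeny.simps)
    also have "\<dots> = emeasure (progeny M W (Suc k) (Anc, x)) (\<Union>n. graft_event M (Suc n) (\<lambda>_. finite_event M))"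
      by (rule suminf_emeasure[OF gs' dj])
    also have "\<dots> \<le> emeasure (progeny M W (Suc k) (Anc, x)) (finite_event M)"
      by (rule emeasure_mono[OF Fin_UN_Suc]) (simp add: pp finite_event_sets del: progeny.simps)
    finally show ?thesis using Anc prob_space.emeasure_le_1[OF pp(1)[of Anc], of "finite_event M"] by (auto simp del: progeny.simps)
  qed
qed

definition height_event :: "nat \<Rightarrow> (nat list \<Rightarrow> (kind \<times> 'a) \<times> nat) set" where
  "height_event j = (\<Union>q\<in>{q. height q = j}. tree_event M q)"

lemma height_event_sets: "height_event j \<in> sets (labelling_space M)"
  unfolding height_event_def by (intro sets.countable_UN'') (auto simp: tree_event_sets)

lemma progeny_H: assumes x: "x \<in> space M" shows "emeasure (progeny M W j (Anc, x)) (height_event j) = 1"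
proof -
  have pp: "sets (progeny M W j (Anc, x)) = sets (labelling_space M)" using progeny_prob[of "(Anc, x)" j] x by auto
  have null: "(\<Union>q\<in>{q. height q \<noteq> j}. tree_event M q) \<in> null_sets (progeny M W j (Anc, x))"
    by (rule null_sets_UN') (use progeny_Anc_height x in \<open>auto intro!: null_setsI simp: pp tree_event_sets\<close>)
  have "finite_event M = height_event j \<union> (\<Union>q\<in>{q. height q \<noteq> j}. tree_event M q)" unfolding finite_event_eq height_event_def by auto
  then show ?thesis using progeny_Fin[OF x, of j Anc] emeasure_Un_null_set[OF _ null, of "height_event j"] height_event_sets pp by simp
qed

text \<open>In the first \<open>Suc j\<close> generations exactly one child of the root, the ancestor, has descendants
  in the last generation. Removing its subtree leaves the tree of a particle of the other kind.\<close>
lemma spine_removal: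
  assumes x: "x \<in> space M" and q: "height q \<le> j"
  shows "emeasure (progeny M W (Suc j) (Anc, x)) (\<Union>r\<in>spine_set j q. tree_event M r)
    = (\<Sum>s\<in>{s. canon s = canon q}. emeasure (progeny M W (Suc j) (Oth, x)) (tree_event M s))"
proof -
  let ?Q = "progeny M W (Suc j) (Anc, x)"
  \<comment> \<open>All plane orders in which the other subtrees can realise \<open>q\<close>; in
    \<open>?E\<close> such a list stands behind the subtree of the next ancestor.\<close>
  let ?L = "{l. canon (PNode l) = canon q}"
  let ?E = "\<lambda>l. graft_event M (Suc (length l)) (case_nat (height_event j) (\<lambda>i. tree_event M (l ! i)))"
  have pp: "sets ?Q = sets (labelling_space M)" using progeny_prob[of "(Anc, x)" "Suc j"] x by (auto simp del: progeny.simps)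
  have na: "prob_space (na x)" "sets (na x) = sets M"
    using measurable_space[OF na_measurable x] by (auto simp: space_prob_algebra)
  have fin: "finite ?L" using finite_canon[of q] by (rule finite_surj[of _ _ "\<lambda>s. case s of PNode l \<Rightarrow> l"]) (auto intro!: image_eqI[of _ _ "PNode _"])
  have kids: "height t < j" if "l \<in> ?L" "t \<in> set l" for l t
    using that canon_height[of "PNode l" q] q height_le[of l j] by auto
  have Es: "?E l \<in> sets ?Q" for l unfolding pp by (rule graft_event_sets) (auto simp: height_event_sets tree_event_sets split: nat.split)
  have E: "emeasure ?Q (?E l) = emeasure (progeny M W (Suc j) (Oth, x)) (tree_event M (PNode l))" for l
  proof -
    have "(\<integral>\<^sup>+ y. emeasure (progeny M W j (Anc, y)) (height_event j) \<partial>na x) = (\<integral>\<^sup>+ y. 1 \<partial>na x)"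
      by (rule nn_integral_cong) (use progeny_H sets_eq_imp_space_eq[OF na(2)] in auto)
    also have "\<dots> = 1" using prob_space.emeasure_space_1[OF na(1)] by simp
    finally show ?thesis using progeny_Anc_graft[OF height_event_sets x, where k = j] by (simp del: progeny.simps)
  qed
  have EU: "?E l = (\<Union>r\<in>{r. height r = j}. tree_event M (PNode (r # l)))" for l
    unfolding tree_event_Cons by (auto simp: graft_event_Suc height_event_def)
  have dis: "disjoint_family_on ?E ?L"
    unfolding disjoint_family_on_def EU using disjoint_tree_event[of M] by (auto simp: disjoint_family_on_def) (metis disjoint_iff list.inject ptree.inject)
  let ?N = "\<Union>r\<in>{PNode (r # l) | r l. height r \<noteq> j}. tree_event M r"
  have null: "?N \<in> null_sets ?Q"
  proof (rule null_sets_UN')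
    fix s assume "s \<in> {PNode (r # l) | r l. height r \<noteq> j}"
    then obtain r l where s: "s = PNode (r # l)" "height r \<noteq> j" by auto
    have "(\<integral>\<^sup>+ y. emeasure (progeny M W j (Anc, y)) (tree_event M r) \<partial>na x) = (\<integral>\<^sup>+ y. 0 \<partial>na x)"
      by (rule nn_integral_cong) (use progeny_Anc_height[OF s(2)] sets_eq_imp_space_eq[OF na(2)] in auto)
    then have "emeasure ?Q (tree_event M s) = 0" unfolding s tree_event_Cons using progeny_Anc_graft[OF tree_event_sets x, where k = j] by (simp del: progeny.simps)
    then show "tree_event M s \<in> null_sets ?Q" by (intro null_setsI) (simp_all add: pp tree_event_sets del: progeny.simps)
  qed simp
  have sub1: "(\<Union>l\<in>?L. ?E l) \<subseteq> (\<Union>r\<in>spine_set j q. tree_event M r)"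
  proof
    fix \<omega> assume "\<omega> \<in> (\<Union>l\<in>?L. ?E l)"
    then obtain l r where l: "l \<in> ?L" "height r = j" "\<omega> \<in> tree_event M (PNode (r # l))" unfolding EU by auto
    have "filter (\<lambda>t. j \<le> height t) l = []" "filter (\<lambda>t. height t < j) l = l" using kids[OF l(1)] by (auto simp: filter_empty_conv not_le intro!: filter_True)
    then have "PNode (r # l) \<in> spine_set j q" using l(1,2) unfolding spine_set_def by (intro CollectI exI[of _ "r # l"]) simp
    then show "\<omega> \<in> (\<Union>r\<in>spine_set j q. tree_event M r)" using l(3) by blast
  qed
  have sub2: "(\<Union>r\<in>spine_set j q. tree_event M r) \<subseteq> (\<Union>l\<in>?L. ?E l) \<union> ?N"
  proof
    fix \<omega> assume "\<omega> \<in> (\<Union>r\<in>spine_set j q. tree_event M r)"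
    then obtain l' where l': "length (filter (\<lambda>t. j \<le> height t) l') = 1" "canon (PNode (filter (\<lambda>t. height t < j) l')) = canon q" "\<omega> \<in> tree_event M (PNode l')"
      by (auto simp: spine_set_def)
    then obtain r l where rl: "l' = r # l" by (cases l') auto
    show "\<omega> \<in> (\<Union>l\<in>?L. ?E l) \<union> ?N"
    proof (cases "height r = j")
      case True
      then have "filter (\<lambda>t. j \<le> height t) l = []" using l'(1) rl by simp
      then have "filter (\<lambda>t. height t < j) l = l" by (auto simp: filter_empty_conv not_le intro!: filter_True)
      then have "l \<in> ?L" using l'(2) rl True by simp
      then show ?thesis using l'(3) rl True unfolding EU by blast
    next
      case False then show ?thesis using l'(3) rl by blast
    qed
  qed
  have Us: "(\<Union>l\<in>?L. ?E l) \<in> sets ?Q" using fin Es by (intro sets.finite_UN) auto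
  have Ss: "(\<Union>r\<in>spine_set j q. tree_event M r) \<in> sets ?Q" unfolding pp by (intro sets.countable_UN'') (auto simp: tree_event_sets)
  \<comment> \<open>By \<open>sub1\<close> and \<open>sub2\<close> the two events differ only by a
    part of the null set \<open>?N\<close>.\<close>
  have "emeasure ?Q (\<Union>r\<in>spine_set j q. tree_event M r) = emeasure ?Q (\<Union>l\<in>?L. ?E l)"
  proof (rule antisym)
    have "emeasure ?Q (\<Union>r\<in>spine_set j q. tree_event M r) \<le> emeasure ?Q ((\<Union>l\<in>?L. ?E l) \<union> ?N)"
      by (rule emeasure_mono[OF sub2]) (use Us null in auto)
    also have "\<dots> = emeasure ?Q (\<Union>l\<in>?L. ?E l)" by (rule emeasure_Un_null_set[OF Us null])
    finally show "emeasure ?Q (\<Union>r\<in>spine_set j q. tree_event M r) \<le> emeasure ?Q (\<Union>l\<in>?L. ?E l)" .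
    show "emeasure ?Q (\<Union>l\<in>?L. ?E l) \<le> emeasure ?Q (\<Union>r\<in>spine_set j q. tree_event M r)"
      by (rule emeasure_mono[OF sub1 Ss])
  qed
  also have "\<dots> = (\<Sum>l\<in>?L. emeasure ?Q (?E l))"
    by (rule sum_emeasure[symmetric, OF _ dis fin]) (use Es in auto)
  also have "\<dots> = (\<Sum>l\<in>?L. emeasure (progeny M W (Suc j) (Oth, x)) (tree_event M (PNode l)))" by (simp only: E)
  also have "\<dots> = (\<Sum>s\<in>{s. canon s = canon q}. emeasure (progeny M W (Suc j) (Oth, x)) (tree_event M s))"
    by (rule sum.reindex_bij_witness[of _ "\<lambda>s. case s of PNode l \<Rightarrow> l" PNode]) (auto split: ptree.split)
  finally show ?thesis .
qed

section \<open>Ball probabilities and isomorphism classes\<close>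

lemma branching_emeasure:
  assumes "X \<in> sets (labelling_space M)"
  shows "emeasure (branching_process M W k) X = (\<integral>\<^sup>+ x. emeasure (progeny M W k (Anc, x)) X \<partial>M)"
    "sets (branching_process M W k) = sets (labelling_space M)" "prob_space (branching_process M W k)"
proof -
  have M: "M \<in> space (prob_algebra M)" using prob_space_axioms by (simp add: space_prob_algebra)
  have k: "(\<lambda>x. progeny M W k (Anc, x)) \<in> M \<rightarrow>\<^sub>M prob_algebra (labelling_space M)"
    by (rule measurable_compose[OF type_measurable progeny_measurable])
  show "emeasure (branching_process M W k) X = (\<integral>\<^sup>+ x. emeasure (progeny M W k (Anc, x)) X \<partial>M)"
    unfolding branching_process_def by (rule emeasure_bind_prob_algebra[OF M k assms])
  show "sets (branching_process M W k) = sets (labelling_space M)"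
    unfolding branching_process_def by (rule sets_bind'[OF M k])
  show "prob_space (branching_process M W k)"
    unfolding branching_process_def by (rule prob_space_bind'[OF M k])
qed

lemma ball_prob_eq:
  assumes "finite F"
  shows "ennreal (ball_prob M W k F) = emeasure (branching_process M W k) (\<Union>q\<in>{q. rooted_isomorphic (tree q) F}. tree_event M q)"
proof -
  note b = branching_emeasure[OF sets.top]
  interpret B: prob_space "branching_process M W k" by (rule b)
  have "{\<omega> \<in> space (branching_process M W k). rooted_isomorphic (untyped_tree \<omega>) F} = (\<Union>q\<in>{q. rooted_isomorphic (tree q) F}. tree_event M q)"
  proof (rule set_eqI)
    fix \<omega> :: "nat list \<Rightarrow> (kind \<times> 'a) \<times> nat"
    have "rooted_isomorphic (untyped_tree \<omega>) F \<Longrightarrow> finite (untyped_tree \<omega>)"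
      using assms bij_betw_finite unfolding rooted_isomorphic_def by blast
    then show "\<omega> \<in> {\<omega> \<in> space (branching_process M W k). rooted_isomorphic (untyped_tree \<omega>) F} \<longleftrightarrow> \<omega> \<in> (\<Union>q\<in>{q. rooted_isomorphic (tree q) F}. tree_event M q)"
      using finite_untyped_tree[of \<omega>] sets_eq_imp_space_eq[OF b(2)] unfolding tree_event_def by auto metis
  qed
  then show ?thesis by (simp add: ball_prob_def B.emeasure_eq_measure)
qed

lemma branching_UN:
  "emeasure (branching_process M W k) (\<Union>q\<in>A. tree_event M q) = (\<integral>\<^sup>+ q. emeasure (branching_process M W k) (tree_event M q) \<partial>count_space A)"
proof (rule emeasure_UN_countable)
  show "disjoint_family_on (tree_event M) A" using disjoint_tree_event by (auto simp: disjoint_family_on_def)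
qed (auto simp: branching_emeasure(2)[OF sets.top] tree_event_sets)

text \<open>An event closed under isomorphism is a countable disjoint union of classes, so it is
  determined by the ball probabilities. The representatives are fixed by an equation about plane
  trees alone, so that two kernels on different spaces use the same ones.\<close>

lemma branching_iso_closed:
  assumes A: "\<And>r s. r \<in> A \<Longrightarrow> rooted_isomorphic (tree s) (tree r) \<Longrightarrow> s \<in> A"
    and rep: "rep = (\<lambda>q. SOME r. rooted_isomorphic (tree q) (tree r))"
  shows "emeasure (branching_process M W k) (\<Union>q\<in>A. tree_event M q) = (\<integral>\<^sup>+ r. ennreal (ball_prob M W k (tree r)) \<partial>count_space (rep ` A))"
proof -
  let ?cls = "\<lambda>r. {q. rooted_isomorphic (tree q) (tree r)}"
  have rep_iso: "rooted_isomorphic (tree q) (tree (rep q))" for q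
    unfolding rep by (rule someI[of "\<lambda>r. rooted_isomorphic (tree q) (tree r)" q]) (simp add: rooted_isomorphic_refl)
  have rep_eq: "rep q = rep r" if "rooted_isomorphic (tree q) (tree r)" for q r
  proof -
    have "rooted_isomorphic (tree q) (tree s) \<longleftrightarrow> rooted_isomorphic (tree r) (tree s)" for s
      using that rooted_isomorphic_trans rooted_isomorphic_sym by blast
    then show ?thesis unfolding rep by simp
  qed
  have "(\<Union>q\<in>A. tree_event M q) = (\<Union>r\<in>rep ` A. \<Union>q\<in>?cls r. tree_event M q)"
  proof (intro equalityI subsetI)
    fix \<omega> assume "\<omega> \<in> (\<Union>q\<in>A. tree_event M q)" then show "\<omega> \<in> (\<Union>r\<in>rep ` A. \<Union>q\<in>?cls r. tree_event M q)" using rep_iso by blast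
  next
    fix \<omega> assume "\<omega> \<in> (\<Union>r\<in>rep ` A. \<Union>q\<in>?cls r. tree_event M q)"
    then obtain a q where a: "a \<in> A" "rooted_isomorphic (tree q) (tree (rep a))" "\<omega> \<in> tree_event M q" by auto
    have "rooted_isomorphic (tree q) (tree a)" using rooted_isomorphic_trans[OF a(2) rooted_isomorphic_sym[OF rep_iso]] .
    then show "\<omega> \<in> (\<Union>q\<in>A. tree_event M q)" using A a by blast
  qed
  moreover have "emeasure (branching_process M W k) (\<Union>r\<in>rep ` A. \<Union>q\<in>?cls r. tree_event M q)
    = (\<integral>\<^sup>+ r. emeasure (branching_process M W k) (\<Union>q\<in>?cls r. tree_event M q) \<partial>count_space (rep ` A))"
  proof (rule emeasure_UN_countable)
    show "disjoint_family_on (\<lambda>r. \<Union>q\<in>?cls r. tree_event M q) (rep ` A)"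
      unfolding disjoint_family_on_def
    proof (intro ballI impI, rule ccontr)
      fix r s assume rs: "r \<in> rep ` A" "s \<in> rep ` A" "r \<noteq> s" "(\<Union>q\<in>?cls r. tree_event M q) \<inter> (\<Union>q\<in>?cls s. tree_event M q) \<noteq> {}"
      then obtain p q \<omega> where "p \<in> ?cls r" "q \<in> ?cls s" "\<omega> \<in> tree_event M p" "\<omega> \<in> tree_event M q" by blast
      then have "p = q" using tree_inj by (auto simp: tree_event_def)
      then have "rep r = rep s" using \<open>p \<in> ?cls r\<close> \<open>q \<in> ?cls s\<close> rep_eq by (metis mem_Collect_eq)
      moreover have "rep r = r" "rep s = s" using rs(1,2) rep_eq[OF rep_iso] by auto
      ultimately show False using rs(3) by simp
    qed
    show "(\<Union>q\<in>?cls r. tree_event M q) \<in> sets (branching_process M W k)" for r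
      unfolding branching_emeasure(2)[OF sets.top] by (intro sets.countable_UN'') (auto simp: tree_event_sets)
  qed auto
  ultimately show ?thesis by (simp add: ball_prob_eq finite_tree)
qed

end

text \<open>Heights are determined by canonical forms, so selecting subtrees by height can be done
  on the multiset of their canonical forms.\<close>

lemma spine_set_canon:
  assumes "canon r = canon s" shows "r \<in> spine_set j q \<longleftrightarrow> s \<in> spine_set j q"
proof -
  have *: "s \<in> spine_set j q" if cs: "canon r = canon s" and rs: "r \<in> spine_set j q" for r s
  proof -
    obtain l where l: "r = PNode l" "length (filter (\<lambda>t. j \<le> height t) l) = 1" "canon (PNode (filter (\<lambda>t. height t < j) l)) = canon q"
      using rs by (auto simp: spine_set_def)
    obtain l' where l': "s = PNode l'" by (cases s)
    have m: "mset (map canon l) = mset (map canon l')" using cs l(1) l' by simp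
    define h where "h c = height (SOME t. canon t = c)" for c
    have h: "h (canon t) = height t" for t
      unfolding h_def by (rule canon_height) (rule someI[of "\<lambda>u. canon u = canon t" t], rule refl)
    have f: "image_mset canon (filter_mset (\<lambda>t. P (height t)) (mset l)) = filter_mset (\<lambda>c. P (h c)) (mset (map canon l))" for P l
      by (simp add: filter_mset_image_mset h o_def)
    have m1: "image_mset canon (filter_mset (\<lambda>t. P (height t)) (mset l)) = image_mset canon (filter_mset (\<lambda>t. P (height t)) (mset l'))" for P
      unfolding f m ..
    have "size (image_mset canon (filter_mset (\<lambda>t. j \<le> height t) (mset l))) = size (image_mset canon (filter_mset (\<lambda>t. j \<le> height t) (mset l')))"
      by (simp only: m1)
    then have "length (filter (\<lambda>t. j \<le> height t) l') = 1" using l(2) by (simp flip: mset_filter)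
    moreover have "canon (PNode (filter (\<lambda>t. height t < j) l')) = canon q" using l(3) m1[of "\<lambda>n. n < j"] by (simp add: mset_filter)
    ultimately show ?thesis unfolding l' spine_set_def by blast
  qed
  show ?thesis using *[of r s] *[of s r] assms by auto
qed

section \<open>The law of the tree in terms of operators\<close>

primrec kids :: "ptree \<Rightarrow> ptree list" where "kids (PNode ts) = ts"

text \<open>Probability that the first \<open>k\<close> generations below an ordinary particle at
  \<open>x\<close> form the plane tree \<open>q\<close>. Only \<open>K\<close> occurs in the
  formula, which turns statements about the process into statements about an operator.\<close>

primrec oth_prob :: "'a measure \<Rightarrow> ('a \<Rightarrow> 'a \<Rightarrow> real) \<Rightarrow> nat \<Rightarrow> ptree \<Rightarrow> 'a \<Rightarrow> real" where
  "oth_prob M K 0 q = (\<lambda>x. if q = PNode [] then 1 else 0)"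
| "oth_prob M K (Suc k) q = (\<lambda>x. exp (- kop M K (\<lambda>_. 1) x) / fact (length (kids q)) *
     (\<Prod>f\<leftarrow>map (oth_prob M K k) (kids q). kop M K f x))"

text \<open>The same without cutoff: the probability that the entire progeny is the given finite
  plane tree.\<close>

primrec oth_tree_prob :: "'a measure \<Rightarrow> ('a \<Rightarrow> 'a \<Rightarrow> real) \<Rightarrow> ptree \<Rightarrow> 'a \<Rightarrow> real" where
  "oth_tree_prob M K (PNode ts) = (\<lambda>x. exp (- kop M K (\<lambda>_. 1) x) / fact (length ts) * (\<Prod>f\<leftarrow>map (oth_tree_prob M K) ts. kop M K f x))"

primrec anc_prob :: "'a measure \<Rightarrow> ('a \<Rightarrow> 'a \<Rightarrow> real) \<Rightarrow> ('a \<Rightarrow> 'a \<Rightarrow> real) \<Rightarrow> nat \<Rightarrow> ptree \<Rightarrow> 'a \<Rightarrow> real" where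
  "anc_prob M K P 0 q = (\<lambda>x. if q = PNode [] then 1 else 0)"
| "anc_prob M K P (Suc k) q = (case kids q of [] \<Rightarrow> (\<lambda>x. 0)
     | r # l \<Rightarrow> (\<lambda>x. kop M P (anc_prob M K P k r) x * oth_prob M K (Suc k) (PNode l) x))"

text \<open>If the height is below \<open>k\<close>, then generation \<open>k\<close> is empty and
  the cutoff has no effect.\<close>

lemma oth_prob_eq_oth_tree_prob: "height q < k \<Longrightarrow> oth_prob M K k q = oth_tree_prob M K q"
proof (induction q arbitrary: k)
  case (PNode ts)
  obtain j where k: "k = Suc j" using PNode.prems by (cases k) auto
  have "height t < j" if "t \<in> set ts" for t using height_le[of ts j] PNode.prems that k by auto
  then have "map (oth_prob M K j) ts = map (oth_tree_prob M K) ts" using PNode.IH by simp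
  then show ?case unfolding k oth_prob.simps oth_tree_prob.simps kids.simps by (simp only:)
qed

text \<open>Reordering the children only permutes the factors.\<close>

lemma oth_tree_prob_canon: "canon s = canon t \<Longrightarrow> oth_tree_prob M K s = oth_tree_prob M K t"
proof (induction s arbitrary: t)
  case (PNode ss)
  obtain ts where t: "t = PNode ts" by (cases t)
  have "mset (map (oth_tree_prob M K) ss) = mset (map (oth_tree_prob M K) ts)"
    by (rule canon_children[OF PNode.prems[unfolded t] PNode.IH])
  then have m: "mset (map (\<lambda>f. kop M K f x) (map (oth_tree_prob M K) ss)) = mset (map (\<lambda>f. kop M K f x) (map (oth_tree_prob M K) ts))" for x
    by (simp only: mset_map)
  have "(\<Prod>f\<leftarrow>map (oth_tree_prob M K) ss. kop M K f x) = (\<Prod>f\<leftarrow>map (oth_tree_prob M K) ts. kop M K f x)" for x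
    using arg_cong[OF m[of x], of prod_mset] by (simp only: prod_mset_prod_list)
  moreover have "length ss = length ts" using PNode.prems unfolding t by (simp, metis mset_map size_mset length_map)
  ultimately show ?case unfolding t by (simp add: fun_eq_iff)
qed

context nice_kernel begin

sublocale meas_kernel M W by unfold_locales (rule W_meas)

lemma exp_kop_ess_bounded: "ess_bounded M (\<lambda>x. exp (- kop M K (\<lambda>_. 1) x))"
proof (rule ess_boundedI)
  have "AE x in M. 0 \<le> kop M K (\<lambda>_. 1) x" by (rule K_nonneg) auto
  then show "AE x in M. \<bar>exp (- kop M K (\<lambda>_. 1) x)\<bar> \<le> 1" by eventually_elim simp
  have [measurable]: "kop M K (\<lambda>_. 1) \<in> borel_measurable M" by (rule kop_measurable[OF prob_space_axioms bd_kernel_K]) simp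
  show "(\<lambda>x. exp (- kop M K (\<lambda>_. 1) x)) \<in> borel_measurable M" by measurable
qed

lemma prod_kop_ess_bounded: "(\<And>f. f \<in> set fs \<Longrightarrow> ess_bounded M f) \<Longrightarrow> ess_bounded M (\<lambda>x. \<Prod>f\<leftarrow>fs. kop M K f x)"
  by (induction fs) (auto intro!: ess_bounded_mult ess_bounded_K)

lemma prod_kop_nonneg: "(\<And>f. f \<in> set fs \<Longrightarrow> ess_bounded M f \<and> (AE x in M. 0 \<le> f x)) \<Longrightarrow> AE x in M. 0 \<le> (\<Prod>f\<leftarrow>fs. kop M K f x)"
proof (induction fs)
  case (Cons f fs)
  have "AE x in M. 0 \<le> kop M K f x" using Cons(2)[of f] by (intro K_nonneg) auto
  moreover have "AE x in M. 0 \<le> (\<Prod>f\<leftarrow>fs. kop M K f x)" using Cons by auto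
  ultimately show ?case by eventually_elim simp
qed simp

lemma oth_prob_ess_bounded: "ess_bounded M (oth_prob M K k q) \<and> (AE x in M. 0 \<le> oth_prob M K k q x)"
proof (induction k arbitrary: q)
  case (Suc k)
  let ?p = "\<lambda>x. \<Prod>f\<leftarrow>map (oth_prob M K k) (kids q). kop M K f x"
  have "ess_bounded M ?p" by (rule prod_kop_ess_bounded) (use Suc in auto)
  then have "ess_bounded M (\<lambda>x. (1 / fact (length (kids q)) * exp (- kop M K (\<lambda>_. 1) x)) * ?p x)"
    by (intro ess_bounded_mult exp_kop_ess_bounded) auto
  moreover have "AE x in M. 0 \<le> ?p x" by (rule prod_kop_nonneg) (use Suc in auto)
  ultimately show ?case by (auto elim!: eventually_mono)
qed auto

lemma oth_tree_prob_ess_bounded: "ess_bounded M (oth_tree_prob M K q)"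
  using oth_prob_ess_bounded[of "Suc (height q)" q] oth_prob_eq_oth_tree_prob[of q "Suc (height q)" M K] by simp

lemma AE_rows: "AE x in M. AE y in M. f0 x y = ennreal (K x y)"
  using AE_space
proof eventually_elim
  case (elim x)
  show ?case using D_bounds AE_space
    by eventually_elim (use elim W_nonneg d_pos in \<open>auto simp: K_def divide_ennreal\<close>)
qed

text \<open>Since \<open>D \<le> C\<close>, the value is at least \<open>D x / C\<close>. Positivity
  keeps the Poisson process and the normalised density out of their default branches.\<close>

lemma K_one_pos: "AE x in M. 0 < kop M K (\<lambda>_. 1) x"
  using W_one D_bounds bd_kernel_integrable[OF prob_space_axioms bd_kernel_W] bd_kernel_integrable[OF prob_space_axioms bd_kernel_K] AE_space
proof eventually_elim
  case (elim x)
  have "D x / C = (\<integral>y. W x y / C \<partial>M)" using elim by (simp add: kop_def)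
  also have "\<dots> \<le> (\<integral>y. K x y \<partial>M)"
  proof (rule integral_mono_AE)
    show "AE y in M. W x y / C \<le> K x y" using D_bounds AE_space
      by eventually_elim (use elim W_nonneg d_pos in \<open>auto simp: K_def intro!: divide_left_mono mult_pos_pos\<close>)
  qed (use elim in auto)
  finally have "D x / C \<le> kop M K (\<lambda>_. 1) x" by (simp add: kop_def)
  moreover have "0 < D x / C" using elim d_pos C_pos by simp
  ultimately show ?case by linarith
qed

lemma normalized_integral:
  assumes f: "f \<in> borel_measurable M" "AE y in M. f y = ennreal (k y)" "AE y in M. 0 \<le> k y" "integrable M k" "0 < (\<integral>y. k y \<partial>M)"
    and G: "G \<in> borel_measurable M" "AE y in M. G y = ennreal (g y)" "AE y in M. 0 \<le> g y" "integrable M (\<lambda>y. k y * g y)"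
  shows "(\<integral>\<^sup>+ y. G y \<partial>normalized_density M f) = ennreal ((\<integral>y. k y * g y \<partial>M) / (\<integral>y. k y \<partial>M))"
proof -
  let ?m = "\<integral>y. k y \<partial>M"
  have [measurable]: "f \<in> borel_measurable M" "G \<in> borel_measurable M" by fact+
  have m: "(\<integral>\<^sup>+ y. f y \<partial>M) = ennreal ?m"
    using nn_integral_cong_AE[OF f(2)] nn_integral_eq_integral[OF f(4,3)] by simp
  have "(\<integral>\<^sup>+ y. G y \<partial>normalized_density M f) = (\<integral>\<^sup>+ y. f y / ennreal ?m * G y \<partial>M)"
    using f(5) unfolding normalized_density_def m Let_def by (simp add: nn_integral_density)
  also have "\<dots> = (\<integral>\<^sup>+ y. ennreal (k y * g y / ?m) \<partial>M)"
  proof (rule nn_integral_cong_AE)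
    show "AE y in M. f y / ennreal ?m * G y = ennreal (k y * g y / ?m)"
      using f(2,3) G(2,3) by eventually_elim (use f(5) in \<open>simp add: divide_ennreal flip: ennreal_mult\<close>)
  qed
  also have "\<dots> = ennreal (\<integral>y. k y * g y / ?m \<partial>M)"
  proof (rule nn_integral_eq_integral)
    show "AE y in M. 0 \<le> k y * g y / ?m" using f(3) G(3) by eventually_elim (use f(5) in simp)
  qed (use G(4) in simp)
  finally show ?thesis by simp
qed

lemma nd_integral:
  assumes G: "G \<in> borel_measurable M" "AE y in M. G y = ennreal (g y)" and g: "ess_bounded M g" "AE y in M. 0 \<le> g y"
  shows "AE x in M. (\<integral>\<^sup>+ y. G y \<partial>nd x) = ennreal (kop M K g x / kop M K (\<lambda>_. 1) x)"
  using AE_rows K_one_pos bd_kernel_integrable[OF prob_space_axioms bd_kernel_K] bd_kernel_integrable_mult[OF prob_space_axioms bd_kernel_K g(1)] AE_space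
proof eventually_elim
  case (elim x)
  have [measurable]: "x \<in> space M" by fact
  have "(\<integral>\<^sup>+ y. G y \<partial>nd x) = ennreal ((\<integral>y. K x y * g y \<partial>M) / (\<integral>y. K x y \<partial>M))"
  proof (rule normalized_integral[OF _ elim(1) _ _ _ G g(2)])
    show "f0 x \<in> borel_measurable M" by measurable
    show "AE y in M. 0 \<le> K x y" using elim bd_kernel_K by (auto simp: bd_kernel_def)
  qed (use elim in \<open>auto simp: kop_def\<close>)
  then show ?case by (simp add: kop_def)
qed

lemma na_integral:
  assumes G: "G \<in> borel_measurable M" "AE y in M. G y = ennreal (g y)" and g: "ess_bounded M g" "AE y in M. 0 \<le> g y"
  shows "AE x in M. (\<integral>\<^sup>+ y. G y \<partial>na x) = ennreal (kop M P g x)"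
  using W_one D_bounds bd_kernel_integrable[OF prob_space_axioms bd_kernel_W] bd_kernel_integrable_mult[OF prob_space_axioms bd_kernel_W g(1)] AE_space
proof eventually_elim
  case (elim x)
  have [measurable]: "x \<in> space M" by fact
  have D: "(\<integral>y. W x y \<partial>M) = D x" using elim by (simp add: kop_def)
  have "(\<integral>\<^sup>+ y. G y \<partial>na x) = ennreal ((\<integral>y. W x y * g y \<partial>M) / (\<integral>y. W x y \<partial>M))"
  proof (rule normalized_integral[OF _ _ _ _ _ G g(2)])
    show "(\<lambda>y. ennreal (W x y)) \<in> borel_measurable M" by measurable
    show "AE y in M. 0 \<le> W x y" using elim W_nonneg by auto
  qed (use elim d_pos in \<open>auto simp: kop_def\<close>)
  then show ?case unfolding kop_P D unfolding kop_def .
qed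

lemma pmf_pois: "AE x in M. pmf (pois x) n = kop M K (\<lambda>_. 1) x ^ n / fact n * exp (- kop M K (\<lambda>_. 1) x)"
  using AE_rows K_one_pos bd_kernel_integrable[OF prob_space_axioms bd_kernel_K] AE_space
proof eventually_elim
  case (elim x)
  have "(\<integral>\<^sup>+ y. f0 x y \<partial>M) = (\<integral>\<^sup>+ y. ennreal (K x y) \<partial>M)" by (rule nn_integral_cong_AE[OF elim(1)])
  also have "\<dots> = ennreal (kop M K (\<lambda>_. 1) x)"
    unfolding kop_def using elim bd_kernel_K by (subst nn_integral_eq_integral) (auto simp: bd_kernel_def)
  finally show ?case using elim(2) by (simp add: pois_def)
qed

lemma emeasure_progeny_measurable: "(\<lambda>x. emeasure (progeny M W k (kd, x)) (tree_event M q)) \<in> borel_measurable M"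
  by (rule measurable_compose[OF type_measurable progeny_emeasure_measurable[OF tree_event_sets]])

text \<open>With \<open>b = K1\<close>, the Poisson weight is
  \<open>b ^ n / fact n * exp (- b)\<close>, and normalising the intensity for each of the
  \<open>n\<close> children divides by \<open>b\<close>. The powers of \<open>b\<close>
  cancel.\<close>

lemma progeny_Oth_oth_prob: "AE x in M. emeasure (progeny M W k (Oth, x)) (tree_event M q) = ennreal (oth_prob M K k q x)"
proof (induction k arbitrary: q)
  case 0
  show ?case using AE_space by eventually_elim (use progeny_0 in \<open>simp del: progeny.simps\<close>)
next
  case (Suc k)
  obtain ts where q: "q = PNode ts" by (cases q)
  let ?b = "kop M K (\<lambda>_. 1)"
  have "AE x in M. \<forall>i\<in>{..<length ts}. (\<integral>\<^sup>+ y. emeasure (progeny M W k (Oth, y)) (tree_event M (ts ! i)) \<partial>nd x)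
      = ennreal (kop M K (oth_prob M K k (ts ! i)) x / ?b x) \<and> 0 \<le> kop M K (oth_prob M K k (ts ! i)) x"
  proof (rule AE_finite_allI)
    fix i assume "i \<in> {..<length ts}"
    have "AE x in M. 0 \<le> kop M K (oth_prob M K k (ts ! i)) x" using oth_prob_ess_bounded by (intro K_nonneg) auto
    with nd_integral[OF emeasure_progeny_measurable Suc conjunct1[OF oth_prob_ess_bounded] conjunct2[OF oth_prob_ess_bounded]]
    show "AE x in M. (\<integral>\<^sup>+ y. emeasure (progeny M W k (Oth, y)) (tree_event M (ts ! i)) \<partial>nd x)
      = ennreal (kop M K (oth_prob M K k (ts ! i)) x / ?b x) \<and> 0 \<le> kop M K (oth_prob M K k (ts ! i)) x"
      by eventually_elim auto
  qed simp
  then show ?case using pmf_pois[of "length ts"] K_one_pos AE_space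
  proof eventually_elim
    case (elim x)
    have "emeasure (progeny M W (Suc k) (Oth, x)) (tree_event M q)
      = ennreal (pmf (pois x) (length ts)) * (\<Prod>i<length ts. \<integral>\<^sup>+ y. emeasure (progeny M W k (Oth, y)) (tree_event M (ts ! i)) \<partial>nd x)"
      unfolding q tree_event_graft by (rule progeny_Oth[OF tree_event_sets elim(4)])
    also have "\<dots> = ennreal (pmf (pois x) (length ts)) * (\<Prod>i<length ts. ennreal (kop M K (oth_prob M K k (ts ! i)) x / ?b x))"
      using elim(1) by simp
    also have "\<dots> = ennreal (pmf (pois x) (length ts) * (\<Prod>i<length ts. kop M K (oth_prob M K k (ts ! i)) x / ?b x))"
    proof -
      have nn: "0 \<le> kop M K (oth_prob M K k (ts ! i)) x / ?b x" if "i \<in> {..<length ts}" for i using elim(1,3) that by simp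
      have "(\<Prod>i<length ts. ennreal (kop M K (oth_prob M K k (ts ! i)) x / ?b x)) = ennreal (\<Prod>i<length ts. kop M K (oth_prob M K k (ts ! i)) x / ?b x)"
        by (rule prod_ennreal) (rule nn)
      moreover have "0 \<le> (\<Prod>i<length ts. kop M K (oth_prob M K k (ts ! i)) x / ?b x)" by (rule prod_nonneg) (use nn in blast)
      ultimately show ?thesis by (simp add: ennreal_mult)
    qed
    also have "(\<Prod>i<length ts. kop M K (oth_prob M K k (ts ! i)) x / ?b x) = (\<Prod>f\<leftarrow>map (oth_prob M K k) ts. kop M K f x) / ?b x ^ length ts"
      by (simp add: prod_dividef prod.list_conv_set_nth atLeast0LessThan o_def)
    also have "pmf (pois x) (length ts) * \<dots> = oth_prob M K (Suc k) q x"
      using elim(3) unfolding elim(2) q by simp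
    finally show ?case .
  qed
qed

lemma ess_bounded_P: "ess_bounded M f \<Longrightarrow> ess_bounded M (kop M P f)" by (rule kop_ess_bounded[OF prob_space_axioms bd_kernel_P])

lemma P_nonneg: assumes "ess_bounded M f" "AE x in M. 0 \<le> f x" shows "AE x in M. 0 \<le> kop M P f x"
  using AE_space
proof eventually_elim
  case (elim x)
  show ?case unfolding kop_def
  proof (rule integral_nonneg_AE)
    show "AE y in M. 0 \<le> P x y * f y" using assms(2) AE_space
      by eventually_elim (use elim W_nonneg D_nonneg in \<open>auto simp: P_def\<close>)
  qed
qed

lemma anc_prob_ess_bounded: "ess_bounded M (anc_prob M K P k q) \<and> (AE x in M. 0 \<le> anc_prob M K P k q x)"
proof (induction k arbitrary: q)
  case (Suc k)
  show ?case
  proof (cases "kids q")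
    case (Cons r l)
    have "ess_bounded M (kop M P (anc_prob M K P k r))" "AE x in M. 0 \<le> kop M P (anc_prob M K P k r) x"
      using Suc ess_bounded_P P_nonneg by auto
    moreover have "ess_bounded M (oth_prob M K (Suc k) (PNode l))" "AE x in M. 0 \<le> oth_prob M K (Suc k) (PNode l) x" using oth_prob_ess_bounded by blast+
    ultimately show ?thesis using Cons ess_bounded_mult[of M "kop M P (anc_prob M K P k r)" "oth_prob M K (Suc k) (PNode l)"]
      by (auto elim: eventually_elim2 simp del: oth_prob.simps)
  qed simp
qed auto

lemma progeny_Anc_anc_prob: "AE x in M. emeasure (progeny M W k (Anc, x)) (tree_event M q) = ennreal (anc_prob M K P k q x)"
proof (induction k arbitrary: q)
  case 0
  show ?case using AE_space by eventually_elim (use progeny_0 in \<open>simp del: progeny.simps\<close>)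
next
  case (Suc k)
  obtain ts where q: "q = PNode ts" by (cases q)
  show ?case
  proof (cases ts)
    case Nil
    show ?thesis using AE_space
      by eventually_elim (use progeny_Anc_leaf in \<open>simp add: q Nil tree_event_graft del: progeny.simps\<close>)
  next
    case (Cons r l)
    have "AE x in M. 0 \<le> kop M P (anc_prob M K P k r) x" using anc_prob_ess_bounded by (intro P_nonneg) auto
    moreover have "AE x in M. 0 \<le> oth_prob M K (Suc k) (PNode l) x" using oth_prob_ess_bounded by blast
    ultimately show ?thesis
      using na_integral[OF emeasure_progeny_measurable Suc conjunct1[OF anc_prob_ess_bounded] conjunct2[OF anc_prob_ess_bounded], of r] progeny_Oth_oth_prob[of "Suc k" "PNode l"] AE_space
    proof eventually_elim
      case (elim x)
      show ?case unfolding q Cons tree_event_Cons progeny_Anc_graft[OF tree_event_sets elim(5)] elim(3,4)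
        using elim(1,2) by (simp add: ennreal_mult del: oth_prob.simps)
    qed
  qed
qed

lemma branching_anc_prob: "emeasure (branching_process M W k) (tree_event M q) = ennreal (\<integral>x. anc_prob M K P k q x \<partial>M)"
proof -
  have "emeasure (branching_process M W k) (tree_event M q) = (\<integral>\<^sup>+ x. ennreal (anc_prob M K P k q x) \<partial>M)"
    unfolding branching_emeasure(1)[OF tree_event_sets] by (rule nn_integral_cong_AE[OF progeny_Anc_anc_prob])
  also have "\<dots> = ennreal (\<integral>x. anc_prob M K P k q x \<partial>M)"
    using anc_prob_ess_bounded by (intro nn_integral_eq_integral) auto
  finally show ?thesis .
qed

text \<open>All plane orders of \<open>q\<close> are equally likely, whence the cardinality. As the
  root is distributed according to the ground measure, the tree of the ancestor reveals the integral
  of \<open>oth_tree_prob\<close>.\<close>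

lemma branching_spine:
  assumes "height q \<le> j"
  shows "emeasure (branching_process M W (Suc j)) (\<Union>r\<in>spine_set j q. tree_event M r)
    = of_nat (card {s. canon s = canon q}) * ennreal (\<integral>x. oth_tree_prob M K q x \<partial>M)"
proof -
  have s: "(\<Union>r\<in>spine_set j q. tree_event M r) \<in> sets (labelling_space M)"
    by (intro sets.countable_UN'') (auto simp: tree_event_sets)
  have O: "(\<integral>\<^sup>+ x. emeasure (progeny M W (Suc j) (Oth, x)) (tree_event M s) \<partial>M) = ennreal (\<integral>x. oth_tree_prob M K q x \<partial>M)" if "canon s = canon q" for s
  proof -
    have h: "height s < Suc j" using canon_height[OF that] assms by simp
    have e: "oth_prob M K (Suc j) s = oth_tree_prob M K q" using oth_prob_eq_oth_tree_prob[OF h] oth_tree_prob_canon[OF that] by metis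
    have "(\<integral>\<^sup>+ x. emeasure (progeny M W (Suc j) (Oth, x)) (tree_event M s) \<partial>M) = (\<integral>\<^sup>+ x. ennreal (oth_prob M K (Suc j) s x) \<partial>M)"
      by (rule nn_integral_cong_AE[OF progeny_Oth_oth_prob])
    also have "\<dots> = ennreal (\<integral>x. oth_prob M K (Suc j) s x \<partial>M)"
      using oth_prob_ess_bounded[of "Suc j" s] by (intro nn_integral_eq_integral) (auto simp del: oth_prob.simps)
    finally show ?thesis unfolding e .
  qed
  have "emeasure (branching_process M W (Suc j)) (\<Union>r\<in>spine_set j q. tree_event M r)
    = (\<integral>\<^sup>+ x. (\<Sum>s\<in>{s. canon s = canon q}. emeasure (progeny M W (Suc j) (Oth, x)) (tree_event M s)) \<partial>M)"
    unfolding branching_emeasure(1)[OF s] by (rule nn_integral_cong) (rule spine_removal[OF _ assms])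
  also have "\<dots> = (\<Sum>s\<in>{s. canon s = canon q}. \<integral>\<^sup>+ x. emeasure (progeny M W (Suc j) (Oth, x)) (tree_event M s) \<partial>M)"
    by (rule nn_integral_sum) (rule emeasure_progeny_measurable)
  also have "\<dots> = (\<Sum>s\<in>{s. canon s = canon q}. ennreal (\<integral>x. oth_tree_prob M K q x \<partial>M))" by (rule sum.cong) (use O in auto)
  finally show ?thesis by simp
qed

lemma oth_tree_prob_integral_nonneg: "0 \<le> (\<integral>x. oth_tree_prob M K q x \<partial>M)"
  using oth_prob_ess_bounded[of "Suc (height q)" q] oth_prob_eq_oth_tree_prob[of q "Suc (height q)" M K] by (intro integral_nonneg_AE) (simp del: oth_prob.simps)

end

section \<open>Two kernels\<close>

text \<open>Taylor polynomials of the exponential, multiplied by a fixed factor \<open>A\<close>.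
  The factor is carried along because powers of \<open>z\<close> alone, in particular the constant
  1, are not assumed to lie in the closure.\<close>

lemma uclosure_exp:
  assumes B: "ess_bounded_pairs M N B" and A: "ess_bounded M A1" "ess_bounded N A2" and z: "ess_bounded M z1" "ess_bounded N z2"
    and mem: "\<And>j. (\<lambda>x. A1 x * z1 x ^ j, \<lambda>y. A2 y * z2 y ^ j) \<in> uclosure M N B"
  shows "(\<lambda>x. A1 x * exp (z1 x), \<lambda>y. A2 y * exp (z2 y)) \<in> uclosure M N B"
proof (rule uclosure.lim)
  have [measurable]: "A1 \<in> borel_measurable M" "z1 \<in> borel_measurable M" "A2 \<in> borel_measurable N" "z2 \<in> borel_measurable N"
    using A z by (auto simp: ess_bounded_def)
  show "(\<lambda>x. A1 x * exp (z1 x)) \<in> borel_measurable M" "(\<lambda>y. A2 y * exp (z2 y)) \<in> borel_measurable N" by measurable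
  obtain a1 where a1: "0 \<le> a1" "AE x in M. \<bar>A1 x\<bar> \<le> a1" using A(1) by (rule ess_boundedE)
  obtain a2 where a2: "0 \<le> a2" "AE x in N. \<bar>A2 x\<bar> \<le> a2" using A(2) by (rule ess_boundedE)
  obtain b1 where b1: "0 \<le> b1" "AE x in M. \<bar>z1 x\<bar> \<le> b1" using z(1) by (rule ess_boundedE)
  obtain b2 where b2: "0 \<le> b2" "AE x in N. \<bar>z2 x\<bar> \<le> b2" using z(2) by (rule ess_boundedE)
  define a b where "a = max a1 a2" and "b = max b1 b2"
  fix e :: real assume e: "0 < e"
  have "(\<lambda>n. a * exp b * (inverse (fact n) * b ^ n)) \<longlonglongrightarrow> a * exp b * 0"
    by (intro tendsto_intros summable_LIMSEQ_zero[OF summable_exp])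
  then have "eventually (\<lambda>n. a * exp b * (inverse (fact n) * b ^ n) < e) sequentially"
    using e by (auto dest!: order_tendstoD(2))
  \<comment> \<open>Chosen to make the Lagrange remainder small for all values bounded by
    \<open>a\<close> and \<open>b\<close>.\<close>
  then obtain n where n: "a * exp b * (inverse (fact n) * b ^ n) < e" by (auto simp: eventually_sequentially)
  have bound: "\<bar>A * exp z - (\<Sum>j<n. 1 / fact j * (A * z ^ j))\<bar> \<le> e" if "\<bar>A\<bar> \<le> a" "\<bar>z\<bar> \<le> b" for A z :: real
  proof -
    obtain t where t: "\<bar>t\<bar> \<le> \<bar>z\<bar>" "exp z = (\<Sum>m<n. z ^ m / fact m) + exp t / fact n * z ^ n"
      using Maclaurin_exp_le[of z n] by auto
    have "A * exp z - (\<Sum>j<n. 1 / fact j * (A * z ^ j)) = A * (exp t / fact n * z ^ n)"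
      unfolding t(2) by (simp add: sum_distrib_left algebra_simps)
    also have "\<bar>\<dots>\<bar> = \<bar>A\<bar> * (exp t * (inverse (fact n) * \<bar>z\<bar> ^ n))"
      by (simp add: abs_mult power_abs divide_inverse mult.assoc)
    also have "\<dots> \<le> a * (exp b * (inverse (fact n) * b ^ n))"
      using that t(1) by (intro mult_mono power_mono) auto
    finally show ?thesis using n by (simp add: mult.assoc)
  qed
  have "(\<lambda>x. \<Sum>j<n. 1 / fact j * (A1 x * z1 x ^ j), \<lambda>y. \<Sum>j<n. 1 / fact j * (A2 y * z2 y ^ j)) \<in> uclosure M N B"
    by (rule uclosure_sum[OF mem[of 0]]) (rule uclosure_scale[OF mem])
  moreover have "AE x in M. \<bar>A1 x * exp (z1 x) - (\<Sum>j<n. 1 / fact j * (A1 x * z1 x ^ j))\<bar> \<le> e"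
    using a1(2) b1(2) by eventually_elim (rule bound, auto simp: a_def b_def)
  moreover have "AE x in N. \<bar>A2 x * exp (z2 x) - (\<Sum>j<n. 1 / fact j * (A2 x * z2 x ^ j))\<bar> \<le> e"
    using a2(2) b2(2) by eventually_elim (rule bound, auto simp: a_def b_def)
  ultimately show "\<exists>f' g'. (f', g') \<in> uclosure M N B \<and> (AE x in M. \<bar>A1 x * exp (z1 x) - f' x\<bar> \<le> e) \<and> (AE y in N. \<bar>A2 y * exp (z2 y) - g' y\<bar> \<le> e)"
    by blast
qed

section \<open>Fractional isomorphism in terms of tree functions\<close>

text \<open>Cutting the degrees alters whole rows \<open>V x\<close>, for a null set of
  \<open>x\<close>. Inside the integrals this is invisible, so tree functions change on a null set
  only.\<close>

lemma tree_fun_cong_rows: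
  assumes "prob_space M" "bd_kernel M V B" "bd_kernel M V' B'" "AE x in M. \<forall>y. V x y = V' x y"
  shows "AE x in M. tree_fun M V t x = tree_fun M V' t x"
proof (induction t)
  case (PNode ts)
  have "AE x in M. \<forall>t\<in>set ts. kop M V (tree_fun M V t) x = kop M V' (tree_fun M V' t) x"
  proof (rule AE_finite_allI)
    fix t assume t: "t \<in> set ts"
    have m: "tree_fun M V t \<in> borel_measurable M" "tree_fun M V' t \<in> borel_measurable M"
      using tree_fun_ess_bounded[OF assms(1,2)] tree_fun_ess_bounded[OF assms(1,3)] by (auto simp: ess_bounded_def)
    show "AE x in M. kop M V (tree_fun M V t) x = kop M V' (tree_fun M V' t) x"
      using assms(4) AE_space
    proof eventually_elim
      case (elim x)
      have "kop M V (tree_fun M V t) x = kop M V (tree_fun M V' t) x"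
        by (rule kop_cong_AE[OF assms(1,2) PNode[OF t] m elim(2)])
      also have "\<dots> = kop M V' (tree_fun M V' t) x" using elim(1) by (simp add: kop_def)
      finally show ?case .
    qed
  qed simp
  then show ?case by eventually_elim (simp add: o_def cong: map_cong)
qed

lemma tree_fun_integral_cong_rows:
  assumes "prob_space M" "bd_kernel M V B" "bd_kernel M V' B'" "AE x in M. \<forall>y. V x y = V' x y"
  shows "(\<integral>x. tree_fun M V t x \<partial>M) = (\<integral>x. tree_fun M V' t x \<partial>M)"
  by (rule integral_cong_AE[OF _ _ tree_fun_cong_rows[OF assms]])
    (use tree_fun_ess_bounded[OF assms(1,2)] tree_fun_ess_bounded[OF assms(1,3)] in \<open>auto simp: ess_bounded_def\<close>)

lemma cut_deg_bounded:
  assumes "prob_space M" "bd_kernel M V B" "0 < c"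
  shows "deg_bounded M (cut_degrees c M V) c"
proof -
  interpret prob_space M by fact
  have [measurable]: "(\<lambda>(x, y). V x y) \<in> borel_measurable (M \<Otimes>\<^sub>M M)" using assms by (simp add: bd_kernel_def)
  have "(\<lambda>x. \<integral>\<^sup>+ y. ennreal (V x y) \<partial>M) \<in> borel_measurable M" by measurable
  then have [measurable]: "deg M V \<in> borel_measurable M" by (simp add: deg_def[abs_def])
  have "(\<integral>\<^sup>+ y. ennreal (cut_degrees c M V x y) \<partial>M) \<le> ennreal c" for x
    by (cases "deg M V x \<le> ennreal c") (simp_all add: cut_degrees_def deg_def)
  moreover have "(\<lambda>(x, y). cut_degrees c M V x y) \<in> borel_measurable (M \<Otimes>\<^sub>M M)"
    unfolding cut_degrees_def by measurable
  ultimately show ?thesis using assms by (auto simp: deg_bounded_def bd_kernel_def cut_degrees_def)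
qed

lemma bd_kernel_deg_measurable:
  assumes "prob_space Q" "bd_kernel Q V b" shows "deg Q V \<in> borel_measurable Q"
proof -
  interpret prob_space Q by fact
  have [measurable]: "(\<lambda>(x, y). V x y) \<in> borel_measurable (Q \<Otimes>\<^sub>M Q)" using assms by (simp add: bd_kernel_def)
  have "(\<lambda>x. \<integral>\<^sup>+ y. ennreal (V x y) \<partial>Q) \<in> borel_measurable Q" by measurable
  then show ?thesis by (simp add: deg_def[abs_def])
qed

lemma bd_kernel_max_deg:
  assumes "prob_space Q" "bd_kernel Q V b" shows "max_deg Q V \<le> ennreal b"
  unfolding max_deg_def by (rule esssup_I[OF bd_kernel_deg_measurable[OF assms]]) (use assms in \<open>simp add: bd_kernel_def deg_def\<close>)

lemma iterated_degree_measure_eq_profile: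
  "iterated_degree_measure c M V = distr M (borel_of (Pspace_lim c)) (profile c M (cut_degrees c M V))"
  unfolding iterated_degree_measure_def profile_eq ..

lemma cut_rows:
  assumes "prob_space M" "bd_kernel M V B" "max_deg M V \<le> ennreal c"
  shows "AE x in M. \<forall>y. cut_degrees c M V x y = V x y"
proof -
  have "AE x in M. deg M V x \<le> esssup M (deg M V)" by (rule esssup_AE)
  then show ?thesis
    by eventually_elim (use assms(3) in \<open>auto simp: cut_degrees_def max_deg_def\<close>)
qed

text \<open>For each admissible \<open>c\<close> the equality of the two measures is equivalent to a
  condition that does not mention \<open>c\<close>; since some \<open>c\<close> is admissible, the
  quantifier over \<open>c\<close> disappears.\<close>

lemma fractionally_isomorphic_iff_tree_fun:
  assumes HM: "prob_space M" "bd_kernel M U B" and HN: "prob_space N" "bd_kernel N W B'"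
  shows "fractionally_isomorphic M U N W \<longleftrightarrow> (\<forall>t. (\<integral>x. tree_fun M U t x \<partial>M) = (\<integral>y. tree_fun N W t y \<partial>N))"
proof -
  have key: "iterated_degree_measure c M U = iterated_degree_measure c N W
      \<longleftrightarrow> (\<forall>t. (\<integral>x. tree_fun M U t x \<partial>M) = (\<integral>y. tree_fun N W t y \<partial>N))"
    if c: "0 < c" "max_deg M U \<le> ennreal c" "max_deg N W \<le> ennreal c" for c
  proof -
    interpret deg_bounded_pair M "cut_degrees c M U" N "cut_degrees c N W" c
      by unfold_locales (rule cut_deg_bounded[OF HM c(1)], rule cut_deg_bounded[OF HN c(1)])
    have "(\<integral>x. tree_fun M (cut_degrees c M U) t x \<partial>M) = (\<integral>x. tree_fun M U t x \<partial>M)" for t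
      by (rule tree_fun_integral_cong_rows[OF HM(1) deg_bounded_bd_kernel[OF M] HM(2) cut_rows[OF HM c(2)]])
    moreover have "(\<integral>x. tree_fun N (cut_degrees c N W) t x \<partial>N) = (\<integral>x. tree_fun N W t x \<partial>N)" for t
      by (rule tree_fun_integral_cong_rows[OF HN(1) deg_bounded_bd_kernel[OF N] HN(2) cut_rows[OF HN c(3)]])
    ultimately show ?thesis unfolding iterated_degree_measure_eq_profile
      using profile_law_eq tree_fun_eq_of_profile_law by auto
  qed
  have bd: "max_deg M U \<le> ennreal B" "max_deg N W \<le> ennreal B'" by (rule bd_kernel_max_deg[OF HM], rule bd_kernel_max_deg[OF HN])
  have "bounded_degree M U" "bounded_degree N W"
    unfolding bounded_degree_def using bd by (auto intro: le_less_trans[OF _ ennreal_less_top] simp: infinity_ennreal_def)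
  moreover have "\<exists>c>0. max_deg M U \<le> ennreal c \<and> max_deg N W \<le> ennreal c"
  proof (intro exI[of _ "max 1 (max B B')"] conjI)
    show "max_deg M U \<le> ennreal (max 1 (max B B'))" by (rule order_trans[OF bd(1)]) (auto intro!: ennreal_leI)
    show "max_deg N W \<le> ennreal (max 1 (max B B'))" by (rule order_trans[OF bd(2)]) (auto intro!: ennreal_leI)
  qed simp
  ultimately show ?thesis unfolding fractionally_isomorphic_def using key by meson
qed

lemma bd_kernel_scale: assumes "bd_kernel M W B" "0 \<le> t" shows "bd_kernel M (\<lambda>x y. t * W x y) (t * B)"
proof -
  have m: "(\<lambda>(x, y). W x y) \<in> borel_measurable (M \<Otimes>\<^sub>M M)" using assms by (simp add: bd_kernel_def)
  have "AE x in M. (\<integral>\<^sup>+ y. ennreal (t * W x y) \<partial>M) \<le> ennreal (t * B)"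
  proof -
    have "AE x in M. (\<integral>\<^sup>+ y. ennreal (W x y) \<partial>M) \<le> ennreal B" using assms by (simp add: bd_kernel_def)
    then show ?thesis using AE_space
    proof eventually_elim
      case (elim x)
      have [measurable]: "W x \<in> borel_measurable M" using measurable_compose[OF measurable_Pair1'[OF elim(2)] m] by simp
      have "(\<integral>\<^sup>+ y. ennreal (t * W x y) \<partial>M) = ennreal t * (\<integral>\<^sup>+ y. ennreal (W x y) \<partial>M)"
        using assms(2) by (simp add: ennreal_mult' nn_integral_cmult)
      also have "\<dots> \<le> ennreal t * ennreal B" by (rule mult_left_mono[OF elim(1)]) simp
      finally show ?case using assms by (simp add: bd_kernel_def ennreal_mult)
    qed
  qed
  moreover have "(\<lambda>(x, y). t * W x y) \<in> borel_measurable (M \<Otimes>\<^sub>M M)"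
    using borel_measurable_times[OF borel_measurable_const m, of t] by (simp add: split_beta')
  ultimately show ?thesis using assms by (auto simp: bd_kernel_def)
qed

lemma kop_scale: "kop M (\<lambda>x y. t * W x y) f x = t * kop M W f x"
proof -
  have "kop M (\<lambda>x y. t * W x y) f x = (\<integral>y. t * (W x y * f y) \<partial>M)" by (simp add: kop_def mult.assoc)
  then show ?thesis by (simp add: kop_def)
qed

section \<open>From the law of the tree to tree functions of \<open>K\<close>\<close>

locale nice_kernel_pair = L: nice_kernel M U CU dU + R: nice_kernel N W CW dW
  for M :: "'a measure" and U CU dU and N :: "'b measure" and W CW dW
begin

lemmas pM = L.prob_space_axioms
lemmas pN = R.prob_space_axioms

text \<open>In the ball of radius \<open>height q + 1\<close> the spine event of \<open>q\<close> is
  closed under isomorphism, so it has the same probability for both kernels; the positive number of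
  plane orders of \<open>q\<close> is then cancelled.\<close>

lemma oth_tree_prob_integral_eq:
  assumes "same_tree_distribution M U N W"
  shows "(\<integral>x. oth_tree_prob M L.K q x \<partial>M) = (\<integral>y. oth_tree_prob N R.K q y \<partial>N)"
proof -
  let ?j = "height q"
  define rep where "rep = (\<lambda>q. SOME r. rooted_isomorphic (tree q) (tree r))"
  have closed: "s \<in> spine_set ?j q" if "r \<in> spine_set ?j q" "rooted_isomorphic (tree s) (tree r)" for r s
    using spine_set_canon[OF rooted_isomorphic_canon[OF that(2)]] that(1) by blast
  have "emeasure (branching_process M U (Suc ?j)) (\<Union>r\<in>spine_set ?j q. tree_event M r)
      = emeasure (branching_process N W (Suc ?j)) (\<Union>r\<in>spine_set ?j q. tree_event N r)"
  proof -
    note l = L.branching_iso_closed[of "spine_set ?j q", OF closed rep_def, where k = "Suc ?j"]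
      and r = R.branching_iso_closed[of "spine_set ?j q", OF closed rep_def, where k = "Suc ?j"]
    have "ball_prob M U k (tree r) = ball_prob N W k (tree r)" for k r
      using assms finite_tree by (simp add: same_tree_distribution_def)
    then show ?thesis using l r by (simp only:)
  qed
  then have eq: "of_nat (card {s. canon s = canon q}) * ennreal (\<integral>x. oth_tree_prob M L.K q x \<partial>M) = of_nat (card {s. canon s = canon q}) * ennreal (\<integral>y. oth_tree_prob N R.K q y \<partial>N)"
    unfolding L.branching_spine[OF order_refl] R.branching_spine[OF order_refl] .
  have "card {s. canon s = canon q} \<noteq> 0" using finite_canon[of q] by (auto simp: card_eq_0_iff)
  then have "ennreal (\<integral>x. oth_tree_prob M L.K q x \<partial>M) = ennreal (\<integral>y. oth_tree_prob N R.K q y \<partial>N)"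
    using eq by (subst (asm) ennreal_mult_cancel_left) auto
  then show ?thesis using L.oth_tree_prob_integral_nonneg R.oth_tree_prob_integral_nonneg by simp
qed

lemma same_treeI:
  assumes "\<And>k q. (\<integral>x. anc_prob M L.K L.P k q x \<partial>M) = (\<integral>y. anc_prob N R.K R.P k q y \<partial>N)"
  shows "same_tree_distribution M U N W"
  unfolding same_tree_distribution_def
proof (intro allI impI)
  fix k and F :: "nat list set" assume F: "finite F"
  have "ennreal (ball_prob M U k F) = ennreal (ball_prob N W k F)"
    unfolding L.ball_prob_eq[OF F] R.ball_prob_eq[OF F] L.branching_UN R.branching_UN L.branching_anc_prob R.branching_anc_prob assms ..
  then show "ball_prob M U k F = ball_prob N W k F" by (simp add: ball_prob_def)
qed

text \<open>A product of two of these functions would carry \<open>exp (- K1)\<close> twice, so the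
  algebra arguments for tree functions do not apply to this generating set.\<close>

definition "oth_tree_probs = range (\<lambda>q. (oth_tree_prob M L.K q, oth_tree_prob N R.K q))"

abbreviation "\<L> \<equiv> uclosure M N oth_tree_probs"

lemma oth_tree_probs_ess_bounded_pairs: "ess_bounded_pairs M N oth_tree_probs"
  unfolding ess_bounded_pairs_def oth_tree_probs_def using L.oth_tree_prob_ess_bounded R.oth_tree_prob_ess_bounded by auto

abbreviation "eb1 x \<equiv> exp (- kop M L.K (\<lambda>_. 1) x)"
abbreviation "eb2 x \<equiv> exp (- kop N R.K (\<lambda>_. 1) x)"

text \<open>A generator is, up to a factorial, \<open>exp (- K1)\<close> times a product of images
  under \<open>K\<close> of generators. Its factors are replaced one at a time by images of closure
  elements, by lifting the operator \<open>f \<mapsto> A * K f\<close>; \<open>qs\<close> holds the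
  factors that are still generators.\<close>

lemma oth_tree_probs_step:
  assumes "set hs \<subseteq> \<L>"
  shows "(\<lambda>x. eb1 x * (\<Prod>h\<leftarrow>hs. kop M L.K (fst h) x) * (\<Prod>f\<leftarrow>map (oth_tree_prob M L.K) qs. kop M L.K f x),
    \<lambda>y. eb2 y * (\<Prod>h\<leftarrow>hs. kop N R.K (snd h) y) * (\<Prod>f\<leftarrow>map (oth_tree_prob N R.K) qs. kop N R.K f y)) \<in> \<L>"
  using assms
proof (induction hs arbitrary: qs)
  case Nil
  have "(oth_tree_prob M L.K (PNode qs), oth_tree_prob N R.K (PNode qs)) \<in> \<L>" unfolding oth_tree_probs_def by (rule uclosure.base[OF rangeI])
  from uclosure_scale[OF this, of "fact (length qs)"] show ?case by simp
next
  case (Cons h hs)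
  obtain h1 h2 where h: "h = (h1, h2)" by (cases h)
  have hL: "(h1, h2) \<in> \<L>" using Cons.prems h by auto
  let ?A1 = "\<lambda>x. eb1 x * (\<Prod>h\<leftarrow>hs. kop M L.K (fst h) x) * (\<Prod>f\<leftarrow>map (oth_tree_prob M L.K) qs. kop M L.K f x)"
  let ?A2 = "\<lambda>y. eb2 y * (\<Prod>h\<leftarrow>hs. kop N R.K (snd h) y) * (\<Prod>f\<leftarrow>map (oth_tree_prob N R.K) qs. kop N R.K f y)"
  have A: "(?A1, ?A2) \<in> \<L>" by (rule Cons.IH) (use Cons.prems in auto)
  have "(\<lambda>x. ?A1 x * kop M L.K h1 x, \<lambda>y. ?A2 y * kop N R.K h2 y) \<in> \<L>"
  proof (rule uclosure_lift[OF bounded_op_comp[OF bounded_op_mult bounded_op_kop] bounded_op_comp[OF bounded_op_mult bounded_op_kop] oth_tree_probs_ess_bounded_pairs _ hL])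
    show "ess_bounded M ?A1" "ess_bounded N ?A2" using uclosure_ess_bounded[OF oth_tree_probs_ess_bounded_pairs A] by auto
    show "prob_space M" "bd_kernel M L.K (CU / dU)" "prob_space N" "bd_kernel N R.K (CW / dW)" by (rule pM L.bd_kernel_K pN R.bd_kernel_K)+
    fix f g assume "(f, g) \<in> oth_tree_probs"
    then obtain q where q: "f = oth_tree_prob M L.K q" "g = oth_tree_prob N R.K q" by (auto simp: oth_tree_probs_def)
    show "(\<lambda>x. ?A1 x * kop M L.K f x, \<lambda>y. ?A2 y * kop N R.K g y) \<in> \<L>"
      using Cons.IH[of "q # qs"] Cons.prems unfolding q by (simp add: mult.commute mult.left_commute)
  qed
  then show ?case unfolding h by (simp add: mult.commute mult.left_commute)
qed

lemma oth_tree_probs_step_replicate: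
  assumes "set hs \<subseteq> \<L>" "(g1, g2) \<in> \<L>"
  shows "(\<lambda>x. (eb1 x * (\<Prod>h\<leftarrow>hs. kop M L.K (fst h) x)) * kop M L.K g1 x ^ j, \<lambda>y. (eb2 y * (\<Prod>h\<leftarrow>hs. kop N R.K (snd h) y)) * kop N R.K g2 y ^ j) \<in> \<L>"
proof -
  have "set (replicate j (g1, g2)) \<subseteq> \<L>" using assms(2) by (induction j) auto
  then show ?thesis using oth_tree_probs_step[of "hs @ replicate j (g1, g2)" "[]"] assms(1) by (simp add: mult.assoc)
qed

lemma eb_prod_ess_bounded:
  assumes "set hs \<subseteq> \<L>"
  shows "ess_bounded M (\<lambda>x. eb1 x * (\<Prod>h\<leftarrow>hs. kop M L.K (fst h) x))" "ess_bounded N (\<lambda>y. eb2 y * (\<Prod>h\<leftarrow>hs. kop N R.K (snd h) y))"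
proof -
  have "(\<lambda>x. eb1 x * (\<Prod>h\<leftarrow>hs. kop M L.K (fst h) x), \<lambda>y. eb2 y * (\<Prod>h\<leftarrow>hs. kop N R.K (snd h) y)) \<in> \<L>"
    using oth_tree_probs_step[OF assms, of "[]"] by simp
  from uclosure_ess_bounded[OF oth_tree_probs_ess_bounded_pairs this] show "ess_bounded M (\<lambda>x. eb1 x * (\<Prod>h\<leftarrow>hs. kop M L.K (fst h) x))" "ess_bounded N (\<lambda>y. eb2 y * (\<Prod>h\<leftarrow>hs. kop N R.K (snd h) y))" by auto
qed

lemma oth_tree_probs_exp:
  assumes "set hs \<subseteq> \<L>" "(g1, g2) \<in> \<L>"
  shows "(\<lambda>x. (eb1 x * (\<Prod>h\<leftarrow>hs. kop M L.K (fst h) x)) * exp (kop M L.K g1 x), \<lambda>y. (eb2 y * (\<Prod>h\<leftarrow>hs. kop N R.K (snd h) y)) * exp (kop N R.K g2 y)) \<in> \<L>"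
  by (rule uclosure_exp[OF oth_tree_probs_ess_bounded_pairs eb_prod_ess_bounded[OF assms(1)] _ _ oth_tree_probs_step_replicate[OF assms]])
    (use uclosure_ess_bounded[OF oth_tree_probs_ess_bounded_pairs assms(2)] L.ess_bounded_K R.ess_bounded_K in auto)

text \<open>Inside the exponential, \<open>- K1 + K (1 - \<rho>) = - K \<rho>\<close>, which is the
  recursion of \<open>survival\<close>.\<close>

lemma (in nice_kernel) kop_one_minus_survival:
  "AE x in M. exp (- kop M K (\<lambda>_. 1) x) * exp (kop M K (\<lambda>x. 1 - survival n x) x) = 1 - survival (Suc n) x"
proof -
  have r: "ess_bounded M (survival n)" using survival_bounds by blast
  have "AE x in M. kop M K (\<lambda>x. 1 * 1 + (-1) * survival n x) x = 1 * kop M K (\<lambda>_. 1) x + (-1) * kop M K (survival n) x"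
    by (rule bounded_op_lin[OF bounded_op_kop[OF prob_space_axioms bd_kernel_K] ess_bounded_const r])
  then show ?thesis by eventually_elim (simp flip: exp_add)
qed

text \<open>Starting from 0, each extinction probability is an exponential accompanied by exactly
  one factor \<open>exp (- K1)\<close>, the shape that the closure admits.\<close>

lemma one_minus_survival: "(\<lambda>x. 1 - L.survival n x, \<lambda>y. 1 - R.survival n y) \<in> \<L>"
proof (induction n)
  case 0
  have "(oth_tree_prob M L.K (PNode []), oth_tree_prob N R.K (PNode [])) \<in> \<L>" unfolding oth_tree_probs_def by (rule uclosure.base[OF rangeI])
  from uclosure_scale[OF this, of 0] show ?case by simp
next
  case (Suc n)
  have "(\<lambda>x. eb1 x * exp (kop M L.K (\<lambda>x. 1 - L.survival n x) x), \<lambda>y. eb2 y * exp (kop N R.K (\<lambda>x. 1 - R.survival n x) y)) \<in> \<L>"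
    using oth_tree_probs_exp[of "[]", OF _ Suc] by simp
  then show ?case
  proof (rule uclosure_cong_AE)
    show "(\<lambda>x. 1 - L.survival (Suc n) x) \<in> borel_measurable M" "(\<lambda>x. 1 - R.survival (Suc n) x) \<in> borel_measurable N"
      using L.survival_bounds[of "Suc n"] R.survival_bounds[of "Suc n"] by (auto simp: ess_bounded_def simp del: L.survival.simps R.survival.simps)
    show "AE x in M. 1 - L.survival (Suc n) x = eb1 x * exp (kop M L.K (\<lambda>x. 1 - L.survival n x) x)"
      using L.kop_one_minus_survival[of n] by eventually_elim simp
    show "AE x in N. 1 - R.survival (Suc n) x = eb2 x * exp (kop N R.K (\<lambda>x. 1 - R.survival n x) x)"
      using R.kop_one_minus_survival[of n] by eventually_elim simp
  qed
qed

text \<open>Extinction probabilities tend to 1 uniformly, on both sides with a common number of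
  generations.\<close>

lemma oth_tree_probs_one: "(\<lambda>x. 1, \<lambda>y. 1) \<in> \<L>"
proof (rule uclosure.lim)
  fix e :: real assume e: "0 < e"
  obtain n1 n2 where n: "\<And>n. n \<ge> n1 \<Longrightarrow> AE x in M. \<bar>L.survival n x\<bar> \<le> e" "\<And>n. n \<ge> n2 \<Longrightarrow> AE x in N. \<bar>R.survival n x\<bar> \<le> e"
    using L.extinction[OF e] R.extinction[OF e] by blast
  let ?n = "max n1 n2"
  have "AE x in M. \<bar>1 - (1 - L.survival ?n x)\<bar> \<le> e" "AE x in N. \<bar>1 - (1 - R.survival ?n x)\<bar> \<le> e"
    using n[of ?n] by simp_all
  then show "\<exists>f' g'. (f', g') \<in> \<L> \<and> (AE x in M. \<bar>1 - f' x\<bar> \<le> e) \<and> (AE x in N. \<bar>1 - g' x\<bar> \<le> e)"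
    using one_minus_survival[of ?n] by blast
qed auto

text \<open>Once 1 is in the closure, the factor \<open>exp (K1)\<close> is available and cancels
  \<open>exp (- K1)\<close>.\<close>

lemma oth_tree_probs_prod:
  assumes "set hs \<subseteq> \<L>"
  shows "(\<lambda>x. \<Prod>h\<leftarrow>hs. kop M L.K (fst h) x, \<lambda>y. \<Prod>h\<leftarrow>hs. kop N R.K (snd h) y) \<in> \<L>"
proof -
  have e: "exp (- b) * p * exp b = p" for b p :: real by (simp add: exp_minus field_simps)
  show ?thesis using oth_tree_probs_exp[OF assms oth_tree_probs_one] unfolding e .
qed

lemma tree_fun_K_mem: "(tree_fun M L.K t, tree_fun N R.K t) \<in> \<L>"
proof (induction t)
  case (PNode ts)
  have "set (map (\<lambda>t. (tree_fun M L.K t, tree_fun N R.K t)) ts) \<subseteq> \<L>" using PNode by auto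
  from oth_tree_probs_prod[OF this] show ?case by (simp add: o_def)
qed

lemma tree_fun_K_integral_eq:
  assumes "same_tree_distribution M U N W"
  shows "(\<integral>x. tree_fun M L.K t x \<partial>M) = (\<integral>y. tree_fun N R.K t y \<partial>N)"
  by (rule uclosure_integral_eq[OF pM pN oth_tree_probs_ess_bounded_pairs _ tree_fun_K_mem]) (use oth_tree_prob_integral_eq[OF assms] in \<open>auto simp: oth_tree_probs_def\<close>)

section \<open>From tree functions of \<open>K\<close> to tree functions of \<open>W\<close>\<close>

abbreviation "\<K> \<equiv> uclosure M N (tree_funs M L.K N R.K)"

lemma K_ess_bounded_pairs: "ess_bounded_pairs M N (tree_funs M L.K N R.K)" by (rule tree_funs_ess_bounded_pairs[OF pM L.bd_kernel_K pN R.bd_kernel_K])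
lemmas K_kop = tree_funs_kop_closed[OF pM L.bd_kernel_K pN R.bd_kernel_K]
lemmas K_mult = uclosure_mult[OF K_ess_bounded_pairs tree_funs_mult_closed]

lemma mean_pop_mem: "(L.mean_pop n, R.mean_pop n) \<in> \<K>"
proof (induction n)
  case 0 show ?case using tree_funs_one unfolding L.mean_pop_def R.mean_pop_def by simp
next
  case (Suc n) then show ?case unfolding L.mean_pop_Suc R.mean_pop_Suc by (rule K_kop)
qed

lemma normalised_degree_mem: "(\<lambda>x. L.D x / (\<integral>x. L.D x \<partial>M), \<lambda>y. R.D y / (\<integral>y. R.D y \<partial>N)) \<in> \<K>"
proof (rule uclosure.lim)
  fix e :: real assume e: "0 < e"
  let ?g1 = "\<lambda>n x. (L.mean_pop (Suc (2 * n)) x + L.mean_pop (Suc (Suc (2 * n))) x) / 2"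
  let ?g2 = "\<lambda>n x. (R.mean_pop (Suc (2 * n)) x + R.mean_pop (Suc (Suc (2 * n))) x) / 2"
  obtain n1 n2 where n: "\<And>n. n \<ge> n1 \<Longrightarrow> AE x in M. \<bar>?g1 n x - L.D x / (\<integral>x. L.D x \<partial>M)\<bar> \<le> e"
    "\<And>n. n \<ge> n2 \<Longrightarrow> AE x in N. \<bar>?g2 n x - R.D x / (\<integral>x. R.D x \<partial>N)\<bar> \<le> e"
    using L.degree_limit[OF e] R.degree_limit[OF e] by blast
  let ?n = "max n1 n2"
  have "AE x in M. \<bar>L.D x / (\<integral>x. L.D x \<partial>M) - ?g1 ?n x\<bar> \<le> e" "AE x in N. \<bar>R.D x / (\<integral>x. R.D x \<partial>N) - ?g2 ?n x\<bar> \<le> e"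
    using n[of ?n] by (simp_all add: abs_minus_commute)
  moreover have "(?g1 ?n, ?g2 ?n) \<in> \<K>"
    using uclosure_scale[OF uclosure_add[OF mean_pop_mem mean_pop_mem], of "1/2" "Suc (2 * ?n)" "Suc (Suc (2 * ?n))"] by simp
  ultimately show "\<exists>f' g'. (f', g') \<in> \<K> \<and> (AE x in M. \<bar>L.D x / (\<integral>x. L.D x \<partial>M) - f' x\<bar> \<le> e) \<and> (AE x in N. \<bar>R.D x / (\<integral>x. R.D x \<partial>N) - g' x\<bar> \<le> e)"
    by blast
qed (use L.D_meas R.D_meas in auto)

lemma (in nice_kernel) kop_W_eq_K: assumes "ess_bounded M f" "x \<in> space M" shows "kop M W f x = kop M K (\<lambda>y. D y * f y) x"
proof -
  have [measurable]: "f \<in> borel_measurable M" using assms by (simp add: ess_bounded_def)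
  have [measurable]: "W x \<in> borel_measurable M" using assms(2) by measurable
  show ?thesis unfolding kop_K unfolding kop_def
  proof (rule integral_cong_AE)
    show "AE y in M. W x y * f y = W x y * (D y * f y / D y)" using D_bounds by eventually_elim (use d_pos in auto)
  qed measurable
qed

text \<open>Multiplying the normalised degrees on both sides by the integral of the first degree
  gives the first degree itself and \<open>s\<close> times the second; so \<open>s\<close>, the
  ratio of the two integrals, is the scaling factor. Since \<open>W f = K (D f)\<close>, the closure
  is then stable under the operators of \<open>U\<close> and of \<open>s * W\<close>.\<close>

lemma tree_fun_integral_eq:
  assumes "same_tree_distribution M U N W"
  defines "s \<equiv> (\<integral>x. L.D x \<partial>M) / (\<integral>y. R.D y \<partial>N)"
  shows "0 < s" "(\<integral>x. tree_fun M U t x \<partial>M) = (\<integral>y. tree_fun N (\<lambda>x y. s * W x y) t y \<partial>N)"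
proof -
  show s: "0 < s" unfolding s_def using L.D_integral_pos R.D_integral_pos by simp
  have kW: "bd_kernel N (\<lambda>x y. s * W x y) (s * CW)" using s by (intro bd_kernel_scale R.bd_kernel_W) simp
  have D: "(L.D, \<lambda>y. s * R.D y) \<in> \<K>"
    using uclosure_scale[OF normalised_degree_mem, of "\<integral>x. L.D x \<partial>M"] L.D_integral_pos by (simp add: s_def)
  have "(tree_fun M U t, tree_fun N (\<lambda>x y. s * W x y) t) \<in> \<K>"
  proof (rule tree_fun_mem_closed)
    show "(\<lambda>x. 1, \<lambda>y. 1) \<in> \<K>" by (rule tree_funs_one)
    show "(\<lambda>x. f x * f' x, \<lambda>y. g y * g' y) \<in> \<K>" if "(f, g) \<in> \<K>" "(f', g') \<in> \<K>" for f g f' g'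
      by (rule K_mult[OF that])
    fix f g assume fg: "(f, g) \<in> \<K>"
    note e = uclosure_ess_bounded[OF K_ess_bounded_pairs fg]
    from K_kop[OF K_mult[OF D fg]]
    show "(kop M U f, kop N (\<lambda>x y. s * W x y) g) \<in> \<K>"
    proof (rule uclosure_cong_AE)
      show "kop M U f \<in> borel_measurable M" "kop N (\<lambda>x y. s * W x y) g \<in> borel_measurable N"
        using kop_ess_bounded[OF pM L.bd_kernel_W] kop_ess_bounded[OF pN kW] e by (auto simp: ess_bounded_def)
      show "AE x in M. kop M U f x = kop M L.K (\<lambda>x. L.D x * f x) x" using L.kop_W_eq_K e by auto
      have "kop N R.K (\<lambda>x. s * R.D x * g x) y = s * kop N R.K (\<lambda>x. R.D x * g x) y" for y
        unfolding kop_def by (simp add: mult.assoc mult.left_commute[of _ s])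
      then show "AE x in N. kop N (\<lambda>x y. s * W x y) g x = kop N R.K (\<lambda>x. s * R.D x * g x) x"
        unfolding kop_scale using R.kop_W_eq_K e by auto
    qed
  qed
  then show "(\<integral>x. tree_fun M U t x \<partial>M) = (\<integral>y. tree_fun N (\<lambda>x y. s * W x y) t y \<partial>N)"
    by (rule uclosure_integral_eq[OF pM pN K_ess_bounded_pairs, rotated]) (use tree_fun_K_integral_eq[OF assms(1)] in \<open>auto simp: tree_funs_def\<close>)
qed

section \<open>From tree functions of \<open>W\<close> back to the law of the tree\<close>

text \<open>Degrees are images of 1 under the operators and are bounded away from 0, so their
  inverses lie in the closure. Dividing \<open>s * W\<close> by \<open>s * D\<close> cancels
  \<open>s\<close>, which yields \<open>K\<close> and \<open>P\<close> on both sides; the recursion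
  for \<open>anc_prob\<close> then stays inside the closure.\<close>

lemma anc_prob_integral_eq:
  assumes s: "0 < s" and eq: "\<And>t. (\<integral>x. tree_fun M U t x \<partial>M) = (\<integral>y. tree_fun N (\<lambda>x y. s * W x y) t y \<partial>N)"
  shows "(\<integral>x. anc_prob M L.K L.P k q x \<partial>M) = (\<integral>y. anc_prob N R.K R.P k q y \<partial>N)"
proof -
  let ?V = "\<lambda>x y. s * W x y"
  have kV: "bd_kernel N ?V (s * CW)" using s by (intro bd_kernel_scale R.bd_kernel_W) simp
  let ?A = "uclosure M N (tree_funs M U N ?V)"
  have eb: "ess_bounded_pairs M N (tree_funs M U N ?V)" by (rule tree_funs_ess_bounded_pairs[OF pM L.bd_kernel_W pN kV])
  note mult = uclosure_mult[OF eb tree_funs_mult_closed] and V_kop = tree_funs_kop_closed[OF pM L.bd_kernel_W pN kV]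
  have D: "(L.D, \<lambda>y. s * R.D y) \<in> ?A"
  proof (rule uclosure_cong_AE[OF V_kop[OF tree_funs_one]])
    show "AE x in M. L.D x = kop M U (\<lambda>_. 1) x" using L.W_one by eventually_elim simp
    show "AE y in N. s * R.D y = kop N ?V (\<lambda>_. 1) y" unfolding kop_scale using R.W_one by eventually_elim simp
  qed (use R.D_meas L.D_meas in auto)
  \<comment> \<open>A common range for both degrees, away from 0, on which the inverse is
    continuous.\<close>
  define a b where "a = min dU (s * dW)" and "b = max CU (s * CW)"
  have a: "0 < a" using L.d_pos R.d_pos s by (simp add: a_def)
  have invD: "(\<lambda>x. inverse (L.D x), \<lambda>y. inverse (s * R.D y)) \<in> ?A"
  proof (rule uclosure_comp[OF eb tree_funs_mult_closed tree_funs_one D, of a b])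
    show "AE x in M. L.D x \<in> {a..b}" using L.D_bounds by eventually_elim (auto simp: a_def b_def)
    show "AE y in N. s * R.D y \<in> {a..b}" using R.D_bounds
    proof eventually_elim
      case (elim y)
      have "s * dW \<le> s * R.D y" "s * R.D y \<le> s * CW" using elim s by (auto intro!: mult_left_mono)
      then show ?case by (auto simp: a_def b_def)
    qed
    show "continuous_on {a..b} inverse" using a by (intro continuous_intros) auto
  qed (use L.D_meas R.D_meas in auto)
  have K_kop: "(kop M L.K f, kop N R.K g) \<in> ?A" if fg: "(f, g) \<in> ?A" for f g
  proof -
    have "(kop M U (\<lambda>y. f y * inverse (L.D y)), kop N ?V (\<lambda>y. g y * inverse (s * R.D y))) \<in> ?A"
      by (rule V_kop[OF mult[OF fg invD]])
    moreover have "kop M U (\<lambda>y. f y * inverse (L.D y)) = kop M L.K f"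
      by (simp add: fun_eq_iff L.kop_K divide_inverse)
    moreover have "kop N ?V (\<lambda>y. g y * inverse (s * R.D y)) = kop N R.K g"
    proof
      fix x
      have "kop N ?V (\<lambda>y. g y * inverse (s * R.D y)) x = (\<integral>y. W x y * (g y / R.D y) \<partial>N)"
        unfolding kop_def using s by (intro Bochner_Integration.integral_cong) (simp_all add: field_simps)
      then show "kop N ?V (\<lambda>y. g y * inverse (s * R.D y)) x = kop N R.K g x" unfolding R.kop_K unfolding kop_def .
    qed
    ultimately show ?thesis by simp
  qed
  have P_kop: "(kop M L.P f, kop N R.P g) \<in> ?A" if fg: "(f, g) \<in> ?A" for f g
  proof -
    have "(\<lambda>x. inverse (L.D x) * kop M U f x, \<lambda>y. inverse (s * R.D y) * kop N ?V g y) \<in> ?A"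
      by (rule mult[OF invD V_kop[OF fg]])
    moreover have "(\<lambda>x. inverse (L.D x) * kop M U f x) = kop M L.P f"
      by (simp add: fun_eq_iff L.kop_P divide_inverse)
    moreover have "(\<lambda>y. inverse (s * R.D y) * kop N ?V g y) = kop N R.P g"
      using s by (simp add: fun_eq_iff R.kop_P kop_scale divide_inverse)
    ultimately show ?thesis by simp
  qed
  have e: "(\<lambda>x. exp (- kop M L.K (\<lambda>_. 1) x), \<lambda>y. exp (- kop N R.K (\<lambda>_. 1) y)) \<in> ?A"
    by (rule uclosure_comp_continuous[OF eb tree_funs_mult_closed tree_funs_one K_kop[OF tree_funs_one], where \<phi> = "\<lambda>z. exp (- z)"])
      (intro continuous_intros)
  have zero: "(\<lambda>x. 0, \<lambda>y. 0) \<in> ?A" using uclosure_scale[OF tree_funs_one, of 0 M N U ?V] by simp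
  have prod: "(\<lambda>x. \<Prod>f\<leftarrow>map F ts. kop M L.K f x, \<lambda>y. \<Prod>f\<leftarrow>map G ts. kop N R.K f y) \<in> ?A"
    if "\<And>t. t \<in> set ts \<Longrightarrow> (F t, G t) \<in> ?A" for F G and ts :: "ptree list"
    using that
  proof (induction ts)
    case Nil then show ?case using tree_funs_one by simp
  next
    case (Cons t ts)
    have "(kop M L.K (F t), kop N R.K (G t)) \<in> ?A" using Cons.prems by (intro K_kop) simp
    from mult[OF this Cons.IH] Cons.prems show ?case by simp
  qed
  have oth_prob: "(oth_prob M L.K k q, oth_prob N R.K k q) \<in> ?A" for k q
  proof (induction k arbitrary: q)
    case 0 show ?case by (cases "q = PNode []") (simp_all add: tree_funs_one zero)
  next
    case (Suc k)
    have "(\<lambda>x. \<Prod>f\<leftarrow>map (oth_prob M L.K k) (kids q). kop M L.K f x, \<lambda>y. \<Prod>f\<leftarrow>map (oth_prob N R.K k) (kids q). kop N R.K f y) \<in> ?A"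
      by (rule prod) (rule Suc)
    from uclosure_scale[OF mult[OF e this], of "1 / fact (length (kids q))"] show ?case by simp
  qed
  have "(anc_prob M L.K L.P k q, anc_prob N R.K R.P k q) \<in> ?A"
  proof (induction k arbitrary: q)
    case 0 show ?case by (cases "q = PNode []") (simp_all add: tree_funs_one zero)
  next
    case (Suc k)
    show ?case
    proof (cases "kids q")
      case Nil then show ?thesis using zero by simp
    next
      case (Cons r l)
      from mult[OF P_kop[OF Suc[of r]] oth_prob[of "Suc k" "PNode l"]] show ?thesis using Cons by (simp del: oth_prob.simps)
    qed
  qed
  then show ?thesis
    by (rule uclosure_integral_eq[OF pM pN eb, rotated]) (use eq in \<open>auto simp: tree_funs_def\<close>)
qed

end

section \<open>Extraction of constants and the equivalence\<close>

lemma nice_kernel_exists: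
  assumes "Linf_kernel M W" "connected_kernel M W" "0 < min_deg M W"
  shows "\<exists>C d. nice_kernel M W C d"
proof -
  have k: "kernel M W" using assms(1) by (simp add: Linf_kernel_def)
  then have a: "akernel M W" by (simp add: kernel_def)
  interpret prob_space M using a by (simp add: akernel_def ground_space_def)
  interpret pp: pair_prob_space M M by unfold_locales
  have [measurable]: "(\<lambda>(x, y). W x y) \<in> borel_measurable (M \<Otimes>\<^sub>M M)" using a by (simp add: akernel_def)
  let ?S = "esssup (M \<Otimes>\<^sub>M M) (\<lambda>(x, y). ennreal (W x y))"
  have fin: "?S < \<top>" using assms(1) by (simp add: Linf_kernel_def)
  define C where "C = enn2real ?S"
  have "AE p in M \<Otimes>\<^sub>M M. (\<lambda>(x, y). ennreal (W x y)) p \<le> ?S" by (rule esssup_AE)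
  then have "AE p in M \<Otimes>\<^sub>M M. W (fst p) (snd p) \<le> C"
  proof eventually_elim
    case (elim p)
    then have "ennreal (W (fst p) (snd p)) \<le> ennreal C" using fin by (simp add: split_beta C_def)
    then show ?case by (simp add: ennreal_le_iff C_def)
  qed
  then have bd: "AE x in M. AE y in M. W x y \<le> C" using pp.AE_pair[of "\<lambda>p. W (fst p) (snd p) \<le> C"] by simp
  obtain z where z: "0 < z" "AE x in M. z \<le> deg M W x"
    using assms(3) unfolding min_deg_def essinf_def less_Sup_iff by auto
  \<comment> \<open>The lower bound \<open>z\<close> of the degree is an extended number; capping it
    at 1 makes it finite and keeps it positive.\<close>
  define d where "d = enn2real (min z 1)"
  have "min z 1 < \<top>" by (simp add: min_less_iff_disj)
  then have d: "ennreal d = min z 1" by (simp add: d_def)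
  have "0 < d" using z(1) \<open>min z 1 < \<top>\<close> unfolding d_def by (simp add: enn2real_positive_iff)
  have "AE x in M. ennreal d \<le> deg M W x" using z(2) by eventually_elim (simp add: d min.coboundedI1)
  then have "nice_kernel M W C d"
    using bd \<open>0 < d\<close> a k assms(2) by unfold_locales (auto simp: akernel_def kernel_def C_def)
  then show ?thesis by blast
qed

theorem theorem1p9:
  fixes M :: "'a measure" and U :: "'a \<Rightarrow> 'a \<Rightarrow> real"
    and N :: "'b measure" and W :: "'b \<Rightarrow> 'b \<Rightarrow> real"
  assumes "Linf_kernel M U" and "connected_kernel M U" and "0 < min_deg M U"
    and "Linf_kernel N W" and "connected_kernel N W" and "0 < min_deg N W"
  shows "same_tree_distribution M U N W \<longleftrightarrow> projectively_fractionally_isomorphic M U N W"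
proof -
  obtain CU dU CW dW where L: "nice_kernel M U CU dU" and R: "nice_kernel N W CW dW"
    using nice_kernel_exists[OF assms(1-3)] nice_kernel_exists[OF assms(4-6)] by blast
  interpret nice_kernel_pair M U CU dU N W CW dW by (rule nice_kernel_pair.intro[OF L R])
  have iff: "fractionally_isomorphic M U N (\<lambda>x y. t * W x y)
      \<longleftrightarrow> (\<forall>q. (\<integral>x. tree_fun M U q x \<partial>M) = (\<integral>y. tree_fun N (\<lambda>x y. t * W x y) q y \<partial>N))" if "0 < t" for t
    by (rule fractionally_isomorphic_iff_tree_fun[OF pM L.bd_kernel_W pN bd_kernel_scale[OF R.bd_kernel_W]]) (use that in simp)
  show ?thesis
  proof
    assume "same_tree_distribution M U N W"
    from tree_fun_integral_eq[OF this] show "projectively_fractionally_isomorphic M U N W"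
      unfolding projectively_fractionally_isomorphic_def using iff by blast
  next
    assume "projectively_fractionally_isomorphic M U N W"
    then obtain t where t: "0 < t" "fractionally_isomorphic M U N (\<lambda>x y. t * W x y)"
      by (auto simp: projectively_fractionally_isomorphic_def)
    show "same_tree_distribution M U N W"
      by (rule same_treeI) (rule anc_prob_integral_eq[OF t(1)], use iff[OF t(1)] t(2) in blast)
  qed
qed

end
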